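(* Let $\mathcal{Q}$ be a small quantaloid of closed cribles. Then $\mathsf{Sh}(\mathcal{Q})$ is a Grothendieck topos (isomorphic parallel functors between enriched categories being identified) and $\mathsf{Rel}(\mathcal{Q})$ is its category of relations, i.e. $\mathsf{Rel}(\mathcal{Q})\simeq\mathsf{Rel}(\mathsf{Sh}(\mathcal{Q}))$ as involutive quantaloids.
   Context: A quantaloid is a category whose homs are complete lattices and whose composition preserves arbitrary suprema in each variable; a homomorphism is a functor preserving local suprema. An involution on $\mathcal{Q}$ is a homomorphism $(-)^{\circ}:\mathcal{Q}^{\mathrm{op}}\to\mathcal{Q}$ that is the identity on objects with $f^{\circ\circ}=f$; equivalences of involutive quantaloids preserve it. A morphism $f:X\to Y$ is a left adjoint if there is $f^*:Y\to X$ with $1_X\le f^*f$, $ff^*\le 1_Y$; it is a symmetric left adjoint if moreover $f^*=f^{\circ}$. Closed cribles. For a small site $(\mathcal{C},J)$, the quantaloid $\mathcal{R}(\mathcal{C},J)$ has the objects of $\mathcal{C}$ as objects; an arrow $X\to Y$ is a closed crible, i.e. a set $R$ of spans $(f:U\to Y,\ g:U\to X)$ in $\mathcal{C}$ closed under precomposition and such that a span $(f,g)$ with domain $U$ is in $R$ whenever $\{s:V\to U\mid (fs,gs)\in R\}\in J(U)$. Arrows are ordered by inclusion; $S\circ R$ is the smallest closed crible containing $\{(h,g)\mid \exists f: (h,f)\in S,(f,g)\in R\}$; the identity on $X$ is the smallest closed crible containing $(1_X,1_X)$. A small quantaloid of closed cribles is a small quantaloid $\mathcal{Q}$ equivalent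 to some $\mathcal{R}(\mathcal{C},J)$; it is always considered with the involution sending $q:Y\to X$ to $q^{\circ}=\bigvee\{gf^*\mid f:U\to X,\ g:U\to Y\text{ left adjoints in }\mathcal{Q}\text{ with } fg^*\le q\}$ (for $\mathcal{R}(\mathcal{C},J)$: reversal of spans). Splitting. $\mathcal{Q}_{\mathsf{ssi}}$ is the involutive quantaloid whose objects are all symmetric idempotents ($e^2=e=e^{\circ}$) of $\mathcal{Q}$, with $\mathcal{Q}_{\mathsf{ssi}}(e,f)=\{x:A\to B\mid fx=x=xe\}$ for $e:A\to A$, $f:B\to B$; composition, suprema and involution are as in $\mathcal{Q}$, the identity on $e$ is $e$. Enriched categories (over any small involutive quantaloid $\mathcal{Q}$). A $\mathcal{Q}$-category $\mathbb{A}$ is a set $\mathbb{A}_0$ with types $tx\in\mathcal{Q}_0$ and arrows $\mathbb{A}(y,x):tx\to ty$ with $\mathbb{A}(z,y)\circ\mathbb{A}(y,x)\le\mathbb{A}(z,x)$ and $1_{tx}\le\mathbb{A}(x,x)$; it is symmetric if $\mathbb{A}(x,y)=\mathbb{A}(y,x)^{\circ}$. A functor $F:\mathbb{A}\to\mathbb{B}$ is a type-preserving object map with $\mathbb{A}(y,x)\le\mathbb{B}(Fy,Fx)$; $F\le G$ means $1_{tx}\le\mathbb{B}(Fx,Gx)$ for all $x$ (a symmetric relation when $\mathbb{B}$ is symmetric). A distributor $\Phi$ from $\mathbb{A}$ to $\mathbb{B}$ is a family $\Phi(y,x):tx\to ty$ ($x\in\mathbb{A}_0$, $y\in\mathbb{B}_0$)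 with $\mathbb{B}(y',y)\circ\Phi(y,x)\le\Phi(y',x)$ and $\Phi(y,x)\circ\mathbb{A}(x,x')\le\Phi(y,x')$; composition is $(\Psi\otimes\Phi)(z,x)=\bigvee_y\Psi(z,y)\circ\Phi(y,x)$, the identity on $\mathbb{A}$ is given by its hom-arrows, order is elementwise. $\mathsf{SymDist}(\mathcal{Q})$ is the quantaloid of symmetric $\mathcal{Q}$-categories and distributors, with involution $\Phi^{\circ}(a,b)=\Phi(b,a)^{\circ}$. A symmetric $\mathbb{A}$ is symmetrically complete if every symmetric left adjoint $\mathbb{B}\to\mathbb{A}$ in $\mathsf{SymDist}(\mathcal{Q})$ is of the form $\mathbb{A}(-,F-)$ for a functor $F:\mathbb{B}\to\mathbb{A}$. $\mathsf{SymCat}_{\mathsf{sc}}(\mathcal{Q})$ (resp. $\mathsf{SymDist}_{\mathsf{sc}}(\mathcal{Q})$) consists of symmetrically complete symmetric $\mathcal{Q}$-categories and functors (resp. distributors). Define $\mathsf{Sh}(\mathcal{Q}):=\mathsf{SymCat}_{\mathsf{sc}}(\mathcal{Q}_{\mathsf{ssi}})$ and $\mathsf{Rel}(\mathcal{Q}):=\mathsf{SymDist}_{\mathsf{sc}}(\mathcal{Q}_{\mathsf{ssi}})$. For a topos $\mathcal{T}$, $\mathsf{Rel}(\mathcal{T})$ is the category of objects of $\mathcal{T}$ and internal relations (subobjects of products), ordered by inclusion, with opposite relation as involution. *)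

theory Defs
  imports "HOL-Library.FuncSet" "HOL-Algebra.Complete_Lattice"
begin

unbundle cardinal_syntax

section \<open>Size\<close>

text \<open>
  HOL has no type of all sets, so the sets of the metatheory are modelled relative to a type
  \<open>'v\<close> whose cardinality is an uncountable (strongly) inaccessible cardinal; that is, up to
  bijection, \<open>'v\<close> is a Grothendieck universe containing the natural numbers, and the sets belonging
  to the universe are those of cardinality less than that of \<open>'v\<close>.
\<close>

definition small :: "'v itself \<Rightarrow> 'a set \<Rightarrow> bool" where
  "small TYPE('v) A \<longleftrightarrow> |A| <o |UNIV :: 'v set|"

definition universe :: "'v itself \<Rightarrow> bool" where
  "universe TYPE('v) \<longleftrightarrow>
     small TYPE('v) (UNIV :: nat set) \<and>
     (\<forall>A :: 'v set. small TYPE('v) A \<longrightarrow> small TYPE('v) (Pow A)) \<and>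
     (\<forall>(A :: 'v set) (F :: 'v \<Rightarrow> 'v set).
        small TYPE('v) A \<and> (\<forall>i\<in>A. small TYPE('v) (F i)) \<longrightarrow> small TYPE('v) (\<Union>i\<in>A. F i))"


section \<open>Categories and equivalences\<close>

text \<open>
  Hom-sets are not required to be disjoint, so all operations on arrows take the objects involved
  as arguments: \<open>Comp C X Y Z g f\<close> is the composite of \<open>f : X \<rightarrow> Y\<close> and \<open>g : Y \<rightarrow> Z\<close>.
  A functor is an object map \<open>F\<close> together with arrow maps \<open>F' X Y\<close>.
\<close>

record ('o, 'a) cat =
  Obj :: "'o set"
  Hom :: "'o \<Rightarrow> 'o \<Rightarrow> 'a set"
  Idn :: "'o \<Rightarrow> 'a"
  Comp :: "'o \<Rightarrow> 'o \<Rightarrow> 'o \<Rightarrow> 'a \<Rightarrow> 'a \<Rightarrow> 'a"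

locale category =
  fixes C :: "('o, 'a, 'm) cat_scheme"
  assumes Idn_closed: "X \<in> Obj C \<Longrightarrow> Idn C X \<in> Hom C X X"
    and Comp_closed: "\<lbrakk>X \<in> Obj C; Y \<in> Obj C; Z \<in> Obj C; f \<in> Hom C X Y; g \<in> Hom C Y Z\<rbrakk>
      \<Longrightarrow> Comp C X Y Z g f \<in> Hom C X Z"
    and Comp_assoc: "\<lbrakk>W \<in> Obj C; X \<in> Obj C; Y \<in> Obj C; Z \<in> Obj C;
        f \<in> Hom C W X; g \<in> Hom C X Y; h \<in> Hom C Y Z\<rbrakk>
      \<Longrightarrow> Comp C W X Z (Comp C X Y Z h g) f = Comp C W Y Z h (Comp C W X Y g f)"
    and Comp_Idn: "\<lbrakk>X \<in> Obj C; Y \<in> Obj C; f \<in> Hom C X Y\<rbrakk> \<Longrightarrow> Comp C X X Y f (Idn C X) = f"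
    and Idn_Comp: "\<lbrakk>X \<in> Obj C; Y \<in> Obj C; f \<in> Hom C X Y\<rbrakk> \<Longrightarrow> Comp C X Y Y (Idn C Y) f = f"

definition small_category :: "'v itself \<Rightarrow> ('o, 'a, 'm) cat_scheme \<Rightarrow> bool" where
  "small_category TYPE('v) C \<longleftrightarrow> category C \<and> small TYPE('v) (Obj C) \<and>
     (\<forall>X\<in>Obj C. \<forall>Y\<in>Obj C. small TYPE('v) (Hom C X Y))"

definition is_functor ::
  "('o, 'a, 'm) cat_scheme \<Rightarrow> ('p, 'b, 'n) cat_scheme \<Rightarrow> ('o \<Rightarrow> 'p) \<Rightarrow> ('o \<Rightarrow> 'o \<Rightarrow> 'a \<Rightarrow> 'b) \<Rightarrow> bool"
where
  "is_functor C D F F' \<longleftrightarrow>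
     (\<forall>X\<in>Obj C. F X \<in> Obj D) \<and>
     (\<forall>X\<in>Obj C. \<forall>Y\<in>Obj C. \<forall>f\<in>Hom C X Y. F' X Y f \<in> Hom D (F X) (F Y)) \<and>
     (\<forall>X\<in>Obj C. F' X X (Idn C X) = Idn D (F X)) \<and>
     (\<forall>X\<in>Obj C. \<forall>Y\<in>Obj C. \<forall>Z\<in>Obj C. \<forall>f\<in>Hom C X Y. \<forall>g\<in>Hom C Y Z.
        F' X Z (Comp C X Y Z g f) = Comp D (F X) (F Y) (F Z) (F' Y Z g) (F' X Y f))"

definition is_iso :: "('o, 'a, 'm) cat_scheme \<Rightarrow> 'o \<Rightarrow> 'o \<Rightarrow> 'a \<Rightarrow> bool" where
  "is_iso C X Y f \<longleftrightarrow> f \<in> Hom C X Y \<and>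
     (\<exists>g\<in>Hom C Y X. Comp C X Y X g f = Idn C X \<and> Comp C Y X Y f g = Idn C Y)"

definition naturally_iso_to_identity ::
  "('o, 'a, 'm) cat_scheme \<Rightarrow> ('o \<Rightarrow> 'o) \<Rightarrow> ('o \<Rightarrow> 'o \<Rightarrow> 'a \<Rightarrow> 'a) \<Rightarrow> bool"
where
  "naturally_iso_to_identity C F F' \<longleftrightarrow>
     (\<exists>\<eta>. (\<forall>X\<in>Obj C. is_iso C X (F X) (\<eta> X)) \<and>
          (\<forall>X\<in>Obj C. \<forall>Y\<in>Obj C. \<forall>f\<in>Hom C X Y.
             Comp C X Y (F Y) (\<eta> Y) f = Comp C X (F X) (F Y) (F' X Y f) (\<eta> X)))"

definition inverse_equivalences ::
  "('o, 'a, 'm) cat_scheme \<Rightarrow> ('p, 'b, 'n) cat_scheme \<Rightarrow>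
   ('o \<Rightarrow> 'p) \<Rightarrow> ('o \<Rightarrow> 'o \<Rightarrow> 'a \<Rightarrow> 'b) \<Rightarrow> ('p \<Rightarrow> 'o) \<Rightarrow> ('p \<Rightarrow> 'p \<Rightarrow> 'b \<Rightarrow> 'a) \<Rightarrow> bool"
where
  "inverse_equivalences C D F F' G G' \<longleftrightarrow>
     is_functor C D F F' \<and> is_functor D C G G' \<and>
     naturally_iso_to_identity C (\<lambda>X. G (F X)) (\<lambda>X Y f. G' (F X) (F Y) (F' X Y f)) \<and>
     naturally_iso_to_identity D (\<lambda>X. F (G X)) (\<lambda>X Y f. F' (G X) (G Y) (G' X Y f))"

definition equivalent_categories ::
  "('o, 'a, 'm) cat_scheme \<Rightarrow> ('p, 'b, 'n) cat_scheme \<Rightarrow> bool"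
where
  "equivalent_categories C D \<longleftrightarrow>
     category C \<and> category D \<and> (\<exists>F F' G G'. inverse_equivalences C D F F' G G')"


section \<open>Quantaloids\<close>

record ('o, 'a) quantaloid_rec = "('o, 'a) cat" +
  Le :: "'o \<Rightarrow> 'o \<Rightarrow> 'a \<Rightarrow> 'a \<Rightarrow> bool"

definition hom_order :: "('o, 'a, 'm) quantaloid_rec_scheme \<Rightarrow> 'o \<Rightarrow> 'o \<Rightarrow> 'a gorder" where
  "hom_order Q X Y = \<lparr>carrier = Hom Q X Y, eq = (=), le = Le Q X Y\<rparr>"

definition Join :: "('o, 'a, 'm) quantaloid_rec_scheme \<Rightarrow> 'o \<Rightarrow> 'o \<Rightarrow> 'a set \<Rightarrow> 'a" where
  "Join Q X Y A = \<Squnion>\<^bsub>hom_order Q X Y\<^esub> A"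

locale quantaloid = category Q
  for Q :: "('o, 'a, 'm) quantaloid_rec_scheme" +
  assumes hom_complete: "\<lbrakk>X \<in> Obj Q; Y \<in> Obj Q\<rbrakk> \<Longrightarrow> complete_lattice (hom_order Q X Y)"
    and Comp_Join_left: "\<lbrakk>X \<in> Obj Q; Y \<in> Obj Q; Z \<in> Obj Q; f \<in> Hom Q X Y; A \<subseteq> Hom Q Y Z\<rbrakk>
      \<Longrightarrow> Comp Q X Y Z (Join Q Y Z A) f = Join Q X Z ((\<lambda>g. Comp Q X Y Z g f) ` A)"
    and Comp_Join_right: "\<lbrakk>X \<in> Obj Q; Y \<in> Obj Q; Z \<in> Obj Q; A \<subseteq> Hom Q X Y; g \<in> Hom Q Y Z\<rbrakk>
      \<Longrightarrow> Comp Q X Y Z g (Join Q X Y A) = Join Q X Z ((\<lambda>f. Comp Q X Y Z g f) ` A)"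

definition is_homomorphism ::
  "('o, 'a, 'm) quantaloid_rec_scheme \<Rightarrow> ('p, 'b, 'n) quantaloid_rec_scheme \<Rightarrow>
   ('o \<Rightarrow> 'p) \<Rightarrow> ('o \<Rightarrow> 'o \<Rightarrow> 'a \<Rightarrow> 'b) \<Rightarrow> bool"
where
  "is_homomorphism Q R F F' \<longleftrightarrow> is_functor Q R F F' \<and>
     (\<forall>X\<in>Obj Q. \<forall>Y\<in>Obj Q. \<forall>A. A \<subseteq> Hom Q X Y \<longrightarrow>
        F' X Y (Join Q X Y A) = Join R (F X) (F Y) (F' X Y ` A))"

definition equivalent_quantaloids ::
  "('o, 'a, 'm) quantaloid_rec_scheme \<Rightarrow> ('p, 'b, 'n) quantaloid_rec_scheme \<Rightarrow> bool"
where
  "equivalent_quantaloids Q R \<longleftrightarrow> quantaloid Q \<and> quantaloid R \<and>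
     (\<exists>F F' G G'. inverse_equivalences Q R F F' G G' \<and>
        is_homomorphism Q R F F' \<and> is_homomorphism R Q G G')"

text \<open>\<open>is_adjoint Q X Y f f'\<close>: the arrow \<open>f : X \<rightarrow> Y\<close> is left adjoint to \<open>f' : Y \<rightarrow> X\<close>.\<close>

definition is_adjoint ::
  "('o, 'a, 'm) quantaloid_rec_scheme \<Rightarrow> 'o \<Rightarrow> 'o \<Rightarrow> 'a \<Rightarrow> 'a \<Rightarrow> bool"
where
  "is_adjoint Q X Y f f' \<longleftrightarrow> f \<in> Hom Q X Y \<and> f' \<in> Hom Q Y X \<and>
     Le Q X X (Idn Q X) (Comp Q X Y X f' f) \<and> Le Q Y Y (Comp Q Y X Y f f') (Idn Q Y)"


section \<open>Involutive quantaloids\<close>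

record ('o, 'a) inv_quantaloid_rec = "('o, 'a) quantaloid_rec" +
  Inv :: "'o \<Rightarrow> 'o \<Rightarrow> 'a \<Rightarrow> 'a"

locale involutive_quantaloid = quantaloid Q
  for Q :: "('o, 'a, 'm) inv_quantaloid_rec_scheme" +
  assumes Inv_closed: "\<lbrakk>X \<in> Obj Q; Y \<in> Obj Q; f \<in> Hom Q X Y\<rbrakk> \<Longrightarrow> Inv Q X Y f \<in> Hom Q Y X"
    and Inv_Idn: "X \<in> Obj Q \<Longrightarrow> Inv Q X X (Idn Q X) = Idn Q X"
    and Inv_Comp: "\<lbrakk>X \<in> Obj Q; Y \<in> Obj Q; Z \<in> Obj Q; f \<in> Hom Q X Y; g \<in> Hom Q Y Z\<rbrakk>
      \<Longrightarrow> Inv Q X Z (Comp Q X Y Z g f) = Comp Q Z Y X (Inv Q X Y f) (Inv Q Y Z g)"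
    and Inv_Join: "\<lbrakk>X \<in> Obj Q; Y \<in> Obj Q; A \<subseteq> Hom Q X Y\<rbrakk>
      \<Longrightarrow> Inv Q X Y (Join Q X Y A) = Join Q Y X (Inv Q X Y ` A)"
    and Inv_Inv: "\<lbrakk>X \<in> Obj Q; Y \<in> Obj Q; f \<in> Hom Q X Y\<rbrakk> \<Longrightarrow> Inv Q Y X (Inv Q X Y f) = f"

definition preserves_involution ::
  "('o, 'a, 'm) inv_quantaloid_rec_scheme \<Rightarrow> ('p, 'b, 'n) inv_quantaloid_rec_scheme \<Rightarrow>
   ('o \<Rightarrow> 'p) \<Rightarrow> ('o \<Rightarrow> 'o \<Rightarrow> 'a \<Rightarrow> 'b) \<Rightarrow> bool"
where
  "preserves_involution Q R F F' \<longleftrightarrow>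
     (\<forall>X\<in>Obj Q. \<forall>Y\<in>Obj Q. \<forall>f\<in>Hom Q X Y. F' Y X (Inv Q X Y f) = Inv R (F X) (F Y) (F' X Y f))"

definition equivalent_involutive_quantaloids ::
  "('o, 'a, 'm) inv_quantaloid_rec_scheme \<Rightarrow> ('p, 'b, 'n) inv_quantaloid_rec_scheme \<Rightarrow> bool"
where
  "equivalent_involutive_quantaloids Q R \<longleftrightarrow>
     involutive_quantaloid Q \<and> involutive_quantaloid R \<and>
     (\<exists>F F' G G'. inverse_equivalences Q R F F' G G' \<and>
        is_homomorphism Q R F F' \<and> is_homomorphism R Q G G' \<and>
        preserves_involution Q R F F' \<and> preserves_involution R Q G G')"

definition is_symmetric_left_adjoint ::
  "('o, 'a, 'm) inv_quantaloid_rec_scheme \<Rightarrow> 'o \<Rightarrow> 'o \<Rightarrow> 'a \<Rightarrow> bool"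
where
  "is_symmetric_left_adjoint Q X Y f \<longleftrightarrow> is_adjoint Q X Y f (Inv Q X Y f)"

text \<open>
  The canonical involution: for \<open>q : Y \<rightarrow> X\<close>, the arrow \<open>q\<degree> : X \<rightarrow> Y\<close> is the supremum of the
  \<open>g f*\<close> with \<open>f : U \<rightarrow> X\<close> and \<open>g : U \<rightarrow> Y\<close> left adjoints such that \<open>f g* \<le> q\<close>.
  (Right adjoints \<open>f*\<close>, \<open>g*\<close> are unique in a quantaloid.)
\<close>

definition canonical_inv ::
  "('o, 'a, 'm) quantaloid_rec_scheme \<Rightarrow> 'o \<Rightarrow> 'o \<Rightarrow> 'a \<Rightarrow> 'a"
where
  "canonical_inv Q Y X q = Join Q X Y
     {Comp Q X U Y g f' | U f f' g g'. U \<in> Obj Q \<and> is_adjoint Q U X f f' \<and> is_adjoint Q U Y g g' \<and>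
        Le Q Y X (Comp Q Y U X f g') q}"

definition with_canonical_inv ::
  "('o, 'a) quantaloid_rec \<Rightarrow> ('o, 'a) inv_quantaloid_rec"
where
  "with_canonical_inv Q = quantaloid_rec.extend Q \<lparr>Inv = canonical_inv Q\<rparr>"


section \<open>Sites, sheaves and Grothendieck toposes\<close>

text \<open>A sieve on \<open>U\<close> is a set of pairs \<open>(V, s)\<close> with \<open>s : V \<rightarrow> U\<close>.\<close>

definition is_sieve :: "('o, 'a, 'm) cat_scheme \<Rightarrow> 'o \<Rightarrow> ('o \<times> 'a) set \<Rightarrow> bool" where
  "is_sieve C U S \<longleftrightarrow>
     (\<forall>(V, s)\<in>S. V \<in> Obj C \<and> s \<in> Hom C V U) \<and>
     (\<forall>(V, s)\<in>S. \<forall>W\<in>Obj C. \<forall>t\<in>Hom C W V. (W, Comp C W V U s t) \<in> S)"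

definition sieve_pullback ::
  "('o, 'a, 'm) cat_scheme \<Rightarrow> 'o \<Rightarrow> 'o \<Rightarrow> 'a \<Rightarrow> ('o \<times> 'a) set \<Rightarrow> ('o \<times> 'a) set"
where
  "sieve_pullback C V U f S = {(W, t). W \<in> Obj C \<and> t \<in> Hom C W V \<and> (W, Comp C W V U f t) \<in> S}"

definition grothendieck_topology ::
  "('o, 'a, 'm) cat_scheme \<Rightarrow> ('o \<Rightarrow> ('o \<times> 'a) set set) \<Rightarrow> bool"
where
  "grothendieck_topology C J \<longleftrightarrow>
     (\<forall>U\<in>Obj C. \<forall>S\<in>J U. is_sieve C U S) \<and>
     (\<forall>U\<in>Obj C. {(V, s). V \<in> Obj C \<and> s \<in> Hom C V U} \<in> J U) \<and>
     (\<forall>U\<in>Obj C. \<forall>V\<in>Obj C. \<forall>f\<in>Hom C V U. \<forall>S\<in>J U. sieve_pullback C V U f S \<in> J V) \<and>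
     (\<forall>U\<in>Obj C. \<forall>S\<in>J U. \<forall>R. is_sieve C U R \<longrightarrow>
        (\<forall>(V, s)\<in>S. sieve_pullback C V U s R \<in> J V) \<longrightarrow> R \<in> J U)"

definition small_site ::
  "'v itself \<Rightarrow> ('o, 'a, 'm) cat_scheme \<Rightarrow> ('o \<Rightarrow> ('o \<times> 'a) set set) \<Rightarrow> bool"
where
  "small_site TYPE('v) C J \<longleftrightarrow> small_category TYPE('v) C \<and> grothendieck_topology C J"

text \<open>
  For a presheaf \<open>P\<close> and \<open>f : V \<rightarrow> U\<close>, the restriction map \<open>PAct P V U f\<close> goes from \<open>PSet P U\<close> to
  \<open>PSet P V\<close>. Maps are extensional, i.e. take the value \<^const>\<open>undefined\<close> outside of their
  domain, so that equality of natural transformations is equality of functions.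
\<close>

record ('o, 'a, 'v) presheaf =
  PSet :: "'o \<Rightarrow> 'v set"
  PAct :: "'o \<Rightarrow> 'o \<Rightarrow> 'a \<Rightarrow> 'v \<Rightarrow> 'v"

definition is_presheaf :: "('o, 'a, 'm) cat_scheme \<Rightarrow> ('o, 'a, 'v) presheaf \<Rightarrow> bool" where
  "is_presheaf C P \<longleftrightarrow>
     (\<forall>U\<in>Obj C. small TYPE('v) (PSet P U)) \<and>
     (\<forall>U\<in>Obj C. \<forall>V\<in>Obj C. \<forall>f\<in>Hom C V U. PAct P V U f \<in> PSet P U \<rightarrow>\<^sub>E PSet P V) \<and>
     (\<forall>U\<in>Obj C. \<forall>x\<in>PSet P U. PAct P U U (Idn C U) x = x) \<and>
     (\<forall>U\<in>Obj C. \<forall>V\<in>Obj C. \<forall>W\<in>Obj C. \<forall>f\<in>Hom C V U. \<forall>g\<in>Hom C W V. \<forall>x\<in>PSet P U.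
        PAct P W U (Comp C W V U f g) x = PAct P W V g (PAct P V U f x))"

definition matching_family ::
  "('o, 'a, 'm) cat_scheme \<Rightarrow> ('o, 'a, 'v) presheaf \<Rightarrow> 'o \<Rightarrow> ('o \<times> 'a) set \<Rightarrow> ('o \<Rightarrow> 'a \<Rightarrow> 'v) \<Rightarrow> bool"
where
  "matching_family C P U S x \<longleftrightarrow>
     (\<forall>(V, s)\<in>S. x V s \<in> PSet P V) \<and>
     (\<forall>(V, s)\<in>S. \<forall>W\<in>Obj C. \<forall>t\<in>Hom C W V. PAct P W V t (x V s) = x W (Comp C W V U s t))"

definition is_sheaf ::
  "('o, 'a, 'm) cat_scheme \<Rightarrow> ('o \<Rightarrow> ('o \<times> 'a) set set) \<Rightarrow> ('o, 'a, 'v) presheaf \<Rightarrow> bool"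
where
  "is_sheaf C J P \<longleftrightarrow> is_presheaf C P \<and>
     (\<forall>U\<in>Obj C. \<forall>S\<in>J U. \<forall>x. matching_family C P U S x \<longrightarrow>
        (\<exists>!z. z \<in> PSet P U \<and> (\<forall>(V, s)\<in>S. PAct P V U s z = x V s)))"

definition natural_transformations ::
  "('o, 'a, 'm) cat_scheme \<Rightarrow> ('o, 'a, 'v) presheaf \<Rightarrow> ('o, 'a, 'v) presheaf \<Rightarrow> ('o \<Rightarrow> 'v \<Rightarrow> 'v) set"
where
  "natural_transformations C P R =
     {\<theta> \<in> (\<Pi>\<^sub>E U\<in>Obj C. PSet P U \<rightarrow>\<^sub>E PSet R U).
        \<forall>U\<in>Obj C. \<forall>V\<in>Obj C. \<forall>f\<in>Hom C V U. \<forall>x\<in>PSet P U.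
          \<theta> V (PAct P V U f x) = PAct R V U f (\<theta> U x)}"

definition sheaf_category ::
  "('o, 'a, 'm) cat_scheme \<Rightarrow> ('o \<Rightarrow> ('o \<times> 'a) set set) \<Rightarrow>
   (('o, 'a, 'v) presheaf, 'o \<Rightarrow> 'v \<Rightarrow> 'v) cat"
where
  "sheaf_category C J =
     \<lparr>Obj = {P. is_sheaf C J P},
      Hom = natural_transformations C,
      Idn = (\<lambda>P. \<lambda>U\<in>Obj C. \<lambda>x\<in>PSet P U. x),
      Comp = (\<lambda>P R S \<phi> \<theta>. \<lambda>U\<in>Obj C. compose (PSet P U) (\<phi> U) (\<theta> U))\<rparr>"

text \<open>
  Taking the objects and arrows of sites to be elements of the universe \<open>'v\<close> is no restriction,
  since every small category is isomorphic to one of this kind.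
\<close>

definition grothendieck_topos :: "'v itself \<Rightarrow> ('o, 'a, 'm) cat_scheme \<Rightarrow> bool" where
  "grothendieck_topos TYPE('v) T \<longleftrightarrow>
     (\<exists>(C :: ('v, 'v) cat) J. small_site TYPE('v) C J \<and>
        equivalent_categories T
          (sheaf_category C J :: (('v, 'v, 'v) presheaf, 'v \<Rightarrow> 'v \<Rightarrow> 'v) cat))"


section \<open>Internal relations\<close>

definition is_product ::
  "('o, 'a, 'm) cat_scheme \<Rightarrow> 'o \<Rightarrow> 'o \<Rightarrow> 'o \<times> 'a \<times> 'a \<Rightarrow> bool"
where
  "is_product T X Y = (\<lambda>(P, p, q). P \<in> Obj T \<and> p \<in> Hom T P X \<and> q \<in> Hom T P Y \<and>
     (\<forall>Z\<in>Obj T. \<forall>f\<in>Hom T Z X. \<forall>g\<in>Hom T Z Y.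
        \<exists>!h. h \<in> Hom T Z P \<and> Comp T Z P X p h = f \<and> Comp T Z P Y q h = g))"

definition product_cone :: "('o, 'a, 'm) cat_scheme \<Rightarrow> 'o \<Rightarrow> 'o \<Rightarrow> 'o \<times> 'a \<times> 'a" where
  "product_cone T X Y = (SOME c. is_product T X Y c)"

definition Prd :: "('o, 'a, 'm) cat_scheme \<Rightarrow> 'o \<Rightarrow> 'o \<Rightarrow> 'o" where
  "Prd T X Y = fst (product_cone T X Y)"

definition pr1 :: "('o, 'a, 'm) cat_scheme \<Rightarrow> 'o \<Rightarrow> 'o \<Rightarrow> 'a" where
  "pr1 T X Y = fst (snd (product_cone T X Y))"

definition pr2 :: "('o, 'a, 'm) cat_scheme \<Rightarrow> 'o \<Rightarrow> 'o \<Rightarrow> 'a" where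
  "pr2 T X Y = snd (snd (product_cone T X Y))"

text \<open>\<open>W\<close> with \<open>a : W \<rightarrow> U\<close> and \<open>b : W \<rightarrow> V\<close> is a pullback of \<open>f : U \<rightarrow> Y\<close> and \<open>g : V \<rightarrow> Y\<close>.\<close>

definition is_pullback ::
  "('o, 'a, 'm) cat_scheme \<Rightarrow> 'o \<Rightarrow> 'o \<Rightarrow> 'o \<Rightarrow> 'a \<Rightarrow> 'a \<Rightarrow> 'o \<Rightarrow> 'a \<Rightarrow> 'a \<Rightarrow> bool"
where
  "is_pullback T U V Y f g W a b \<longleftrightarrow> W \<in> Obj T \<and> a \<in> Hom T W U \<and> b \<in> Hom T W V \<and>
     Comp T W U Y f a = Comp T W V Y g b \<and>
     (\<forall>Z\<in>Obj T. \<forall>c\<in>Hom T Z U. \<forall>d\<in>Hom T Z V. Comp T Z U Y f c = Comp T Z V Y g d \<longrightarrow>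
        (\<exists>!h. h \<in> Hom T Z W \<and> Comp T Z W U a h = c \<and> Comp T Z W V b h = d))"

text \<open>The monomorphisms into \<open>P\<close>, as pairs \<open>(U, m)\<close> with \<open>m : U \<rightarrow> P\<close>.\<close>

definition monos_into :: "('o, 'a, 'm) cat_scheme \<Rightarrow> 'o \<Rightarrow> ('o \<times> 'a) set" where
  "monos_into T P = {(U, m). U \<in> Obj T \<and> m \<in> Hom T U P \<and>
     (\<forall>Z\<in>Obj T. \<forall>h\<in>Hom T Z U. \<forall>k\<in>Hom T Z U. Comp T Z U P m h = Comp T Z U P m k \<longrightarrow> h = k)}"

definition factors_through ::
  "('o, 'a, 'm) cat_scheme \<Rightarrow> 'o \<Rightarrow> 'o \<times> 'a \<Rightarrow> 'o \<times> 'a \<Rightarrow> bool"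
where
  "factors_through T P = (\<lambda>(U, m) (V, n). \<exists>k\<in>Hom T U V. m = Comp T U V P n k)"

definition mono_equiv ::
  "('o, 'a, 'm) cat_scheme \<Rightarrow> 'o \<Rightarrow> (('o \<times> 'a) \<times> ('o \<times> 'a)) set"
where
  "mono_equiv T P = {(r, s). r \<in> monos_into T P \<and> s \<in> monos_into T P \<and>
     factors_through T P r s \<and> factors_through T P s r}"

definition subobjects :: "('o, 'a, 'm) cat_scheme \<Rightarrow> 'o \<Rightarrow> ('o \<times> 'a) set set" where
  "subobjects T P = monos_into T P // mono_equiv T P"

definition is_image ::
  "('o, 'a, 'm) cat_scheme \<Rightarrow> 'o \<Rightarrow> 'o \<times> 'a \<Rightarrow> 'o \<times> 'a \<Rightarrow> bool"
where
  "is_image T P w i \<longleftrightarrow> i \<in> monos_into T P \<and> factors_through T P w i \<and>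
     (\<forall>k\<in>monos_into T P. factors_through T P w k \<longrightarrow> factors_through T P i k)"

text \<open>
  Relations \<open>X \<rightarrow> Y\<close> are subobjects of \<open>X \<times> Y\<close>, that is, equivalence classes of monomorphisms.
  The identity is the class of the diagonal. For \<open>(U, m)\<close> in \<open>R : X \<rightarrow> Y\<close> and \<open>(V, n)\<close> in
  \<open>S : Y \<rightarrow> Z\<close>, the composite \<open>S R\<close> is the image of the arrow \<open>U \<times>\<^sub>Y V \<rightarrow> X \<times> Z\<close>; the class is
  obtained as the set of all images of such arrows.
\<close>

definition rel_diagonal :: "('o, 'a, 'm) cat_scheme \<Rightarrow> 'o \<Rightarrow> ('o \<times> 'a) set" where
  "rel_diagonal T X = {r. \<exists>d\<in>Hom T X (Prd T X X).
     Comp T X (Prd T X X) X (pr1 T X X) d = Idn T X \<and>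
     Comp T X (Prd T X X) X (pr2 T X X) d = Idn T X \<and>
     ((X, d), r) \<in> mono_equiv T (Prd T X X)}"

definition rel_comp ::
  "('o, 'a, 'm) cat_scheme \<Rightarrow> 'o \<Rightarrow> 'o \<Rightarrow> 'o \<Rightarrow> ('o \<times> 'a) set \<Rightarrow> ('o \<times> 'a) set \<Rightarrow> ('o \<times> 'a) set"
where
  "rel_comp T X Y Z S R = {i. \<exists>(U, m)\<in>R. \<exists>(V, n)\<in>S. \<exists>W a b w.
     is_pullback T U V Y (Comp T U (Prd T X Y) Y (pr2 T X Y) m)
       (Comp T V (Prd T Y Z) Y (pr1 T Y Z) n) W a b \<and>
     w \<in> Hom T W (Prd T X Z) \<and>
     Comp T W (Prd T X Z) X (pr1 T X Z) w =
       Comp T W U X (Comp T U (Prd T X Y) X (pr1 T X Y) m) a \<and>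
     Comp T W (Prd T X Z) Z (pr2 T X Z) w =
       Comp T W V Z (Comp T V (Prd T Y Z) Z (pr2 T Y Z) n) b \<and>
     is_image T (Prd T X Z) (W, w) i}"

definition rel_opposite ::
  "('o, 'a, 'm) cat_scheme \<Rightarrow> 'o \<Rightarrow> 'o \<Rightarrow> ('o \<times> 'a) set \<Rightarrow> ('o \<times> 'a) set"
where
  "rel_opposite T X Y R = {(U, m'). m' \<in> Hom T U (Prd T Y X) \<and> (\<exists>m. (U, m) \<in> R \<and>
     Comp T U (Prd T Y X) Y (pr1 T Y X) m' = Comp T U (Prd T X Y) Y (pr2 T X Y) m \<and>
     Comp T U (Prd T Y X) X (pr2 T Y X) m' = Comp T U (Prd T X Y) X (pr1 T X Y) m)}"

definition Rel_of_topos ::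
  "('o, 'a, 'm) cat_scheme \<Rightarrow> ('o, ('o \<times> 'a) set) inv_quantaloid_rec"
where
  "Rel_of_topos T =
     \<lparr>Obj = Obj T,
      Hom = (\<lambda>X Y. subobjects T (Prd T X Y)),
      Idn = rel_diagonal T,
      Comp = rel_comp T,
      Le = (\<lambda>X Y R S. \<exists>r\<in>R. \<exists>s\<in>S. factors_through T (Prd T X Y) r s),
      Inv = rel_opposite T\<rparr>"


section \<open>Closed cribles\<close>

text \<open>A span from \<open>X\<close> to \<open>Y\<close> is a triple \<open>(U, f, g)\<close> with \<open>f : U \<rightarrow> Y\<close> and \<open>g : U \<rightarrow> X\<close>.\<close>

definition spans :: "('o, 'a, 'm) cat_scheme \<Rightarrow> 'o \<Rightarrow> 'o \<Rightarrow> ('o \<times> 'a \<times> 'a) set" where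
  "spans C X Y = {(U, f, g). U \<in> Obj C \<and> f \<in> Hom C U Y \<and> g \<in> Hom C U X}"

definition closed_cribles ::
  "('o, 'a, 'm) cat_scheme \<Rightarrow> ('o \<Rightarrow> ('o \<times> 'a) set set) \<Rightarrow> 'o \<Rightarrow> 'o \<Rightarrow> ('o \<times> 'a \<times> 'a) set set"
where
  "closed_cribles C J X Y = {R. R \<subseteq> spans C X Y \<and>
     (\<forall>(U, f, g)\<in>R. \<forall>V\<in>Obj C. \<forall>s\<in>Hom C V U. (V, Comp C V U Y f s, Comp C V U X g s) \<in> R) \<and>
     (\<forall>(U, f, g)\<in>spans C X Y.
        {(V, s). V \<in> Obj C \<and> s \<in> Hom C V U \<and> (V, Comp C V U Y f s, Comp C V U X g s) \<in> R} \<in> J U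
        \<longrightarrow> (U, f, g) \<in> R)}"

definition crible_closure ::
  "('o, 'a, 'm) cat_scheme \<Rightarrow> ('o \<Rightarrow> ('o \<times> 'a) set set) \<Rightarrow> 'o \<Rightarrow> 'o \<Rightarrow>
   ('o \<times> 'a \<times> 'a) set \<Rightarrow> ('o \<times> 'a \<times> 'a) set"
where
  "crible_closure C J X Y A = \<Inter>{R \<in> closed_cribles C J X Y. A \<subseteq> R}"

definition crible_quantaloid ::
  "('o, 'a, 'm) cat_scheme \<Rightarrow> ('o \<Rightarrow> ('o \<times> 'a) set set) \<Rightarrow> ('o, ('o \<times> 'a \<times> 'a) set) quantaloid_rec"
where
  "crible_quantaloid C J =
     \<lparr>Obj = Obj C,
      Hom = closed_cribles C J,
      Idn = (\<lambda>X. crible_closure C J X X {(X, Idn C X, Idn C X)}),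
      Comp = (\<lambda>X Y Z S R. crible_closure C J X Z
                {(U, h, g). \<exists>f. (U, h, f) \<in> S \<and> (U, f, g) \<in> R}),
      Le = (\<lambda>X Y R S. R \<subseteq> S)\<rparr>"

definition small_quantaloid_of_closed_cribles ::
  "'v itself \<Rightarrow> ('o, 'a, 'm) quantaloid_rec_scheme \<Rightarrow> bool"
where
  "small_quantaloid_of_closed_cribles TYPE('v) Q \<longleftrightarrow>
     quantaloid Q \<and> small_category TYPE('v) Q \<and>
     (\<exists>(C :: ('v, 'v) cat) J. small_site TYPE('v) C J \<and>
        equivalent_quantaloids Q (crible_quantaloid C J))"


section \<open>Splitting the symmetric idempotents\<close>

text \<open>
  A symmetric idempotent \<open>e : A \<rightarrow> A\<close> is recorded as \<open>(A, e)\<close>, because an arrow does not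
  determine its domain.
\<close>

definition ssi ::
  "('o, 'a) inv_quantaloid_rec \<Rightarrow> ('o \<times> 'a, 'a) inv_quantaloid_rec"
where
  "ssi Q =
     \<lparr>Obj = {(A, e). A \<in> Obj Q \<and> e \<in> Hom Q A A \<and> Comp Q A A A e e = e \<and> Inv Q A A e = e},
      Hom = (\<lambda>(A, e) (B, f). {x \<in> Hom Q A B. Comp Q A B B f x = x \<and> Comp Q A A B x e = x}),
      Idn = (\<lambda>(A, e). e),
      Comp = (\<lambda>X Y Z. Comp Q (fst X) (fst Y) (fst Z)),
      Le = (\<lambda>X Y. Le Q (fst X) (fst Y)),
      Inv = (\<lambda>X Y. Inv Q (fst X) (fst Y))\<rparr>"


section \<open>Enriched categories\<close>

text \<open>
  \<open>Arr A y x\<close> is the hom-arrow from the type of \<open>x\<close> to the type of \<open>y\<close>. As for presheaves,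
  everything is extensional, so that equality of functors and of distributors is equality of
  functions.
\<close>

record ('o, 'a, 'v) qcat =
  Elts :: "'v set"
  Ty :: "'v \<Rightarrow> 'o"
  Arr :: "'v \<Rightarrow> 'v \<Rightarrow> 'a"

definition is_qcat ::
  "('o, 'a, 'm) inv_quantaloid_rec_scheme \<Rightarrow> ('o, 'a, 'v) qcat \<Rightarrow> bool"
where
  "is_qcat Q A \<longleftrightarrow>
     small TYPE('v) (Elts A) \<and>
     Ty A \<in> Elts A \<rightarrow>\<^sub>E Obj Q \<and>
     (\<forall>x\<in>Elts A. \<forall>y\<in>Elts A. Arr A y x \<in> Hom Q (Ty A x) (Ty A y)) \<and>
     (\<forall>x y. \<not> (x \<in> Elts A \<and> y \<in> Elts A) \<longrightarrow> Arr A y x = undefined) \<and>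
     (\<forall>x\<in>Elts A. \<forall>y\<in>Elts A. \<forall>z\<in>Elts A. Le Q (Ty A x) (Ty A z)
        (Comp Q (Ty A x) (Ty A y) (Ty A z) (Arr A z y) (Arr A y x)) (Arr A z x)) \<and>
     (\<forall>x\<in>Elts A. Le Q (Ty A x) (Ty A x) (Idn Q (Ty A x)) (Arr A x x))"

definition is_symmetric ::
  "('o, 'a, 'm) inv_quantaloid_rec_scheme \<Rightarrow> ('o, 'a, 'v) qcat \<Rightarrow> bool"
where
  "is_symmetric Q A \<longleftrightarrow>
     (\<forall>x\<in>Elts A. \<forall>y\<in>Elts A. Arr A x y = Inv Q (Ty A x) (Ty A y) (Arr A y x))"

definition qfunctors ::
  "('o, 'a, 'm) inv_quantaloid_rec_scheme \<Rightarrow> ('o, 'a, 'v) qcat \<Rightarrow> ('o, 'a, 'v) qcat \<Rightarrow> ('v \<Rightarrow> 'v) set"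
where
  "qfunctors Q A B = {F \<in> Elts A \<rightarrow>\<^sub>E Elts B.
     (\<forall>x\<in>Elts A. Ty B (F x) = Ty A x) \<and>
     (\<forall>x\<in>Elts A. \<forall>y\<in>Elts A. Le Q (Ty A x) (Ty A y) (Arr A y x) (Arr B (F y) (F x)))}"

definition qfunctor_le ::
  "('o, 'a, 'm) inv_quantaloid_rec_scheme \<Rightarrow> ('o, 'a, 'v) qcat \<Rightarrow> ('o, 'a, 'v) qcat \<Rightarrow>
   ('v \<Rightarrow> 'v) \<Rightarrow> ('v \<Rightarrow> 'v) \<Rightarrow> bool"
where
  "qfunctor_le Q A B F G \<longleftrightarrow>
     (\<forall>x\<in>Elts A. Le Q (Ty A x) (Ty A x) (Idn Q (Ty A x)) (Arr B (F x) (G x)))"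

definition qfunctor_iso ::
  "('o, 'a, 'm) inv_quantaloid_rec_scheme \<Rightarrow> ('o, 'a, 'v) qcat \<Rightarrow> ('o, 'a, 'v) qcat \<Rightarrow>
   (('v \<Rightarrow> 'v) \<times> ('v \<Rightarrow> 'v)) set"
where
  "qfunctor_iso Q A B = {(F, G). F \<in> qfunctors Q A B \<and> G \<in> qfunctors Q A B \<and>
     qfunctor_le Q A B F G \<and> qfunctor_le Q A B G F}"

text \<open>\<open>\<Phi> y x\<close>, for \<open>x\<close> in \<open>A\<close> and \<open>y\<close> in \<open>B\<close>, is an arrow from the type of \<open>x\<close> to the type of \<open>y\<close>.\<close>

definition distributors ::
  "('o, 'a, 'm) inv_quantaloid_rec_scheme \<Rightarrow> ('o, 'a, 'v) qcat \<Rightarrow> ('o, 'a, 'v) qcat \<Rightarrow>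
   ('v \<Rightarrow> 'v \<Rightarrow> 'a) set"
where
  "distributors Q A B = {\<Phi>.
     (\<forall>x\<in>Elts A. \<forall>y\<in>Elts B. \<Phi> y x \<in> Hom Q (Ty A x) (Ty B y)) \<and>
     (\<forall>x y. \<not> (x \<in> Elts A \<and> y \<in> Elts B) \<longrightarrow> \<Phi> y x = undefined) \<and>
     (\<forall>x\<in>Elts A. \<forall>y\<in>Elts B. \<forall>y'\<in>Elts B. Le Q (Ty A x) (Ty B y')
        (Comp Q (Ty A x) (Ty B y) (Ty B y') (Arr B y' y) (\<Phi> y x)) (\<Phi> y' x)) \<and>
     (\<forall>x\<in>Elts A. \<forall>x'\<in>Elts A. \<forall>y\<in>Elts B. Le Q (Ty A x') (Ty B y)
        (Comp Q (Ty A x') (Ty A x) (Ty B y) (\<Phi> y x) (Arr A x x')) (\<Phi> y x'))}"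

definition dist_comp ::
  "('o, 'a, 'm) inv_quantaloid_rec_scheme \<Rightarrow>
   ('o, 'a, 'v) qcat \<Rightarrow> ('o, 'a, 'v) qcat \<Rightarrow> ('o, 'a, 'v) qcat \<Rightarrow>
   ('v \<Rightarrow> 'v \<Rightarrow> 'a) \<Rightarrow> ('v \<Rightarrow> 'v \<Rightarrow> 'a) \<Rightarrow> 'v \<Rightarrow> 'v \<Rightarrow> 'a"
where
  "dist_comp Q A B C \<Psi> \<Phi> = (\<lambda>z x. if x \<in> Elts A \<and> z \<in> Elts C
     then Join Q (Ty A x) (Ty C z)
       ((\<lambda>y. Comp Q (Ty A x) (Ty B y) (Ty C z) (\<Psi> z y) (\<Phi> y x)) ` Elts B)
     else undefined)"

definition SymDist ::
  "('o, 'a, 'm) inv_quantaloid_rec_scheme \<Rightarrow>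
   (('o, 'a, 'v) qcat, 'v \<Rightarrow> 'v \<Rightarrow> 'a) inv_quantaloid_rec"
where
  "SymDist Q =
     \<lparr>Obj = {A. is_qcat Q A \<and> is_symmetric Q A},
      Hom = distributors Q,
      Idn = Arr,
      Comp = dist_comp Q,
      Le = (\<lambda>A B \<Phi> \<Psi>. \<forall>x\<in>Elts A. \<forall>y\<in>Elts B. Le Q (Ty A x) (Ty B y) (\<Phi> y x) (\<Psi> y x)),
      Inv = (\<lambda>A B \<Phi> a b. if a \<in> Elts A \<and> b \<in> Elts B
               then Inv Q (Ty A a) (Ty B b) (\<Phi> b a) else undefined)\<rparr>"

text \<open>The distributor \<open>A(-, F-)\<close> from \<open>B\<close> to \<open>A\<close> represented by a functor \<open>F : B \<rightarrow> A\<close>.\<close>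

definition represented ::
  "('o, 'a, 'v) qcat \<Rightarrow> ('o, 'a, 'v) qcat \<Rightarrow> ('v \<Rightarrow> 'v) \<Rightarrow> 'v \<Rightarrow> 'v \<Rightarrow> 'a"
where
  "represented B A F = (\<lambda>y x. if x \<in> Elts B \<and> y \<in> Elts A then Arr A y (F x) else undefined)"

definition symmetrically_complete ::
  "('o, 'a, 'm) inv_quantaloid_rec_scheme \<Rightarrow> ('o, 'a, 'v) qcat \<Rightarrow> bool"
where
  "symmetrically_complete Q A \<longleftrightarrow>
     (\<forall>B :: ('o, 'a, 'v) qcat. B \<in> Obj (SymDist Q) \<longrightarrow>
        (\<forall>\<Phi>. is_symmetric_left_adjoint (SymDist Q) B A \<Phi> \<longrightarrow>
           (\<exists>F\<in>qfunctors Q B A. \<Phi> = represented B A F)))"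

definition SymDist_sc ::
  "('o, 'a, 'm) inv_quantaloid_rec_scheme \<Rightarrow>
   (('o, 'a, 'v) qcat, 'v \<Rightarrow> 'v \<Rightarrow> 'a) inv_quantaloid_rec"
where
  "SymDist_sc Q = (SymDist Q)\<lparr>Obj := {A \<in> Obj (SymDist Q). symmetrically_complete Q A}\<rparr>"

text \<open>
  The category of symmetrically complete symmetric categories; its arrows are the isomorphism
  classes of functors.
\<close>

definition SymCat_sc ::
  "('o, 'a, 'm) inv_quantaloid_rec_scheme \<Rightarrow> (('o, 'a, 'v) qcat, ('v \<Rightarrow> 'v) set) cat"
where
  "SymCat_sc Q =
     \<lparr>Obj = {A. is_qcat Q A \<and> is_symmetric Q A \<and> symmetrically_complete Q A},
      Hom = (\<lambda>A B. qfunctors Q A B // qfunctor_iso Q A B),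
      Idn = (\<lambda>A. qfunctor_iso Q A A `` {\<lambda>x\<in>Elts A. x}),
      Comp = (\<lambda>A B C g f.
        {H. \<exists>F\<in>f. \<exists>G\<in>g. (compose (Elts A) G F, H) \<in> qfunctor_iso Q A C})\<rparr>"

definition Sh ::
  "'v itself \<Rightarrow> ('o, 'a) inv_quantaloid_rec \<Rightarrow>
   (('o \<times> 'a, 'a, 'v) qcat, ('v \<Rightarrow> 'v) set) cat"
where
  "Sh TYPE('v) Q = SymCat_sc (ssi Q)"

definition Rel ::
  "'v itself \<Rightarrow> ('o, 'a) inv_quantaloid_rec \<Rightarrow>
   (('o \<times> 'a, 'a, 'v) qcat, 'v \<Rightarrow> 'v \<Rightarrow> 'a) inv_quantaloid_rec"
where
  "Rel TYPE('v) Q = SymDist_sc (ssi Q)"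

end

theory Submission
  imports Defs
begin

text \<open>
  A site \<open>(C, J)\<close> is represented in an involutive quantaloid \<open>Q\<close> by objects \<open>\<iota> U\<close> and symmetric left
  adjoints \<open>\<gamma> T U f\<close> such that every arrow between the \<open>\<iota> U\<close> is a join of spans of them, joins of spans are
  controlled by \<open>J\<close>, and every object of \<open>Q\<close> is covered by symmetric left adjoints out of the \<open>\<iota> U\<close>.
  Then the elements of type \<open>\<iota> U\<close> of a symmetrically complete category form a sheaf: maps into the type of an
  element restrict it, and covering families glue because they present a symmetric left adjoint. Functors are
  the same as morphisms of these sheaves, and every sheaf arises by completing the category of its sections.
  A distributor \<open>\<Phi>\<close> amounts to the closed relation \<open>1 \<le> \<Phi>(y, x)\<close> between elements \<open>x\<close> and \<open>y\<close> of equal type, that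
  is, to a subobject of the product. The representation by graphs in the closed cribles is transported along
  the equivalence, which preserves the canonical involution because left adjoints between closed cribles have
  their opposites as right adjoints. Splitting the symmetric idempotents keeps it, since the spans below an
  idempotent cover the split object by maps.
\<close>

section \<open>Smallness\<close>

text \<open>\<open>Q\<close> is only equivalent to the closed cribles, and an object of the
  splitting need not come from the site. This is why the argument runs over the abstract locale
  \<open>site_quantaloid\<close>, phrased with composition, order and involution, which survives
  both passages.

  The site need not be subcanonical, so \<open>\<gamma>\<close> may identify distinct arrows. They
  then agree on a covering sieve (\<open>gm_eq_local\<close>), and a sheaf cannot tell such arrows
  apart.

  The element that represents a point is unique only up to isomorphism, whereas a presheaf acts by
  functions. A skeleton \<open>pts\<close> of chosen representatives turns isomorphism into
  equality.

  Products in \<open>Sh\<close> are fixed by \<open>SOME\<close> and have no known form. They are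
  compared with tabulations of relations between sheaves; composition of subobjects becomes
  relational composition followed by closure. The laws of an involutive quantaloid then reach
  \<open>Rel_of_topos\<close> through the bijection with distributors, instead of being checked on
  classes of monomorphisms.\<close>

lemma universe_infinite:
  assumes "universe TYPE('v)" shows "infinite (UNIV :: 'v set)"
proof
  assume "finite (UNIV :: 'v set)"
  moreover have "|UNIV :: nat set| <o |UNIV :: 'v set|" using assms by (simp add: universe_def small_def)
  ultimately have "finite (UNIV :: nat set)" using card_of_ordLeq_finite ordLess_imp_ordLeq by blast
  then show False by simp
qed

lemma small_ordLeq: "small TYPE('v) A \<Longrightarrow> |B| \<le>o |A| \<Longrightarrow> small TYPE('v) B"
  unfolding small_def using ordLeq_ordLess_trans by blast

lemma small_subset: "small TYPE('v) A \<Longrightarrow> B \<subseteq> A \<Longrightarrow> small TYPE('v) B"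
  by (erule small_ordLeq, rule card_of_mono1)

lemma small_image: "small TYPE('v) A \<Longrightarrow> small TYPE('v) (f ` A)"
  by (erule small_ordLeq, rule card_of_image)

lemma small_inj_on_image: "small TYPE('v) (f ` A) \<Longrightarrow> inj_on f A \<Longrightarrow> small TYPE('v) A"
  by (erule small_ordLeq) (auto simp: card_of_ordLeq[symmetric])

lemma small_injection:
  assumes "small TYPE('v) A" obtains f :: "'a \<Rightarrow> 'v" where "inj_on f A"
proof -
  have "|A| \<le>o |UNIV :: 'v set|" using assms unfolding small_def by (rule ordLess_imp_ordLeq)
  then show ?thesis using that unfolding card_of_ordLeq[symmetric] by blast
qed

text \<open>The union axiom of \<open>universe\<close> speaks of subsets of \<open>'v\<close>
  indexed by a subset of \<open>'v\<close>. So the index set and the fibres are injected into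
  \<open>'v\<close>, and a pairing function, available because \<open>'v\<close> is infinite, keeps
  the images of different fibres apart.\<close>

lemma small_Sigma:
  fixes A :: "'a set" and F :: "'a \<Rightarrow> 'b set"
  assumes U: "universe TYPE('v)" and A: "small TYPE('v) A" and F: "\<And>i. i \<in> A \<Longrightarrow> small TYPE('v) (F i)"
  shows "small TYPE('v) (Sigma A F)"
proof -
  obtain p :: "'v \<times> 'v \<Rightarrow> 'v" where p: "inj p"
  proof -
    have "|UNIV \<times> UNIV :: ('v \<times> 'v) set| \<le>o |UNIV :: 'v set|"
      using card_of_Times_same_infinite[OF universe_infinite[OF U]] ordIso_imp_ordLeq by blast
    then show ?thesis using that unfolding card_of_ordLeq[symmetric] by auto
  qed
  obtain e :: "'a \<Rightarrow> 'v" where e: "inj_on e A" using small_injection[OF A] .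
  have "\<exists>h :: 'b \<Rightarrow> 'v. inj_on h (F i)" if "i \<in> A" for i using small_injection[OF F[OF that]] by blast
  then obtain h :: "'a \<Rightarrow> 'b \<Rightarrow> 'v" where h: "\<And>i. i \<in> A \<Longrightarrow> inj_on (h i) (F i)" by metis
  define G where "G j = (\<lambda>x. p (j, h (inv_into A e j) x)) ` F (inv_into A e j)" for j
  have "small TYPE('v) (\<Union>j\<in>e ` A. G j)"
  proof -
    have "small TYPE('v) (G j)" if "j \<in> e ` A" for j
      unfolding G_def by (rule small_image, rule F, rule inv_into_into[OF that])
    then show ?thesis using U small_image[OF A] unfolding universe_def by blast
  qed
  moreover have "(\<lambda>(i, x). p (e i, h i x)) ` Sigma A F \<subseteq> (\<Union>j\<in>e ` A. G j)"
    using e by (auto simp: G_def)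
  moreover have "inj_on (\<lambda>(i, x). p (e i, h i x)) (Sigma A F)"
  proof (rule inj_onI, clarify)
    fix i x i' x' assume *: "i \<in> A" "x \<in> F i" "i' \<in> A" "x' \<in> F i'" "p (e i, h i x) = p (e i', h i' x')"
    then have "e i = e i'" "h i x = h i' x'" using p by (auto dest: injD)
    then show "i = i' \<and> x = x'" using * e h by (auto dest: inj_onD)
  qed
  ultimately show ?thesis by (rule small_inj_on_image[OF small_subset])
qed

lemma small_Pow:
  fixes A :: "'a set"
  assumes U: "universe TYPE('v)" and A: "small TYPE('v) A" shows "small TYPE('v) (Pow A)"
proof -
  obtain e :: "'a \<Rightarrow> 'v" where e: "inj_on e A" using small_injection[OF A] .
  have "small TYPE('v) (Pow (e ` A))" using U small_image[OF A] unfolding universe_def by blast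
  moreover have "(`) e ` Pow A = Pow (e ` A)" by (rule image_Pow_surj) simp
  ultimately have "small TYPE('v) ((`) e ` Pow A)" by simp
  then show ?thesis by (rule small_inj_on_image) (rule inj_on_image_Pow[OF e])
qed

text \<open>A member of the product is extensional, so it is determined by its graph, which is a
  subset of \<open>Sigma A F\<close>.\<close>

lemma small_PiE:
  assumes U: "universe TYPE('v)" and A: "small TYPE('v) A" and F: "\<And>i. i \<in> A \<Longrightarrow> small TYPE('v) (F i)"
  shows "small TYPE('v) (PiE A F)"
proof -
  let ?g = "\<lambda>f. (\<lambda>x. (x, f x)) ` A"
  have "?g ` PiE A F \<subseteq> Pow (Sigma A F)" by (auto simp: PiE_def Pi_def)
  moreover have "inj_on ?g (PiE A F)"
  proof (rule inj_onI)
    fix f f' assume *: "f \<in> PiE A F" "f' \<in> PiE A F" "?g f = ?g f'"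
    have "f x = f' x" if "x \<in> A" for x
    proof -
      have "(x, f x) \<in> ?g f'" using *(3) that by blast
      then show ?thesis by auto
    qed
    then show "f = f'" using * by (auto intro: PiE_ext)
  qed
  ultimately show ?thesis
    by (intro small_inj_on_image[of ?g] small_subset[OF small_Pow[OF U small_Sigma[OF U A F]]])
qed

section \<open>Orders and joins\<close>

text \<open>The supremum as a single equivalence: that \<open>j\<close> bounds \<open>A\<close> is
  the case \<open>z = j\<close>, by reflexivity. Joins are exhibited in this form before being
  compared with the chosen \<open>Join\<close>.\<close>

definition is_join :: "('o, 'a, 'm) quantaloid_rec_scheme \<Rightarrow> 'o \<Rightarrow> 'o \<Rightarrow> 'a set \<Rightarrow> 'a \<Rightarrow> bool" where
  "is_join Q X Y A j \<longleftrightarrow> j \<in> Hom Q X Y \<and> (\<forall>z\<in>Hom Q X Y. Le Q X Y j z \<longleftrightarrow> (\<forall>a\<in>A. Le Q X Y a z))"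

locale hom_poset =
  fixes Q :: "('o, 'a, 'm) quantaloid_rec_scheme" and X Y
  assumes ord_refl: "a \<in> Hom Q X Y \<Longrightarrow> Le Q X Y a a"
    and ord_antisym: "\<lbrakk>a \<in> Hom Q X Y; b \<in> Hom Q X Y; Le Q X Y a b; Le Q X Y b a\<rbrakk> \<Longrightarrow> a = b"
    and ord_trans: "\<lbrakk>a \<in> Hom Q X Y; b \<in> Hom Q X Y; c \<in> Hom Q X Y; Le Q X Y a b; Le Q X Y b c\<rbrakk> \<Longrightarrow> Le Q X Y a c"
begin

lemma partial_order: "partial_order (hom_order Q X Y)"
  by standard (auto simp: hom_order_def intro: ord_refl ord_antisym ord_trans)

lemma least_iff_is_join:
  assumes "A \<subseteq> Hom Q X Y"
  shows "least (hom_order Q X Y) j (Upper (hom_order Q X Y) A) \<longleftrightarrow> is_join Q X Y A j"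
proof
  assume "is_join Q X Y A j"
  then show "least (hom_order Q X Y) j (Upper (hom_order Q X Y) A)"
    using assms ord_refl unfolding is_join_def least_def Upper_def by (auto simp: hom_order_def)
next
  assume L: "least (hom_order Q X Y) j (Upper (hom_order Q X Y) A)"
  then have j: "j \<in> Hom Q X Y" "\<forall>a\<in>A. Le Q X Y a j"
    using assms unfolding least_def Upper_def by (auto simp: hom_order_def)
  moreover have "Le Q X Y j z" if "z \<in> Hom Q X Y" "\<forall>a\<in>A. Le Q X Y a z" for z
    using L assms that unfolding least_def Upper_def by (auto simp: hom_order_def)
  ultimately show "is_join Q X Y A j" using assms ord_trans unfolding is_join_def by blast
qed

lemma is_join_unique: "is_join Q X Y A j \<Longrightarrow> is_join Q X Y A k \<Longrightarrow> j = k"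
  by (metis is_join_def ord_refl ord_antisym)

text \<open>Suprema suffice: the infimum of \<open>A\<close> is the supremum of its lower
  bounds.\<close>

lemma complete_latticeI:
  assumes ex: "\<And>A. A \<subseteq> Hom Q X Y \<Longrightarrow> \<exists>j. is_join Q X Y A j"
  shows "complete_lattice (hom_order Q X Y)"
proof -
  interpret partial_order "hom_order Q X Y" by (rule partial_order)
  show ?thesis
  proof
    fix A assume A: "A \<subseteq> carrier (hom_order Q X Y)"
    then have A': "A \<subseteq> Hom Q X Y" by (simp add: hom_order_def)
    show "\<exists>s. least (hom_order Q X Y) s (Upper (hom_order Q X Y) A)"
      using ex[OF A'] least_iff_is_join[OF A'] by blast
    let ?L = "{l \<in> Hom Q X Y. \<forall>a\<in>A. Le Q X Y l a}"
    obtain i where "is_join Q X Y ?L i" using ex[of ?L] by blast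
    then have i: "i \<in> Hom Q X Y" "\<And>z. z \<in> Hom Q X Y \<Longrightarrow> Le Q X Y i z \<longleftrightarrow> (\<forall>a\<in>?L. Le Q X Y a z)"
      by (auto simp: is_join_def)
    have "Le Q X Y i a" if "a \<in> A" for a using i(2)[of a] that A' by blast
    moreover have "Le Q X Y l i" if "l \<in> ?L" for l using i(2)[of i] i(1) ord_refl[of i] that by blast
    ultimately have "greatest (hom_order Q X Y) i (Lower (hom_order Q X Y) A)"
      using A' i(1) unfolding greatest_def Lower_def by (auto simp: hom_order_def subset_iff)
    then show "\<exists>i. greatest (hom_order Q X Y) i (Lower (hom_order Q X Y) A)" ..
  qed
qed

lemma Join_eqI:
  assumes "A \<subseteq> Hom Q X Y" "is_join Q X Y A j" shows "Join Q X Y A = j"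
  using least_iff_is_join[OF assms(1)] assms(2) is_join_unique unfolding Join_def sup_def
  by (metis (mono_tags, lifting) someI)

end

lemma hom_poset_if_complete_lattice:
  assumes "complete_lattice (hom_order Q X Y)" shows "hom_poset Q X Y"
proof -
  interpret complete_lattice "hom_order Q X Y" by (rule assms)
  show ?thesis
  proof
    show "Le Q X Y a a" if "a \<in> Hom Q X Y" for a using le_refl[of a] that by (simp add: hom_order_def)
    show "a = b" if "a \<in> Hom Q X Y" "b \<in> Hom Q X Y" "Le Q X Y a b" "Le Q X Y b a" for a b
      using le_antisym[of a b] that by (simp add: hom_order_def)
    show "Le Q X Y a c" if "a \<in> Hom Q X Y" "b \<in> Hom Q X Y" "c \<in> Hom Q X Y" "Le Q X Y a b" "Le Q X Y b c" for a b c
      using le_trans[of a b c] that by (simp add: hom_order_def)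
  qed
qed

context quantaloid
begin

lemma poset: "X \<in> Obj Q \<Longrightarrow> Y \<in> Obj Q \<Longrightarrow> hom_poset Q X Y"
  by (intro hom_poset_if_complete_lattice hom_complete)

lemma Le_refl: "X \<in> Obj Q \<Longrightarrow> Y \<in> Obj Q \<Longrightarrow> a \<in> Hom Q X Y \<Longrightarrow> Le Q X Y a a"
  using hom_poset.ord_refl[OF poset] .

lemma Le_antisym:
  "\<lbrakk>X \<in> Obj Q; Y \<in> Obj Q; a \<in> Hom Q X Y; b \<in> Hom Q X Y; Le Q X Y a b; Le Q X Y b a\<rbrakk> \<Longrightarrow> a = b"
  using hom_poset.ord_antisym[OF poset] .

lemma Le_trans:
  "\<lbrakk>X \<in> Obj Q; Y \<in> Obj Q; a \<in> Hom Q X Y; b \<in> Hom Q X Y; c \<in> Hom Q X Y; Le Q X Y a b; Le Q X Y b c\<rbrakk>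
   \<Longrightarrow> Le Q X Y a c"
  using hom_poset.ord_trans[OF poset] .

lemma is_join_Join:
  assumes "X \<in> Obj Q" "Y \<in> Obj Q" "A \<subseteq> Hom Q X Y" shows "is_join Q X Y A (Join Q X Y A)"
proof -
  interpret complete_lattice "hom_order Q X Y" by (rule hom_complete) fact+
  have A: "A \<subseteq> carrier (hom_order Q X Y)" using assms by (simp add: hom_order_def)
  show ?thesis unfolding Join_def
    by (rule supI[OF _ A]) (simp add: hom_poset.least_iff_is_join[OF poset] assms)
qed

lemma Join_closed: "X \<in> Obj Q \<Longrightarrow> Y \<in> Obj Q \<Longrightarrow> A \<subseteq> Hom Q X Y \<Longrightarrow> Join Q X Y A \<in> Hom Q X Y"
  using is_join_Join by (simp add: is_join_def)

lemma Join_le_iff: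
  "\<lbrakk>X \<in> Obj Q; Y \<in> Obj Q; A \<subseteq> Hom Q X Y; z \<in> Hom Q X Y\<rbrakk>
   \<Longrightarrow> Le Q X Y (Join Q X Y A) z \<longleftrightarrow> (\<forall>a\<in>A. Le Q X Y a z)"
  using is_join_Join by (simp add: is_join_def)

lemma Join_upper:
  "\<lbrakk>X \<in> Obj Q; Y \<in> Obj Q; A \<subseteq> Hom Q X Y; a \<in> A\<rbrakk> \<Longrightarrow> Le Q X Y a (Join Q X Y A)"
  using Join_le_iff Join_closed Le_refl by metis

text \<open>Turns preservation of suprema into monotonicity: for comparable arrows the larger one is
  the join of the pair, hence its image under composition or involution is the join of the two
  images.\<close>

lemma Join_pair:
  assumes "X \<in> Obj Q" "Y \<in> Obj Q" "a \<in> Hom Q X Y" "b \<in> Hom Q X Y" "Le Q X Y a b"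
  shows "Join Q X Y {a, b} = b"
proof (rule hom_poset.Join_eqI[OF poset])
  have "Le Q X Y a z" if "z \<in> Hom Q X Y" "Le Q X Y b z" for z using Le_trans[of X Y a b z] assms that by simp
  then show "is_join Q X Y {a, b} b" using assms(4) by (auto simp: is_join_def)
qed (use assms in auto)

lemma Comp_mono_left:
  assumes "X \<in> Obj Q" "Y \<in> Obj Q" "Z \<in> Obj Q" "f \<in> Hom Q X Y" "g \<in> Hom Q Y Z" "g' \<in> Hom Q Y Z" "Le Q Y Z g g'"
  shows "Le Q X Z (Comp Q X Y Z g f) (Comp Q X Y Z g' f)"
proof -
  have "Comp Q X Y Z g' f = Join Q X Z ((\<lambda>g. Comp Q X Y Z g f) ` {g, g'})"
    using Comp_Join_left[of X Y Z f "{g, g'}"] assms Join_pair[of Y Z g g'] by simp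
  then show ?thesis using assms Comp_closed Join_upper[of X Z "(\<lambda>g. Comp Q X Y Z g f) ` {g, g'}"] by simp
qed

lemma Comp_mono_right:
  assumes "X \<in> Obj Q" "Y \<in> Obj Q" "Z \<in> Obj Q" "f \<in> Hom Q X Y" "f' \<in> Hom Q X Y" "g \<in> Hom Q Y Z" "Le Q X Y f f'"
  shows "Le Q X Z (Comp Q X Y Z g f) (Comp Q X Y Z g f')"
proof -
  have "Comp Q X Y Z g f' = Join Q X Z ((\<lambda>f. Comp Q X Y Z g f) ` {f, f'})"
    using Comp_Join_right[of X Y Z "{f, f'}" g] assms Join_pair[of X Y f f'] by simp
  then show ?thesis using assms Comp_closed Join_upper[of X Z "(\<lambda>f. Comp Q X Y Z g f) ` {f, f'}"] by simp
qed

end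

text \<open>\<open>Join\<close> is a choice of supremum. Given explicit suprema \<open>J\<close>,
  antisymmetry identifies the two, and preservation of joins is asked for as a comparison with an
  arbitrary \<open>z\<close>, so that no join has to be computed.\<close>

lemma quantaloidI:
  assumes C: "category Q"
    and P: "\<And>X Y. \<lbrakk>X \<in> Obj Q; Y \<in> Obj Q\<rbrakk> \<Longrightarrow> hom_poset Q X Y"
    and J: "\<And>X Y A. \<lbrakk>X \<in> Obj Q; Y \<in> Obj Q; A \<subseteq> Hom Q X Y\<rbrakk> \<Longrightarrow> is_join Q X Y A (J X Y A)"
    and L: "\<And>X Y Z f A z. \<lbrakk>X \<in> Obj Q; Y \<in> Obj Q; Z \<in> Obj Q; f \<in> Hom Q X Y; A \<subseteq> Hom Q Y Z; z \<in> Hom Q X Z\<rbrakk>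
      \<Longrightarrow> Le Q X Z (Comp Q X Y Z (J Y Z A) f) z \<longleftrightarrow> (\<forall>g\<in>A. Le Q X Z (Comp Q X Y Z g f) z)"
    and R: "\<And>X Y Z A g z. \<lbrakk>X \<in> Obj Q; Y \<in> Obj Q; Z \<in> Obj Q; A \<subseteq> Hom Q X Y; g \<in> Hom Q Y Z; z \<in> Hom Q X Z\<rbrakk>
      \<Longrightarrow> Le Q X Z (Comp Q X Y Z g (J X Y A)) z \<longleftrightarrow> (\<forall>f\<in>A. Le Q X Z (Comp Q X Y Z g f) z)"
  shows "quantaloid Q" and "\<And>X Y A. \<lbrakk>X \<in> Obj Q; Y \<in> Obj Q; A \<subseteq> Hom Q X Y\<rbrakk> \<Longrightarrow> Join Q X Y A = J X Y A"
proof -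
  interpret category Q by (rule C)
  show JJ: "Join Q X Y A = J X Y A" if "X \<in> Obj Q" "Y \<in> Obj Q" "A \<subseteq> Hom Q X Y" for X Y A
    using hom_poset.Join_eqI[OF P] J that by blast
  have Jc: "J X Y A \<in> Hom Q X Y" if "X \<in> Obj Q" "Y \<in> Obj Q" "A \<subseteq> Hom Q X Y" for X Y A
    using J[OF that] by (simp add: is_join_def)
  show "quantaloid Q"
  proof (intro quantaloid.intro quantaloid_axioms.intro C)
    show "complete_lattice (hom_order Q X Y)" if "X \<in> Obj Q" "Y \<in> Obj Q" for X Y
      using hom_poset.complete_latticeI[OF P] J that by blast
  next
    fix X Y Z f A
    assume *: "X \<in> Obj Q" "Y \<in> Obj Q" "Z \<in> Obj Q" "f \<in> Hom Q X Y" "A \<subseteq> Hom Q Y Z"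
    have "Join Q X Z ((\<lambda>g. Comp Q X Y Z g f) ` A) = Comp Q X Y Z (J Y Z A) f"
      by (rule hom_poset.Join_eqI[OF P]) (use * L Jc Comp_closed in \<open>auto simp: is_join_def\<close>)
    then show "Comp Q X Y Z (Join Q Y Z A) f = Join Q X Z ((\<lambda>g. Comp Q X Y Z g f) ` A)"
      using JJ * by simp
  next
    fix X Y Z A g
    assume *: "X \<in> Obj Q" "Y \<in> Obj Q" "Z \<in> Obj Q" "A \<subseteq> Hom Q X Y" "g \<in> Hom Q Y Z"
    have "Join Q X Z ((\<lambda>f. Comp Q X Y Z g f) ` A) = Comp Q X Y Z g (J X Y A)"
      by (rule hom_poset.Join_eqI[OF P]) (use * R Jc Comp_closed in \<open>auto simp: is_join_def\<close>)
    then show "Comp Q X Y Z g (Join Q X Y A) = Join Q X Z ((\<lambda>f. Comp Q X Y Z g f) ` A)"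
      using JJ * by simp
  qed
qed

context involutive_quantaloid
begin

lemma Inv_mono:
  assumes "X \<in> Obj Q" "Y \<in> Obj Q" "a \<in> Hom Q X Y" "b \<in> Hom Q X Y" "Le Q X Y a b"
  shows "Le Q Y X (Inv Q X Y a) (Inv Q X Y b)"
proof -
  have "Inv Q X Y b = Join Q Y X (Inv Q X Y ` {a, b})"
    using Inv_Join[of X Y "{a, b}"] Join_pair[of X Y a b] assms by simp
  then show ?thesis using Join_upper[of Y X "Inv Q X Y ` {a, b}"] assms Inv_closed by simp
qed

end

text \<open>A monotone map that is its own inverse is an order isomorphism, so it preserves suprema;
  this supplies the axiom \<open>Inv_Join\<close>.\<close>

lemma involutive_quantaloidI:
  assumes "quantaloid Q"
    and cl: "\<And>X Y f. \<lbrakk>X \<in> Obj Q; Y \<in> Obj Q; f \<in> Hom Q X Y\<rbrakk> \<Longrightarrow> Inv Q X Y f \<in> Hom Q Y X"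
    and "\<And>X. X \<in> Obj Q \<Longrightarrow> Inv Q X X (Idn Q X) = Idn Q X"
    and "\<And>X Y Z f g. \<lbrakk>X \<in> Obj Q; Y \<in> Obj Q; Z \<in> Obj Q; f \<in> Hom Q X Y; g \<in> Hom Q Y Z\<rbrakk>
      \<Longrightarrow> Inv Q X Z (Comp Q X Y Z g f) = Comp Q Z Y X (Inv Q X Y f) (Inv Q Y Z g)"
    and mono: "\<And>X Y f g. \<lbrakk>X \<in> Obj Q; Y \<in> Obj Q; f \<in> Hom Q X Y; g \<in> Hom Q X Y; Le Q X Y f g\<rbrakk>
      \<Longrightarrow> Le Q Y X (Inv Q X Y f) (Inv Q X Y g)"
    and inv: "\<And>X Y f. \<lbrakk>X \<in> Obj Q; Y \<in> Obj Q; f \<in> Hom Q X Y\<rbrakk> \<Longrightarrow> Inv Q Y X (Inv Q X Y f) = f"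
  shows "involutive_quantaloid Q"
proof -
  interpret quantaloid Q by fact
  have "Inv Q X Y (Join Q X Y A) = Join Q Y X (Inv Q X Y ` A)"
    if XY: "X \<in> Obj Q" "Y \<in> Obj Q" and A: "A \<subseteq> Hom Q X Y" for X Y A
  proof (rule sym, rule hom_poset.Join_eqI[OF poset])
    show "Inv Q X Y ` A \<subseteq> Hom Q Y X" using XY A cl by auto
    show "is_join Q Y X (Inv Q X Y ` A) (Inv Q X Y (Join Q X Y A))"
      unfolding is_join_def
    proof (intro conjI ballI)
      show c: "Inv Q X Y (Join Q X Y A) \<in> Hom Q Y X" using XY A cl Join_closed by simp
      have sw: "Le Q Y X (Inv Q X Y a) z \<longleftrightarrow> Le Q X Y a (Inv Q Y X z)"
        if "a \<in> Hom Q X Y" "z \<in> Hom Q Y X" for a z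
        using XY that mono[of X Y a "Inv Q Y X z"] mono[of Y X "Inv Q X Y a" z] cl inv by metis
      fix z assume z: "z \<in> Hom Q Y X"
      show "Le Q Y X (Inv Q X Y (Join Q X Y A)) z \<longleftrightarrow> (\<forall>a\<in>Inv Q X Y ` A. Le Q Y X a z)"
        using XY A z by (simp add: sw Join_closed Join_le_iff cl subset_iff)
    qed
  qed (use XY in simp_all)
  then show ?thesis by unfold_locales (use assms in auto)
qed

text \<open>Transport of structure: \<open>R\<close> is only a record of operations, and its laws
  are those of \<open>D\<close> read through the bijections \<open>\<phi>\<close>. Applied with
  \<open>R\<close> the relations of a topos, it spares proving associativity and completeness for
  subobjects.\<close>

lemma iso_involutive_quantaloid:
  assumes D: "involutive_quantaloid D" and O: "Obj R = Obj D"
    and bij: "\<And>X Y. \<lbrakk>X \<in> Obj D; Y \<in> Obj D\<rbrakk> \<Longrightarrow> bij_betw (\<phi> X Y) (Hom D X Y) (Hom R X Y)"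
    and idn: "\<And>X. X \<in> Obj D \<Longrightarrow> \<phi> X X (Idn D X) = Idn R X"
    and cmp: "\<And>X Y Z f g. \<lbrakk>X \<in> Obj D; Y \<in> Obj D; Z \<in> Obj D; f \<in> Hom D X Y; g \<in> Hom D Y Z\<rbrakk>
      \<Longrightarrow> \<phi> X Z (Comp D X Y Z g f) = Comp R X Y Z (\<phi> Y Z g) (\<phi> X Y f)"
    and le: "\<And>X Y f g. \<lbrakk>X \<in> Obj D; Y \<in> Obj D; f \<in> Hom D X Y; g \<in> Hom D X Y\<rbrakk>
      \<Longrightarrow> Le R X Y (\<phi> X Y f) (\<phi> X Y g) \<longleftrightarrow> Le D X Y f g"
    and inv: "\<And>X Y f. \<lbrakk>X \<in> Obj D; Y \<in> Obj D; f \<in> Hom D X Y\<rbrakk> \<Longrightarrow> \<phi> Y X (Inv D X Y f) = Inv R X Y (\<phi> X Y f)"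
  shows "equivalent_involutive_quantaloids D R"
proof -
  interpret D: involutive_quantaloid D by (rule D)
  define \<psi> where "\<psi> X Y = inv_into (Hom D X Y) (\<phi> X Y)" for X Y
  have \<phi>: "\<phi> X Y f \<in> Hom R X Y" if "X \<in> Obj D" "Y \<in> Obj D" "f \<in> Hom D X Y" for X Y f
    using bij that by (auto simp: bij_betw_def)
  have \<psi>: "\<psi> X Y f \<in> Hom D X Y" "\<phi> X Y (\<psi> X Y f) = f" if "X \<in> Obj D" "Y \<in> Obj D" "f \<in> Hom R X Y" for X Y f
    using bij[of X Y] that unfolding \<psi>_def bij_betw_def by (auto simp: f_inv_into_f intro: inv_into_into)
  have \<psi>\<phi>: "\<psi> X Y (\<phi> X Y f) = f" if "X \<in> Obj D" "Y \<in> Obj D" "f \<in> Hom D X Y" for X Y f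
    using bij[of X Y] that unfolding \<psi>_def bij_betw_def by simp
  have ext: "\<exists>f'\<in>Hom D X Y. f = \<phi> X Y f'" if "X \<in> Obj D" "Y \<in> Obj D" "f \<in> Hom R X Y" for X Y f
    using \<psi> that by metis
  have cat: "category R"
  proof
    fix X assume X: "X \<in> Obj R"
    then show "Idn R X \<in> Hom R X X" using O idn \<phi> D.Idn_closed by metis
    fix Y assume Y: "Y \<in> Obj R"
    {
      fix f assume "f \<in> Hom R X Y"
      then obtain f' where f': "f' \<in> Hom D X Y" "f = \<phi> X Y f'" using ext X Y O by metis
      show "Comp R X X Y f (Idn R X) = f"
        using X Y O f' cmp[of X X Y "Idn D X" f'] idn D.Idn_closed D.Comp_Idn by simp
      show "Comp R X Y Y (Idn R Y) f = f"
        using X Y O f' cmp[of X Y Y f' "Idn D Y"] idn D.Idn_closed D.Idn_Comp by simp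
    }
    fix Z assume Z: "Z \<in> Obj R"
    {
      fix f g assume "f \<in> Hom R X Y" "g \<in> Hom R Y Z"
      then obtain f' g' where "f' \<in> Hom D X Y" "f = \<phi> X Y f'" "g' \<in> Hom D Y Z" "g = \<phi> Y Z g'"
        using ext X Y Z O by metis
      then show "Comp R X Y Z g f \<in> Hom R X Z" using X Y Z O by (simp add: cmp[symmetric] D.Comp_closed \<phi>)
    }
    fix W f g h assume W: "W \<in> Obj R" and "f \<in> Hom R W X" "g \<in> Hom R X Y" "h \<in> Hom R Y Z"
    then obtain f' g' h' where "f' \<in> Hom D W X" "f = \<phi> W X f'" "g' \<in> Hom D X Y" "g = \<phi> X Y g'"
      "h' \<in> Hom D Y Z" "h = \<phi> Y Z h'" using ext X Y Z W O by metis
    then show "Comp R W X Z (Comp R X Y Z h g) f = Comp R W Y Z h (Comp R W X Y g f)"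
      using W X Y Z O by (simp add: cmp[symmetric] D.Comp_closed D.Comp_assoc)
  qed
  have poset: "hom_poset R X Y" if XY: "X \<in> Obj R" "Y \<in> Obj R" for X Y
  proof
    have E: "\<exists>f'\<in>Hom D X Y. f = \<phi> X Y f'" if "f \<in> Hom R X Y" for f using ext that XY O by metis
    show "Le R X Y a a" if "a \<in> Hom R X Y" for a
      using E[OF that] XY O le D.Le_refl by metis
    show "a = b" if "a \<in> Hom R X Y" "b \<in> Hom R X Y" "Le R X Y a b" "Le R X Y b a" for a b
      using E[OF that(1)] E[OF that(2)] that(3,4) XY O le D.Le_antisym by metis
    show "Le R X Y a c" if h: "a \<in> Hom R X Y" "b \<in> Hom R X Y" "c \<in> Hom R X Y" and l: "Le R X Y a b" "Le R X Y b c" for a b c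
    proof -
      obtain a' b' c' where "a' \<in> Hom D X Y" "a = \<phi> X Y a'" "b' \<in> Hom D X Y" "b = \<phi> X Y b'"
        "c' \<in> Hom D X Y" "c = \<phi> X Y c'" using E h by meson
      then show ?thesis using l XY O le D.Le_trans[of X Y a' b' c'] by simp
    qed
  qed
  have isj: "is_join R X Y (\<phi> X Y ` A) (\<phi> X Y j)"
    if XY: "X \<in> Obj D" "Y \<in> Obj D" "A \<subseteq> Hom D X Y" "is_join D X Y A j" for X Y A j
    unfolding is_join_def
  proof (intro conjI ballI)
    show "\<phi> X Y j \<in> Hom R X Y" using that \<phi> by (simp add: is_join_def)
    fix z assume "z \<in> Hom R X Y"
    then obtain z' where "z' \<in> Hom D X Y" "z = \<phi> X Y z'" using ext XY by metis
    then show "Le R X Y (\<phi> X Y j) z \<longleftrightarrow> (\<forall>a\<in>\<phi> X Y ` A. Le R X Y a z)"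
      using that le by (auto simp: is_join_def subset_iff)
  qed
  define J where "J X Y A = \<phi> X Y (Join D X Y (\<psi> X Y ` A))" for X Y A
  have im: "\<phi> X Y ` \<psi> X Y ` A = A" "\<psi> X Y ` A \<subseteq> Hom D X Y" if "X \<in> Obj D" "Y \<in> Obj D" "A \<subseteq> Hom R X Y" for X Y A
    using \<psi> that by (force simp: image_image subset_iff)+
  have R: "quantaloid R" and J: "\<And>X Y A. X \<in> Obj R \<Longrightarrow> Y \<in> Obj R \<Longrightarrow> A \<subseteq> Hom R X Y \<Longrightarrow> Join R X Y A = J X Y A"
  proof (atomize (full), intro conjI allI impI)
    have 1: "is_join R X Y A (J X Y A)" if "X \<in> Obj R" "Y \<in> Obj R" "A \<subseteq> Hom R X Y" for X Y A
      using isj[of X Y "\<psi> X Y ` A"] im[of X Y A] that D.is_join_Join O unfolding J_def by metis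
    have \<psi>J: "J X Y A \<in> Hom R X Y" "\<psi> X Y (J X Y A) = Join D X Y (\<psi> X Y ` A)" if "X \<in> Obj D" "Y \<in> Obj D" "A \<subseteq> Hom R X Y" for X Y A
      using that im(2)[OF that] by (simp_all add: J_def \<phi> \<psi>\<phi> D.Join_closed)
    have e: "Le R X Z (Comp R X Y Z g f) z \<longleftrightarrow> Le D X Z (Comp D X Y Z (\<psi> Y Z g) (\<psi> X Y f)) (\<psi> X Z z)"
      if "X \<in> Obj D" "Y \<in> Obj D" "Z \<in> Obj D" "f \<in> Hom R X Y" "g \<in> Hom R Y Z" "z \<in> Hom R X Z" for X Y Z f g z
      using le[of X Z "Comp D X Y Z (\<psi> Y Z g) (\<psi> X Y f)" "\<psi> X Z z"] that by (simp add: cmp \<psi> D.Comp_closed)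
    have 2: "Le R X Z (Comp R X Y Z (J Y Z A) f) z \<longleftrightarrow> (\<forall>g\<in>A. Le R X Z (Comp R X Y Z g f) z)"
      if ob: "X \<in> Obj R" "Y \<in> Obj R" "Z \<in> Obj R" and f: "f \<in> Hom R X Y" and A: "A \<subseteq> Hom R Y Z" and z: "z \<in> Hom R X Z" for X Y Z f A z
    proof -
      have "(\<lambda>g. Comp D X Y Z g (\<psi> X Y f)) ` \<psi> Y Z ` A \<subseteq> Hom D X Z" using ob f A O \<psi> D.Comp_closed by (auto simp: subset_iff)
      then have "Le R X Z (Comp R X Y Z (J Y Z A) f) z \<longleftrightarrow> (\<forall>g\<in>A. Le D X Z (Comp D X Y Z (\<psi> Y Z g) (\<psi> X Y f)) (\<psi> X Z z))"
        using ob f A z O im by (simp add: e \<psi>J \<psi> D.Comp_Join_left D.Join_le_iff)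
      then show ?thesis using ob f A z O e by (simp add: subset_iff)
    qed
    have 3: "Le R X Z (Comp R X Y Z g (J X Y A)) z \<longleftrightarrow> (\<forall>f\<in>A. Le R X Z (Comp R X Y Z g f) z)"
      if ob: "X \<in> Obj R" "Y \<in> Obj R" "Z \<in> Obj R" and A: "A \<subseteq> Hom R X Y" and g: "g \<in> Hom R Y Z" and z: "z \<in> Hom R X Z" for X Y Z g A z
    proof -
      have "(\<lambda>f. Comp D X Y Z (\<psi> Y Z g) f) ` \<psi> X Y ` A \<subseteq> Hom D X Z" using ob g A O \<psi> D.Comp_closed by (auto simp: subset_iff)
      then have "Le R X Z (Comp R X Y Z g (J X Y A)) z \<longleftrightarrow> (\<forall>f\<in>A. Le D X Z (Comp D X Y Z (\<psi> Y Z g) (\<psi> X Y f)) (\<psi> X Z z))"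
        using ob g A z O im by (simp add: e \<psi>J \<psi> D.Comp_Join_right D.Join_le_iff)
      then show ?thesis using ob g A z O e by (simp add: subset_iff)
    qed
    show "quantaloid R" by (rule quantaloidI(1)[OF cat, where J = J]; rule poset 1 2 3; assumption)
    show "Join R X Y A = J X Y A" if "X \<in> Obj R" "Y \<in> Obj R" "A \<subseteq> Hom R X Y" for X Y A
      by (rule quantaloidI(2)[OF cat _ _ _ _ that, where J = J]; rule poset 1 2 3; assumption)
  qed
  interpret R: quantaloid R by (rule R)
  have IR: "involutive_quantaloid R"
  proof (rule involutive_quantaloidI[OF R])
    fix X Y assume XY: "X \<in> Obj R" "Y \<in> Obj R"
    show "Inv R X X (Idn R X) = Idn R X" using XY O inv[of X X "Idn D X"] idn[of X] D.Inv_Idn[of X] D.Idn_closed[of X] by simp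
    {
      fix f assume "f \<in> Hom R X Y"
      then obtain f' where f': "f' \<in> Hom D X Y" "f = \<phi> X Y f'" using ext XY O by metis
      show "Inv R X Y f \<in> Hom R Y X" using XY O f' inv[symmetric] \<phi> D.Inv_closed by simp
      show "Inv R Y X (Inv R X Y f) = f" using XY O f' by (simp add: inv[symmetric] D.Inv_closed D.Inv_Inv)
      fix g assume "g \<in> Hom R X Y" and le': "Le R X Y f g"
      then obtain g' where g': "g' \<in> Hom D X Y" "g = \<phi> X Y g'" using ext XY O by metis
      then show "Le R Y X (Inv R X Y f) (Inv R X Y g)" using XY O f' le' D.Inv_mono[of X Y f' g']
        by (simp add: inv[symmetric] D.Inv_closed le)
    }
    fix Z f g assume Z: "Z \<in> Obj R" and "f \<in> Hom R X Y" "g \<in> Hom R Y Z"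
    then obtain f' g' where "f' \<in> Hom D X Y" "f = \<phi> X Y f'" "g' \<in> Hom D Y Z" "g = \<phi> Y Z g'"
      using ext XY O by metis
    then show "Inv R X Z (Comp R X Y Z g f) = Comp R Z Y X (Inv R X Y f) (Inv R Y Z g)"
      using XY Z O by (simp add: cmp[symmetric] inv[symmetric] D.Comp_closed D.Inv_Comp D.Inv_closed)
  qed
  have F: "is_functor D R (\<lambda>X. X) \<phi>" unfolding is_functor_def using O \<phi> idn cmp by simp
  have G: "is_functor R D (\<lambda>X. X) \<psi>" unfolding is_functor_def
  proof (intro conjI ballI)
    fix X assume X: "X \<in> Obj R"
    then show "X \<in> Obj D" using O by simp
    show "\<psi> X X (Idn R X) = Idn D X" using X O \<psi>\<phi>[of X X "Idn D X"] idn D.Idn_closed by simp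
    fix Y assume Y: "Y \<in> Obj R"
    show "\<psi> X Y f \<in> Hom D X Y" if "f \<in> Hom R X Y" for f using X Y O \<psi> that by simp
    fix Z f g assume Z: "Z \<in> Obj R" and "f \<in> Hom R X Y" "g \<in> Hom R Y Z"
    then have "\<phi> X Z (Comp D X Y Z (\<psi> Y Z g) (\<psi> X Y f)) = Comp R X Y Z g f" using X Y O cmp \<psi> by simp
    then show "\<psi> X Z (Comp R X Y Z g f) = Comp D X Y Z (\<psi> Y Z g) (\<psi> X Y f)"
      using \<psi>\<phi>[of X Z] D.Comp_closed X Y Z O \<psi> \<open>f \<in> Hom R X Y\<close> \<open>g \<in> Hom R Y Z\<close> by metis
  qed
  have ID: "is_iso D X X (Idn D X)" if "X \<in> Obj D" for X
    unfolding is_iso_def using that D.Idn_closed D.Idn_Comp by blast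
  have IR': "is_iso R X X (Idn R X)" if "X \<in> Obj R" for X
    unfolding is_iso_def using that R.Idn_closed R.Idn_Comp by blast
  have "naturally_iso_to_identity D (\<lambda>X. X) (\<lambda>X Y f. \<psi> X Y (\<phi> X Y f))"
    unfolding naturally_iso_to_identity_def
    by (rule exI[of _ "Idn D"]) (simp add: ID \<psi>\<phi> D.Idn_Comp D.Comp_Idn)
  moreover have "naturally_iso_to_identity R (\<lambda>X. X) (\<lambda>X Y f. \<phi> X Y (\<psi> X Y f))"
    unfolding naturally_iso_to_identity_def
    by (rule exI[of _ "Idn R"]) (use O in \<open>simp add: IR' \<psi> R.Idn_Comp R.Comp_Idn\<close>)
  ultimately have eq: "inverse_equivalences D R (\<lambda>X. X) \<phi> (\<lambda>X. X) \<psi>"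
    unfolding inverse_equivalences_def using F G by simp
  have \<phi>J: "\<phi> X Y (Join D X Y A) = Join R X Y (\<phi> X Y ` A)" if "X \<in> Obj D" "Y \<in> Obj D" "A \<subseteq> Hom D X Y" for X Y A
  proof (rule sym, rule hom_poset.Join_eqI[OF R.poset])
    show "\<phi> X Y ` A \<subseteq> Hom R X Y" using that \<phi> by (auto simp: subset_iff)
    show "is_join R X Y (\<phi> X Y ` A) (\<phi> X Y (Join D X Y A))" by (rule isj[OF that D.is_join_Join[OF that]])
  qed (use that O in simp_all)
  have hF: "is_homomorphism D R (\<lambda>X. X) \<phi>" unfolding is_homomorphism_def using F \<phi>J by simp
  have hG: "is_homomorphism R D (\<lambda>X. X) \<psi>" unfolding is_homomorphism_def
    using G O J \<psi>\<phi> D.Join_closed im by (simp add: J_def)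
  have pF: "preserves_involution D R (\<lambda>X. X) \<phi>" unfolding preserves_involution_def using inv by simp
  have "\<psi> Y X (Inv R X Y f) = Inv D X Y (\<psi> X Y f)" if "X \<in> Obj D" "Y \<in> Obj D" "f \<in> Hom R X Y" for X Y f
    using that inv[of X Y "\<psi> X Y f"] \<psi>[of X Y f] \<psi>\<phi>[of Y X "Inv D X Y (\<psi> X Y f)"] D.Inv_closed by simp
  then have pG: "preserves_involution R D (\<lambda>X. X) \<psi>" unfolding preserves_involution_def using O by simp
  show ?thesis unfolding equivalent_involutive_quantaloids_def using D IR eq hF hG pF pG by blast
qed

section \<open>Equivalences of categories\<close>

context category
begin

lemma iso_inverse:
  assumes "is_iso C X Y f"
  obtains g where "g \<in> Hom C Y X" "Comp C X Y X g f = Idn C X" "Comp C Y X Y f g = Idn C Y"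
  using assms by (auto simp: is_iso_def)

end

text \<open>The inverse functor conjugates \<open>h\<close> with the chosen isomorphisms
  \<open>i\<close>, \<open>j\<close> and takes the preimage under the hom bijection. Its laws, and
  those of the unit \<open>\<eta>\<close>, the preimage of \<open>i (F X)\<close>, are checked after
  applying the faithful \<open>F'\<close>.\<close>

lemma equivalent_categoriesI:
  assumes C: "category C" and D: "category D" and F: "is_functor C D F F'"
    and bij: "\<And>X Y. \<lbrakk>X \<in> Obj C; Y \<in> Obj C\<rbrakk> \<Longrightarrow> bij_betw (F' X Y) (Hom C X Y) (Hom D (F X) (F Y))"
    and es: "\<And>Z. Z \<in> Obj D \<Longrightarrow> \<exists>X\<in>Obj C. \<exists>i. is_iso D Z (F X) i"
  shows "equivalent_categories C D"
proof -
  interpret C: category C by (rule C)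
  interpret D: category D by (rule D)
  obtain G where G: "\<And>Z. Z \<in> Obj D \<Longrightarrow> G Z \<in> Obj C \<and> (\<exists>i. is_iso D Z (F (G Z)) i)" using es by metis
  then obtain i where i: "\<And>Z. Z \<in> Obj D \<Longrightarrow> is_iso D Z (F (G Z)) (i Z)" by metis
  then obtain j where j: "\<And>Z. Z \<in> Obj D \<Longrightarrow> j Z \<in> Hom D (F (G Z)) Z \<and> Comp D Z (F (G Z)) Z (j Z) (i Z) = Idn D Z
      \<and> Comp D (F (G Z)) Z (F (G Z)) (i Z) (j Z) = Idn D (F (G Z))"
    unfolding is_iso_def by metis
  have i': "i Z \<in> Hom D Z (F (G Z))" if "Z \<in> Obj D" for Z using i[OF that] by (simp add: is_iso_def)
  have FO: "F X \<in> Obj D" if "X \<in> Obj C" for X using F that by (simp add: is_functor_def)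
  have FH: "F' X Y f \<in> Hom D (F X) (F Y)" if "X \<in> Obj C" "Y \<in> Obj C" "f \<in> Hom C X Y" for X Y f
    using F that by (simp add: is_functor_def)
  have FI: "F' X X (Idn C X) = Idn D (F X)" if "X \<in> Obj C" for X using F that by (simp add: is_functor_def)
  have FC: "F' X Z (Comp C X Y Z g f) = Comp D (F X) (F Y) (F Z) (F' Y Z g) (F' X Y f)"
    if "X \<in> Obj C" "Y \<in> Obj C" "Z \<in> Obj C" "f \<in> Hom C X Y" "g \<in> Hom C Y Z" for X Y Z f g
    using F that by (simp add: is_functor_def)
  have GO: "G Z \<in> Obj C" if "Z \<in> Obj D" for Z using G that by blast
  define P where "P X Y = inv_into (Hom C X Y) (F' X Y)" for X Y
  have P: "P X Y h \<in> Hom C X Y" "F' X Y (P X Y h) = h" if "X \<in> Obj C" "Y \<in> Obj C" "h \<in> Hom D (F X) (F Y)" for X Y h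
    using bij[of X Y] that unfolding P_def bij_betw_def by (auto simp: f_inv_into_f intro: inv_into_into)
  have inj: "f = g" if "X \<in> Obj C" "Y \<in> Obj C" "f \<in> Hom C X Y" "g \<in> Hom C X Y" "F' X Y f = F' X Y g" for X Y f g
    using bij[of X Y] that by (auto simp: bij_betw_def dest: inj_onD)
  define G' where "G' Z W h = P (G Z) (G W) (Comp D (F (G Z)) Z (F (G W)) (Comp D Z W (F (G W)) (i W) h) (j Z))" for Z W h
  have G': "G' Z W h \<in> Hom C (G Z) (G W)"
    "F' (G Z) (G W) (G' Z W h) = Comp D (F (G Z)) Z (F (G W)) (Comp D Z W (F (G W)) (i W) h) (j Z)"
    if "Z \<in> Obj D" "W \<in> Obj D" "h \<in> Hom D Z W" for Z W h
    unfolding G'_def using P that G FO D.Comp_closed i' j by simp_all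
  have nat: "Comp D Z W (F (G W)) (i W) h = Comp D Z (F (G Z)) (F (G W)) (F' (G Z) (G W) (G' Z W h)) (i Z)"
    if "Z \<in> Obj D" "W \<in> Obj D" "h \<in> Hom D Z W" for Z W h
    using that by (simp add: G' D.Comp_assoc D.Comp_closed D.Comp_Idn i' j GO FO)
  have GF: "is_functor D C G G'" unfolding is_functor_def
  proof (intro conjI ballI)
    fix X assume X: "X \<in> Obj D"
    show "G X \<in> Obj C" using GO X .
    show "G' X X (Idn D X) = Idn C (G X)"
      by (rule inj[of "G X" "G X"]) (use X in \<open>simp_all add: GO FO G' C.Idn_closed D.Idn_closed FI D.Comp_Idn i' j\<close>)
    fix Y assume Y: "Y \<in> Obj D"
    show "G' X Y f \<in> Hom C (G X) (G Y)" if "f \<in> Hom D X Y" for f using G' X Y that by blast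
    fix Z f g assume Z: "Z \<in> Obj D" and fg: "f \<in> Hom D X Y" "g \<in> Hom D Y Z"
    have jY: "j Y \<in> Hom D (F (G Y)) Y" "Comp D Y (F (G Y)) Y (j Y) (i Y) = Idn D Y" using j Y by auto
    have "Comp D (F (G X)) (F (G Y)) Y (j Y) (Comp D (F (G X)) Y (F (G Y)) (i Y) w) = w"
      if "w \<in> Hom D (F (G X)) Y" for w
      using that X Y jY i' GO FO D.Comp_assoc[of "F (G X)" Y "F (G Y)" Y w "i Y" "j Y"] by (simp add: D.Idn_Comp)
    then show "G' X Z (Comp D X Y Z g f) = Comp C (G X) (G Y) (G Z) (G' Y Z g) (G' X Y f)"
      by (intro inj[of "G X" "G Z"])
        (use X Y Z fg in \<open>simp_all add: FC GO FO G' C.Comp_closed D.Comp_closed i' j D.Comp_assoc\<close>)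
  qed
  have n2: "naturally_iso_to_identity D (\<lambda>Z. F (G Z)) (\<lambda>Z W h. F' (G Z) (G W) (G' Z W h))"
    unfolding naturally_iso_to_identity_def
    by (rule exI[of _ i]) (use i nat in blast)
  define \<eta> where "\<eta> X = P X (G (F X)) (i (F X))" for X
  have \<eta>: "\<eta> X \<in> Hom C X (G (F X))" "F' X (G (F X)) (\<eta> X) = i (F X)" if "X \<in> Obj C" for X
    unfolding \<eta>_def using that P GO FO i' by simp_all
  have "is_iso C X (G (F X)) (\<eta> X)" if X: "X \<in> Obj C" for X
  proof -
    let ?k = "P (G (F X)) X (j (F X))"
    have k: "?k \<in> Hom C (G (F X)) X" "F' (G (F X)) X ?k = j (F X)" using X P GO FO j by simp_all
    have "Comp C X (G (F X)) X ?k (\<eta> X) = Idn C X"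
      by (rule inj[of X X]) (use X k in \<open>simp_all add: FC FI GO FO \<eta> C.Comp_closed C.Idn_closed j\<close>)
    moreover have "Comp C (G (F X)) X (G (F X)) (\<eta> X) ?k = Idn C (G (F X))"
      by (rule inj[of "G (F X)" "G (F X)"]) (use X k in \<open>simp_all add: FC FI GO FO \<eta> C.Comp_closed C.Idn_closed j\<close>)
    ultimately show ?thesis unfolding is_iso_def using \<eta> k X by blast
  qed
  moreover have "Comp C X Y (G (F Y)) (\<eta> Y) f = Comp C X (G (F X)) (G (F Y)) (G' (F X) (F Y) (F' X Y f)) (\<eta> X)"
    if XY: "X \<in> Obj C" "Y \<in> Obj C" "f \<in> Hom C X Y" for X Y f
    by (rule inj[of X "G (F Y)"]) (use XY nat[of "F X" "F Y" "F' X Y f"] in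
        \<open>simp_all add: FC GO FO FH G'(1) \<eta> C.Comp_closed\<close>)
  ultimately have n1: "naturally_iso_to_identity C (\<lambda>X. G (F X)) (\<lambda>X Y f. G' (F X) (F Y) (F' X Y f))"
    unfolding naturally_iso_to_identity_def by (intro exI[of _ \<eta>]) blast
  show ?thesis unfolding equivalent_categories_def inverse_equivalences_def using C D F GF n1 n2 by blast
qed

lemma inverse_equivalences_sym: "inverse_equivalences C D F F' G G' \<Longrightarrow> inverse_equivalences D C G G' F F'"
  by (simp add: inverse_equivalences_def)

text \<open>By naturality, \<open>F' X Y f\<close> determines the composite of \<open>f\<close> with
  \<open>\<eta> Y\<close>, from which the inverse of \<open>\<eta> Y\<close> recovers
  \<open>f\<close>.\<close>

lemma inverse_equivalences_faithful:
  assumes C: "category C" and E: "inverse_equivalences C D F F' G G'"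
    and XY: "X \<in> Obj C" "Y \<in> Obj C" "f \<in> Hom C X Y" "g \<in> Hom C X Y" "F' X Y f = F' X Y g"
  shows "f = g"
proof -
  interpret category C by (rule C)
  obtain \<eta> where \<eta>: "\<And>X. X \<in> Obj C \<Longrightarrow> is_iso C X (G (F X)) (\<eta> X)"
    and n: "\<And>X Y f. \<lbrakk>X \<in> Obj C; Y \<in> Obj C; f \<in> Hom C X Y\<rbrakk> \<Longrightarrow>
      Comp C X Y (G (F Y)) (\<eta> Y) f = Comp C X (G (F X)) (G (F Y)) (G' (F X) (F Y) (F' X Y f)) (\<eta> X)"
    using E unfolding inverse_equivalences_def naturally_iso_to_identity_def by blast
  have GFY: "G (F Y) \<in> Obj C" using E XY(2) by (simp add: inverse_equivalences_def is_functor_def)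
  obtain k where k: "k \<in> Hom C (G (F Y)) Y" "Comp C Y (G (F Y)) Y k (\<eta> Y) = Idn C Y"
    using iso_inverse[OF \<eta>[OF XY(2)]] by metis
  have \<eta>Y: "\<eta> Y \<in> Hom C Y (G (F Y))" using \<eta> XY by (simp add: is_iso_def)
  have "Comp C X Y (G (F Y)) (\<eta> Y) f = Comp C X Y (G (F Y)) (\<eta> Y) g" using n XY by simp
  then have "Comp C X (G (F Y)) Y k (Comp C X Y (G (F Y)) (\<eta> Y) f) = Comp C X (G (F Y)) Y k (Comp C X Y (G (F Y)) (\<eta> Y) g)"
    by simp
  then show ?thesis using XY GFY k \<eta>Y by (simp add: Comp_assoc[symmetric] Idn_Comp)
qed

lemma inverse_equivalences_bij_betw:
  assumes C: "category C" and D: "category D" and E: "inverse_equivalences C D F F' G G'"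
    and XY: "X \<in> Obj C" "Y \<in> Obj C"
  shows "bij_betw (F' X Y) (Hom C X Y) (Hom D (F X) (F Y))"
  unfolding bij_betw_def
proof
  show "inj_on (F' X Y) (Hom C X Y)" using inverse_equivalences_faithful[OF C E XY] by (auto intro: inj_onI)
  interpret category C by (rule C)
  obtain \<eta> where \<eta>: "\<And>X. X \<in> Obj C \<Longrightarrow> is_iso C X (G (F X)) (\<eta> X)"
    and n: "\<And>X Y f. \<lbrakk>X \<in> Obj C; Y \<in> Obj C; f \<in> Hom C X Y\<rbrakk> \<Longrightarrow>
      Comp C X Y (G (F Y)) (\<eta> Y) f = Comp C X (G (F X)) (G (F Y)) (G' (F X) (F Y) (F' X Y f)) (\<eta> X)"
    using E unfolding inverse_equivalences_def naturally_iso_to_identity_def by blast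
  have ob: "F X \<in> Obj D" "F Y \<in> Obj D" "G (F X) \<in> Obj C" "G (F Y) \<in> Obj C"
    using E XY by (simp_all add: inverse_equivalences_def is_functor_def)
  obtain k where k: "k \<in> Hom C (G (F Y)) Y" "Comp C Y (G (F Y)) Y k (\<eta> Y) = Idn C Y" "Comp C (G (F Y)) Y (G (F Y)) (\<eta> Y) k = Idn C (G (F Y))"
    using iso_inverse[OF \<eta>[OF XY(2)]] by metis
  obtain l where l: "l \<in> Hom C (G (F X)) X" "Comp C (G (F X)) X (G (F X)) (\<eta> X) l = Idn C (G (F X))"
    using iso_inverse[OF \<eta>[OF XY(1)]] by metis
  have \<eta>': "\<eta> Y \<in> Hom C Y (G (F Y))" "\<eta> X \<in> Hom C X (G (F X))" using \<eta> XY by (simp_all add: is_iso_def)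
  have FH: "F' X Y f \<in> Hom D (F X) (F Y)" if "f \<in> Hom C X Y" for f
    using E that XY by (simp add: inverse_equivalences_def is_functor_def)
  show "F' X Y ` Hom C X Y = Hom D (F X) (F Y)"
  proof
    show "F' X Y ` Hom C X Y \<subseteq> Hom D (F X) (F Y)" using FH by auto
    show "Hom D (F X) (F Y) \<subseteq> F' X Y ` Hom C X Y"
    proof
      fix h assume h: "h \<in> Hom D (F X) (F Y)"
      let ?h = "G' (F X) (F Y) h"
      have h': "?h \<in> Hom C (G (F X)) (G (F Y))" using E h ob by (simp add: inverse_equivalences_def is_functor_def)
      \<comment> \<open>The preimage of \<open>h\<close> is the conjugate of \<open>G' h\<close> by
        the unit. Naturality and cancellation of \<open>\<eta> X\<close> show that \<open>G'\<close>
        takes the same value on \<open>F' X Y f\<close> and on \<open>h\<close>, and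
        \<open>G'\<close> is faithful by the previous lemma applied to the reversed
        equivalence.\<close>
      define f where "f = Comp C X (G (F Y)) Y k (Comp C X (G (F X)) (G (F Y)) ?h (\<eta> X))"
      have f: "f \<in> Hom C X Y" unfolding f_def using Comp_closed h' XY ob k \<eta>' by simp
      have "Comp C X (G (F X)) (G (F Y)) (G' (F X) (F Y) (F' X Y f)) (\<eta> X) = Comp C X Y (G (F Y)) (\<eta> Y) f"
        using n f XY by simp
      also have "\<dots> = Comp C X (G (F X)) (G (F Y)) ?h (\<eta> X)"
        unfolding f_def using Comp_assoc[of X "G (F Y)" Y "G (F Y)" "Comp C X (G (F X)) (G (F Y)) ?h (\<eta> X)" k "\<eta> Y"]
          XY ob k \<eta>' h' by (simp add: Comp_closed Idn_Comp)
      finally have "Comp C (G (F X)) X (G (F Y)) (Comp C X (G (F X)) (G (F Y)) (G' (F X) (F Y) (F' X Y f)) (\<eta> X)) l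
         = Comp C (G (F X)) X (G (F Y)) (Comp C X (G (F X)) (G (F Y)) ?h (\<eta> X)) l" by simp
      moreover have "G' (F X) (F Y) (F' X Y f) \<in> Hom C (G (F X)) (G (F Y))"
        using E FH[OF f] ob by (simp add: inverse_equivalences_def is_functor_def)
      ultimately have "G' (F X) (F Y) (F' X Y f) = ?h"
        using XY ob l \<eta>' h' by (simp add: Comp_assoc Comp_Idn)
      then have "F' X Y f = h"
        using inverse_equivalences_faithful[OF D inverse_equivalences_sym[OF E] ob(1,2)] FH[OF f] h by simp
      then show "h \<in> F' X Y ` Hom C X Y" using f by auto
    qed
  qed
qed

section \<open>The single-sorted algebra of arrows\<close>

text \<open>
  Arrows are tagged with their domain and codomain, and \<^const>\<open>None\<close> stands for an undefined composite.
  Associativity, monotonicity and the laws of the involution then hold without typing conditions.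
\<close>

type_synonym ('o, 'a) arrow = "('o \<times> 'o \<times> 'a) option"

context involutive_quantaloid
begin

definition hom :: "'o \<Rightarrow> 'o \<Rightarrow> ('o, 'a) arrow set" where
  "hom X Y = {a. \<exists>f. a = Some (X, Y, f) \<and> X \<in> Obj Q \<and> Y \<in> Obj Q \<and> f \<in> Hom Q X Y}"

definition one :: "'o \<Rightarrow> ('o, 'a) arrow" where
  "one X = Some (X, X, Idn Q X)"

definition cmp :: "('o, 'a) arrow \<Rightarrow> ('o, 'a) arrow \<Rightarrow> ('o, 'a) arrow" (infixl "\<cdot>" 70) where
  "b \<cdot> a = (case b of None \<Rightarrow> None | Some (Y', Z, g) \<Rightarrow> (case a of None \<Rightarrow> None | Some (X, Y, f) \<Rightarrow>
     if Y' = Y \<and> X \<in> Obj Q \<and> Y \<in> Obj Q \<and> Z \<in> Obj Q \<and> f \<in> Hom Q X Y \<and> g \<in> Hom Q Y Z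
     then Some (X, Z, Comp Q X Y Z g f) else None))"

text \<open>An ill-typed arrow is returned unchanged rather than sent to \<open>None\<close>, which
  makes \<open>cv_cv\<close> unconditional.\<close>

definition cv :: "('o, 'a) arrow \<Rightarrow> ('o, 'a) arrow" ("_\<degree>" [1000] 1000) where
  "a\<degree> = (case a of None \<Rightarrow> None | Some (X, Y, f) \<Rightarrow>
     if X \<in> Obj Q \<and> Y \<in> Obj Q \<and> f \<in> Hom Q X Y then Some (Y, X, Inv Q X Y f) else a)"

definition leq :: "('o, 'a) arrow \<Rightarrow> ('o, 'a) arrow \<Rightarrow> bool" (infix "\<preceq>" 50) where
  "a \<preceq> b \<longleftrightarrow> a = None \<or> a = b \<or> (\<exists>X Y f g. a = Some (X, Y, f) \<and> b = Some (X, Y, g) \<and>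
     X \<in> Obj Q \<and> Y \<in> Obj Q \<and> f \<in> Hom Q X Y \<and> g \<in> Hom Q X Y \<and> Le Q X Y f g)"

lemma hom_Obj: "a \<in> hom X Y \<Longrightarrow> X \<in> Obj Q \<and> Y \<in> Obj Q" by (auto simp: hom_def)

lemma Some_hom_iff: "Some (X, Y, f) \<in> hom X' Y' \<longleftrightarrow> X = X' \<and> Y = Y' \<and> X \<in> Obj Q \<and> Y \<in> Obj Q \<and> f \<in> Hom Q X Y"
  by (auto simp: hom_def)

lemma one_hom: "X \<in> Obj Q \<Longrightarrow> one X \<in> hom X X" by (simp add: one_def Some_hom_iff Idn_closed)

lemma cmp_hom: "b \<in> hom Y Z \<Longrightarrow> a \<in> hom X Y \<Longrightarrow> b \<cdot> a \<in> hom X Z"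
  by (auto simp: hom_def cmp_def Comp_closed)

lemma cv_hom: "a \<in> hom X Y \<Longrightarrow> a\<degree> \<in> hom Y X"
  by (auto simp: hom_def cv_def Inv_closed)

lemma cmp_Some: "\<lbrakk>X \<in> Obj Q; Y \<in> Obj Q; Z \<in> Obj Q; f \<in> Hom Q X Y; g \<in> Hom Q Y Z\<rbrakk>
    \<Longrightarrow> Some (Y, Z, g) \<cdot> Some (X, Y, f) = Some (X, Z, Comp Q X Y Z g f)"
  by (simp add: cmp_def)

lemma cv_Some: "\<lbrakk>X \<in> Obj Q; Y \<in> Obj Q; f \<in> Hom Q X Y\<rbrakk> \<Longrightarrow> (Some (X, Y, f))\<degree> = Some (Y, X, Inv Q X Y f)"
  by (simp add: cv_def)

lemma leq_Some: "\<lbrakk>X \<in> Obj Q; Y \<in> Obj Q; f \<in> Hom Q X Y; g \<in> Hom Q X Y\<rbrakk>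
    \<Longrightarrow> Some (X, Y, f) \<preceq> Some (X, Y, g) \<longleftrightarrow> Le Q X Y f g"
  by (auto simp: leq_def Le_refl)

lemma cmp_one: "a \<in> hom X Y \<Longrightarrow> a \<cdot> one X = a" "a \<in> hom X Y \<Longrightarrow> one Y \<cdot> a = a"
  by (auto simp: hom_def cmp_def one_def Comp_Idn Idn_Comp Idn_closed)

lemma cmp_assoc: "a \<cdot> b \<cdot> c = a \<cdot> (b \<cdot> c)"
  by (auto simp: cmp_def Comp_assoc Comp_closed split: option.splits prod.splits if_splits)

lemma cv_cv [simp]: "a\<degree>\<degree> = a"
  by (auto simp: cv_def Inv_Inv Inv_closed split: option.splits prod.splits if_splits)

lemma cv_cmp: "(a \<cdot> b)\<degree> = b\<degree> \<cdot> a\<degree>"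
  by (auto simp: cv_def cmp_def Inv_Comp Inv_closed Comp_closed split: option.splits prod.splits if_splits)

lemma cv_one: "X \<in> Obj Q \<Longrightarrow> (one X)\<degree> = one X"
  by (simp add: one_def cv_Some Idn_closed Inv_Idn)

lemma leq_refl [simp]: "a \<preceq> a" by (simp add: leq_def)

lemma leq_trans [trans]: "a \<preceq> b \<Longrightarrow> b \<preceq> c \<Longrightarrow> a \<preceq> c"
  unfolding leq_def by (auto intro: Le_trans)

lemma leq_antisym: "a \<preceq> b \<Longrightarrow> b \<preceq> a \<Longrightarrow> a = b"
  unfolding leq_def by (auto intro: Le_antisym)

lemma cmp_mono_left: assumes "a \<preceq> b" shows "c \<cdot> a \<preceq> c \<cdot> b"
proof -
  consider "a = None" | "a = b" | X Y f g where "a = Some (X, Y, f)" "b = Some (X, Y, g)"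
     "X \<in> Obj Q" "Y \<in> Obj Q" "f \<in> Hom Q X Y" "g \<in> Hom Q X Y" "Le Q X Y f g" using assms unfolding leq_def by blast
  then show ?thesis
  proof cases
    case 3
    then show ?thesis
      by (auto simp: cmp_def leq_Some Comp_closed Comp_mono_right split: option.splits prod.splits)
  qed (auto simp: cmp_def leq_def split: option.splits)
qed

lemma cv_mono: assumes "a \<preceq> b" shows "a\<degree> \<preceq> b\<degree>"
proof -
  consider "a = None" | "a = b" | X Y f g where "a = Some (X, Y, f)" "b = Some (X, Y, g)"
     "X \<in> Obj Q" "Y \<in> Obj Q" "f \<in> Hom Q X Y" "g \<in> Hom Q X Y" "Le Q X Y f g" using assms unfolding leq_def by blast
  then show ?thesis
    by cases (auto simp: cv_Some leq_Some Inv_closed Inv_mono, simp add: cv_def leq_def)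
qed

lemma cv_leq_iff: "a\<degree> \<preceq> b\<degree> \<longleftrightarrow> a \<preceq> b"
  using cv_mono[of a b] cv_mono[of "a\<degree>" "b\<degree>"] by auto

lemma cmp_mono_right: assumes "a \<preceq> b" shows "a \<cdot> c \<preceq> b \<cdot> c"
proof -
  have "(c\<degree> \<cdot> a\<degree>)\<degree> \<preceq> (c\<degree> \<cdot> b\<degree>)\<degree>" by (intro cv_mono cmp_mono_left assms)
  then show ?thesis by (simp add: cv_cmp)
qed

lemma cmp_mono: "a \<preceq> b \<Longrightarrow> c \<preceq> d \<Longrightarrow> a \<cdot> c \<preceq> b \<cdot> d"
  by (rule leq_trans[OF cmp_mono_right cmp_mono_left])

lemma cmp_ge_left: "one Y \<preceq> c \<Longrightarrow> a \<in> hom X Y \<Longrightarrow> a \<preceq> c \<cdot> a"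
  using cmp_mono_right[of "one Y" c a] cmp_one by simp

lemma cmp_ge_right: "one X \<preceq> c \<Longrightarrow> a \<in> hom X Y \<Longrightarrow> a \<preceq> a \<cdot> c"
  using cmp_mono_left[of "one X" c a] cmp_one by simp

lemma cmp_le_left: "c \<preceq> one Y \<Longrightarrow> a \<in> hom X Y \<Longrightarrow> c \<cdot> a \<preceq> a"
  using cmp_mono_right[of c "one Y" a] cmp_one by simp

lemma cmp_le_right: "c \<preceq> one X \<Longrightarrow> a \<in> hom X Y \<Longrightarrow> a \<cdot> c \<preceq> a"
  using cmp_mono_left[of c "one X" a] cmp_one by simp

lemma leq_cvI: "one X \<preceq> a \<Longrightarrow> X \<in> Obj Q \<Longrightarrow> one X \<preceq> a\<degree>"
  using cv_mono[of "one X" a] cv_one by simp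

text \<open>\<open>a\<close> lies below the supremum of \<open>B\<close>, though \<open>B\<close>
  need not lie below \<open>a\<close>. It is stated by testing against \<open>z\<close>, so that no
  join has to be formed.\<close>

definition covered :: "'o \<Rightarrow> 'o \<Rightarrow> ('o, 'a) arrow \<Rightarrow> ('o, 'a) arrow set \<Rightarrow> bool" where
  "covered X Y a B \<longleftrightarrow> a \<in> hom X Y \<and> B \<subseteq> hom X Y \<and> (\<forall>z\<in>hom X Y. (\<forall>b\<in>B. b \<preceq> z) \<longrightarrow> a \<preceq> z)"

lemma coveredI:
  assumes "a \<in> hom X Y" "\<And>b. b \<in> B \<Longrightarrow> b \<in> hom X Y" "\<And>z. \<lbrakk>z \<in> hom X Y; \<And>b. b \<in> B \<Longrightarrow> b \<preceq> z\<rbrakk> \<Longrightarrow> a \<preceq> z"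
  shows "covered X Y a B"
  using assms unfolding covered_def by blast

lemma coveredD: "covered X Y a B \<Longrightarrow> z \<in> hom X Y \<Longrightarrow> (\<And>b. b \<in> B \<Longrightarrow> b \<preceq> z) \<Longrightarrow> a \<preceq> z"
  unfolding covered_def by blast

definition jn :: "'o \<Rightarrow> 'o \<Rightarrow> ('o, 'a) arrow set \<Rightarrow> ('o, 'a) arrow" where
  "jn X Y B = Some (X, Y, Join Q X Y {f. Some (X, Y, f) \<in> B})"

lemma jn_props:
  assumes "X \<in> Obj Q" "Y \<in> Obj Q" "B \<subseteq> hom X Y"
  shows jn_hom: "jn X Y B \<in> hom X Y"
    and jn_covered: "covered X Y (jn X Y B) B"
    and jn_upper: "b \<in> B \<Longrightarrow> b \<preceq> jn X Y B"
proof -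
  let ?F = "{f. Some (X, Y, f) \<in> B}"
  have F: "?F \<subseteq> Hom Q X Y" using assms by (auto simp: Some_hom_iff)
  show h: "jn X Y B \<in> hom X Y" using assms F by (simp add: jn_def Some_hom_iff Join_closed)
  show "covered X Y (jn X Y B) B"
  proof (rule coveredI)
    fix z assume "z \<in> hom X Y" and le: "\<And>b. b \<in> B \<Longrightarrow> b \<preceq> z"
    then obtain g where g: "z = Some (X, Y, g)" "g \<in> Hom Q X Y" by (auto simp: hom_def)
    have "Le Q X Y f g" if "f \<in> ?F" for f using le[of "Some (X, Y, f)"] that F g assms by (simp add: leq_Some subset_iff)
    then show "jn X Y B \<preceq> z" using assms F g by (simp add: jn_def leq_Some Join_closed Join_le_iff)
  qed (use h assms in auto)
  show "b \<preceq> jn X Y B" if "b \<in> B"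
  proof -
    have "b \<in> hom X Y" using that assms by blast
    then obtain f where "b = Some (X, Y, f)" by (auto simp: hom_def)
    then show ?thesis using that assms F Join_upper[OF assms(1,2) F, of f]
      by (simp add: jn_def leq_Some Join_closed subset_iff)
  qed
qed

lemma jn_leq_iff:
  assumes "X \<in> Obj Q" "Y \<in> Obj Q" "B \<subseteq> hom X Y" "z \<in> hom X Y"
  shows "jn X Y B \<preceq> z \<longleftrightarrow> (\<forall>b\<in>B. b \<preceq> z)"
  using jn_upper[OF assms(1-3)] jn_covered[OF assms(1-3)] assms(4) leq_trans unfolding covered_def by blast

lemma covered_iff_jn:
  assumes "X \<in> Obj Q" "Y \<in> Obj Q"
  shows "covered X Y a B \<longleftrightarrow> a \<in> hom X Y \<and> B \<subseteq> hom X Y \<and> a \<preceq> jn X Y B"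
proof (intro iffI conjI)
  assume "a \<in> hom X Y \<and> B \<subseteq> hom X Y \<and> a \<preceq> jn X Y B"
  then show "covered X Y a B"
    using leq_trans[of a "jn X Y B"] jn_leq_iff[OF assms] unfolding covered_def by blast
next
  assume c: "covered X Y a B"
  then show "a \<in> hom X Y" and B: "B \<subseteq> hom X Y" by (auto simp: covered_def)
  show "a \<preceq> jn X Y B" by (rule coveredD[OF c jn_hom[OF assms B] jn_upper[OF assms B]])
qed

lemma cmp_jn:
  assumes "B \<subseteq> hom X Y" "X \<in> Obj Q" "u \<in> hom Y Z"
  shows "u \<cdot> jn X Y B = jn X Z ((\<cdot>) u ` B)"
proof -
  obtain g where g: "u = Some (Y, Z, g)" "g \<in> Hom Q Y Z" "Y \<in> Obj Q" "Z \<in> Obj Q" using assms by (auto simp: hom_def)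
  let ?F = "{f. Some (X, Y, f) \<in> B}"
  have F: "?F \<subseteq> Hom Q X Y" using assms by (auto simp: Some_hom_iff)
  have "(\<lambda>f. Comp Q X Y Z g f) ` ?F = {f. Some (X, Z, f) \<in> (\<cdot>) u ` B}"
  proof (intro equalityI subsetI)
    fix k assume "k \<in> {f. Some (X, Z, f) \<in> (\<cdot>) u ` B}"
    then obtain b where b: "b \<in> B" "Some (X, Z, k) = u \<cdot> b" by auto
    then obtain f where f: "b = Some (X, Y, f)" "f \<in> Hom Q X Y" using assms by (auto simp: hom_def)
    then show "k \<in> (\<lambda>f. Comp Q X Y Z g f) ` ?F" using b g assms(2) by (auto simp: cmp_Some)
  qed (use F assms g in \<open>force simp: cmp_Some image_iff subset_iff\<close>)
  then show ?thesis using g F assms by (simp add: jn_def cmp_Some Join_closed Comp_Join_right)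
qed

lemma covered_cmp_left: assumes "covered X Y a B" "u \<in> hom Y Z" shows "covered X Z (u \<cdot> a) ((\<cdot>) u ` B)"
proof -
  have ob: "X \<in> Obj Q" "Y \<in> Obj Q" "Z \<in> Obj Q" using assms hom_Obj by (auto simp: covered_def)
  have "u \<cdot> a \<preceq> u \<cdot> jn X Y B" using assms ob by (intro cmp_mono_left) (simp add: covered_iff_jn)
  then show ?thesis using assms ob cmp_jn[of B X Y u Z] cmp_hom[OF assms(2)] by (auto simp: covered_iff_jn)
qed

lemma covered_cv: assumes "covered X Y a B" shows "covered Y X (a\<degree>) (cv ` B)"
proof (rule coveredI)
  show "a\<degree> \<in> hom Y X" using assms cv_hom by (auto simp: covered_def)
  show "b \<in> hom Y X" if "b \<in> cv ` B" for b using assms cv_hom that by (auto simp: covered_def)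
  fix z assume z: "z \<in> hom Y X" "\<And>b. b \<in> cv ` B \<Longrightarrow> b \<preceq> z"
  have "b \<preceq> z\<degree>" if "b \<in> B" for b using z(2)[of "b\<degree>"] that cv_mono[of "b\<degree>" z] by simp
  then have "a \<preceq> z\<degree>" using coveredD[OF assms] cv_hom z(1) by blast
  then show "a\<degree> \<preceq> z" using cv_mono[of a "z\<degree>"] by simp
qed

text \<open>The involution exchanges the two sides, so this is \<open>covered_cmp_left\<close>
  conjugated.\<close>

lemma covered_cmp_right: assumes "covered X Y a B" "v \<in> hom W X" shows "covered W Y (a \<cdot> v) ((\<lambda>b. b \<cdot> v) ` B)"
proof -
  have "covered W Y ((v\<degree> \<cdot> a\<degree>)\<degree>) (cv ` (\<cdot>) (v\<degree>) ` cv ` B)"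
    by (rule covered_cv[OF covered_cmp_left[OF covered_cv[OF assms(1)] cv_hom[OF assms(2)]]])
  then show ?thesis by (simp add: cv_cmp image_image)
qed

lemma covered_ctx:
  assumes "covered X Y a B" "u \<in> hom Y Z" "v \<in> hom W X" "z \<in> hom W Z" "\<And>b. b \<in> B \<Longrightarrow> u \<cdot> b \<cdot> v \<preceq> z"
  shows "u \<cdot> a \<cdot> v \<preceq> z"
  using coveredD[OF covered_cmp_right[OF covered_cmp_left[OF assms(1,2)] assms(3)] assms(4)] assms(5) by auto

lemma covered_left:
  assumes "covered X Y a B" "v \<in> hom W X" "z \<in> hom W Y" "\<And>b. b \<in> B \<Longrightarrow> b \<cdot> v \<preceq> z"
  shows "a \<cdot> v \<preceq> z"
  using coveredD[OF covered_cmp_right[OF assms(1,2)] assms(3)] assms(4) by auto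

lemma covered_right:
  assumes "covered X Y a B" "u \<in> hom Y Z" "z \<in> hom X Z" "\<And>b. b \<in> B \<Longrightarrow> u \<cdot> b \<preceq> z"
  shows "u \<cdot> a \<preceq> z"
  using coveredD[OF covered_cmp_left[OF assms(1,2)] assms(3)] assms(4) by auto

lemma covered_comp:
  assumes a: "covered X Y a A" and b: "covered Y Z b B" and z: "z \<in> hom X Z" and le: "\<And>u v. u \<in> A \<Longrightarrow> v \<in> B \<Longrightarrow> v \<cdot> u \<preceq> z"
  shows "b \<cdot> a \<preceq> z"
proof (rule covered_left[OF b _ z])
  show "a \<in> hom X Y" using a by (simp add: covered_def)
  show "v \<cdot> a \<preceq> z" if "v \<in> B" for v by (rule covered_right[OF a _ z le[OF _ that]]) (use b that in \<open>auto simp: covered_def\<close>)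
qed

lemma jn_right_iff:
  assumes "X \<in> Obj Q" "Y \<in> Obj Q" "B \<subseteq> hom X Y" "v \<in> hom W X" "z \<in> hom W Y"
  shows "jn X Y B \<cdot> v \<preceq> z \<longleftrightarrow> (\<forall>b\<in>B. b \<cdot> v \<preceq> z)"
  using covered_left[OF jn_covered[OF assms(1-3)] assms(4,5)] leq_trans[OF cmp_mono_right[OF jn_upper[OF assms(1-3)]]] by blast

lemma jn_left_iff:
  assumes "X \<in> Obj Q" "Y \<in> Obj Q" "B \<subseteq> hom X Y" "u \<in> hom Y Z" "z \<in> hom X Z"
  shows "u \<cdot> jn X Y B \<preceq> z \<longleftrightarrow> (\<forall>b\<in>B. u \<cdot> b \<preceq> z)"
  using covered_right[OF jn_covered[OF assms(1-3)] assms(4,5)] leq_trans[OF cmp_mono_left[OF jn_upper[OF assms(1-3)]]] by blast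

subsection \<open>Maps\<close>

text \<open>These are the maps of an allegory: symmetric left adjoints, with
  \<open>t\<degree>\<close> as right adjoint.\<close>

definition is_map :: "'o \<Rightarrow> 'o \<Rightarrow> ('o, 'a) arrow \<Rightarrow> bool" where
  "is_map X Y t \<longleftrightarrow> t \<in> hom X Y \<and> one X \<preceq> t\<degree> \<cdot> t \<and> t \<cdot> t\<degree> \<preceq> one Y"

lemma is_mapD:
  assumes "is_map X Y t"
  shows "t \<in> hom X Y" "t\<degree> \<in> hom Y X" "X \<in> Obj Q" "Y \<in> Obj Q" "one X \<preceq> t\<degree> \<cdot> t" "t \<cdot> t\<degree> \<preceq> one Y"
  using assms cv_hom hom_Obj unfolding is_map_def by blast+

lemma is_map_one: "X \<in> Obj Q \<Longrightarrow> is_map X X (one X)"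
  by (simp add: is_map_def one_hom cv_one cmp_one[OF one_hom])

lemma is_map_cmp: assumes "is_map Y Z t" "is_map X Y s" shows "is_map X Z (t \<cdot> s)"
proof -
  note t = is_mapD[OF assms(1)] and s = is_mapD[OF assms(2)]
  have "one X \<preceq> s\<degree> \<cdot> s" by (rule s)
  also have "\<dots> \<preceq> s\<degree> \<cdot> (t\<degree> \<cdot> t \<cdot> s)" by (rule cmp_mono_left[OF cmp_ge_left[OF t(5) s(1)]])
  finally have 1: "one X \<preceq> (t \<cdot> s)\<degree> \<cdot> (t \<cdot> s)" by (simp add: cv_cmp cmp_assoc)
  have "t \<cdot> (s \<cdot> s\<degree> \<cdot> t\<degree>) \<preceq> t \<cdot> t\<degree>" by (rule cmp_mono_left[OF cmp_le_left[OF s(6) t(2)]])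
  also have "\<dots> \<preceq> one Z" by (rule t)
  finally show ?thesis using 1 t s cmp_hom by (auto simp: is_map_def cv_cmp cmp_assoc)
qed

text \<open>Maps are discretely ordered: \<open>s \<preceq> s \<cdot> t\<degree> \<cdot> t \<preceq>
  s \<cdot> s\<degree> \<cdot> t \<preceq> t\<close>. Inequalities obtained by adjunction thus
  become the equations that express commuting squares.\<close>

lemma map_leq_imp_eq: assumes "is_map X Y t" "is_map X Y s" "t \<preceq> s" shows "t = s"
proof (rule leq_antisym[OF assms(3)])
  note t = is_mapD[OF assms(1)] and s = is_mapD[OF assms(2)]
  have "s \<preceq> s \<cdot> (t\<degree> \<cdot> t)" by (rule cmp_ge_right[OF t(5) s(1)])
  also have "\<dots> \<preceq> s \<cdot> (s\<degree> \<cdot> t)" by (intro cmp_mono_left cmp_mono_right cv_mono assms)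
  also have "\<dots> = s \<cdot> s\<degree> \<cdot> t" by (simp add: cmp_assoc)
  also have "\<dots> \<preceq> t" by (rule cmp_le_left[OF s(6) t(1)])
  finally show "s \<preceq> t" .
qed

lemma map_shift_left: \<comment> \<open>the adjunction \<open>t \<stileturn> t\<degree>\<close>\<close>
  assumes "is_map X Y t" "a \<in> hom W X" "b \<in> hom W Y"
  shows "t \<cdot> a \<preceq> b \<longleftrightarrow> a \<preceq> t\<degree> \<cdot> b"
proof
  note t = is_mapD[OF assms(1)]
  assume "t \<cdot> a \<preceq> b"
  then have "t\<degree> \<cdot> (t \<cdot> a) \<preceq> t\<degree> \<cdot> b" by (rule cmp_mono_left)
  moreover have "a \<preceq> t\<degree> \<cdot> t \<cdot> a" by (rule cmp_ge_left[OF t(5) assms(2)])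
  ultimately show "a \<preceq> t\<degree> \<cdot> b" by (metis leq_trans cmp_assoc)
next
  note t = is_mapD[OF assms(1)]
  assume "a \<preceq> t\<degree> \<cdot> b"
  then have "t \<cdot> a \<preceq> t \<cdot> (t\<degree> \<cdot> b)" by (rule cmp_mono_left)
  moreover have "t \<cdot> t\<degree> \<cdot> b \<preceq> b" by (rule cmp_le_left[OF t(6) assms(3)])
  ultimately show "t \<cdot> a \<preceq> b" by (metis leq_trans cmp_assoc)
qed

lemma map_shift_right:
  assumes "is_map X Y t" "a \<in> hom X W" "b \<in> hom Y W"
  shows "a \<cdot> t\<degree> \<preceq> b \<longleftrightarrow> a \<preceq> b \<cdot> t"
proof -
  have "a \<cdot> t\<degree> \<preceq> b \<longleftrightarrow> t \<cdot> a\<degree> \<preceq> b\<degree>" using cv_leq_iff[of "a \<cdot> t\<degree>" b] by (simp add: cv_cmp)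
  also have "\<dots> \<longleftrightarrow> a\<degree> \<preceq> t\<degree> \<cdot> b\<degree>" by (rule map_shift_left[OF assms(1) cv_hom cv_hom]) fact+
  also have "\<dots> \<longleftrightarrow> a \<preceq> b \<cdot> t" using cv_leq_iff[of a "b \<cdot> t"] by (simp add: cv_cmp)
  finally show ?thesis .
qed

subsection \<open>Enriched categories and distributors\<close>

definition sqc :: "('o, 'a, 'v) qcat \<Rightarrow> bool" where
  "sqc A \<longleftrightarrow> is_qcat Q A \<and> is_symmetric Q A"

definition hm :: "('o, 'a, 'v) qcat \<Rightarrow> 'v \<Rightarrow> 'v \<Rightarrow> ('o, 'a) arrow" where
  "hm A y x = Some (Ty A x, Ty A y, Arr A y x)"

definition dm :: "('o, 'a, 'v) qcat \<Rightarrow> ('o, 'a, 'v) qcat \<Rightarrow> ('v \<Rightarrow> 'v \<Rightarrow> 'a) \<Rightarrow> 'v \<Rightarrow> 'v \<Rightarrow> ('o, 'a) arrow" where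
  "dm A B \<Phi> y x = Some (Ty A x, Ty B y, \<Phi> y x)"

lemma Obj_SymDist: "A \<in> Obj (SymDist Q) \<longleftrightarrow> sqc A" by (simp add: SymDist_def sqc_def)

lemma sqc_props:
  assumes "sqc A"
  shows sqc_Ty: "x \<in> Elts A \<Longrightarrow> Ty A x \<in> Obj Q"
    and hm_hom: "x \<in> Elts A \<Longrightarrow> y \<in> Elts A \<Longrightarrow> hm A y x \<in> hom (Ty A x) (Ty A y)"
    and hm_trans: "x \<in> Elts A \<Longrightarrow> y \<in> Elts A \<Longrightarrow> z \<in> Elts A \<Longrightarrow> hm A z y \<cdot> hm A y x \<preceq> hm A z x"
    and hm_one: "x \<in> Elts A \<Longrightarrow> one (Ty A x) \<preceq> hm A x x"
    and hm_cv: "x \<in> Elts A \<Longrightarrow> y \<in> Elts A \<Longrightarrow> (hm A y x)\<degree> = hm A x y"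
proof -
  have A: "is_qcat Q A" "is_symmetric Q A" using assms by (auto simp: sqc_def)
  show T: "Ty A x \<in> Obj Q" if "x \<in> Elts A" for x using A that by (auto simp: is_qcat_def)
  have H: "Arr A y x \<in> Hom Q (Ty A x) (Ty A y)" if "x \<in> Elts A" "y \<in> Elts A" for x y
    using A that by (auto simp: is_qcat_def)
  show "hm A y x \<in> hom (Ty A x) (Ty A y)" if "x \<in> Elts A" "y \<in> Elts A"
    using that T H by (simp add: hm_def Some_hom_iff)
  show "hm A z y \<cdot> hm A y x \<preceq> hm A z x" if "x \<in> Elts A" "y \<in> Elts A" "z \<in> Elts A"
    using A that T H by (auto simp: hm_def cmp_Some leq_Some Comp_closed is_qcat_def)
  show "one (Ty A x) \<preceq> hm A x x" if "x \<in> Elts A"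
    using A that T H by (auto simp: hm_def one_def leq_Some Idn_closed is_qcat_def)
  show "(hm A y x)\<degree> = hm A x y" if "x \<in> Elts A" "y \<in> Elts A"
  proof -
    have "Arr A x y = Inv Q (Ty A x) (Ty A y) (Arr A y x)" using A that unfolding is_symmetric_def by blast
    then show ?thesis using cv_Some[OF T T H] that by (simp only: hm_def)
  qed
qed

lemma sqcI:
  assumes "small TYPE('v) (Elts A)" "Ty A \<in> Elts A \<rightarrow>\<^sub>E Obj Q"
    and "\<And>x y. \<not> (x \<in> Elts A \<and> y \<in> Elts A) \<Longrightarrow> Arr A y x = undefined"
    and hom: "\<And>x y. x \<in> Elts A \<Longrightarrow> y \<in> Elts A \<Longrightarrow> hm A y x \<in> hom (Ty A x) (Ty A y)"
    and tr: "\<And>x y z. x \<in> Elts A \<Longrightarrow> y \<in> Elts A \<Longrightarrow> z \<in> Elts A \<Longrightarrow> hm A z y \<cdot> hm A y x \<preceq> hm A z x"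
    and one: "\<And>x. x \<in> Elts A \<Longrightarrow> one (Ty A x) \<preceq> hm A x x"
    and cv: "\<And>x y. x \<in> Elts A \<Longrightarrow> y \<in> Elts A \<Longrightarrow> hm A x y \<preceq> (hm A y x)\<degree>"
  shows "sqc (A :: ('o, 'a, 'v) qcat)"
proof -
  have T: "Ty A x \<in> Obj Q" if "x \<in> Elts A" for x using assms(2) that by auto
  have H: "Arr A y x \<in> Hom Q (Ty A x) (Ty A y)" if "x \<in> Elts A" "y \<in> Elts A" for x y
    using hom[OF that] by (simp add: hm_def Some_hom_iff)
  have l1: "Le Q (Ty A x) (Ty A z) (Comp Q (Ty A x) (Ty A y) (Ty A z) (Arr A z y) (Arr A y x)) (Arr A z x)"
    if "x \<in> Elts A" "y \<in> Elts A" "z \<in> Elts A" for x y z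
    using tr[OF that] that T H by (simp add: hm_def cmp_Some leq_Some Comp_closed)
  have l2: "Le Q (Ty A x) (Ty A x) (Idn Q (Ty A x)) (Arr A x x)" if "x \<in> Elts A" for x
    using one[OF that] that T H by (simp add: hm_def one_def leq_Some Idn_closed)
  have l3: "Arr A x y = Inv Q (Ty A x) (Ty A y) (Arr A y x)" if "x \<in> Elts A" "y \<in> Elts A" for x y
  proof -
    \<comment> \<open>One inequality for every ordered pair is enough: the involution turns the
      swapped instance into the converse.\<close>
    have "hm A y x \<preceq> (hm A x y)\<degree>" by (rule cv[OF that(2,1)])
    then have "(hm A y x)\<degree> \<preceq> hm A x y" using cv_mono by fastforce
    then have "hm A x y = (hm A y x)\<degree>" using cv[OF that] leq_antisym by blast
    then show ?thesis using that T H by (simp add: hm_def cv_Some)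
  qed
  show ?thesis unfolding sqc_def is_qcat_def is_symmetric_def
    by (intro conjI ballI allI impI; rule assms(1-3) H l1 l2 l3; assumption)
qed

lemma distributors_iff:
  assumes A: "sqc A" and B: "sqc B"
  shows "\<Phi> \<in> distributors Q A B \<longleftrightarrow>
    (\<forall>x\<in>Elts A. \<forall>y\<in>Elts B. dm A B \<Phi> y x \<in> hom (Ty A x) (Ty B y)) \<and>
    (\<forall>x y. \<not> (x \<in> Elts A \<and> y \<in> Elts B) \<longrightarrow> \<Phi> y x = undefined) \<and>
    (\<forall>x\<in>Elts A. \<forall>y\<in>Elts B. \<forall>y'\<in>Elts B. hm B y' y \<cdot> dm A B \<Phi> y x \<preceq> dm A B \<Phi> y' x) \<and>
    (\<forall>x\<in>Elts A. \<forall>x'\<in>Elts A. \<forall>y\<in>Elts B. dm A B \<Phi> y x \<cdot> hm A x x' \<preceq> dm A B \<Phi> y x')"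
    (is "_ \<longleftrightarrow> ?H \<and> ?U \<and> ?L \<and> ?R")
proof -
  have AH: "Ty A x \<in> Obj Q" "x' \<in> Elts A \<Longrightarrow> Arr A x' x \<in> Hom Q (Ty A x) (Ty A x')" if "x \<in> Elts A" for x x'
    using sqc_Ty[OF A that] hm_hom[OF A that] by (simp_all add: hm_def Some_hom_iff)
  have BH: "Ty B x \<in> Obj Q" "x' \<in> Elts B \<Longrightarrow> Arr B x' x \<in> Hom Q (Ty B x) (Ty B x')" if "x \<in> Elts B" for x x'
    using sqc_Ty[OF B that] hm_hom[OF B that] by (simp_all add: hm_def Some_hom_iff)
  have H: "?H \<longleftrightarrow> (\<forall>x\<in>Elts A. \<forall>y\<in>Elts B. \<Phi> y x \<in> Hom Q (Ty A x) (Ty B y))"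
    using AH BH by (auto simp: dm_def Some_hom_iff)
  show ?thesis
  \<comment> \<open>The action laws translate entry by entry only if all entries are well typed;
    otherwise both sides fail.\<close>
  proof (cases ?H)
    case True
    have "?L \<longleftrightarrow> (\<forall>x\<in>Elts A. \<forall>y\<in>Elts B. \<forall>y'\<in>Elts B. Le Q (Ty A x) (Ty B y')
        (Comp Q (Ty A x) (Ty B y) (Ty B y') (Arr B y' y) (\<Phi> y x)) (\<Phi> y' x))"
      using True H AH BH by (simp add: dm_def hm_def cmp_Some leq_Some Comp_closed)
    moreover have "?R \<longleftrightarrow> (\<forall>x\<in>Elts A. \<forall>x'\<in>Elts A. \<forall>y\<in>Elts B. Le Q (Ty A x') (Ty B y)
        (Comp Q (Ty A x') (Ty A x) (Ty B y) (\<Phi> y x) (Arr A x x')) (\<Phi> y x'))"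
      using True H AH BH by (simp add: dm_def hm_def cmp_Some leq_Some Comp_closed)
    ultimately show ?thesis using H unfolding distributors_def mem_Collect_eq by argo
  next
    case False
    then show ?thesis using H unfolding distributors_def mem_Collect_eq by argo
  qed
qed

lemma dist_props:
  assumes "sqc A" "sqc B" "\<Phi> \<in> distributors Q A B"
  shows dm_hom: "x \<in> Elts A \<Longrightarrow> y \<in> Elts B \<Longrightarrow> dm A B \<Phi> y x \<in> hom (Ty A x) (Ty B y)"
    and dm_undefined: "\<not> (x \<in> Elts A \<and> y \<in> Elts B) \<Longrightarrow> \<Phi> y x = undefined"
    and dm_left: "x \<in> Elts A \<Longrightarrow> y \<in> Elts B \<Longrightarrow> y' \<in> Elts B \<Longrightarrow> hm B y' y \<cdot> dm A B \<Phi> y x \<preceq> dm A B \<Phi> y' x"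
    and dm_right: "x \<in> Elts A \<Longrightarrow> x' \<in> Elts A \<Longrightarrow> y \<in> Elts B \<Longrightarrow> dm A B \<Phi> y x \<cdot> hm A x x' \<preceq> dm A B \<Phi> y x'"
  using assms(3) unfolding distributors_iff[OF assms(1,2)] by blast+

lemma dist_eqI:
  assumes "sqc A" "sqc B" "\<Phi> \<in> distributors Q A B" "\<Psi> \<in> distributors Q A B"
    and "\<And>x y. x \<in> Elts A \<Longrightarrow> y \<in> Elts B \<Longrightarrow> dm A B \<Phi> y x = dm A B \<Psi> y x"
  shows "\<Phi> = \<Psi>"
proof (intro ext)
  fix y x
  show "\<Phi> y x = \<Psi> y x"
    using assms(5)[of x y] dm_undefined[OF assms(1,2,3)] dm_undefined[OF assms(1,2,4)]
    by (cases "x \<in> Elts A \<and> y \<in> Elts B") (auto simp: dm_def)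
qed

definition mk_dist :: "('o, 'a, 'v) qcat \<Rightarrow> ('o, 'a, 'v) qcat \<Rightarrow> ('v \<Rightarrow> 'v \<Rightarrow> ('o, 'a) arrow) \<Rightarrow> 'v \<Rightarrow> 'v \<Rightarrow> 'a" where
  "mk_dist A B \<phi> = (\<lambda>y x. if x \<in> Elts A \<and> y \<in> Elts B then snd (snd (the (\<phi> y x))) else undefined)"

lemma dm_mk_dist:
  "x \<in> Elts A \<Longrightarrow> y \<in> Elts B \<Longrightarrow> \<phi> y x \<in> hom (Ty A x) (Ty B y) \<Longrightarrow> dm A B (mk_dist A B \<phi>) y x = \<phi> y x"
  by (auto simp: dm_def mk_dist_def hom_def)

lemma mk_dist_closed:
  assumes A: "sqc A" and B: "sqc B"
    and h: "\<And>x y. x \<in> Elts A \<Longrightarrow> y \<in> Elts B \<Longrightarrow> \<phi> y x \<in> hom (Ty A x) (Ty B y)"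
    and l: "\<And>x y y'. x \<in> Elts A \<Longrightarrow> y \<in> Elts B \<Longrightarrow> y' \<in> Elts B \<Longrightarrow> hm B y' y \<cdot> \<phi> y x \<preceq> \<phi> y' x"
    and r: "\<And>x x' y. x \<in> Elts A \<Longrightarrow> x' \<in> Elts A \<Longrightarrow> y \<in> Elts B \<Longrightarrow> \<phi> y x \<cdot> hm A x x' \<preceq> \<phi> y x'"
  shows "mk_dist A B \<phi> \<in> distributors Q A B"
  unfolding distributors_iff[OF A B] using h l r by (simp add: dm_mk_dist) (auto simp: mk_dist_def)

lemma Le_SymDist:
  assumes "sqc A" "sqc B" "\<Phi> \<in> distributors Q A B" "\<Psi> \<in> distributors Q A B"
  shows "Le (SymDist Q) A B \<Phi> \<Psi> \<longleftrightarrow> (\<forall>x\<in>Elts A. \<forall>y\<in>Elts B. dm A B \<Phi> y x \<preceq> dm A B \<Psi> y x)"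
  using dm_hom[OF assms(1,2,3)] dm_hom[OF assms(1,2,4)]
  by (simp add: SymDist_def dm_def leq_Some Some_hom_iff)

text \<open>The Yoneda principle for a partial order. With \<open>Le_dist_comp\<close> it proves
  equations between composites without manipulating the joins inside them.\<close>

lemma dist_eq_by_upper:
  assumes "sqc A" "sqc B" "\<Phi> \<in> distributors Q A B" "\<Psi> \<in> distributors Q A B"
    and "\<And>\<Theta>. \<Theta> \<in> distributors Q A B \<Longrightarrow> Le (SymDist Q) A B \<Phi> \<Theta> \<longleftrightarrow> Le (SymDist Q) A B \<Psi> \<Theta>"
  shows "\<Phi> = \<Psi>"
  using assms(5)[OF assms(3)] assms(5)[OF assms(4)] leq_antisym
  by (intro dist_eqI[OF assms(1-4)]) (simp add: Le_SymDist[OF assms(1,2)] assms(3,4))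

context
  fixes A B C :: "('o, 'a, 'v) qcat" and \<Phi> \<Psi>
  assumes A: "sqc A" and B: "sqc B" and C: "sqc C" and \<Phi>: "\<Phi> \<in> distributors Q A B" and \<Psi>: "\<Psi> \<in> distributors Q B C"
begin

lemma dm_comp:
  assumes xz: "x \<in> Elts A" "z \<in> Elts C"
  shows "dm A C (dist_comp Q A B C \<Psi> \<Phi>) z x = jn (Ty A x) (Ty C z) ((\<lambda>y. dm B C \<Psi> z y \<cdot> dm A B \<Phi> y x) ` Elts B)"
    (is "?l = jn ?X ?Z ?S")
proof -
  have c: "dm B C \<Psi> z y \<cdot> dm A B \<Phi> y x = Some (?X, ?Z, Comp Q (Ty A x) (Ty B y) (Ty C z) (\<Psi> z y) (\<Phi> y x))"
    if "y \<in> Elts B" for y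
    using that xz dm_hom[OF A B \<Phi>] dm_hom[OF B C \<Psi>] by (simp add: dm_def cmp_Some Some_hom_iff)
  have "{f. Some (?X, ?Z, f) \<in> ?S} = (\<lambda>y. Comp Q (Ty A x) (Ty B y) (Ty C z) (\<Psi> z y) (\<Phi> y x)) ` Elts B"
    using c by (auto simp: image_iff)
  then show ?thesis using xz by (simp add: dm_def dist_comp_def jn_def)
qed

lemma dm_comp_sub:
  assumes "x \<in> Elts A" "z \<in> Elts C"
  shows "(\<lambda>y. dm B C \<Psi> z y \<cdot> dm A B \<Phi> y x) ` Elts B \<subseteq> hom (Ty A x) (Ty C z)"
  by (rule image_subsetI, rule cmp_hom[OF dm_hom[OF B C \<Psi>] dm_hom[OF A B \<Phi>]]) (use assms in auto)

context
  fixes x z assumes x: "x \<in> Elts A" and z: "z \<in> Elts C"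
begin

lemma dm_comp_hom: "dm A C (dist_comp Q A B C \<Psi> \<Phi>) z x \<in> hom (Ty A x) (Ty C z)"
  unfolding dm_comp[OF x z] by (rule jn_hom[OF sqc_Ty[OF A x] sqc_Ty[OF C z] dm_comp_sub[OF x z]])

lemma dm_comp_upper: "y \<in> Elts B \<Longrightarrow> dm B C \<Psi> z y \<cdot> dm A B \<Phi> y x \<preceq> dm A C (dist_comp Q A B C \<Psi> \<Phi>) z x"
  unfolding dm_comp[OF x z] by (rule jn_upper[OF sqc_Ty[OF A x] sqc_Ty[OF C z] dm_comp_sub[OF x z]]) simp

lemma dm_comp_iff:
  assumes "w \<in> hom (Ty A x) (Ty C z)"
  shows "dm A C (dist_comp Q A B C \<Psi> \<Phi>) z x \<preceq> w \<longleftrightarrow> (\<forall>y\<in>Elts B. dm B C \<Psi> z y \<cdot> dm A B \<Phi> y x \<preceq> w)"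
  unfolding dm_comp[OF x z] using jn_leq_iff[OF sqc_Ty[OF A x] sqc_Ty[OF C z] dm_comp_sub[OF x z] assms] by simp

lemma dm_comp_left_iff:
  assumes "u \<in> hom (Ty C z) Z" "w \<in> hom (Ty A x) Z"
  shows "u \<cdot> dm A C (dist_comp Q A B C \<Psi> \<Phi>) z x \<preceq> w \<longleftrightarrow> (\<forall>y\<in>Elts B. u \<cdot> (dm B C \<Psi> z y \<cdot> dm A B \<Phi> y x) \<preceq> w)"
  unfolding dm_comp[OF x z] using jn_left_iff[OF sqc_Ty[OF A x] sqc_Ty[OF C z] dm_comp_sub[OF x z] assms] by simp

lemma dm_comp_right_iff:
  assumes "v \<in> hom X (Ty A x)" "w \<in> hom X (Ty C z)"
  shows "dm A C (dist_comp Q A B C \<Psi> \<Phi>) z x \<cdot> v \<preceq> w \<longleftrightarrow> (\<forall>y\<in>Elts B. dm B C \<Psi> z y \<cdot> dm A B \<Phi> y x \<cdot> v \<preceq> w)"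
  unfolding dm_comp[OF x z] using jn_right_iff[OF sqc_Ty[OF A x] sqc_Ty[OF C z] dm_comp_sub[OF x z] assms] by simp

end

lemma dist_comp_closed: "dist_comp Q A B C \<Psi> \<Phi> \<in> distributors Q A C"
  unfolding distributors_iff[OF A C]
proof (intro conjI ballI allI impI)
  fix x z assume "\<not> (x \<in> Elts A \<and> z \<in> Elts C)"
  then show "dist_comp Q A B C \<Psi> \<Phi> z x = undefined" by (auto simp: dist_comp_def)
next
  fix x z assume xz: "x \<in> Elts A" "z \<in> Elts C"
  show "dm A C (dist_comp Q A B C \<Psi> \<Phi>) z x \<in> hom (Ty A x) (Ty C z)" by (rule dm_comp_hom[OF xz])
  show "hm C z' z \<cdot> dm A C (dist_comp Q A B C \<Psi> \<Phi>) z x \<preceq> dm A C (dist_comp Q A B C \<Psi> \<Phi>) z' x" if z': "z' \<in> Elts C" for z'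
    unfolding dm_comp_left_iff[OF xz hm_hom[OF C xz(2) z'] dm_comp_hom[OF xz(1) z']]
    using leq_trans[OF cmp_mono_right[OF dm_left[OF B C \<Psi> _ xz(2) z']] dm_comp_upper[OF xz(1) z']] by (simp add: cmp_assoc)
  show "dm A C (dist_comp Q A B C \<Psi> \<Phi>) z x \<cdot> hm A x x' \<preceq> dm A C (dist_comp Q A B C \<Psi> \<Phi>) z x'" if x': "x' \<in> Elts A" for x'
    unfolding dm_comp_right_iff[OF xz hm_hom[OF A x' xz(1)] dm_comp_hom[OF x' xz(2)]]
    using leq_trans[OF cmp_mono_left[OF dm_right[OF A B \<Phi> xz(1) x']] dm_comp_upper[OF x' xz(2)]] by (simp add: cmp_assoc)
qed

lemma Le_dist_comp:
  assumes \<Theta>: "\<Theta> \<in> distributors Q A C"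
  shows "Le (SymDist Q) A C (dist_comp Q A B C \<Psi> \<Phi>) \<Theta> \<longleftrightarrow>
    (\<forall>x\<in>Elts A. \<forall>z\<in>Elts C. \<forall>y\<in>Elts B. dm B C \<Psi> z y \<cdot> dm A B \<Phi> y x \<preceq> dm A C \<Theta> z x)"
  unfolding Le_SymDist[OF A C dist_comp_closed \<Theta>] by (simp add: dm_comp_iff dm_hom[OF A C \<Theta>])

end

lemma Arr_distributor: assumes "sqc A" shows "Arr A \<in> distributors Q A A"
proof -
  have "dm A A (Arr A) y x = hm A y x" for x y by (simp add: dm_def hm_def)
  moreover have "Arr A y x = undefined" if "\<not> (x \<in> Elts A \<and> y \<in> Elts A)" for x y
    using assms that unfolding sqc_def is_qcat_def by blast
  ultimately show ?thesis unfolding distributors_iff[OF assms assms] using hm_hom[OF assms] hm_trans[OF assms] by simp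
qed

lemma dm_Arr: "dm A A (Arr A) = hm A" by (intro ext) (simp add: dm_def hm_def)

definition dist_inv :: "('o, 'a, 'v) qcat \<Rightarrow> ('o, 'a, 'v) qcat \<Rightarrow> ('v \<Rightarrow> 'v \<Rightarrow> 'a) \<Rightarrow> 'v \<Rightarrow> 'v \<Rightarrow> 'a" where
  "dist_inv A B \<Phi> = (\<lambda>a b. if a \<in> Elts A \<and> b \<in> Elts B then Inv Q (Ty A a) (Ty B b) (\<Phi> b a) else undefined)"

lemma dm_inv:
  assumes "sqc A" "sqc B" "\<Phi> \<in> distributors Q A B" "a \<in> Elts A" "b \<in> Elts B"
  shows "dm B A (dist_inv A B \<Phi>) a b = (dm A B \<Phi> b a)\<degree>"
  using dm_hom[OF assms] assms by (simp add: dm_def dist_inv_def cv_Some Some_hom_iff)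

lemma dist_inv_closed:
  assumes A: "sqc A" and B: "sqc B" and \<Phi>: "\<Phi> \<in> distributors Q A B"
  shows "dist_inv A B \<Phi> \<in> distributors Q B A"
  unfolding distributors_iff[OF B A]
proof (intro conjI ballI allI impI)
  fix b a assume "\<not> (b \<in> Elts B \<and> a \<in> Elts A)"
  then show "dist_inv A B \<Phi> a b = undefined" by (auto simp: dist_inv_def)
next
  fix b a assume ab: "b \<in> Elts B" "a \<in> Elts A"
  show "dm B A (dist_inv A B \<Phi>) a b \<in> hom (Ty B b) (Ty A a)"
    using dm_inv[OF assms ab(2,1)] cv_hom dm_hom[OF assms ab(2,1)] by simp
  show "hm A a' a \<cdot> dm B A (dist_inv A B \<Phi>) a b \<preceq> dm B A (dist_inv A B \<Phi>) a' b" if "a' \<in> Elts A" for a'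
    using cv_mono[OF dm_right[OF assms ab(2) that ab(1)]] dm_inv[OF assms] ab that hm_cv[OF A] by (simp add: cv_cmp)
  show "dm B A (dist_inv A B \<Phi>) a b \<cdot> hm B b b' \<preceq> dm B A (dist_inv A B \<Phi>) a b'" if "b' \<in> Elts B" for b'
    using cv_mono[OF dm_left[OF assms ab(2,1) that]] dm_inv[OF assms] ab that hm_cv[OF B] by (simp add: cv_cmp)
qed

lemma SymDist_simps:
  "Obj (SymDist Q) = {A. sqc A}" "Hom (SymDist Q) = distributors Q" "Idn (SymDist Q) = Arr"
  "Comp (SymDist Q) = dist_comp Q" "Inv (SymDist Q) = dist_inv"
  by (auto simp: SymDist_def sqc_def dist_inv_def[abs_def])

context
  fixes A B :: "('o, 'a, 'v) qcat" and F
  assumes A: "sqc A" and B: "sqc B" and F: "F \<subseteq> distributors Q A B"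
begin

definition dist_jn :: "'v \<Rightarrow> 'v \<Rightarrow> 'a" where
  "dist_jn = mk_dist A B (\<lambda>y x. jn (Ty A x) (Ty B y) ((\<lambda>\<Phi>. dm A B \<Phi> y x) ` F))"

context
  fixes x y assumes x: "x \<in> Elts A" and y: "y \<in> Elts B"
begin

lemma dist_jn_args: "Ty A x \<in> Obj Q" "Ty B y \<in> Obj Q" "(\<lambda>\<Phi>. dm A B \<Phi> y x) ` F \<subseteq> hom (Ty A x) (Ty B y)"
  using sqc_Ty[OF A x] sqc_Ty[OF B y] dm_hom[OF A B _ x y] F by auto

lemma dm_dist_jn: "dm A B dist_jn y x = jn (Ty A x) (Ty B y) ((\<lambda>\<Phi>. dm A B \<Phi> y x) ` F)"
  unfolding dist_jn_def by (rule dm_mk_dist[OF x y]) (rule jn_hom[OF dist_jn_args])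

lemma dm_dist_jn_leq_iff: "w \<in> hom (Ty A x) (Ty B y) \<Longrightarrow> dm A B dist_jn y x \<preceq> w \<longleftrightarrow> (\<forall>\<Phi>\<in>F. dm A B \<Phi> y x \<preceq> w)"
  unfolding dm_dist_jn using jn_leq_iff[OF dist_jn_args] by simp

lemma dm_dist_jn_right_iff: "\<lbrakk>v \<in> hom X (Ty A x); w \<in> hom X (Ty B y)\<rbrakk> \<Longrightarrow> dm A B dist_jn y x \<cdot> v \<preceq> w \<longleftrightarrow> (\<forall>\<Phi>\<in>F. dm A B \<Phi> y x \<cdot> v \<preceq> w)"
  unfolding dm_dist_jn using jn_right_iff[OF dist_jn_args] by simp

lemma dm_dist_jn_left_iff: "\<lbrakk>u \<in> hom (Ty B y) Z; w \<in> hom (Ty A x) Z\<rbrakk> \<Longrightarrow> u \<cdot> dm A B dist_jn y x \<preceq> w \<longleftrightarrow> (\<forall>\<Phi>\<in>F. u \<cdot> dm A B \<Phi> y x \<preceq> w)"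
  unfolding dm_dist_jn using jn_left_iff[OF dist_jn_args] by simp

end

lemma dist_jn_closed: "dist_jn \<in> distributors Q A B"
  unfolding distributors_iff[OF A B]
proof (intro conjI ballI allI impI)
  show "dist_jn y x = undefined" if "\<not> (x \<in> Elts A \<and> y \<in> Elts B)" for x y using that by (auto simp: dist_jn_def mk_dist_def)
  have h: "dm A B dist_jn y x \<in> hom (Ty A x) (Ty B y)" if "x \<in> Elts A" "y \<in> Elts B" for x y
    unfolding dm_dist_jn[OF that] by (rule jn_hom[OF dist_jn_args[OF that]])
  have u: "dm A B \<Phi> y x \<preceq> dm A B dist_jn y x" if "x \<in> Elts A" "y \<in> Elts B" "\<Phi> \<in> F" for x y \<Phi>
    using dm_dist_jn_leq_iff[OF that(1,2) h[OF that(1,2)]] that(3) by simp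
  fix x y assume x: "x \<in> Elts A" and y: "y \<in> Elts B"
  show "dm A B dist_jn y x \<in> hom (Ty A x) (Ty B y)" by (rule h[OF x y])
  show "hm B y' y \<cdot> dm A B dist_jn y x \<preceq> dm A B dist_jn y' x" if y': "y' \<in> Elts B" for y'
    unfolding dm_dist_jn_left_iff[OF x y hm_hom[OF B y y'] h[OF x y']]
    using leq_trans[OF dm_left[OF A B _ x y y'] u[OF x y']] F by blast
  show "dm A B dist_jn y x \<cdot> hm A x x' \<preceq> dm A B dist_jn y x'" if x': "x' \<in> Elts A" for x'
    unfolding dm_dist_jn_right_iff[OF x y hm_hom[OF A x' x] h[OF x' y]]
    using leq_trans[OF dm_right[OF A B _ x x' y] u[OF x' y]] F by blast
qed

end

lemma Le_dist_inv:
  assumes A: "sqc A" and B: "sqc B" and \<Phi>: "\<Phi> \<in> distributors Q A B" and \<Theta>: "\<Theta> \<in> distributors Q B A"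
  shows "Le (SymDist Q) B A (dist_inv A B \<Phi>) \<Theta> \<longleftrightarrow> Le (SymDist Q) A B \<Phi> (dist_inv B A \<Theta>)"
  unfolding Le_SymDist[OF B A dist_inv_closed[OF A B \<Phi>] \<Theta>] Le_SymDist[OF A B \<Phi> dist_inv_closed[OF B A \<Theta>]]
  using cv_leq_iff[of _ "(_)\<degree>"] by (auto simp: dm_inv[OF A B \<Phi>] dm_inv[OF B A \<Theta>])

text \<open>Unit laws, associativity and the law for the involute of a composite are tested against
  an arbitrary upper bound. They then concern composites of single entries, where the unconditional
  laws of tagged arrows apply.\<close>

theorem involutive_quantaloid_SymDist: "involutive_quantaloid (SymDist Q :: (('o, 'a, 'v) qcat, _) inv_quantaloid_rec)"
proof (rule involutive_quantaloidI)
  let ?D = "SymDist Q :: (('o, 'a, 'v) qcat, _) inv_quantaloid_rec"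
  have cat: "category ?D"
  proof (unfold_locales, unfold SymDist_simps mem_Collect_eq)
    fix A B :: "('o, 'a, 'v) qcat" and \<Phi> assume A: "sqc A" and B: "sqc B" and \<Phi>: "\<Phi> \<in> distributors Q A B"
    note h = dm_hom[OF A B \<Phi>]
    show "dist_comp Q A A B \<Phi> (Arr A) = \<Phi>"
    proof (rule dist_eq_by_upper[OF A B dist_comp_closed[OF A A B Arr_distributor[OF A] \<Phi>] \<Phi>])
      fix \<Theta> assume \<Theta>: "\<Theta> \<in> distributors Q A B"
      show "Le ?D A B (dist_comp Q A A B \<Phi> (Arr A)) \<Theta> \<longleftrightarrow> Le ?D A B \<Phi> \<Theta>"
        unfolding Le_dist_comp[OF A A B Arr_distributor[OF A] \<Phi> \<Theta>] Le_SymDist[OF A B \<Phi> \<Theta>] dm_Arr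
        using leq_trans[OF cmp_ge_right[OF hm_one[OF A] h]] leq_trans[OF dm_right[OF A B \<Phi>]] by blast
    qed
    show "dist_comp Q A B B (Arr B) \<Phi> = \<Phi>"
    proof (rule dist_eq_by_upper[OF A B dist_comp_closed[OF A B B \<Phi> Arr_distributor[OF B]] \<Phi>])
      fix \<Theta> assume \<Theta>: "\<Theta> \<in> distributors Q A B"
      show "Le ?D A B (dist_comp Q A B B (Arr B) \<Phi>) \<Theta> \<longleftrightarrow> Le ?D A B \<Phi> \<Theta>"
        unfolding Le_dist_comp[OF A B B \<Phi> Arr_distributor[OF B] \<Theta>] Le_SymDist[OF A B \<Phi> \<Theta>] dm_Arr
        using leq_trans[OF cmp_ge_left[OF hm_one[OF B] h]] leq_trans[OF dm_left[OF A B \<Phi>]] by blast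
    qed
  next
    fix A B C D :: "('o, 'a, 'v) qcat" and \<Phi> \<Psi> \<Theta>
    assume A: "sqc A" and B: "sqc B" and C: "sqc C" and D: "sqc D"
      and \<Phi>: "\<Phi> \<in> distributors Q A B" and \<Psi>: "\<Psi> \<in> distributors Q B C" and \<Theta>: "\<Theta> \<in> distributors Q C D"
    note \<Psi>\<Phi> = dist_comp_closed[OF A B C \<Phi> \<Psi>] and \<Theta>\<Psi> = dist_comp_closed[OF B C D \<Psi> \<Theta>]
    show "dist_comp Q A B D (dist_comp Q B C D \<Theta> \<Psi>) \<Phi> = dist_comp Q A C D \<Theta> (dist_comp Q A B C \<Psi> \<Phi>)"
    proof (rule dist_eq_by_upper[OF A D dist_comp_closed[OF A B D \<Phi> \<Theta>\<Psi>] dist_comp_closed[OF A C D \<Psi>\<Phi> \<Theta>]])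
      fix \<Omega> assume \<Omega>: "\<Omega> \<in> distributors Q A D"
      note w = dm_hom[OF A D \<Omega>]
      show "Le ?D A D (dist_comp Q A B D (dist_comp Q B C D \<Theta> \<Psi>) \<Phi>) \<Omega> \<longleftrightarrow> Le ?D A D (dist_comp Q A C D \<Theta> (dist_comp Q A B C \<Psi> \<Phi>)) \<Omega>"
        unfolding Le_dist_comp[OF A B D \<Phi> \<Theta>\<Psi> \<Omega>] Le_dist_comp[OF A C D \<Psi>\<Phi> \<Theta> \<Omega>]
        using dm_comp_right_iff[OF B C D \<Psi> \<Theta> _ _ dm_hom[OF A B \<Phi>] w] dm_comp_left_iff[OF A B C \<Phi> \<Psi> _ _ dm_hom[OF C D \<Theta>] w]
        by (simp add: cmp_assoc) blast
    qed
  qed (simp_all add: Arr_distributor dist_comp_closed)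
  show "quantaloid ?D"
  proof (rule quantaloidI(1)[OF cat, of dist_jn], unfold SymDist_simps mem_Collect_eq)
    fix A B :: "('o, 'a, 'v) qcat" assume A: "sqc A" and B: "sqc B"
    show "hom_poset ?D A B"
    proof (unfold_locales, unfold SymDist_simps)
      fix \<Phi> assume \<Phi>: "\<Phi> \<in> distributors Q A B"
      show "Le ?D A B \<Phi> \<Phi>" using Le_SymDist[OF A B \<Phi> \<Phi>] by simp
      fix \<Psi> assume \<Psi>: "\<Psi> \<in> distributors Q A B"
      show "\<Phi> = \<Psi>" if "Le ?D A B \<Phi> \<Psi>" "Le ?D A B \<Psi> \<Phi>"
        using that dist_eqI[OF A B \<Phi> \<Psi>] leq_antisym unfolding Le_SymDist[OF A B \<Phi> \<Psi>] Le_SymDist[OF A B \<Psi> \<Phi>] by blast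
      fix \<Theta> assume \<Theta>: "\<Theta> \<in> distributors Q A B"
      show "Le ?D A B \<Phi> \<Theta>" if "Le ?D A B \<Phi> \<Psi>" "Le ?D A B \<Psi> \<Theta>"
        using that leq_trans unfolding Le_SymDist[OF A B \<Phi> \<Psi>] Le_SymDist[OF A B \<Psi> \<Theta>] Le_SymDist[OF A B \<Phi> \<Theta>] by blast
    qed
    fix F assume F: "F \<subseteq> distributors Q A B"
    note JF = dist_jn_closed[OF A B F]
    show "is_join ?D A B F (dist_jn A B F)" unfolding is_join_def SymDist_simps
    proof (intro conjI ballI JF)
      fix \<Psi> assume \<Psi>: "\<Psi> \<in> distributors Q A B"
      show "Le ?D A B (dist_jn A B F) \<Psi> \<longleftrightarrow> (\<forall>\<Phi>\<in>F. Le ?D A B \<Phi> \<Psi>)"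
        using Le_SymDist[OF A B _ \<Psi>] JF F dm_dist_jn_leq_iff[OF A B F _ _ dm_hom[OF A B \<Psi>]] by (auto simp: subset_iff)
    qed
    fix C :: "('o, 'a, 'v) qcat" and \<Psi> \<Theta> assume C: "sqc C" and \<Psi>: "\<Psi> \<in> distributors Q B C" and \<Theta>: "\<Theta> \<in> distributors Q A C"
    show "Le ?D A C (dist_comp Q A B C \<Psi> (dist_jn A B F)) \<Theta> \<longleftrightarrow> (\<forall>\<Phi>\<in>F. Le ?D A C (dist_comp Q A B C \<Psi> \<Phi>) \<Theta>)"
      using Le_dist_comp[OF A B C _ \<Psi> \<Theta>] JF F dm_dist_jn_left_iff[OF A B F _ _ dm_hom[OF B C \<Psi>] dm_hom[OF A C \<Theta>]]
      by (auto simp: subset_iff)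
  next
    fix A B C :: "('o, 'a, 'v) qcat" and \<Phi> F \<Theta>
    assume A: "sqc A" and B: "sqc B" and C: "sqc C" and \<Phi>: "\<Phi> \<in> distributors Q A B" and F: "F \<subseteq> distributors Q B C"
      and \<Theta>: "\<Theta> \<in> distributors Q A C"
    show "Le ?D A C (dist_comp Q A B C (dist_jn B C F) \<Phi>) \<Theta> \<longleftrightarrow> (\<forall>\<Psi>\<in>F. Le ?D A C (dist_comp Q A B C \<Psi> \<Phi>) \<Theta>)"
      using Le_dist_comp[OF A B C \<Phi> _ \<Theta>] dist_jn_closed[OF B C F] F
        dm_dist_jn_right_iff[OF B C F _ _ dm_hom[OF A B \<Phi>] dm_hom[OF A C \<Theta>]] by (auto simp: subset_iff)
  qed
  fix A B :: "('o, 'a, 'v) qcat" assume "A \<in> Obj ?D" "B \<in> Obj ?D"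
  then have A: "sqc A" and B: "sqc B" by (simp_all add: SymDist_simps)
  show "Inv ?D A A (Idn ?D A) = Idn ?D A"
    unfolding SymDist_simps
    by (rule dist_eqI[OF A A dist_inv_closed[OF A A Arr_distributor[OF A]] Arr_distributor[OF A]])
      (simp add: dm_inv[OF A A Arr_distributor[OF A]] dm_Arr hm_cv[OF A])
  fix \<Phi> assume "\<Phi> \<in> Hom ?D A B" then have \<Phi>: "\<Phi> \<in> distributors Q A B" by (simp add: SymDist_simps)
  note i\<Phi> = dist_inv_closed[OF A B \<Phi>]
  show "Inv ?D A B \<Phi> \<in> Hom ?D B A" unfolding SymDist_simps by (rule i\<Phi>)
  show ii: "Inv ?D B A (Inv ?D A B \<Phi>) = \<Phi>" unfolding SymDist_simps
    by (rule dist_eqI[OF A B dist_inv_closed[OF B A i\<Phi>] \<Phi>]) (simp add: dm_inv[OF A B \<Phi>] dm_inv[OF B A i\<Phi>])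
  show "Le ?D B A (Inv ?D A B \<Phi>) (Inv ?D A B \<Psi>)" if "\<Psi> \<in> Hom ?D A B" "Le ?D A B \<Phi> \<Psi>" for \<Psi>
  proof -
    have \<Psi>: "\<Psi> \<in> distributors Q A B" using that by (simp add: SymDist_simps)
    show ?thesis using that(2)
      unfolding SymDist_simps Le_SymDist[OF A B \<Phi> \<Psi>] Le_SymDist[OF B A i\<Phi> dist_inv_closed[OF A B \<Psi>]]
      by (simp add: dm_inv[OF A B \<Phi>] dm_inv[OF A B \<Psi>] cv_leq_iff)
  qed
  fix C :: "('o, 'a, 'v) qcat" and \<Psi> assume "C \<in> Obj ?D" "\<Psi> \<in> Hom ?D B C"
  then have C: "sqc C" and \<Psi>: "\<Psi> \<in> distributors Q B C" by (simp_all add: SymDist_simps)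
  note i\<Psi> = dist_inv_closed[OF B C \<Psi>] and c = dist_comp_closed[OF A B C \<Phi> \<Psi>]
  show "Inv ?D A C (Comp ?D A B C \<Psi> \<Phi>) = Comp ?D C B A (Inv ?D A B \<Phi>) (Inv ?D B C \<Psi>)"
    unfolding SymDist_simps
  proof (rule dist_eq_by_upper[OF C A dist_inv_closed[OF A C c] dist_comp_closed[OF C B A i\<Psi> i\<Phi>]])
    fix \<Theta> assume \<Theta>: "\<Theta> \<in> distributors Q C A"
    have "(dm A B \<Phi> y x)\<degree> \<cdot> (dm B C \<Psi> z y)\<degree> \<preceq> w \<longleftrightarrow> dm B C \<Psi> z y \<cdot> dm A B \<Phi> y x \<preceq> w\<degree>" for x y z w
      using cv_leq_iff[of _ "w\<degree>"] by (simp add: cv_cmp[symmetric])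
    then show "Le ?D C A (dist_inv A C (dist_comp Q A B C \<Psi> \<Phi>)) \<Theta> \<longleftrightarrow> Le ?D C A (dist_comp Q C B A (dist_inv A B \<Phi>) (dist_inv B C \<Psi>)) \<Theta>"
      unfolding Le_dist_inv[OF A C c \<Theta>] Le_dist_comp[OF A B C \<Phi> \<Psi> dist_inv_closed[OF C A \<Theta>]] Le_dist_comp[OF C B A i\<Psi> i\<Phi> \<Theta>]
      by (auto simp: dm_inv[OF A B \<Phi>] dm_inv[OF B C \<Psi>] dm_inv[OF C A \<Theta>])
  qed
qed

end

lemma involutive_quantaloid_subset:
  assumes D: "involutive_quantaloid D" and S: "S \<subseteq> Obj D"
  shows "involutive_quantaloid (D\<lparr>Obj := S\<rparr>)"
proof -
  interpret involutive_quantaloid D by (rule D)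
  have o: "hom_order (D\<lparr>Obj := S\<rparr>) X Y = hom_order D X Y" for X Y by (simp add: hom_order_def)
  have j: "Join (D\<lparr>Obj := S\<rparr>) X Y = Join D X Y" for X Y by (rule ext) (simp add: Join_def o)
  show ?thesis
    by (intro involutive_quantaloid.intro quantaloid.intro category.intro quantaloid_axioms.intro involutive_quantaloid_axioms.intro)
      (use S in \<open>simp_all add: subset_iff o j Idn_closed Comp_closed Comp_assoc Comp_Idn Idn_Comp
        hom_complete Comp_Join_left Comp_Join_right Inv_closed Inv_Idn Inv_Comp Inv_Join Inv_Inv\<close>)
qed

section \<open>Splitting symmetric idempotents\<close>

lemma ssi_simps:
  "(A, e) \<in> Obj (ssi Q) \<longleftrightarrow> A \<in> Obj Q \<and> e \<in> Hom Q A A \<and> Comp Q A A A e e = e \<and> Inv Q A A e = e"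
  "x \<in> Hom (ssi Q) (A, e) (B, f) \<longleftrightarrow> x \<in> Hom Q A B \<and> Comp Q A B B f x = x \<and> Comp Q A A B x e = x"
  "Idn (ssi Q) (A, e) = e" "Comp (ssi Q) X Y Z = Comp Q (fst X) (fst Y) (fst Z)"
  "Le (ssi Q) X Y = Le Q (fst X) (fst Y)" "Inv (ssi Q) X Y = Inv Q (fst X) (fst Y)"
  by (simp_all add: ssi_def)

text \<open>Suprema are those of \<open>Q\<close>: composition with the idempotents preserves joins
  and fixes every member of \<open>A\<close>, hence it fixes their join.\<close>

theorem involutive_quantaloid_ssi:
  assumes "involutive_quantaloid Q" shows "involutive_quantaloid (ssi Q)"
proof -
  interpret involutive_quantaloid Q by (rule assms)
  have cat: "category (ssi Q)"
    by (unfold_locales; clarsimp simp: ssi_simps Comp_closed Comp_assoc) (simp add: Comp_assoc[symmetric])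
  have jc: "Join Q (fst X) (fst Y) A \<in> Hom (ssi Q) X Y \<and> is_join (ssi Q) X Y A (Join Q (fst X) (fst Y) A)"
    if "X \<in> Obj (ssi Q)" "Y \<in> Obj (ssi Q)" "A \<subseteq> Hom (ssi Q) X Y" for X Y A
  proof -
    obtain B e D f where XY: "X = (B, e)" "Y = (D, f)" by (metis surj_pair)
    have A: "A \<subseteq> Hom Q B D" using that(3) unfolding XY by (auto simp: ssi_simps)
    have ob: "B \<in> Obj Q" "D \<in> Obj Q" "e \<in> Hom Q B B" "f \<in> Hom Q D D" using that unfolding XY by (auto simp: ssi_simps)
    have "(\<lambda>g. Comp Q B D D f g) ` A = A" "(\<lambda>g. Comp Q B B D g e) ` A = A"
      using that(3) unfolding XY by (auto simp: ssi_simps image_iff subset_iff)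
    then have "Join Q B D A \<in> Hom (ssi Q) X Y"
      using A ob Comp_Join_right[of B D D A f] Comp_Join_left[of B B D e A] by (simp add: XY ssi_simps Join_closed)
    then show ?thesis using A ob unfolding is_join_def XY
      by (auto simp: ssi_simps Join_le_iff)
  qed
  have "quantaloid (ssi Q)"
  proof (rule quantaloidI(1)[OF cat, of "\<lambda>X Y. Join Q (fst X) (fst Y)"])
    show "hom_poset (ssi Q) X Y" if "X \<in> Obj (ssi Q)" "Y \<in> Obj (ssi Q)" for X Y
      using that by (cases X; cases Y) (unfold_locales, auto simp: ssi_simps Le_refl intro: Le_antisym Le_trans)
    show "is_join (ssi Q) X Y A (Join Q (fst X) (fst Y) A)"
      if "X \<in> Obj (ssi Q)" "Y \<in> Obj (ssi Q)" "A \<subseteq> Hom (ssi Q) X Y" for X Y A using jc[OF that] by blast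
    show "Le (ssi Q) X Z (Comp (ssi Q) X Y Z (Join Q (fst Y) (fst Z) A) f) z \<longleftrightarrow> (\<forall>g\<in>A. Le (ssi Q) X Z (Comp (ssi Q) X Y Z g f) z)"
      if "X \<in> Obj (ssi Q)" "Y \<in> Obj (ssi Q)" "Z \<in> Obj (ssi Q)" "f \<in> Hom (ssi Q) X Y" "A \<subseteq> Hom (ssi Q) Y Z" "z \<in> Hom (ssi Q) X Z" for X Y Z f A z
    proof -
      have *: "fst X \<in> Obj Q" "fst Y \<in> Obj Q" "fst Z \<in> Obj Q" "f \<in> Hom Q (fst X) (fst Y)" "A \<subseteq> Hom Q (fst Y) (fst Z)" "z \<in> Hom Q (fst X) (fst Z)"
        using that by (cases X; cases Y; cases Z; auto simp: ssi_simps)+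
      then have "(\<lambda>g. Comp Q (fst X) (fst Y) (fst Z) g f) ` A \<subseteq> Hom Q (fst X) (fst Z)" using Comp_closed by blast
      then show ?thesis using * by (simp add: ssi_simps Comp_Join_left Join_le_iff)
    qed
    show "Le (ssi Q) X Z (Comp (ssi Q) X Y Z g (Join Q (fst X) (fst Y) A)) z \<longleftrightarrow> (\<forall>f\<in>A. Le (ssi Q) X Z (Comp (ssi Q) X Y Z g f) z)"
      if "X \<in> Obj (ssi Q)" "Y \<in> Obj (ssi Q)" "Z \<in> Obj (ssi Q)" "A \<subseteq> Hom (ssi Q) X Y" "g \<in> Hom (ssi Q) Y Z" "z \<in> Hom (ssi Q) X Z" for X Y Z A g z
    proof -
      have *: "fst X \<in> Obj Q" "fst Y \<in> Obj Q" "fst Z \<in> Obj Q" "A \<subseteq> Hom Q (fst X) (fst Y)" "g \<in> Hom Q (fst Y) (fst Z)" "z \<in> Hom Q (fst X) (fst Z)"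
        using that by (cases X; cases Y; cases Z; auto simp: ssi_simps)+
      then have "(\<lambda>f. Comp Q (fst X) (fst Y) (fst Z) g f) ` A \<subseteq> Hom Q (fst X) (fst Z)" using Comp_closed by blast
      then show ?thesis using * by (simp add: ssi_simps Comp_Join_right Join_le_iff)
    qed
  qed
  then show ?thesis
  proof (rule involutive_quantaloidI)
    show "Inv (ssi Q) X Y f \<in> Hom (ssi Q) Y X"
      if "X \<in> Obj (ssi Q)" "Y \<in> Obj (ssi Q)" "f \<in> Hom (ssi Q) X Y" for X Y f
      using that by (cases X; cases Y) (auto simp: ssi_simps Inv_closed Inv_Comp[symmetric] simp flip: , metis Inv_Comp, metis Inv_Comp)
  qed (auto simp: ssi_simps Inv_Comp Inv_mono Inv_Inv)
qed

section \<open>Quantaloids generated by a site\<close>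

lemma grothendieck_topologyD:
  assumes "grothendieck_topology C J"
  shows J_sieve: "\<lbrakk>U \<in> Obj C; S \<in> J U\<rbrakk> \<Longrightarrow> is_sieve C U S"
    and J_max: "U \<in> Obj C \<Longrightarrow> {(V, s). V \<in> Obj C \<and> s \<in> Hom C V U} \<in> J U"
    and J_pullback: "\<lbrakk>U \<in> Obj C; V \<in> Obj C; f \<in> Hom C V U; S \<in> J U\<rbrakk> \<Longrightarrow> sieve_pullback C V U f S \<in> J V"
    and J_local: "\<lbrakk>U \<in> Obj C; S \<in> J U; is_sieve C U R; \<And>V s. (V, s) \<in> S \<Longrightarrow> sieve_pullback C V U s R \<in> J V\<rbrakk> \<Longrightarrow> R \<in> J U"
  using assms unfolding grothendieck_topology_def by (simp, simp, simp, fastforce)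

abbreviation span_sieve :: "('o, 'a) cat \<Rightarrow> 'o \<Rightarrow> 'o \<Rightarrow> 'o \<Rightarrow> 'a \<Rightarrow> 'a \<Rightarrow> ('o \<times> 'a \<times> 'a) set \<Rightarrow> ('o \<times> 'a) set" where
  "span_sieve C X Y U f g R \<equiv> {(V, s). V \<in> Obj C \<and> s \<in> Hom C V U \<and> (V, Comp C V U Y f s, Comp C V U X g s) \<in> R}"

abbreviation eq_sieve :: "('o, 'a) cat \<Rightarrow> 'o \<Rightarrow> 'o \<Rightarrow> 'a \<Rightarrow> 'a \<Rightarrow> ('o \<times> 'a) set" where
  "eq_sieve C X U f g \<equiv> {(V, s). V \<in> Obj C \<and> s \<in> Hom C V U \<and> Comp C V U X f s = Comp C V U X g s}"

locale site = category C for C :: "('c, 'b) cat" +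
  fixes J :: "'c \<Rightarrow> ('c \<times> 'b) set set"
  assumes topology: "grothendieck_topology C J"
begin

lemmas J_sieve = J_sieve[OF topology] and J_max = J_max[OF topology]
  and J_pullback = J_pullback[OF topology] and J_local = J_local[OF topology]

lemma sieve_arrow: "\<lbrakk>U \<in> Obj C; S \<in> J U; (V, s) \<in> S\<rbrakk> \<Longrightarrow> V \<in> Obj C \<and> s \<in> Hom C V U"
  using J_sieve unfolding is_sieve_def by blast

lemma sieve_comp:
  "\<lbrakk>U \<in> Obj C; S \<in> J U; (V, s) \<in> S; W \<in> Obj C; t \<in> Hom C W V\<rbrakk> \<Longrightarrow> (W, Comp C W V U s t) \<in> S"
  using J_sieve unfolding is_sieve_def by blast

text \<open>Along an arrow of \<open>S\<close> the sieve \<open>R\<close> pulls back to the maximal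
  sieve, so the local character of \<open>J\<close> applies.\<close>

lemma J_superset:
  assumes U: "U \<in> Obj C" and S: "S \<in> J U" and R: "is_sieve C U R" and sub: "S \<subseteq> R"
  shows "R \<in> J U"
proof (rule J_local[OF U S R])
  fix V s assume s: "(V, s) \<in> S"
  then have V: "V \<in> Obj C" "s \<in> Hom C V U" using sieve_arrow[OF U S] by auto
  have "sieve_pullback C V U s R = {(W, t). W \<in> Obj C \<and> t \<in> Hom C W V}"
    using sieve_comp[OF U S s] sub by (auto simp: sieve_pullback_def)
  then show "sieve_pullback C V U s R \<in> J V" using J_max[OF V(1)] by simp
qed

end

definition span_arrow ::
  "('o, 'a, 'm) inv_quantaloid_rec_scheme \<Rightarrow> ('c \<Rightarrow> 'o) \<Rightarrow> ('c \<Rightarrow> 'c \<Rightarrow> 'b \<Rightarrow> 'a) \<Rightarrow> 'c \<Rightarrow> 'c \<Rightarrow> 'c \<Rightarrow> 'b \<Rightarrow> 'b \<Rightarrow> 'a"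
where
  "span_arrow Q \<iota> \<gamma> T U W f g = Comp Q (\<iota> T) (\<iota> W) (\<iota> U) (\<gamma> W U f) (Inv Q (\<iota> W) (\<iota> T) (\<gamma> W T g))"

text \<open>The interface shared by the closed cribles, by a quantaloid equivalent to them and by
  its splitting. \<open>\<gamma>_cover\<close> makes covering sieves cover in \<open>Q\<close>;
  \<open>\<gamma>_local\<close> is the converse, by which the order remembers the topology: a span
  below the join of a family stable under precomposition belongs to that family locally.
  \<open>\<gamma>\<close> may be neither full nor faithful. \<open>generate_obj\<close> reaches the
  objects outside the image of \<open>\<iota>\<close>; it covers them without asking that they be
  isomorphic to some \<open>\<iota> U\<close>.\<close>

locale site_quantaloid = involutive_quantaloid Q + C: site C J
  for Q :: "('o, 'a, 'm) inv_quantaloid_rec_scheme" and C :: "('c, 'b) cat" and J +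
  fixes V :: "'v itself" and \<iota> :: "'c \<Rightarrow> 'o" and \<gamma> :: "'c \<Rightarrow> 'c \<Rightarrow> 'b \<Rightarrow> 'a"
  assumes universe: "universe TYPE('v)"
    and Q_small: "small_category TYPE('v) Q"
    and C_small: "small_category TYPE('v) C"
    and \<iota>_closed: "U \<in> Obj C \<Longrightarrow> \<iota> U \<in> Obj Q"
    and \<gamma>_map: "\<lbrakk>U \<in> Obj C; T \<in> Obj C; f \<in> Hom C T U\<rbrakk> \<Longrightarrow> is_symmetric_left_adjoint Q (\<iota> T) (\<iota> U) (\<gamma> T U f)"
    and \<gamma>_Idn: "U \<in> Obj C \<Longrightarrow> \<gamma> U U (Idn C U) = Idn Q (\<iota> U)"
    and \<gamma>_Comp: "\<lbrakk>U \<in> Obj C; T \<in> Obj C; W \<in> Obj C; f \<in> Hom C T U; g \<in> Hom C W T\<rbrakk>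
      \<Longrightarrow> \<gamma> W U (Comp C W T U f g) = Comp Q (\<iota> W) (\<iota> T) (\<iota> U) (\<gamma> T U f) (\<gamma> W T g)"
    and \<gamma>_cover: "\<lbrakk>U \<in> Obj C; R \<in> J U; z \<in> Hom Q (\<iota> U) (\<iota> U);
        \<And>T s. (T, s) \<in> R \<Longrightarrow> Le Q (\<iota> U) (\<iota> U) (span_arrow Q \<iota> \<gamma> U U T s s) z\<rbrakk>
      \<Longrightarrow> Le Q (\<iota> U) (\<iota> U) (Idn Q (\<iota> U)) z"
    and \<gamma>_generate: "\<lbrakk>T \<in> Obj C; U \<in> Obj C; r \<in> Hom Q (\<iota> T) (\<iota> U); z \<in> Hom Q (\<iota> T) (\<iota> U);
        \<And>W f g. \<lbrakk>(W, f, g) \<in> spans C T U;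
          Le Q (\<iota> T) (\<iota> U) (span_arrow Q \<iota> \<gamma> T U W f g) r\<rbrakk>
          \<Longrightarrow> Le Q (\<iota> T) (\<iota> U) (span_arrow Q \<iota> \<gamma> T U W f g) z\<rbrakk>
      \<Longrightarrow> Le Q (\<iota> T) (\<iota> U) r z"
    and \<gamma>_local: "\<lbrakk>T \<in> Obj C; U \<in> Obj C; A \<subseteq> spans C T U;
        \<And>W f g W' k. \<lbrakk>(W, f, g) \<in> A; W' \<in> Obj C; k \<in> Hom C W' W\<rbrakk> \<Longrightarrow> (W', Comp C W' W U f k, Comp C W' W T g k) \<in> A;
        (W, f, g) \<in> spans C T U;
        \<And>z. \<lbrakk>z \<in> Hom Q (\<iota> T) (\<iota> U); \<And>W f g. (W, f, g) \<in> A \<Longrightarrow>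
            Le Q (\<iota> T) (\<iota> U) (span_arrow Q \<iota> \<gamma> T U W f g) z\<rbrakk>
          \<Longrightarrow> Le Q (\<iota> T) (\<iota> U) (span_arrow Q \<iota> \<gamma> T U W f g) z\<rbrakk>
      \<Longrightarrow> span_sieve C T U W f g A \<in> J W"
    and generate_obj: "\<lbrakk>X \<in> Obj Q; z \<in> Hom Q X X;
        \<And>U t. \<lbrakk>U \<in> Obj C; is_symmetric_left_adjoint Q (\<iota> U) X t\<rbrakk>
          \<Longrightarrow> Le Q X X (Comp Q X (\<iota> U) X t (Inv Q (\<iota> U) X t)) z\<rbrakk>
      \<Longrightarrow> Le Q X X (Idn Q X) z"
begin

abbreviation "spn \<equiv> span_arrow Q \<iota> \<gamma>"

definition gm :: "'c \<Rightarrow> 'c \<Rightarrow> 'b \<Rightarrow> ('o, 'a) arrow" where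
  "gm T U f = Some (\<iota> T, \<iota> U, \<gamma> T U f)"

lemma is_map_Some:
  assumes "X \<in> Obj Q" "Y \<in> Obj Q"
  shows "is_map X Y (Some (X, Y, f)) \<longleftrightarrow> is_symmetric_left_adjoint Q X Y f"
proof (cases "f \<in> Hom Q X Y")
  case True
  then show ?thesis using assms Inv_closed[OF assms True]
    by (simp add: is_map_def is_symmetric_left_adjoint_def is_adjoint_def Some_hom_iff cv_Some cmp_Some one_def leq_Some
        Comp_closed Idn_closed)
next
  case False
  then show ?thesis by (simp add: is_map_def is_symmetric_left_adjoint_def is_adjoint_def Some_hom_iff)
qed

lemma gm_map: "\<lbrakk>U \<in> Obj C; T \<in> Obj C; f \<in> Hom C T U\<rbrakk> \<Longrightarrow> is_map (\<iota> T) (\<iota> U) (gm T U f)"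
  unfolding gm_def by (simp add: is_map_Some \<iota>_closed \<gamma>_map)

lemma gm_hom: "\<lbrakk>U \<in> Obj C; T \<in> Obj C; f \<in> Hom C T U\<rbrakk> \<Longrightarrow> gm T U f \<in> hom (\<iota> T) (\<iota> U)"
  using gm_map is_mapD(1) by blast

lemma \<gamma>_closed: "\<lbrakk>U \<in> Obj C; T \<in> Obj C; f \<in> Hom C T U\<rbrakk> \<Longrightarrow> \<gamma> T U f \<in> Hom Q (\<iota> T) (\<iota> U)"
  using gm_hom by (auto simp: gm_def Some_hom_iff)

lemma gm_Idn: "U \<in> Obj C \<Longrightarrow> gm U U (Idn C U) = one (\<iota> U)"
  by (simp add: gm_def one_def \<gamma>_Idn)

lemma gm_Comp: "\<lbrakk>U \<in> Obj C; T \<in> Obj C; W \<in> Obj C; f \<in> Hom C T U; g \<in> Hom C W T\<rbrakk>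
    \<Longrightarrow> gm W U (Comp C W T U f g) = gm T U f \<cdot> gm W T g"
  by (simp add: gm_def \<gamma>_Comp cmp_Some \<iota>_closed \<gamma>_closed)

lemma gm_span: assumes "T \<in> Obj C" "U \<in> Obj C" "(W, f, g) \<in> spans C T U"
  shows "gm W U f \<cdot> (gm W T g)\<degree> = Some (\<iota> T, \<iota> U, spn T U W f g)"
    "gm W U f \<cdot> (gm W T g)\<degree> \<in> hom (\<iota> T) (\<iota> U)"
    "spn T U W f g \<in> Hom Q (\<iota> T) (\<iota> U)"
proof -
  have *: "W \<in> Obj C" "f \<in> Hom C W U" "g \<in> Hom C W T" using assms by (auto simp: spans_def)
  show "gm W U f \<cdot> (gm W T g)\<degree> = Some (\<iota> T, \<iota> U, spn T U W f g)"
    using assms * by (simp add: gm_def cv_Some cmp_Some \<iota>_closed \<gamma>_closed Inv_closed span_arrow_def)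
  show "gm W U f \<cdot> (gm W T g)\<degree> \<in> hom (\<iota> T) (\<iota> U)" using assms * by (auto intro: cmp_hom[OF gm_hom cv_hom[OF gm_hom]])
  then show "spn T U W f g \<in> Hom Q (\<iota> T) (\<iota> U)"
    using assms * by (simp add: \<iota>_closed \<gamma>_closed Inv_closed Comp_closed span_arrow_def)
qed

lemma cover_covered:
  assumes U: "U \<in> Obj C" and R: "R \<in> J U"
  shows "covered (\<iota> U) (\<iota> U) (one (\<iota> U)) {gm T U s \<cdot> (gm T U s)\<degree> |T s. (T, s) \<in> R}"
proof (rule coveredI)
  have s: "(T, s, s) \<in> spans C U U" if "(T, s) \<in> R" for T s using C.sieve_arrow[OF U R that] by (simp add: spans_def)
  show "one (\<iota> U) \<in> hom (\<iota> U) (\<iota> U)" using U by (simp add: one_hom \<iota>_closed)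
  show "b \<in> hom (\<iota> U) (\<iota> U)" if "b \<in> {gm T U s \<cdot> (gm T U s)\<degree> |T s. (T, s) \<in> R}" for b
    using that gm_span[OF U U s] by blast
  fix z assume "z \<in> hom (\<iota> U) (\<iota> U)" and le: "\<And>b. b \<in> {gm T U s \<cdot> (gm T U s)\<degree> |T s. (T, s) \<in> R} \<Longrightarrow> b \<preceq> z"
  then obtain y where y: "z = Some (\<iota> U, \<iota> U, y)" "y \<in> Hom Q (\<iota> U) (\<iota> U)" by (auto simp: hom_def)
  have "Le Q (\<iota> U) (\<iota> U) (Idn Q (\<iota> U)) y"
  proof (rule \<gamma>_cover[OF U R y(2)])
    fix T s assume "(T, s) \<in> R"
    then have "gm T U s \<cdot> (gm T U s)\<degree> \<preceq> z" using le by blast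
    then show "Le Q (\<iota> U) (\<iota> U) (spn U U T s s) y"
      using gm_span[OF U U s] \<open>(T, s) \<in> R\<close> y U by (simp add: leq_Some \<iota>_closed)
  qed
  then show "one (\<iota> U) \<preceq> z" using y U by (simp add: one_def leq_Some \<iota>_closed Idn_closed)
qed

lemma generate_covered:
  assumes T: "T \<in> Obj C" and U: "U \<in> Obj C" and r: "r \<in> hom (\<iota> T) (\<iota> U)"
  shows "covered (\<iota> T) (\<iota> U) r {gm W U f \<cdot> (gm W T g)\<degree> |W f g. (W, f, g) \<in> spans C T U \<and> gm W U f \<cdot> (gm W T g)\<degree> \<preceq> r}"
    (is "covered _ _ _ ?B")
proof (rule coveredI[OF r])
  show "b \<in> hom (\<iota> T) (\<iota> U)" if "b \<in> ?B" for b using that gm_span[OF T U] by blast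
  fix z assume z: "z \<in> hom (\<iota> T) (\<iota> U)" and le: "\<And>b. b \<in> ?B \<Longrightarrow> b \<preceq> z"
  obtain y where y: "z = Some (\<iota> T, \<iota> U, y)" "y \<in> Hom Q (\<iota> T) (\<iota> U)" using z by (auto simp: hom_def)
  obtain q where q: "r = Some (\<iota> T, \<iota> U, q)" "q \<in> Hom Q (\<iota> T) (\<iota> U)" using r by (auto simp: hom_def)
  have "Le Q (\<iota> T) (\<iota> U) q y"
  proof (rule \<gamma>_generate[OF T U q(2) y(2)])
    fix W f g assume s: "(W, f, g) \<in> spans C T U"
      and l: "Le Q (\<iota> T) (\<iota> U) (spn T U W f g) q"
    have "gm W U f \<cdot> (gm W T g)\<degree> \<preceq> r" using gm_span[OF T U s] q T U l by (simp add: leq_Some \<iota>_closed)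
    then have "gm W U f \<cdot> (gm W T g)\<degree> \<preceq> z" using le s by blast
    then show "Le Q (\<iota> T) (\<iota> U) (spn T U W f g) y"
      using gm_span[OF T U s] y T U by (simp add: leq_Some \<iota>_closed)
  qed
  then show "r \<preceq> z" using y q T U by (simp add: leq_Some \<iota>_closed)
qed

lemma covered_local:
  assumes T: "T \<in> Obj C" and U: "U \<in> Obj C" and A: "A \<subseteq> spans C T U"
    and cl: "\<And>W f g W' k. \<lbrakk>(W, f, g) \<in> A; W' \<in> Obj C; k \<in> Hom C W' W\<rbrakk> \<Longrightarrow> (W', Comp C W' W U f k, Comp C W' W T g k) \<in> A"
    and s: "(W, f, g) \<in> spans C T U"
    and cov: "covered (\<iota> T) (\<iota> U) (gm W U f \<cdot> (gm W T g)\<degree>) {gm W U f \<cdot> (gm W T g)\<degree> |W f g. (W, f, g) \<in> A}"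
  shows "span_sieve C T U W f g A \<in> J W"
proof (rule \<gamma>_local[OF T U A cl s])
  fix z assume z: "z \<in> Hom Q (\<iota> T) (\<iota> U)" and le: "\<And>W f g. (W, f, g) \<in> A \<Longrightarrow>
            Le Q (\<iota> T) (\<iota> U) (spn T U W f g) z"
  have z': "Some (\<iota> T, \<iota> U, z) \<in> hom (\<iota> T) (\<iota> U)" using z T U by (simp add: Some_hom_iff \<iota>_closed)
  have "gm W U f \<cdot> (gm W T g)\<degree> \<preceq> Some (\<iota> T, \<iota> U, z)"
  proof (rule coveredD[OF cov z'])
    fix b assume "b \<in> {gm W U f \<cdot> (gm W T g)\<degree> |W f g. (W, f, g) \<in> A}"
    then obtain W f g where b: "b = gm W U f \<cdot> (gm W T g)\<degree>" "(W, f, g) \<in> A" by blast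
    then have "(W, f, g) \<in> spans C T U" using A by blast
    then show "b \<preceq> Some (\<iota> T, \<iota> U, z)" using gm_span[OF T U] le[OF b(2)] z T U b by (simp add: leq_Some \<iota>_closed)
  qed
  then show "Le Q (\<iota> T) (\<iota> U) (spn T U W f g) z"
    using gm_span[OF T U s] z T U by (simp add: leq_Some \<iota>_closed)
qed

lemma obj_covered:
  assumes X: "X \<in> Obj Q"
  shows "covered X X (one X) {t \<cdot> t\<degree> |U t. U \<in> Obj C \<and> is_map (\<iota> U) X t}" (is "covered _ _ _ ?B")
proof (rule coveredI[OF one_hom[OF X]])
  show "b \<in> hom X X" if "b \<in> ?B" for b using that cmp_hom[OF is_mapD(1) is_mapD(2)] by blast
  fix z assume z: "z \<in> hom X X" and le: "\<And>b. b \<in> ?B \<Longrightarrow> b \<preceq> z"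
  obtain y where y: "z = Some (X, X, y)" "y \<in> Hom Q X X" using z by (auto simp: hom_def)
  have "Le Q X X (Idn Q X) y"
  proof (rule generate_obj[OF X y(2)])
    fix U t assume U: "U \<in> Obj C" and t: "is_symmetric_left_adjoint Q (\<iota> U) X t"
    then have m: "is_map (\<iota> U) X (Some (\<iota> U, X, t))" using X by (simp add: is_map_Some \<iota>_closed)
    then have "t \<in> Hom Q (\<iota> U) X" by (simp add: is_map_def Some_hom_iff)
    moreover have "Some (\<iota> U, X, t) \<cdot> (Some (\<iota> U, X, t))\<degree> \<preceq> z" using le m U by blast
    ultimately show "Le Q X X (Comp Q X (\<iota> U) X t (Inv Q (\<iota> U) X t)) y"
      using X U y by (simp add: cv_Some cmp_Some leq_Some \<iota>_closed Inv_closed Comp_closed)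
  qed
  then show "one X \<preceq> z" using y X by (simp add: one_def leq_Some Idn_closed)
qed

text \<open>Shifting along both adjunctions gives
  \<open>t \<cdot> gm W T f \<preceq> u \<cdot> gm W U g\<close>, and comparable maps are
  equal.\<close>

lemma span_leq_iff:
  assumes "U \<in> Obj C" "T \<in> Obj C" "is_map (\<iota> T) X t" "is_map (\<iota> U) X u" "(W, f, g) \<in> spans C U T"
  shows "gm W T f \<cdot> (gm W U g)\<degree> \<preceq> t\<degree> \<cdot> u \<longleftrightarrow> t \<cdot> gm W T f = u \<cdot> gm W U g"
proof -
  have s: "W \<in> Obj C" "f \<in> Hom C W T" "g \<in> Hom C W U" using assms(5) by (auto simp: spans_def)
  note t = is_mapD[OF assms(3)] and u = is_mapD[OF assms(4)] and F = gm_hom[OF assms(2) s(1,2)] and G = gm_hom[OF assms(1) s(1,3)]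
  have m: "is_map (\<iota> W) X (t \<cdot> gm W T f)" "is_map (\<iota> W) X (u \<cdot> gm W U g)"
    using is_map_cmp[OF assms(3) gm_map] is_map_cmp[OF assms(4) gm_map] assms(1,2) s by blast+
  have "gm W T f \<cdot> (gm W U g)\<degree> \<preceq> t\<degree> \<cdot> u \<longleftrightarrow> gm W T f \<preceq> t\<degree> \<cdot> u \<cdot> gm W U g"
    by (rule map_shift_right[OF gm_map[OF assms(1) s(1,3)] F cmp_hom[OF t(2) u(1)]])
  also have "\<dots> \<longleftrightarrow> t \<cdot> gm W T f \<preceq> u \<cdot> gm W U g"
    using map_shift_left[OF assms(3) F cmp_hom[OF u(1) G]] by (simp add: cmp_assoc)
  also have "\<dots> \<longleftrightarrow> t \<cdot> gm W T f = u \<cdot> gm W U g" using map_leq_imp_eq[OF m] by auto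
  finally show ?thesis .
qed

text \<open>Stands in for a pullback, which the site need not have: the commuting squares on the
  cospan together exhaust \<open>t\<degree> \<cdot> u\<close>.\<close>

lemma cospan_covered:
  assumes "U \<in> Obj C" "T \<in> Obj C" "is_map (\<iota> T) X t" "is_map (\<iota> U) X u"
  shows "covered (\<iota> U) (\<iota> T) (t\<degree> \<cdot> u) {gm W T f \<cdot> (gm W U g)\<degree> |W f g. (W, f, g) \<in> spans C U T \<and> t \<cdot> gm W T f = u \<cdot> gm W U g}"
proof -
  have "t\<degree> \<cdot> u \<in> hom (\<iota> U) (\<iota> T)" using is_mapD[OF assms(3)] is_mapD[OF assms(4)] cmp_hom by blast
  moreover have "{gm W T f \<cdot> (gm W U g)\<degree> |W f g. (W, f, g) \<in> spans C U T \<and> t \<cdot> gm W T f = u \<cdot> gm W U g}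
    = {gm W T f \<cdot> (gm W U g)\<degree> |W f g. (W, f, g) \<in> spans C U T \<and> gm W T f \<cdot> (gm W U g)\<degree> \<preceq> t\<degree> \<cdot> u}"
    using span_leq_iff[OF assms] by blast
  ultimately show ?thesis using generate_covered[OF assms(1,2)] by simp
qed

text \<open>\<open>\<gamma>_local\<close> is applied to the spans \<open>(g k, k)\<close>, the graph
  of \<open>g\<close>. They cover the span \<open>(f, 1)\<close>, since its arrow equals that of
  \<open>(g, 1)\<close>; and \<open>(f k, k)\<close> belongs to the graph exactly when
  \<open>f k = g k\<close>.\<close>

lemma gm_eq_local:
  assumes "U \<in> Obj C" "W \<in> Obj C" "f \<in> Hom C W U" "g \<in> Hom C W U" "gm W U f = gm W U g"
  shows "eq_sieve C U W f g \<in> J W"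
proof -
  let ?A = "{(T, Comp C T W U g k, k) |T k. T \<in> Obj C \<and> k \<in> Hom C T W}"
  have i: "(W, f, Idn C W) \<in> spans C W U" "(W, g, Idn C W) \<in> ?A"
    using assms C.Idn_closed C.Comp_Idn[OF assms(2,1,4)] by (auto simp: spans_def) 
  have "span_sieve C W U W f (Idn C W) ?A \<in> J W"
  proof (rule covered_local[OF assms(2,1) _ _ i(1)])
    show sub: "?A \<subseteq> spans C W U" using assms C.Comp_closed by (auto simp: spans_def)
    show "(W'', Comp C W'' W' U f' k, Comp C W'' W' W g' k) \<in> ?A" if "(W', f', g') \<in> ?A" "W'' \<in> Obj C" "k \<in> Hom C W'' W'" for W' f' g' W'' k
      using that assms C.Comp_closed C.Comp_assoc by auto
    have "{gm W' U f \<cdot> (gm W' W g)\<degree> |W' f g. (W', f, g) \<in> ?A} \<subseteq> hom (\<iota> W) (\<iota> U)"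
      using gm_span(2)[OF assms(2,1)] sub by blast
    moreover have "gm W U f \<cdot> (gm W W (Idn C W))\<degree> \<in> {gm W' U f \<cdot> (gm W' W g)\<degree> |W' f g. (W', f, g) \<in> ?A}"
      using i(2) unfolding assms(5) by blast
    ultimately show "covered (\<iota> W) (\<iota> U) (gm W U f \<cdot> (gm W W (Idn C W))\<degree>) {gm W' U f \<cdot> (gm W' W g)\<degree> |W' f g. (W', f, g) \<in> ?A}"
      unfolding covered_def by blast
  qed
  also have "span_sieve C W U W f (Idn C W) ?A
     = eq_sieve C U W f g"
  proof -
    have "(W', Comp C W' W U f k, Comp C W' W W (Idn C W) k) \<in> ?A \<longleftrightarrow> Comp C W' W U f k = Comp C W' W U g k"
      if "W' \<in> Obj C" "k \<in> Hom C W' W" for W' k using that C.Idn_Comp[OF that(1) assms(2) that(2)] by simp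
    then show ?thesis by (intro Collect_cong) (simp add: split_def cong: conj_cong)
  qed
  finally show ?thesis .
qed

end

section \<open>Symmetrically complete categories\<close>

context involutive_quantaloid
begin

text \<open>A family \<open>\<phi>\<close> is a symmetric left adjoint into \<open>A\<close> from the one-object category on \<open>X\<close>.\<close>

definition is_point :: "('o, 'a, 'v) qcat \<Rightarrow> 'o \<Rightarrow> ('v \<Rightarrow> ('o, 'a) arrow) \<Rightarrow> bool" where
  "is_point A X \<phi> \<longleftrightarrow> X \<in> Obj Q \<and> (\<forall>y\<in>Elts A. \<phi> y \<in> hom X (Ty A y)) \<and>
     (\<forall>y\<in>Elts A. \<forall>y'\<in>Elts A. hm A y' y \<cdot> \<phi> y \<preceq> \<phi> y') \<and>
     covered X X (one X) {(\<phi> y)\<degree> \<cdot> \<phi> y |y. y \<in> Elts A} \<and>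
     (\<forall>y\<in>Elts A. \<forall>y'\<in>Elts A. \<phi> y \<cdot> (\<phi> y')\<degree> \<preceq> hm A y y')"

lemma is_pointD:
  assumes "is_point A X \<phi>"
  shows "X \<in> Obj Q" "y \<in> Elts A \<Longrightarrow> \<phi> y \<in> hom X (Ty A y)"
    "y \<in> Elts A \<Longrightarrow> y' \<in> Elts A \<Longrightarrow> hm A y' y \<cdot> \<phi> y \<preceq> \<phi> y'"
    "covered X X (one X) {(\<phi> y)\<degree> \<cdot> \<phi> y |y. y \<in> Elts A}"
    "y \<in> Elts A \<Longrightarrow> y' \<in> Elts A \<Longrightarrow> \<phi> y \<cdot> (\<phi> y')\<degree> \<preceq> hm A y y'"
  using assms unfolding is_point_def by blast+

lemma is_pointI:
  assumes "X \<in> Obj Q" and h: "\<And>y. y \<in> Elts A \<Longrightarrow> \<phi> y \<in> hom X (Ty A y)"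
    and "\<And>y y'. y \<in> Elts A \<Longrightarrow> y' \<in> Elts A \<Longrightarrow> hm A y' y \<cdot> \<phi> y \<preceq> \<phi> y'"
    and c: "\<And>z. \<lbrakk>z \<in> hom X X; \<And>y. y \<in> Elts A \<Longrightarrow> (\<phi> y)\<degree> \<cdot> \<phi> y \<preceq> z\<rbrakk> \<Longrightarrow> one X \<preceq> z"
    and "\<And>y y'. y \<in> Elts A \<Longrightarrow> y' \<in> Elts A \<Longrightarrow> \<phi> y \<cdot> (\<phi> y')\<degree> \<preceq> hm A y y'"
  shows "is_point A X \<phi>"
  unfolding is_point_def
proof (intro conjI ballI assms)
  show "covered X X (one X) {(\<phi> y)\<degree> \<cdot> \<phi> y |y. y \<in> Elts A}"
  proof (rule coveredI[OF one_hom[OF assms(1)]])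
    fix b assume "b \<in> {(\<phi> y)\<degree> \<cdot> \<phi> y |y. y \<in> Elts A}"
    then show "b \<in> hom X X" using cmp_hom[OF cv_hom[OF h] h] by blast
  qed (use c in blast)
qed

text \<open>The unit and the counit of the adjunction read entrywise; the unit turns into a covering
  because composition of distributors is a join.\<close>

lemma symmetric_left_adjoint_iff:
  assumes B: "sqc B" and A: "sqc A"
  shows "is_symmetric_left_adjoint (SymDist Q) B A \<Phi> \<longleftrightarrow> \<Phi> \<in> distributors Q B A \<and>
    (\<forall>b\<in>Elts B. \<forall>b'\<in>Elts B. covered (Ty B b) (Ty B b') (hm B b' b) {(dm B A \<Phi> y b')\<degree> \<cdot> dm B A \<Phi> y b |y. y \<in> Elts A}) \<and>
    (\<forall>b\<in>Elts B. \<forall>y\<in>Elts A. \<forall>y'\<in>Elts A. dm B A \<Phi> y b \<cdot> (dm B A \<Phi> y' b)\<degree> \<preceq> hm A y y')"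
proof (cases "\<Phi> \<in> distributors Q B A")
  case True
  note i = dist_inv_closed[OF B A True]
  note c1 = dist_comp_closed[OF B A B True i] and c2 = dist_comp_closed[OF A B A i True]
  have k1: "{(dm B A \<Phi> y b')\<degree> \<cdot> dm B A \<Phi> y b |y. y \<in> Elts A} = (\<lambda>y. dm A B (dist_inv B A \<Phi>) b' y \<cdot> dm B A \<Phi> y b) ` Elts A"
    if "b' \<in> Elts B" for b b' using dm_inv[OF B A True that] by auto
  have k2: "covered (Ty B b) (Ty B b') (hm B b' b) ((\<lambda>y. dm A B (dist_inv B A \<Phi>) b' y \<cdot> dm B A \<Phi> y b) ` Elts A)
     \<longleftrightarrow> hm B b' b \<preceq> dm B B (dist_comp Q B A B (dist_inv B A \<Phi>) \<Phi>) b' b"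
    if "b \<in> Elts B" "b' \<in> Elts B" for b b'
    using that dm_comp[OF B A B True i that] dm_comp_sub[OF B A B True i that] sqc_Ty[OF B] hm_hom[OF B]
    by (simp add: covered_iff_jn)
  have k3: "dm A A (dist_comp Q A B A \<Phi> (dist_inv B A \<Phi>)) y y' \<preceq> hm A y y' \<longleftrightarrow>
      (\<forall>b\<in>Elts B. dm B A \<Phi> y b \<cdot> (dm B A \<Phi> y' b)\<degree> \<preceq> hm A y y')" if "y \<in> Elts A" "y' \<in> Elts A" for y y'
    using dm_comp_iff[OF A B A i True that(2,1) hm_hom[OF A that(2,1)]] dm_inv[OF B A True] that by simp
  have k4: "is_symmetric_left_adjoint (SymDist Q) B A \<Phi> \<longleftrightarrow>
     (\<forall>b\<in>Elts B. \<forall>b'\<in>Elts B. hm B b' b \<preceq> dm B B (dist_comp Q B A B (dist_inv B A \<Phi>) \<Phi>) b' b) \<and>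
     (\<forall>y'\<in>Elts A. \<forall>y\<in>Elts A. dm A A (dist_comp Q A B A \<Phi> (dist_inv B A \<Phi>)) y y' \<preceq> hm A y y')"
    unfolding is_symmetric_left_adjoint_def is_adjoint_def SymDist_simps
    using True i Le_SymDist[OF B B Arr_distributor[OF B] c1] Le_SymDist[OF A A c2 Arr_distributor[OF A]]
    by (simp add: dm_Arr)
  have k5: "covered (Ty B b) (Ty B b') (hm B b' b) {(dm B A \<Phi> y b')\<degree> \<cdot> dm B A \<Phi> y b |y. y \<in> Elts A}
     \<longleftrightarrow> hm B b' b \<preceq> dm B B (dist_comp Q B A B (dist_inv B A \<Phi>) \<Phi>) b' b"
    if "b \<in> Elts B" "b' \<in> Elts B" for b b' unfolding k1[OF that(2)] by (rule k2[OF that])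
  show ?thesis unfolding k4 using True k3 k5 by blast
next
  case False
  then show ?thesis by (simp add: is_symmetric_left_adjoint_def is_adjoint_def SymDist_simps)
qed

text \<open>Completeness is tested on one-object categories: each column of a symmetric left adjoint
  out of \<open>B\<close> is a point, and the elements representing the columns form the functor.
  Infinity of \<open>'v\<close> makes the one-object category small.\<close>

lemma symmetrically_complete_iff:
  assumes A: "sqc (A :: ('o, 'a, 'v) qcat)" and inf: "infinite (UNIV :: 'v set)"
  shows "symmetrically_complete Q A \<longleftrightarrow>
    (\<forall>X \<phi>. is_point A X \<phi> \<longrightarrow> (\<exists>x\<in>Elts A. Ty A x = X \<and> (\<forall>y\<in>Elts A. \<phi> y = hm A y x)))"
proof
  assume sc: "symmetrically_complete Q A"
  show "\<forall>X \<phi>. is_point A X \<phi> \<longrightarrow> (\<exists>x\<in>Elts A. Ty A x = X \<and> (\<forall>y\<in>Elts A. \<phi> y = hm A y x))"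
  proof (intro allI impI)
    fix X \<phi> assume P: "is_point A X \<phi>"
    note p = is_pointD[OF P]
    define b :: 'v where "b = undefined"
    define B :: "('o, 'a, 'v) qcat" where
      "B = \<lparr>Elts = {b}, Ty = (\<lambda>x\<in>{b}. X), Arr = (\<lambda>y x. if x = b \<and> y = b then Idn Q X else undefined)\<rparr>"
    have Bs: "Elts B = {b}" "Ty B b = X" "hm B b b = one X" by (simp_all add: B_def hm_def one_def)
    have B: "sqc B"
    proof (rule sqcI)
      have "|{b}| <o |UNIV :: 'v set|"
        using inf card_of_ordLeq_finite[of UNIV "{b}"] ordLess_or_ordLeq[OF card_of_Well_order card_of_Well_order, of "{b}" "UNIV :: 'v set"]
        by auto
      then show "small TYPE('v) (Elts B)" by (simp add: small_def Bs)
      show "Ty B \<in> Elts B \<rightarrow>\<^sub>E Obj Q" using p(1) by (auto simp: B_def)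
      show "Arr B y x = undefined" if "\<not> (x \<in> Elts B \<and> y \<in> Elts B)" for x y using that by (auto simp: B_def)
    qed (auto simp: Bs one_hom[OF p(1)] cmp_one[OF one_hom[OF p(1)]] cv_one[OF p(1)])
    define \<Phi> where "\<Phi> = mk_dist B A (\<lambda>y _. \<phi> y)"
    have d: "dm B A \<Phi> y b = \<phi> y" if "y \<in> Elts A" for y
      unfolding \<Phi>_def by (subst dm_mk_dist) (use that p(2) Bs in auto)
    have "\<Phi> \<in> distributors Q B A" unfolding \<Phi>_def
      by (rule mk_dist_closed[OF B A]) (use p(2,3) Bs cmp_one(1)[OF p(2)] in auto)
    moreover have "{(dm B A \<Phi> y b)\<degree> \<cdot> dm B A \<Phi> y b |y. y \<in> Elts A} = {(\<phi> y)\<degree> \<cdot> \<phi> y |y. y \<in> Elts A}"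
      by (intro Collect_cong) (use d in metis)
    ultimately have "is_symmetric_left_adjoint (SymDist Q) B A \<Phi>"
      unfolding symmetric_left_adjoint_iff[OF B A]
      using p(4,5) d Bs by (auto simp: Bs cong: conj_cong)
    then obtain F where F: "F \<in> qfunctors Q B A" "\<Phi> = represented B A F"
      using sc B unfolding symmetrically_complete_def by (metis Obj_SymDist)
    have x: "F b \<in> Elts A" "Ty A (F b) = X" using F(1) Bs by (auto simp: qfunctors_def)
    have "\<phi> y = hm A y (F b)" if "y \<in> Elts A" for y
      using d[OF that] that x Bs by (simp add: F(2) represented_def dm_def hm_def)
    then show "\<exists>x\<in>Elts A. Ty A x = X \<and> (\<forall>y\<in>Elts A. \<phi> y = hm A y x)" using x by blast
  qed
next
  assume pt: "\<forall>X \<phi>. is_point A X \<phi> \<longrightarrow> (\<exists>x\<in>Elts A. Ty A x = X \<and> (\<forall>y\<in>Elts A. \<phi> y = hm A y x))"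
  show "symmetrically_complete Q A"
    unfolding symmetrically_complete_def
  proof (intro allI impI)
    fix B :: "('o, 'a, 'v) qcat" and \<Phi> assume "B \<in> Obj (SymDist Q)" and la: "is_symmetric_left_adjoint (SymDist Q) B A \<Phi>"
    then have B: "sqc B" by (simp add: Obj_SymDist)
    note S = la[unfolded symmetric_left_adjoint_iff[OF B A]]
    then have \<Phi>: "\<Phi> \<in> distributors Q B A" by blast
    have "\<exists>x. x \<in> Elts A \<and> Ty A x = Ty B b \<and> (\<forall>y\<in>Elts A. dm B A \<Phi> y b = hm A y x)" if b: "b \<in> Elts B" for b
    proof -
      have "is_point A (Ty B b) (\<lambda>y. dm B A \<Phi> y b)"
      proof (rule is_pointI)
        fix z assume z: "z \<in> hom (Ty B b) (Ty B b)" "\<And>y. y \<in> Elts A \<Longrightarrow> (dm B A \<Phi> y b)\<degree> \<cdot> dm B A \<Phi> y b \<preceq> z"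
        have "hm B b b \<preceq> z" using S b z by (intro coveredD[of "Ty B b" "Ty B b" "hm B b b"]) auto
        then show "one (Ty B b) \<preceq> z" using hm_one[OF B b] leq_trans by blast
      qed (use S b sqc_Ty[OF B] dm_hom[OF B A \<Phi>] dm_left[OF B A \<Phi>] in auto)
      then show ?thesis using pt by blast
    qed
    then obtain F where F: "\<And>b. b \<in> Elts B \<Longrightarrow> F b \<in> Elts A" "\<And>b. b \<in> Elts B \<Longrightarrow> Ty A (F b) = Ty B b"
      "\<And>b y. b \<in> Elts B \<Longrightarrow> y \<in> Elts A \<Longrightarrow> dm B A \<Phi> y b = hm A y (F b)" by metis
    let ?F = "restrict F (Elts B)"
    \<comment> \<open>The unit covers \<open>hm B b' b\<close> by the composites
      \<open>hm A (F b') y \<cdot> hm A y (F b)\<close>, each bounded by transitivity in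
      \<open>A\<close>. This is functoriality of \<open>F\<close>.\<close>
    have le: "hm B b' b \<preceq> hm A (F b') (F b)" if b: "b \<in> Elts B" "b' \<in> Elts B" for b b'
    proof (rule coveredD)
      show "covered (Ty B b) (Ty B b') (hm B b' b) {(dm B A \<Phi> y b')\<degree> \<cdot> dm B A \<Phi> y b |y. y \<in> Elts A}" using S b by blast
      show "hm A (F b') (F b) \<in> hom (Ty B b) (Ty B b')" using hm_hom[OF A F(1)[OF b(1)] F(1)[OF b(2)]] F b by simp
      fix c assume "c \<in> {(dm B A \<Phi> y b')\<degree> \<cdot> dm B A \<Phi> y b |y. y \<in> Elts A}"
      then obtain y where y: "y \<in> Elts A" "c = (dm B A \<Phi> y b')\<degree> \<cdot> dm B A \<Phi> y b" by blast
      then have "c = hm A (F b') y \<cdot> hm A y (F b)" using F b hm_cv[OF A] by simp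
      then show "c \<preceq> hm A (F b') (F b)" using hm_trans[OF A] F y b by simp
    qed
    have "?F \<in> qfunctors Q B A"
      unfolding qfunctors_def mem_Collect_eq
    proof (intro conjI ballI)
      show "?F \<in> Elts B \<rightarrow>\<^sub>E Elts A" using F by auto
      show "Ty A (?F x) = Ty B x" if "x \<in> Elts B" for x using F that by simp
      fix x y assume xy: "x \<in> Elts B" "y \<in> Elts B"
      show "Le Q (Ty B x) (Ty B y) (Arr B y x) (Arr A (?F y) (?F x))"
        using le[OF xy] hm_hom[OF B xy] hm_hom[OF A F(1)[OF xy(1)] F(1)[OF xy(2)]] F xy
        by (simp add: hm_def leq_Some Some_hom_iff)
    qed
    moreover have "\<Phi> = represented B A ?F"
    proof (intro ext)
      fix y x show "\<Phi> y x = represented B A ?F y x"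
        using F(3)[of x y] dm_undefined[OF B A \<Phi>, of x y] by (auto simp: represented_def dm_def hm_def)
    qed
    ultimately show "\<exists>F\<in>qfunctors Q B A. \<Phi> = represented B A F" by blast
  qed
qed

section \<open>Chosen representatives of isomorphic elements; restriction along maps\<close>

definition scc :: "('o, 'a, 'v) qcat \<Rightarrow> bool" where
  "scc A \<longleftrightarrow> sqc A \<and> symmetrically_complete Q A"

lemma scc_sqc: "scc A \<Longrightarrow> sqc A" by (simp add: scc_def)

definition eqv :: "('o, 'a, 'v) qcat \<Rightarrow> 'v \<Rightarrow> 'v \<Rightarrow> bool" where
  "eqv A x y \<longleftrightarrow> x \<in> Elts A \<and> y \<in> Elts A \<and> Ty A x = Ty A y \<and> one (Ty A x) \<preceq> hm A x y"

text \<open>The choice depends on \<open>x\<close> only through the predicate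
  \<open>eqv A x\<close>, so isomorphic elements get the very same representative.\<close>

definition rp :: "('o, 'a, 'v) qcat \<Rightarrow> 'v \<Rightarrow> 'v" where
  "rp A x = (SOME y. eqv A x y)"

text \<open>A skeleton: inside \<open>pts A X\<close> isomorphic elements are equal
  (\<open>pts_eqI\<close>), so these sets can serve as the sections of a presheaf.\<close>

definition pts :: "('o, 'a, 'v) qcat \<Rightarrow> 'o \<Rightarrow> 'v set" where
  "pts A X = {x \<in> Elts A. Ty A x = X \<and> rp A x = x}"

lemma eqv_refl: "sqc A \<Longrightarrow> x \<in> Elts A \<Longrightarrow> eqv A x x"
  by (simp add: eqv_def hm_one)

lemma eqv_sym: assumes A: "sqc A" and "eqv A x y" shows "eqv A y x"
proof -
  have *: "x \<in> Elts A" "y \<in> Elts A" "Ty A x = Ty A y" "one (Ty A x) \<preceq> hm A x y" using assms(2) by (auto simp: eqv_def)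
  then have "one (Ty A x) \<preceq> hm A y x" using leq_cvI[OF *(4) sqc_Ty[OF A *(1)]] hm_cv[OF A *(2,1)] by simp
  then show ?thesis using * by (simp add: eqv_def)
qed

lemma eqv_hm_right: assumes A: "sqc A" and e: "eqv A x y" and z: "z \<in> Elts A" shows "hm A z x = hm A z y"
proof -
  have "hm A z x \<preceq> hm A z y" if "eqv A x y" for x y
  proof -
    have *: "x \<in> Elts A" "y \<in> Elts A" "Ty A y = Ty A x" "one (Ty A x) \<preceq> hm A x y" using that by (auto simp: eqv_def)
    have "hm A z x \<preceq> hm A z x \<cdot> hm A x y" using cmp_ge_right[OF *(4) hm_hom[OF A *(1) z]] .
    then show ?thesis using hm_trans[OF A *(2,1) z] leq_trans by blast
  qed
  then show ?thesis using e eqv_sym[OF A e] leq_antisym by blast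
qed

lemma eqv_trans: assumes A: "sqc A" and "eqv A x y" "eqv A y z" shows "eqv A x z"
  using assms eqv_hm_right[OF A, of y z x] by (auto simp: eqv_def)

lemma eqv_rp: assumes A: "sqc A" and x: "x \<in> Elts A" shows "eqv A x (rp A x)"
  unfolding rp_def using someI[of "eqv A x", OF eqv_refl[OF A x]] .

lemma rp_eq: assumes A: "sqc A" and e: "eqv A x y" shows "rp A x = rp A y"
proof -
  have "eqv A x = eqv A y" using eqv_trans[OF A] eqv_sym[OF A e] e by blast
  then show ?thesis by (simp add: rp_def)
qed

lemma rp_pts: assumes A: "sqc A" and x: "x \<in> Elts A" shows "rp A x \<in> pts A (Ty A x)"
  using eqv_rp[OF A x] rp_eq[OF A eqv_rp[OF A x]] by (auto simp: pts_def eqv_def)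

lemma ptsD: "x \<in> pts A X \<Longrightarrow> x \<in> Elts A" "x \<in> pts A X \<Longrightarrow> Ty A x = X" "x \<in> pts A X \<Longrightarrow> rp A x = x"
  by (auto simp: pts_def)

lemma pts_eqI: assumes A: "sqc A" and "x \<in> pts A X" "y \<in> pts A X" "one X \<preceq> hm A x y" shows "x = y"
  using rp_eq[OF A, of x y] assms by (auto simp: eqv_def pts_def)

lemma point_ex1:
  assumes A: "scc (A :: ('o, 'a, 'v) qcat)" and inf: "infinite (UNIV :: 'v set)" and P: "is_point A X \<phi>"
  shows "\<exists>!x. x \<in> pts A X \<and> (\<forall>y\<in>Elts A. hm A y x = \<phi> y)"
proof -
  have a: "sqc A" "symmetrically_complete Q A" using A by (auto simp: scc_def)
  obtain x where x: "x \<in> Elts A" "Ty A x = X" "\<forall>y\<in>Elts A. \<phi> y = hm A y x"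
    using symmetrically_complete_iff[OF a(1) inf] a(2) P by blast
  have e: "rp A x \<in> pts A X" "\<forall>y\<in>Elts A. hm A y (rp A x) = \<phi> y"
    using rp_pts[OF a(1) x(1)] x eqv_hm_right[OF a(1) eqv_rp[OF a(1) x(1)]] by simp_all
  moreover have "z = rp A x" if z: "z \<in> pts A X" "\<forall>y\<in>Elts A. hm A y z = \<phi> y" for z
  proof (rule pts_eqI[OF a(1) z(1) e(1)])
    have "one X \<preceq> hm A z z" using hm_one[OF a(1) ptsD(1)[OF z(1)]] ptsD(2)[OF z(1)] by simp
    then show "one X \<preceq> hm A z (rp A x)" using e z ptsD(1)[OF z(1)] by simp
  qed
  ultimately show ?thesis by blast
qed

text \<open>The element representing the point \<open>A(-, x)\<close> composed with
  \<open>t\<close>. The domain of \<open>t\<close> is read off its tag.\<close>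

definition res :: "('o, 'a, 'v) qcat \<Rightarrow> 'v \<Rightarrow> ('o, 'a) arrow \<Rightarrow> 'v" where
  "res A x t = (THE z. z \<in> pts A (fst (the t)) \<and> (\<forall>y\<in>Elts A. hm A y z = hm A y x \<cdot> t))"

text \<open>The family \<open>hm A y x \<cdot> t\<close> is a point: its unit combines the unit of
  \<open>t\<close> with reflexivity of \<open>hm A x x\<close>, its counit is that of
  \<open>t\<close> followed by transitivity.\<close>

lemma res_props:
  assumes A: "scc (A :: ('o, 'a, 'v) qcat)" and inf: "infinite (UNIV :: 'v set)"
    and x: "x \<in> Elts A" and t: "is_map X (Ty A x) t"
  shows res_pts: "res A x t \<in> pts A X"
    and hm_res_right: "y \<in> Elts A \<Longrightarrow> hm A y (res A x t) = hm A y x \<cdot> t"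
    and hm_res_left: "y \<in> Elts A \<Longrightarrow> hm A (res A x t) y = t\<degree> \<cdot> hm A x y"
proof -
  have a: "sqc A" by (rule scc_sqc[OF A])
  note m = is_mapD[OF t]
  have "is_point A X (\<lambda>y. hm A y x \<cdot> t)"
  proof (rule is_pointI)
    show "X \<in> Obj Q" by (rule m)
    show "hm A y x \<cdot> t \<in> hom X (Ty A y)" if "y \<in> Elts A" for y using cmp_hom[OF hm_hom[OF a x that] m(1)] .
    show "hm A y' y \<cdot> (hm A y x \<cdot> t) \<preceq> hm A y' x \<cdot> t" if "y \<in> Elts A" "y' \<in> Elts A" for y y'
      using cmp_mono_right[OF hm_trans[OF a x that]] by (simp add: cmp_assoc)
    show "one X \<preceq> z" if z: "\<And>y. y \<in> Elts A \<Longrightarrow> (hm A y x \<cdot> t)\<degree> \<cdot> (hm A y x \<cdot> t) \<preceq> z" for z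
    proof -
      have "t \<preceq> hm A x x \<cdot> t" by (rule cmp_ge_left[OF hm_one[OF a x] m(1)])
      then have "t\<degree> \<cdot> t \<preceq> (hm A x x \<cdot> t)\<degree> \<cdot> (hm A x x \<cdot> t)" by (intro cmp_mono cv_mono)
      then show ?thesis using m(5) z[OF x] leq_trans by blast
    qed
    fix y y' assume y: "y \<in> Elts A" "y' \<in> Elts A"
    have "hm A y x \<cdot> (t \<cdot> t\<degree> \<cdot> hm A x y') \<preceq> hm A y x \<cdot> hm A x y'"
      by (rule cmp_mono_left[OF cmp_le_left[OF m(6) hm_hom[OF a y(2) x]]])
    also have "\<dots> \<preceq> hm A y y'" by (rule hm_trans[OF a y(2) x y(1)])
    finally show "hm A y x \<cdot> t \<cdot> (hm A y' x \<cdot> t)\<degree> \<preceq> hm A y y'"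
      using hm_cv[OF a x y(2)] by (simp add: cv_cmp cmp_assoc)
  qed
  from theI'[OF point_ex1[OF A inf this]]
  have *: "res A x t \<in> pts A X \<and> (\<forall>y\<in>Elts A. hm A y (res A x t) = hm A y x \<cdot> t)"
  proof -
    have "fst (the t) = X" using m(1) by (auto simp: hom_def)
    then show ?thesis using theI'[OF point_ex1[OF A inf \<open>is_point A X _\<close>]] unfolding res_def by simp
  qed
  then show "res A x t \<in> pts A X" by blast
  show r: "hm A y (res A x t) = hm A y x \<cdot> t" if "y \<in> Elts A" for y using * that by blast
  show "hm A (res A x t) y = t\<degree> \<cdot> hm A x y" if y: "y \<in> Elts A"
    using r[OF y] hm_cv[OF a] ptsD(1)[of _ A X] * y x by (metis cv_cmp)
qed

text \<open>The hom-arrow between the restrictions is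
  \<open>s\<degree> \<cdot> hm A y x \<cdot> t\<close>, and the adjunctions of \<open>s\<close> and
  \<open>t\<close> move the two maps across. Equality of restrictions thus decides which spans of
  maps lie below a hom-arrow; this is the link between sheaves and enriched categories.\<close>

lemma res_eq_iff:
  assumes A: "scc (A :: ('o, 'a, 'v) qcat)" and inf: "infinite (UNIV :: 'v set)"
    and x: "x \<in> Elts A" and t: "is_map X (Ty A x) t" and y: "y \<in> Elts A" and s: "is_map X (Ty A y) s"
  shows "res A y s = res A x t \<longleftrightarrow> s \<cdot> t\<degree> \<preceq> hm A y x"
proof -
  have a: "sqc A" by (rule scc_sqc[OF A])
  note rx = res_pts[OF A inf x t] and ry = res_pts[OF A inf y s]
  note S = is_mapD[OF s] and T = is_mapD[OF t]
  have h: "hm A (res A y s) (res A x t) = s\<degree> \<cdot> (hm A y x \<cdot> t)"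
    using hm_res_left[OF A inf y s ptsD(1)[OF rx]] hm_res_right[OF A inf x t y] by simp
  have "res A y s = res A x t \<longleftrightarrow> one X \<preceq> hm A (res A y s) (res A x t)"
    using pts_eqI[OF a ry rx] hm_one[OF a ptsD(1)[OF rx]] ptsD(2)[OF rx] by auto
  also have "\<dots> \<longleftrightarrow> s \<cdot> one X \<preceq> hm A y x \<cdot> t"
    using map_shift_left[OF s one_hom[OF S(3)] cmp_hom[OF hm_hom[OF a x y] T(1)]] by (simp add: h)
  also have "\<dots> \<longleftrightarrow> s \<cdot> t\<degree> \<preceq> hm A y x"
    using map_shift_right[OF t S(1) hm_hom[OF a x y]] cmp_one(1)[OF S(1)] by simp
  finally show ?thesis .
qed

lemma res_res:
  assumes A: "scc (A :: ('o, 'a, 'v) qcat)" and inf: "infinite (UNIV :: 'v set)"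
    and x: "x \<in> Elts A" and t: "is_map X (Ty A x) t" and s: "is_map W X s"
  shows "res A (res A x t) s = res A x (t \<cdot> s)"
proof -
  have a: "sqc A" by (rule scc_sqc[OF A])
  note rx = res_pts[OF A inf x t] and ts = is_map_cmp[OF t s]
  have s': "is_map W (Ty A (res A x t)) s" using s ptsD(2)[OF rx] by simp
  have "s \<cdot> (t \<cdot> s)\<degree> \<preceq> hm A (res A x t) x"
  proof -
    note S = is_mapD[OF s] and T = is_mapD[OF t]
    have "s \<cdot> s\<degree> \<cdot> t\<degree> \<preceq> t\<degree>" by (rule cmp_le_left[OF S(6) T(2)])
    also have "\<dots> \<preceq> t\<degree> \<cdot> hm A x x" by (rule cmp_ge_right[OF hm_one[OF a x] T(2)])
    finally show ?thesis using hm_res_left[OF A inf x t x] by (simp add: cv_cmp cmp_assoc)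
  qed
  then show ?thesis using res_eq_iff[OF A inf x ts ptsD(1)[OF rx] s'] by simp
qed

lemma res_one:
  assumes A: "scc (A :: ('o, 'a, 'v) qcat)" and inf: "infinite (UNIV :: 'v set)" and x: "x \<in> pts A X"
  shows "res A x (one X) = x"
proof -
  have a: "sqc A" by (rule scc_sqc[OF A])
  note d = ptsD[OF x]
  have X: "X \<in> Obj Q" using sqc_Ty[OF a d(1)] d(2) by simp
  have m: "is_map X (Ty A x) (one X)" using is_map_one[OF X] d(2) by simp
  show ?thesis
  proof (rule pts_eqI[OF a res_pts[OF A inf d(1) m] x])
    show "one X \<preceq> hm A (res A x (one X)) x"
      using hm_res_left[OF A inf d(1) m d(1)] cmp_one(2)[OF hm_hom[OF a d(1) d(1)]] hm_one[OF a d(1)] d(2) cv_one[OF X] by simp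
  qed
qed

text \<open>By \<open>res_eq_iff\<close> each \<open>t i \<cdot> (t i)\<degree>\<close> lies below
  \<open>hm A x y\<close>, hence so does the identity that they cover.\<close>

lemma res_separated:
  assumes A: "scc (A :: ('o, 'a, 'v) qcat)" and inf: "infinite (UNIV :: 'v set)"
    and x: "x \<in> pts A X" and y: "y \<in> pts A X"
    and cov: "covered X X (one X) {t i \<cdot> (t i)\<degree> |i. i \<in> I}" and t: "\<And>i. i \<in> I \<Longrightarrow> is_map (W i) X (t i)"
    and eq: "\<And>i. i \<in> I \<Longrightarrow> res A x (t i) = res A y (t i)"
  shows "x = y"
proof -
  have a: "sqc A" by (rule scc_sqc[OF A])
  note dx = ptsD[OF x] and dy = ptsD[OF y]
  have "one X \<preceq> hm A x y"
  proof (rule coveredD[OF cov])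
    show "hm A x y \<in> hom X X" using hm_hom[OF a dy(1) dx(1)] dx dy by simp
    fix b assume "b \<in> {t i \<cdot> (t i)\<degree> |i. i \<in> I}"
    then obtain i where i: "i \<in> I" "b = t i \<cdot> (t i)\<degree>" by blast
    have "is_map (W i) (Ty A x) (t i)" "is_map (W i) (Ty A y) (t i)" using t[OF i(1)] dx dy by simp_all
    from res_eq_iff[OF A inf dy(1) this(2) dx(1) this(1)] show "b \<preceq> hm A x y" using eq[OF i(1)] i by simp
  qed
  then show ?thesis by (rule pts_eqI[OF a x y])
qed

section \<open>Functors modulo isomorphism\<close>

lemma qfunctor_props:
  assumes A: "sqc A" and B: "sqc B" and F: "F \<in> qfunctors Q A B"
  shows "x \<in> Elts A \<Longrightarrow> F x \<in> Elts B" "x \<in> Elts A \<Longrightarrow> Ty B (F x) = Ty A x"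
    "x \<in> Elts A \<Longrightarrow> y \<in> Elts A \<Longrightarrow> hm A y x \<preceq> hm B (F y) (F x)" "x \<notin> Elts A \<Longrightarrow> F x = undefined"
proof -
  show 1: "F x \<in> Elts B" if "x \<in> Elts A" for x using F that by (auto simp: qfunctors_def)
  show 2: "Ty B (F x) = Ty A x" if "x \<in> Elts A" for x using F that by (auto simp: qfunctors_def)
  show "hm A y x \<preceq> hm B (F y) (F x)" if "x \<in> Elts A" "y \<in> Elts A"
    using F that hm_hom[OF A that] hm_hom[OF B 1[OF that(1)] 1[OF that(2)]] 2
    by (auto simp: qfunctors_def hm_def leq_Some Some_hom_iff)
  show "F x = undefined" if "x \<notin> Elts A" using F that by (auto simp: qfunctors_def)
qed

lemma qfunctorI:
  assumes A: "sqc A" and B: "sqc B" and 1: "\<And>x. x \<in> Elts A \<Longrightarrow> F x \<in> Elts B" and 2: "\<And>x. x \<in> Elts A \<Longrightarrow> Ty B (F x) = Ty A x"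
    and 3: "\<And>x y. x \<in> Elts A \<Longrightarrow> y \<in> Elts A \<Longrightarrow> hm A y x \<preceq> hm B (F y) (F x)"
  shows "restrict F (Elts A) \<in> qfunctors Q A B"
  unfolding qfunctors_def mem_Collect_eq
proof (intro conjI ballI)
  show "restrict F (Elts A) \<in> Elts A \<rightarrow>\<^sub>E Elts B" using 1 by auto
  show "Ty B (restrict F (Elts A) x) = Ty A x" if "x \<in> Elts A" for x using 2 that by simp
  fix x y assume xy: "x \<in> Elts A" "y \<in> Elts A"
  show "Le Q (Ty A x) (Ty A y) (Arr A y x) (Arr B (restrict F (Elts A) y) (restrict F (Elts A) x))"
    using 3[OF xy] hm_hom[OF A xy] hm_hom[OF B 1[OF xy(1)] 1[OF xy(2)]] 2 xy
    by (simp add: hm_def leq_Some Some_hom_iff)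
qed

lemma qfunctor_eqv:
  assumes A: "sqc A" and B: "sqc B" and F: "F \<in> qfunctors Q A B" and e: "eqv A x y"
  shows "eqv B (F x) (F y)"
  using e qfunctor_props[OF A B F] leq_trans unfolding eqv_def by metis

text \<open>The map \<open>t\<degree>\<close> lies below the hom-arrow from \<open>x\<close> to its
  restriction, and \<open>F\<close> preserves this; with the unit of \<open>t\<close>, the element
  \<open>F (res A x t)\<close> is isomorphic to the restriction of \<open>F x\<close>.
  \<open>F\<close> need not respect the chosen representatives, hence \<open>rp\<close>.\<close>

lemma qfunctor_res:
  assumes A: "scc (A :: ('o, 'a, 'v) qcat)" and B: "scc (B :: ('o, 'a, 'v) qcat)" and inf: "infinite (UNIV :: 'v set)"
    and F: "F \<in> qfunctors Q A B" and x: "x \<in> Elts A" and t: "is_map X (Ty A x) t"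
  shows "rp B (F (res A x t)) = res B (F x) t"
proof -
  have a: "sqc A" and b: "sqc B" using A B scc_sqc by auto
  note p = qfunctor_props[OF a b F]
  note r = res_pts[OF A inf x t]
  have t': "is_map X (Ty B (F x)) t" using t p(2)[OF x] by simp
  note r' = res_pts[OF B inf p(1)[OF x] t']
  have T: "Ty B (F (res A x t)) = X" using p(2) ptsD[OF r] by simp
  note m = is_mapD[OF t]
  have "one X \<preceq> t\<degree> \<cdot> t" by (rule m)
  also have "\<dots> \<preceq> t\<degree> \<cdot> hm A x x \<cdot> t" by (rule cmp_mono_right[OF cmp_ge_right[OF hm_one[OF a x] m(2)]])
  also have "\<dots> = hm A (res A x t) x \<cdot> t" using hm_res_left[OF A inf x t x] by simp
  also have "\<dots> \<preceq> hm B (F (res A x t)) (F x) \<cdot> t" by (rule cmp_mono_right[OF p(3)[OF x ptsD(1)[OF r]]])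
  also have "\<dots> = hm B (F (res A x t)) (res B (F x) t)"
    using hm_res_right[OF B inf p(1)[OF x] t' p(1)[OF ptsD(1)[OF r]]] by simp
  finally have "eqv B (F (res A x t)) (res B (F x) t)"
    using T ptsD[OF r] ptsD[OF r'] p(1) by (simp add: eqv_def)
  then show ?thesis using rp_eq[OF b] ptsD(3)[OF r'] by metis
qed

text \<open>The codomain is symmetric, so the order of functors is a symmetric relation and one of
  the two inequalities decides isomorphism.\<close>

lemma qfunctor_iso_iff:
  assumes A: "sqc A" and B: "sqc B"
  shows "(F, G) \<in> qfunctor_iso Q A B \<longleftrightarrow> F \<in> qfunctors Q A B \<and> G \<in> qfunctors Q A B \<and> (\<forall>x\<in>Elts A. eqv B (F x) (G x))"
proof -
  have "qfunctor_le Q A B F G \<longleftrightarrow> (\<forall>x\<in>Elts A. eqv B (F x) (G x))" if "F \<in> qfunctors Q A B" "G \<in> qfunctors Q A B" for F G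
  proof -
    have "Le Q (Ty A x) (Ty A x) (Idn Q (Ty A x)) (Arr B (F x) (G x)) \<longleftrightarrow> one (Ty A x) \<preceq> hm B (F x) (G x)" if x: "x \<in> Elts A" for x
      using qfunctor_props[OF A B \<open>F \<in> _\<close>] qfunctor_props[OF A B \<open>G \<in> _\<close>] x hm_hom[OF B, of "G x" "F x"] sqc_Ty[OF A x]
      by (simp add: hm_def one_def leq_Some Some_hom_iff Idn_closed)
    then show ?thesis using qfunctor_props[OF A B that(1)] qfunctor_props[OF A B that(2)]
      by (simp add: qfunctor_le_def eqv_def)
  qed
  then show ?thesis using eqv_sym[OF B] unfolding qfunctor_iso_def by auto
qed

lemma qfunctor_iso_equiv:
  assumes A: "sqc A" and B: "sqc B" shows "equiv (qfunctors Q A B) (qfunctor_iso Q A B)"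
proof (rule equivI)
  note i = qfunctor_iso_iff[OF A B]
  show "qfunctor_iso Q A B \<subseteq> qfunctors Q A B \<times> qfunctors Q A B" by (auto simp: qfunctor_iso_def)
  show "refl_on (qfunctors Q A B) (qfunctor_iso Q A B)"
    by (rule refl_onI) (use eqv_refl[OF B] qfunctor_props[OF A B] in \<open>auto simp: i\<close>)
  show "sym (qfunctor_iso Q A B)" by (rule symI) (use eqv_sym[OF B] in \<open>auto simp: i\<close>)
  show "trans (qfunctor_iso Q A B)" by (rule transI) (use eqv_trans[OF B] in \<open>auto simp: i\<close>)
qed

abbreviation cls :: "('o, 'a, 'v) qcat \<Rightarrow> ('o, 'a, 'v) qcat \<Rightarrow> ('v \<Rightarrow> 'v) \<Rightarrow> ('v \<Rightarrow> 'v) set" where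
  "cls A B F \<equiv> qfunctor_iso Q A B `` {F}"

lemma cls_eq_iff:
  assumes "sqc A" "sqc B" "F \<in> qfunctors Q A B" "G \<in> qfunctors Q A B"
  shows "cls A B F = cls A B G \<longleftrightarrow> (\<forall>x\<in>Elts A. eqv B (F x) (G x))"
  using eq_equiv_class_iff[OF qfunctor_iso_equiv[OF assms(1,2)] assms(3,4)] qfunctor_iso_iff[OF assms(1,2)] assms by simp

lemma SymCat_sc_simps:
  "Obj (SymCat_sc Q) = {A. scc A}" "Hom (SymCat_sc Q) A B = qfunctors Q A B // qfunctor_iso Q A B"
  "Idn (SymCat_sc Q) A = cls A A (\<lambda>x\<in>Elts A. x)"
  by (auto simp: SymCat_sc_def scc_def sqc_def)

lemma Hom_SymCat_scE:
  assumes "f \<in> Hom (SymCat_sc Q) A B" obtains F where "F \<in> qfunctors Q A B" "f = cls A B F"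
  using assms by (auto simp: SymCat_sc_simps elim: quotientE)

lemma cls_in_Hom: "F \<in> qfunctors Q A B \<Longrightarrow> cls A B F \<in> Hom (SymCat_sc Q) A B"
  by (simp add: SymCat_sc_simps quotientI)

lemma qfunctor_compose:
  assumes A: "sqc A" and B: "sqc B" and C: "sqc C" and F: "F \<in> qfunctors Q A B" and G: "G \<in> qfunctors Q B C"
  shows "compose (Elts A) G F \<in> qfunctors Q A C"
proof -
  note f = qfunctor_props[OF A B F] and g = qfunctor_props[OF B C G]
  have "restrict (\<lambda>x. G (F x)) (Elts A) \<in> qfunctors Q A C"
    by (rule qfunctorI[OF A C]) (use f g leq_trans[OF f(3) g(3)] in auto)
  then show ?thesis by (simp add: compose_def)
qed

text \<open>The composite of two classes ranges over all their members; functors preserve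
  isomorphism of elements, so all choices land in one class.\<close>

lemma Comp_SymCat_sc:
  assumes A: "sqc A" and B: "sqc B" and C: "sqc C" and F: "F \<in> qfunctors Q A B" and G: "G \<in> qfunctors Q B C"
  shows "Comp (SymCat_sc Q) A B C (cls B C G) (cls A B F) = cls A C (compose (Elts A) G F)"
proof -
  note e = qfunctor_iso_equiv[OF A B] qfunctor_iso_equiv[OF B C] qfunctor_iso_equiv[OF A C]
  have "(compose (Elts A) G F, compose (Elts A) G' F') \<in> qfunctor_iso Q A C" if "F' \<in> cls A B F" "G' \<in> cls B C G" for F' G'
  proof -
    have F': "F' \<in> qfunctors Q A B" "\<forall>x\<in>Elts A. eqv B (F x) (F' x)" and G': "G' \<in> qfunctors Q B C" "\<forall>x\<in>Elts B. eqv C (G x) (G' x)"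
      using that qfunctor_iso_iff[OF A B] qfunctor_iso_iff[OF B C] by auto
    have "eqv C (G (F x)) (G' (F' x))" if x: "x \<in> Elts A" for x
      using eqv_trans[OF C qfunctor_eqv[OF B C G]] F'(2) G'(2) qfunctor_props(1)[OF A B F'(1) x] x by blast
    then show ?thesis using qfunctor_compose[OF A B C F G] qfunctor_compose[OF A B C F'(1) G'(1)]
      by (simp add: qfunctor_iso_iff[OF A C] compose_def)
  qed
  then have c: "(compose (Elts A) G' F', H) \<in> qfunctor_iso Q A C \<longleftrightarrow> (compose (Elts A) G F, H) \<in> qfunctor_iso Q A C"
    if "F' \<in> cls A B F" "G' \<in> cls B C G" for F' G' H
    using that e(3) by (meson equivE symE transE)
  have m: "F \<in> cls A B F" "G \<in> cls B C G" using equiv_class_self e F G by auto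
  have "Comp (SymCat_sc Q) A B C (cls B C G) (cls A B F)
     = {H. \<exists>F'\<in>cls A B F. \<exists>G'\<in>cls B C G. (compose (Elts A) G' F', H) \<in> qfunctor_iso Q A C}"
    by (simp add: SymCat_sc_def)
  also have "\<dots> = {H. (compose (Elts A) G F, H) \<in> qfunctor_iso Q A C}"
    using c m by (intro Collect_cong) blast
  finally show ?thesis by auto
qed

lemma id_qfunctor: "sqc A \<Longrightarrow> (\<lambda>x\<in>Elts A. x) \<in> qfunctors Q A A"
  using qfunctorI[of A A "\<lambda>x. x"] by simp

lemma category_SymCat_sc: "category (SymCat_sc Q :: (('o, 'a, 'v) qcat, _) cat)"
proof (unfold_locales, unfold SymCat_sc_simps(1) mem_Collect_eq)
  let ?T = "SymCat_sc Q :: (('o, 'a, 'v) qcat, _) cat"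
  fix A :: "('o, 'a, 'v) qcat" assume "scc A" then have A: "sqc A" by (rule scc_sqc)
  show "Idn ?T A \<in> Hom ?T A A" using cls_in_Hom[OF id_qfunctor[OF A]] by (simp add: SymCat_sc_simps)
  fix B :: "('o, 'a, 'v) qcat" assume "scc B" then have B: "sqc B" by (rule scc_sqc)
  {
    fix f assume "f \<in> Hom ?T A B"
    then obtain F where F: "F \<in> qfunctors Q A B" "f = cls A B F" by (rule Hom_SymCat_scE)
    then have e: "compose (Elts A) F (\<lambda>x\<in>Elts A. x) = F" "compose (Elts A) (\<lambda>x\<in>Elts B. x) F = F"
      using qfunctor_props[OF A B F(1)] by (auto simp: compose_def fun_eq_iff)
    show "Comp ?T A A B f (Idn ?T A) = f"
      using Comp_SymCat_sc[OF A A B id_qfunctor[OF A] F(1)] F e by (simp add: SymCat_sc_simps)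
    show "Comp ?T A B B (Idn ?T B) f = f"
      using Comp_SymCat_sc[OF A B B F(1) id_qfunctor[OF B]] F e by (simp add: SymCat_sc_simps)
  }
  fix C :: "('o, 'a, 'v) qcat" and f g assume "scc C" and f: "f \<in> Hom ?T A B" and g: "g \<in> Hom ?T B C"
  then have C: "sqc C" by (simp add: scc_sqc)
  obtain F where F: "F \<in> qfunctors Q A B" "f = cls A B F" using f by (rule Hom_SymCat_scE)
  obtain G where G: "G \<in> qfunctors Q B C" "g = cls B C G" using g by (rule Hom_SymCat_scE)
  note GF = qfunctor_compose[OF A B C F(1) G(1)]
  show "Comp ?T A B C g f \<in> Hom ?T A C" using Comp_SymCat_sc[OF A B C F(1) G(1)] F G cls_in_Hom[OF GF] by simp
  fix D :: "('o, 'a, 'v) qcat" and h assume "scc D" and h: "h \<in> Hom ?T C D"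
  then have D: "sqc D" by (simp add: scc_sqc)
  obtain H where H: "H \<in> qfunctors Q C D" "h = cls C D H" using h by (rule Hom_SymCat_scE)
  have "compose (Elts A) (compose (Elts B) H G) F = compose (Elts A) H (compose (Elts A) G F)"
    using qfunctor_props(1)[OF A B F(1)] by (auto simp: compose_def fun_eq_iff)
  then show "Comp ?T A B D (Comp ?T B C D h g) f = Comp ?T A C D h (Comp ?T A B C g f)"
    using F G H Comp_SymCat_sc[OF A B C F(1) G(1)] Comp_SymCat_sc[OF B C D G(1) H(1)]
      Comp_SymCat_sc[OF A C D GF H(1)] Comp_SymCat_sc[OF A B D F(1) qfunctor_compose[OF B C D G(1) H(1)]] by simp
qed

end

section \<open>The sheaf of elements of a symmetrically complete category\<close>

lemma is_presheafD:
  assumes "is_presheaf C (P :: ('c, 'b, 'v) presheaf)"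
  shows "U \<in> Obj C \<Longrightarrow> small TYPE('v) (PSet P U)"
    "U \<in> Obj C \<Longrightarrow> T \<in> Obj C \<Longrightarrow> f \<in> Hom C T U \<Longrightarrow> PAct P T U f \<in> PSet P U \<rightarrow>\<^sub>E PSet P T"
    "U \<in> Obj C \<Longrightarrow> T \<in> Obj C \<Longrightarrow> f \<in> Hom C T U \<Longrightarrow> x \<in> PSet P U \<Longrightarrow> PAct P T U f x \<in> PSet P T"
    "U \<in> Obj C \<Longrightarrow> x \<in> PSet P U \<Longrightarrow> PAct P U U (Idn C U) x = x"
    "\<lbrakk>U \<in> Obj C; T \<in> Obj C; W \<in> Obj C; f \<in> Hom C T U; g \<in> Hom C W T; x \<in> PSet P U\<rbrakk>
      \<Longrightarrow> PAct P W U (Comp C W T U f g) x = PAct P W T g (PAct P T U f x)"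
  using assms unfolding is_presheaf_def by (simp, simp, meson PiE_mem, simp, simp)

lemma natural_transformationsD:
  assumes "\<theta> \<in> natural_transformations C P R"
  shows "U \<in> Obj C \<Longrightarrow> \<theta> U \<in> PSet P U \<rightarrow>\<^sub>E PSet R U"
    "U \<in> Obj C \<Longrightarrow> x \<in> PSet P U \<Longrightarrow> \<theta> U x \<in> PSet R U"
    "\<lbrakk>U \<in> Obj C; T \<in> Obj C; f \<in> Hom C T U; x \<in> PSet P U\<rbrakk> \<Longrightarrow> \<theta> T (PAct P T U f x) = PAct R T U f (\<theta> U x)"
    "U \<notin> Obj C \<Longrightarrow> \<theta> U = undefined"
  using assms by (auto simp: natural_transformations_def)

lemma natural_transformationsI:
  assumes "\<And>U x. U \<in> Obj C \<Longrightarrow> x \<in> PSet P U \<Longrightarrow> \<theta> U x \<in> PSet R U"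
    and "\<And>U T f x. \<lbrakk>U \<in> Obj C; T \<in> Obj C; f \<in> Hom C T U; x \<in> PSet P U; PAct P T U f x \<in> PSet P T\<rbrakk> \<Longrightarrow> \<theta> T (PAct P T U f x) = PAct R T U f (\<theta> U x)"
    and P: "is_presheaf C P"
  shows "(\<lambda>U\<in>Obj C. \<lambda>x\<in>PSet P U. \<theta> U x) \<in> natural_transformations C P R"
  using assms is_presheafD(3)[OF P] by (auto simp: natural_transformations_def)

lemma natural_transformations_eqI:
  assumes "\<theta> \<in> natural_transformations C P R" "\<theta>' \<in> natural_transformations C P R"
    and "\<And>U x. U \<in> Obj C \<Longrightarrow> x \<in> PSet P U \<Longrightarrow> \<theta> U x = \<theta>' U x"
  shows "\<theta> = \<theta>'"
proof
  fix U show "\<theta> U = \<theta>' U"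
  proof (cases "U \<in> Obj C")
    case True
    then show ?thesis
      using PiE_ext[OF natural_transformationsD(1)[OF assms(1)] natural_transformationsD(1)[OF assms(2)]] assms(3) by blast
  next
    case False
    then show ?thesis using natural_transformationsD(4)[OF assms(1)] natural_transformationsD(4)[OF assms(2)] by simp
  qed
qed

lemma is_sheaf_presheaf: "is_sheaf C J P \<Longrightarrow> is_presheaf C P" by (simp add: is_sheaf_def)

lemma sheaf_category_simps:
  "Obj (sheaf_category C J) = {P. is_sheaf C J P}" "Hom (sheaf_category C J) = natural_transformations C"
  "Idn (sheaf_category C J) P = (\<lambda>U\<in>Obj C. \<lambda>x\<in>PSet P U. x)"
  "Comp (sheaf_category C J) P R S \<phi> \<theta> = (\<lambda>U\<in>Obj C. compose (PSet P U) (\<phi> U) (\<theta> U))"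
  by (simp_all add: sheaf_category_def)

lemma category_sheaf_category: "category (sheaf_category C J :: (('c, 'b, 'v) presheaf, _) cat)"
proof (unfold_locales, unfold sheaf_category_simps mem_Collect_eq)
  fix P R S :: "('c, 'b, 'v) presheaf" assume P: "is_sheaf C J P" and R: "is_sheaf C J R" and S: "is_sheaf C J S"
  note p = is_sheaf_presheaf[OF P] and r = is_sheaf_presheaf[OF R]
  show "(\<lambda>U\<in>Obj C. \<lambda>x\<in>PSet P U. x) \<in> natural_transformations C P P" by (rule natural_transformationsI[OF _ _ p]) simp_all
  {
    fix \<theta> assume \<theta>: "\<theta> \<in> natural_transformations C P R"
    note t = natural_transformationsD[OF \<theta>]
    show "(\<lambda>U\<in>Obj C. compose (PSet P U) (\<theta> U) ((\<lambda>U\<in>Obj C. \<lambda>x\<in>PSet P U. x) U)) = \<theta>"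
    proof
      fix U show "(\<lambda>U\<in>Obj C. compose (PSet P U) (\<theta> U) ((\<lambda>U\<in>Obj C. \<lambda>x\<in>PSet P U. x) U)) U = \<theta> U"
        using t(1)[of U] t(4)[of U] by (cases "U \<in> Obj C") (auto simp: compose_def fun_eq_iff PiE_def extensional_def)
    qed
    show "(\<lambda>U\<in>Obj C. compose (PSet P U) ((\<lambda>U\<in>Obj C. \<lambda>x\<in>PSet R U. x) U) (\<theta> U)) = \<theta>"
    proof
      fix U show "(\<lambda>U\<in>Obj C. compose (PSet P U) ((\<lambda>U\<in>Obj C. \<lambda>x\<in>PSet R U. x) U) (\<theta> U)) U = \<theta> U"
        using t(1)[of U] t(2)[of U] t(4)[of U] by (cases "U \<in> Obj C") (auto simp: compose_def fun_eq_iff PiE_def extensional_def)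
    qed
    fix \<phi> assume \<phi>: "\<phi> \<in> natural_transformations C R S"
    note f = natural_transformationsD[OF \<phi>]
    have "(\<lambda>U\<in>Obj C. \<lambda>x\<in>PSet P U. \<phi> U (\<theta> U x)) \<in> natural_transformations C P S"
      by (rule natural_transformationsI[OF _ _ p]) (use t f in auto)
    then show "(\<lambda>U\<in>Obj C. compose (PSet P U) (\<phi> U) (\<theta> U)) \<in> natural_transformations C P S" by (simp add: compose_def)
  }
  fix W :: "('c, 'b, 'v) presheaf" and \<theta> \<phi> \<psi> assume "is_sheaf C J W" and \<theta>: "\<theta> \<in> natural_transformations C W P"
    and "\<phi> \<in> natural_transformations C P R" "\<psi> \<in> natural_transformations C R S"
  show "(\<lambda>U\<in>Obj C. compose (PSet W U) ((\<lambda>U\<in>Obj C. compose (PSet P U) (\<psi> U) (\<phi> U)) U) (\<theta> U)) =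
        (\<lambda>U\<in>Obj C. compose (PSet W U) (\<psi> U) ((\<lambda>U\<in>Obj C. compose (PSet W U) (\<phi> U) (\<theta> U)) U))"
    using natural_transformationsD(2)[OF \<theta>] by (auto simp: compose_def fun_eq_iff)
qed

section \<open>Covering by maps out of the site, and gluing of elements\<close>

context site_quantaloid
begin

lemma inf: "infinite (UNIV :: 'v set)" by (rule universe_infinite[OF universe])

text \<open>Maps \<open>t\<close> out of the \<open>\<iota> T\<close> cover the codomain. Each
  \<open>t\<degree> \<cdot> r\<close> then runs between objects of the site and is generated by
  spans \<open>(f, g)\<close>, and \<open>t \<cdot> gm W T f\<close> is again a map.\<close>

lemma arrow_covered_dom:
  assumes U: "U \<in> Obj C" and r: "r \<in> hom (\<iota> U) Y"
  shows "covered (\<iota> U) Y r {s \<cdot> (gm W U g)\<degree> |W s g. W \<in> Obj C \<and> g \<in> Hom C W U \<and> is_map (\<iota> W) Y s \<and> s \<cdot> (gm W U g)\<degree> \<preceq> r}"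
    (is "covered _ _ _ ?B")
proof (rule coveredI[OF r])
  have Y: "Y \<in> Obj Q" using hom_Obj[OF r] by simp
  show "b \<in> hom (\<iota> U) Y" if "b \<in> ?B" for b using that cmp_hom[OF is_mapD(1) is_mapD(2)[OF gm_map[OF U]]] by blast
  fix z assume z: "z \<in> hom (\<iota> U) Y" and le: "\<And>b. b \<in> ?B \<Longrightarrow> b \<preceq> z"
  have "one Y \<cdot> r \<preceq> z"
  proof (rule covered_left[OF obj_covered[OF Y] r z])
    fix b assume "b \<in> {t \<cdot> t\<degree> |U t. U \<in> Obj C \<and> is_map (\<iota> U) Y t}"
    then obtain T t where t: "T \<in> Obj C" "is_map (\<iota> T) Y t" "b = t \<cdot> t\<degree>" by blast
    note m = is_mapD[OF t(2)]
    have tr: "t\<degree> \<cdot> r \<in> hom (\<iota> U) (\<iota> T)" by (rule cmp_hom[OF m(2) r])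
    have "t \<cdot> (t\<degree> \<cdot> r) \<preceq> z"
    proof (rule covered_right[OF generate_covered[OF U t(1) tr] m(1) z])
      fix c assume "c \<in> {gm W T f \<cdot> (gm W U g)\<degree> |W f g. (W, f, g) \<in> spans C U T \<and> gm W T f \<cdot> (gm W U g)\<degree> \<preceq> t\<degree> \<cdot> r}"
      then obtain W f g where c: "c = gm W T f \<cdot> (gm W U g)\<degree>" "(W, f, g) \<in> spans C U T" "c \<preceq> t\<degree> \<cdot> r" by blast
      have W: "W \<in> Obj C" "f \<in> Hom C W T" "g \<in> Hom C W U" using c by (auto simp: spans_def)
      have tc: "t \<cdot> c = (t \<cdot> gm W T f) \<cdot> (gm W U g)\<degree>" using c by (simp add: cmp_assoc)
      have "t \<cdot> c \<preceq> t \<cdot> (t\<degree> \<cdot> r)" by (rule cmp_mono_left[OF c(3)])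
      also have "\<dots> = t \<cdot> t\<degree> \<cdot> r" by (simp add: cmp_assoc)
      also have "\<dots> \<preceq> r" by (rule cmp_le_left[OF m(6) r])
      finally have "t \<cdot> c \<in> ?B" using W is_map_cmp[OF t(2) gm_map[OF t(1) W(1,2)]]
        by (intro CollectI exI[of _ W] exI[of _ "t \<cdot> gm W T f"] exI[of _ g] conjI) (simp_all flip: tc)
      then show "t \<cdot> c \<preceq> z" by (rule le)
    qed
    then show "b \<cdot> r \<preceq> z" using t by (simp add: cmp_assoc)
  qed
  then show "r \<preceq> z" using cmp_one(2)[OF r] by simp
qed

text \<open>The same device at the domain: for \<open>t\<close> in the cover of \<open>X\<close>,
  the arrow \<open>r \<cdot> t\<close> is handled by \<open>arrow_covered_dom\<close>, and
  \<open>t \<cdot> gm W T g\<close> is again a map.\<close>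

lemma arrow_covered:
  assumes r: "r \<in> hom X Y"
  shows "covered X Y r {s \<cdot> t\<degree> |U s t. U \<in> Obj C \<and> is_map (\<iota> U) X t \<and> is_map (\<iota> U) Y s \<and> s \<cdot> t\<degree> \<preceq> r}" (is "covered _ _ _ ?B")
proof (rule coveredI[OF r])
  show "b \<in> hom X Y" if "b \<in> ?B" for b using that cmp_hom[OF is_mapD(1) is_mapD(2)] by blast
  fix z assume z: "z \<in> hom X Y" and le: "\<And>b. b \<in> ?B \<Longrightarrow> b \<preceq> z"
  have "r \<cdot> one X \<preceq> z"
  proof (rule covered_right[OF obj_covered r z])
    show "X \<in> Obj Q" using hom_Obj[OF r] by simp
    fix b assume "b \<in> {t \<cdot> t\<degree> |U t. U \<in> Obj C \<and> is_map (\<iota> U) X t}"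
    then obtain T t where t: "T \<in> Obj C" "is_map (\<iota> T) X t" "b = t \<cdot> t\<degree>" by blast
    note m = is_mapD[OF t(2)]
    have "r \<cdot> t \<cdot> t\<degree> \<preceq> z"
    proof (rule covered_left[OF arrow_covered_dom[OF t(1) cmp_hom[OF r m(1)]] m(2) z])
      fix c assume "c \<in> {s \<cdot> (gm W T g)\<degree> |W s g. W \<in> Obj C \<and> g \<in> Hom C W T \<and> is_map (\<iota> W) Y s \<and> s \<cdot> (gm W T g)\<degree> \<preceq> r \<cdot> t}"
      then obtain W s g where c: "c = s \<cdot> (gm W T g)\<degree>" "W \<in> Obj C" "g \<in> Hom C W T" "is_map (\<iota> W) Y s" "c \<preceq> r \<cdot> t" by blast
      have e: "s \<cdot> (t \<cdot> gm W T g)\<degree> = c \<cdot> t\<degree>" using c(1) by (simp add: cv_cmp cmp_assoc)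
      have "c \<cdot> t\<degree> \<preceq> r \<cdot> (t \<cdot> t\<degree>)" using cmp_mono_right[OF c(5)] by (simp add: cmp_assoc)
      also have "\<dots> \<preceq> r" by (rule cmp_le_right[OF m(6) r])
      finally show "c \<cdot> t\<degree> \<preceq> z" unfolding e[symmetric]
        using le is_map_cmp[OF t(2) gm_map[OF t(1) c(2,3)]] c(2,4) by blast
    qed
    then show "r \<cdot> b \<preceq> z" using t by (simp add: cmp_assoc)
  qed
  then show "r \<preceq> z" using cmp_one(1)[OF r] by simp
qed

lemma obj_covered_indexed:
  assumes "X \<in> Obj Q" shows "covered X X (one X) {snd i \<cdot> (snd i)\<degree> |i. i \<in> {(U, t). U \<in> Obj C \<and> is_map (\<iota> U) X t}}"
proof -
  have "{snd i \<cdot> (snd i)\<degree> |i. i \<in> {(U, t). U \<in> Obj C \<and> is_map (\<iota> U) X t}} = {t \<cdot> t\<degree> |U t. U \<in> Obj C \<and> is_map (\<iota> U) X t}" by force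
  then show ?thesis using obj_covered[OF assms] by simp
qed

lemma arrow_leI:
  assumes "r \<in> hom X Y" "z \<in> hom X Y"
    and "\<And>U s t. \<lbrakk>U \<in> Obj C; is_map (\<iota> U) X t; is_map (\<iota> U) Y s; s \<cdot> t\<degree> \<preceq> r\<rbrakk> \<Longrightarrow> s \<cdot> t\<degree> \<preceq> z"
  shows "r \<preceq> z"
  by (rule coveredD[OF arrow_covered[OF assms(1)] assms(2)]) (use assms(3) in blast)

text \<open>The glued element represents the point \<open>\<phi>\<close>, where
  \<open>\<phi> y\<close> is the join of the \<open>hm A y (x i) \<cdot> (t i)\<degree>\<close>; its
  unit comes from \<open>cov\<close>. The lemma serves the sheaf condition as well as the extension
  of a natural transformation to elements of arbitrary type.\<close>

lemma glue:
  fixes A :: "('o, 'a, 'v) qcat"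
  assumes A: "scc A" and X: "X \<in> Obj Q" and cov: "covered X X (one X) {t i \<cdot> (t i)\<degree> |i. i \<in> I}"
    and m: "\<And>i. i \<in> I \<Longrightarrow> U i \<in> Obj C \<and> is_map (\<iota> (U i)) X (t i)"
    and x: "\<And>i. i \<in> I \<Longrightarrow> x i \<in> pts A (\<iota> (U i))"
    and compat: "\<And>i j W f g. \<lbrakk>i \<in> I; j \<in> I; (W, f, g) \<in> spans C (U j) (U i); t i \<cdot> gm W (U i) f = t j \<cdot> gm W (U j) g\<rbrakk>
      \<Longrightarrow> res A (x i) (gm W (U i) f) = res A (x j) (gm W (U j) g)"
  shows "\<exists>z\<in>pts A X. \<forall>i\<in>I. res A z (t i) = x i"
proof -
  have a: "sqc A" by (rule scc_sqc[OF A])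
  note M = is_mapD[OF conjunct2[OF m]]
  have xe: "x i \<in> Elts A" "Ty A (x i) = \<iota> (U i)" if "i \<in> I" for i using ptsD[OF x[OF that]] by auto
  have hr: "hm A y (x i) \<in> hom (\<iota> (U i)) (Ty A y)" and hl: "hm A (x i) y \<in> hom (Ty A y) (\<iota> (U i))"
    if "i \<in> I" "y \<in> Elts A" for i y using hm_hom[OF a] xe[OF that(1)] that(2) by metis+
  define B where "B y = {hm A y (x i) \<cdot> (t i)\<degree> |i. i \<in> I}" for y
  define \<phi> where "\<phi> y = jn X (Ty A y) (B y)" for y
  have sub: "B y \<subseteq> hom X (Ty A y)" if "y \<in> Elts A" for y unfolding B_def using cmp_hom[OF hr M(2)] that by blast
  have \<phi>h: "\<phi> y \<in> hom X (Ty A y)" and \<phi>c: "covered X (Ty A y) (\<phi> y) (B y)" and \<phi>u: "\<And>b. b \<in> B y \<Longrightarrow> b \<preceq> \<phi> y"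
    if y: "y \<in> Elts A" for y
    unfolding \<phi>_def using jn_props[OF X sqc_Ty[OF a y] sub[OF y]] by blast+
  have up: "hm A y (x i) \<cdot> (t i)\<degree> \<preceq> \<phi> y" if "i \<in> I" "y \<in> Elts A" for i y
    by (rule \<phi>u[OF that(2)]) (use that in \<open>auto simp: B_def\<close>)
  have up': "(t i)\<degree> \<preceq> \<phi> (x i)" if i: "i \<in> I" for i
  proof -
    have "(t i)\<degree> \<preceq> hm A (x i) (x i) \<cdot> (t i)\<degree>"
      using cmp_ge_left[OF _ M(2)[OF i]] hm_one[OF a xe(1)[OF i]] xe(2)[OF i] by simp
    then show ?thesis using up[OF i xe(1)[OF i]] leq_trans by blast
  qed
  \<comment> \<open>The counit. \<open>(t i)\<degree> \<cdot> t j\<close> is covered by commuting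
    squares; on each of them \<open>compat\<close> identifies the restrictions of \<open>x i\<close>
    and \<open>x j\<close>, and transitivity through this common restriction gives the
    bound.\<close>
  have key: "hm A y (x i) \<cdot> ((t i)\<degree> \<cdot> t j) \<cdot> hm A (x j) y' \<preceq> hm A y y'"
    if i: "i \<in> I" and j: "j \<in> I" and y: "y \<in> Elts A" "y' \<in> Elts A" for i j y y'
  proof (rule covered_ctx[OF cospan_covered hr[OF i y(1)] hl[OF j y(2)] hm_hom[OF a y(2,1)]])
    show "U j \<in> Obj C" "U i \<in> Obj C" "is_map (\<iota> (U i)) X (t i)" "is_map (\<iota> (U j)) X (t j)" using m i j by auto
    fix b assume "b \<in> {gm W (U i) f \<cdot> (gm W (U j) g)\<degree> |W f g. (W, f, g) \<in> spans C (U j) (U i) \<and> t i \<cdot> gm W (U i) f = t j \<cdot> gm W (U j) g}"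
    then obtain W f g where b: "b = gm W (U i) f \<cdot> (gm W (U j) g)\<degree>" "(W, f, g) \<in> spans C (U j) (U i)"
      "t i \<cdot> gm W (U i) f = t j \<cdot> gm W (U j) g" by blast
    have W: "W \<in> Obj C" "f \<in> Hom C W (U i)" "g \<in> Hom C W (U j)" using b by (auto simp: spans_def)
    have f: "is_map (\<iota> W) (Ty A (x i)) (gm W (U i) f)" and g: "is_map (\<iota> W) (Ty A (x j)) (gm W (U j) g)"
      using gm_map m i j W xe by simp_all
    have r: "res A (x i) (gm W (U i) f) = res A (x j) (gm W (U j) g)" by (rule compat[OF i j b(2,3)])
    note rp = res_pts[OF A inf xe(1)[OF i] f]
    have "hm A y (x i) \<cdot> b \<cdot> hm A (x j) y' = hm A y (res A (x i) (gm W (U i) f)) \<cdot> hm A (res A (x j) (gm W (U j) g)) y'"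
      using hm_res_right[OF A inf xe(1)[OF i] f y(1)] hm_res_left[OF A inf xe(1)[OF j] g y(2)] b by (simp add: cmp_assoc)
    also have "\<dots> \<preceq> hm A y y'" unfolding r[symmetric] by (rule hm_trans[OF a y(2) ptsD(1)[OF rp] y(1)])
    finally show "hm A y (x i) \<cdot> b \<cdot> hm A (x j) y' \<preceq> hm A y y'" .
  qed
  have P: "is_point A X \<phi>"
  proof (rule is_pointI[OF X \<phi>h])
    fix y y' assume y: "y \<in> Elts A" "y' \<in> Elts A"
    show "hm A y' y \<cdot> \<phi> y \<preceq> \<phi> y'"
    proof (rule covered_right[OF \<phi>c[OF y(1)] hm_hom[OF a y] \<phi>h[OF y(2)]])
      fix b assume "b \<in> B y"
      then obtain i where i: "i \<in> I" "b = hm A y (x i) \<cdot> (t i)\<degree>" by (auto simp: B_def)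
      have "hm A y' y \<cdot> b \<preceq> hm A y' (x i) \<cdot> (t i)\<degree>"
        using cmp_mono_right[OF hm_trans[OF a xe(1)[OF i(1)] y]] i by (simp add: cmp_assoc)
      then show "hm A y' y \<cdot> b \<preceq> \<phi> y'" using up[OF i(1) y(2)] leq_trans by blast
    qed
    show "\<phi> y \<cdot> (\<phi> y')\<degree> \<preceq> hm A y y'"
    proof (rule covered_comp[OF covered_cv[OF \<phi>c[OF y(2)]] \<phi>c[OF y(1)] hm_hom[OF a y(2,1)]])
      fix c b assume "b \<in> B y" "c \<in> cv ` B y'"
      then obtain i j where i: "i \<in> I" "b = hm A y (x i) \<cdot> (t i)\<degree>" and j: "j \<in> I" "c = (hm A y' (x j) \<cdot> (t j)\<degree>)\<degree>" by (auto simp: B_def)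
      show "b \<cdot> c \<preceq> hm A y y'" using key[OF i(1) j(1) y] i j hm_cv[OF a xe(1)[OF j(1)] y(2)] by (simp add: cv_cmp cmp_assoc)
    qed
  next
    fix z assume z: "z \<in> hom X X" and le: "\<And>y. y \<in> Elts A \<Longrightarrow> (\<phi> y)\<degree> \<cdot> \<phi> y \<preceq> z"
    show "one X \<preceq> z"
    proof (rule coveredD[OF cov z])
      fix b assume "b \<in> {t i \<cdot> (t i)\<degree> |i. i \<in> I}"
      then obtain i where i: "i \<in> I" "b = t i \<cdot> (t i)\<degree>" by blast
      have "(t i)\<degree>\<degree> \<cdot> (t i)\<degree> \<preceq> (\<phi> (x i))\<degree> \<cdot> \<phi> (x i)" by (intro cmp_mono cv_mono up'[OF i(1)])
      then show "b \<preceq> z" using le[OF xe(1)[OF i(1)]] leq_trans i by simp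
    qed
  qed
  obtain z where z: "z \<in> pts A X" "\<forall>y\<in>Elts A. hm A y z = \<phi> y" using point_ex1[OF A inf P] by blast
  \<comment> \<open>\<open>(t i)\<degree>\<close> lies below \<open>\<phi> (x i)\<close>, which is
    \<open>hm A (x i) z\<close>; so the unit of \<open>t i\<close> yields an isomorphism between
    \<open>x i\<close> and the restriction of \<open>z\<close>.\<close>
  have "res A z (t i) = x i" if i: "i \<in> I" for i
  proof -
    have ti: "is_map (\<iota> (U i)) (Ty A z) (t i)" using m[OF i] ptsD(2)[OF z(1)] by simp
    have "one (\<iota> (U i)) \<preceq> (t i)\<degree> \<cdot> t i" by (rule M(5)[OF i])
    also have "\<dots> \<preceq> \<phi> (x i) \<cdot> t i" by (rule cmp_mono_right[OF up'[OF i]])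
    also have "\<dots> = hm A (x i) (res A z (t i))"
      using hm_res_right[OF A inf ptsD(1)[OF z(1)] ti xe(1)[OF i]] z(2) xe(1)[OF i] by simp
    finally show ?thesis using pts_eqI[OF a x[OF i] res_pts[OF A inf ptsD(1)[OF z(1)] ti]] by simp
  qed
  then show ?thesis using z by blast
qed

definition nv :: "('o, 'a, 'v) qcat \<Rightarrow> ('c, 'b, 'v) presheaf" where
  "nv A = \<lparr>PSet = (\<lambda>U. pts A (\<iota> U)), PAct = (\<lambda>T U f. \<lambda>x\<in>pts A (\<iota> U). res A x (gm T U f))\<rparr>"

lemma gm_map_pts: "\<lbrakk>x \<in> pts A (\<iota> U); U \<in> Obj C; T \<in> Obj C; f \<in> Hom C T U\<rbrakk> \<Longrightarrow> is_map (\<iota> T) (Ty A x) (gm T U f)"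
  by (simp add: gm_map ptsD(2))

lemma PSet_nv [simp]: "PSet (nv A) U = pts A (\<iota> U)" by (simp add: nv_def)

lemma PAct_nv: "x \<in> pts A (\<iota> U) \<Longrightarrow> PAct (nv A) T U f x = res A x (gm T U f)" by (simp add: nv_def)

lemma res_gm_pts: "\<lbrakk>scc A; x \<in> pts A (\<iota> U); U \<in> Obj C; T \<in> Obj C; f \<in> Hom C T U\<rbrakk> \<Longrightarrow> res A x (gm T U f) \<in> pts A (\<iota> T)"
  for A :: "('o, 'a, 'v) qcat"
  using res_pts[OF _ inf ptsD(1) gm_map_pts] by blast

lemma nv_presheaf: assumes A: "scc (A :: ('o, 'a, 'v) qcat)" shows "is_presheaf C (nv A)"
  unfolding is_presheaf_def
proof (intro conjI ballI)
  have "small TYPE('v) (Elts A)" using A by (simp add: scc_def sqc_def is_qcat_def)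
  then show "small TYPE('v) (PSet (nv A) U)" for U by (rule small_subset) (auto simp: pts_def)
  fix U assume U: "U \<in> Obj C"
  show "PAct (nv A) U U (Idn C U) x = x" if "x \<in> PSet (nv A) U" for x
    using that res_one[OF A inf] by (simp add: PAct_nv gm_Idn[OF U])
  fix T assume T: "T \<in> Obj C"
  {
    fix f assume f: "f \<in> Hom C T U"
    show "PAct (nv A) T U f \<in> PSet (nv A) U \<rightarrow>\<^sub>E PSet (nv A) T"
      using res_gm_pts[OF A _ U T f] by (auto simp: nv_def)
    fix W g x assume W: "W \<in> Obj C" and g: "g \<in> Hom C W T" and x: "x \<in> PSet (nv A) U"
    then have x': "x \<in> pts A (\<iota> U)" by simp
    show "PAct (nv A) W U (Comp C W T U f g) x = PAct (nv A) W T g (PAct (nv A) T U f x)"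
      using x' res_res[OF A inf ptsD(1)[OF x'] gm_map_pts[OF x' U T f] gm_map[OF T W g]] res_gm_pts[OF A x' U T f]
      by (simp add: PAct_nv gm_Comp[OF U T W f g])
  }
qed

lemma site_separated:
  assumes A: "scc (A :: ('o, 'a, 'v) qcat)" and U: "U \<in> Obj C" and R: "R \<in> J U" and x: "x \<in> pts A (\<iota> U)" and y: "y \<in> pts A (\<iota> U)"
    and e: "\<And>T s. (T, s) \<in> R \<Longrightarrow> res A x (gm T U s) = res A y (gm T U s)"
  shows "x = y"
proof (rule res_separated[OF A inf x y, where I = R and t = "\<lambda>(T, s). gm T U s" and W = "\<lambda>(T, s). \<iota> T"])
  have "{(case i of (T, s) \<Rightarrow> gm T U s) \<cdot> (case i of (T, s) \<Rightarrow> gm T U s)\<degree> |i. i \<in> R} = {gm T U s \<cdot> (gm T U s)\<degree> |T s. (T, s) \<in> R}"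
    by force
  then show "covered (\<iota> U) (\<iota> U) (one (\<iota> U)) {(case i of (T, s) \<Rightarrow> gm T U s) \<cdot> (case i of (T, s) \<Rightarrow> gm T U s)\<degree> |i. i \<in> R}"
    using cover_covered[OF U R] by simp
qed (use gm_map C.sieve_arrow[OF U R] U e in auto)

lemma nv_sheaf: assumes A: "scc (A :: ('o, 'a, 'v) qcat)" shows "is_sheaf C J (nv A)"
  unfolding is_sheaf_def
proof (intro conjI ballI allI impI nv_presheaf[OF A])
  fix U R x assume U: "U \<in> Obj C" and R: "R \<in> J U" and M: "matching_family C (nv A) U R x"
  have Rs: "T \<in> Obj C" "s \<in> Hom C T U" if "(T, s) \<in> R" for T s using C.sieve_arrow[OF U R that] by auto
  have x: "x T s \<in> pts A (\<iota> T)" if "(T, s) \<in> R" for T s using M that by (auto simp: matching_family_def)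
  have xr: "res A (x T s) (gm W T f) = x W (Comp C W T U s f)" if "(T, s) \<in> R" "W \<in> Obj C" "f \<in> Hom C W T" for T s W f
    using M that x[OF that(1)] by (auto simp: matching_family_def PAct_nv)
  let ?t = "\<lambda>(T, s). gm T U s"
  have "{?t i \<cdot> (?t i)\<degree> |i. i \<in> R} = {gm T U s \<cdot> (gm T U s)\<degree> |T s. (T, s) \<in> R}" by force
  then have cov: "covered (\<iota> U) (\<iota> U) (one (\<iota> U)) {?t i \<cdot> (?t i)\<degree> |i. i \<in> R}" using cover_covered[OF U R] by simp
  have "\<exists>z\<in>pts A (\<iota> U). \<forall>i\<in>R. res A z (?t i) = (case i of (T, s) \<Rightarrow> x T s)"
  proof (rule glue[OF A \<iota>_closed[OF U] cov, where U = fst])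
    show "fst i \<in> Obj C \<and> is_map (\<iota> (fst i)) (\<iota> U) (?t i)" if "i \<in> R" for i
      using that Rs gm_map U by (cases i) auto
    show "(case i of (T, s) \<Rightarrow> x T s) \<in> pts A (\<iota> (fst i))" if "i \<in> R" for i using that x by (cases i) auto
    fix i j W f g assume i: "i \<in> R" and j: "j \<in> R" and sp: "(W, f, g) \<in> spans C (fst j) (fst i)"
      and e: "?t i \<cdot> gm W (fst i) f = ?t j \<cdot> gm W (fst j) g"
    obtain T s T' s' where ij: "i = (T, s)" "j = (T', s')" by (metis surj_pair)
    have s: "(T, s) \<in> R" "(T', s') \<in> R" using i j ij by auto
    have W: "W \<in> Obj C" "f \<in> Hom C W T" "g \<in> Hom C W T'" using sp ij by (auto simp: spans_def)
    let ?a = "Comp C W T U s f" and ?b = "Comp C W T' U s' g"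
    have ab: "?a \<in> Hom C W U" "?b \<in> Hom C W U" "(W, ?a) \<in> R" "(W, ?b) \<in> R"
      using C.Comp_closed W Rs[OF s(1)] Rs[OF s(2)] U C.sieve_comp[OF U R] s by auto
    \<comment> \<open>The composites \<open>?a\<close> and \<open>?b\<close> have the same image in
      \<open>Q\<close> but may differ in the site. They agree on the covering sieve
      \<open>K\<close>, there the matching family takes equal values, and separatedness identifies
      its values at \<open>?a\<close> and \<open>?b\<close>.\<close>
    have "gm W U ?a = gm W U ?b" using e ij W Rs[OF s(1)] Rs[OF s(2)] U by (simp add: gm_Comp)
    note K = gm_eq_local[OF U W(1) ab(1,2) this]
    have "x W ?a = x W ?b"
    proof (rule site_separated[OF A W(1) K x[OF ab(3)] x[OF ab(4)]])
      fix T k assume "(T, k) \<in> eq_sieve C U W ?a ?b"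
      then show "res A (x W ?a) (gm T W k) = res A (x W ?b) (gm T W k)"
        using xr[OF ab(3)] xr[OF ab(4)] by simp
    qed
    then show "res A (case i of (T, s) \<Rightarrow> x T s) (gm W (fst i) f) = res A (case j of (T, s) \<Rightarrow> x T s) (gm W (fst j) g)"
      using xr[OF s(1) W(1,2)] xr[OF s(2) W(1,3)] ij by simp
  qed
  then obtain z where z: "z \<in> pts A (\<iota> U)" "\<And>T s. (T, s) \<in> R \<Longrightarrow> res A z (gm T U s) = x T s" by fastforce
  show "\<exists>!z. z \<in> PSet (nv A) U \<and> (\<forall>(T, s)\<in>R. PAct (nv A) T U s z = x T s)"
  proof (rule ex1I[of _ z])
    show "z \<in> PSet (nv A) U \<and> (\<forall>(T, s)\<in>R. PAct (nv A) T U s z = x T s)" using z by (auto simp: PAct_nv)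
    fix y assume "y \<in> PSet (nv A) U \<and> (\<forall>(T, s)\<in>R. PAct (nv A) T U s y = x T s)"
    then have y: "y \<in> pts A (\<iota> U)" "\<And>T s. (T, s) \<in> R \<Longrightarrow> res A y (gm T U s) = x T s" by (auto simp: PAct_nv)
    show "y = z" by (rule site_separated[OF A U R y(1) z(1)]) (simp add: y z)
  qed
qed

section \<open>Functors as morphisms of sheaves\<close>

definition nt :: "('o, 'a, 'v) qcat \<Rightarrow> ('v \<Rightarrow> 'v) \<Rightarrow> ('o, 'a, 'v) qcat \<Rightarrow> 'c \<Rightarrow> 'v \<Rightarrow> 'v" where
  "nt A F B = (\<lambda>U\<in>Obj C. \<lambda>x\<in>PSet (nv A) U. rp B (F x))"

lemma nt_natural:
  fixes A B :: "('o, 'a, 'v) qcat"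
  assumes A: "scc A" and B: "scc B" and F: "F \<in> qfunctors Q A B"
  shows "nt A F B \<in> natural_transformations C (nv A) (nv B)"
  unfolding nt_def
proof (rule natural_transformationsI[OF _ _ nv_presheaf[OF A]])
  have a: "sqc A" and b: "sqc B" using A B scc_sqc by auto
  note p = qfunctor_props[OF a b F]
  have r: "rp B (F x) \<in> pts B (\<iota> U)" if "x \<in> pts A (\<iota> U)" for x U
    using rp_pts[OF b p(1)] p(2) ptsD[OF that] by metis
  show "rp B (F x) \<in> PSet (nv B) U" if "x \<in> PSet (nv A) U" for U x using r that by simp
  fix U T f x assume U: "U \<in> Obj C" and T: "T \<in> Obj C" and f: "f \<in> Hom C T U" and "x \<in> PSet (nv A) U"
  then have x: "x \<in> pts A (\<iota> U)" by simp
  have Fx: "F x \<in> Elts B" "is_map (\<iota> T) (Ty B (F x)) (gm T U f)" using p ptsD[OF x] gm_map[OF U T f] by simp_all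
  have "rp B (F (res A x (gm T U f))) = res B (F x) (gm T U f)"
    by (rule qfunctor_res[OF A B inf F ptsD(1)[OF x] gm_map_pts[OF x U T f]])
  also have "\<dots> = res B (rp B (F x)) (gm T U f)"
    using eqv_hm_right[OF b eqv_rp[OF b Fx(1)]] by (simp add: res_def)
  finally show "rp B (F (PAct (nv A) T U f x)) = PAct (nv B) T U f (rp B (F x))"
    using x r[OF x] by (simp add: PAct_nv)
qed

lemma res_rp: "sqc A \<Longrightarrow> x \<in> Elts A \<Longrightarrow> res A (rp A x) t = res A x t"
  using eqv_hm_right[OF _ eqv_rp[of A x]] by (simp add: res_def)

text \<open>An element of arbitrary type is detected by its restrictions along the maps out of the
  \<open>\<iota> U\<close>, which cover its type, and \<open>qfunctor_res\<close> expresses these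
  restrictions of \<open>F x\<close> by values of \<open>F\<close> on sections.\<close>

lemma nt_eq_iff:
  fixes A B :: "('o, 'a, 'v) qcat"
  assumes A: "scc A" and B: "scc B" and F: "F \<in> qfunctors Q A B" and G: "G \<in> qfunctors Q A B"
  shows "nt A F B = nt A G B \<longleftrightarrow> cls A B F = cls A B G"
proof -
  have a: "sqc A" and b: "sqc B" using A B scc_sqc by auto
  note f = qfunctor_props[OF a b F] and g = qfunctor_props[OF a b G]
  show ?thesis unfolding cls_eq_iff[OF a b F G]
  proof
    assume "\<forall>x\<in>Elts A. eqv B (F x) (G x)"
    then show "nt A F B = nt A G B" by (auto simp: nt_def fun_eq_iff intro!: rp_eq[OF b] dest!: ptsD(1))
  next
    assume n: "nt A F B = nt A G B"
    have eq: "rp B (F x) = rp B (G x)" if "U \<in> Obj C" "x \<in> pts A (\<iota> U)" for U x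
      using fun_cong[OF fun_cong[OF n, of U], of x] that by (simp add: nt_def)
    show "\<forall>x\<in>Elts A. eqv B (F x) (G x)"
    proof
      fix x assume x: "x \<in> Elts A"
      let ?I = "{(U, t). U \<in> Obj C \<and> is_map (\<iota> U) (Ty A x) t}"
      have "rp B (F x) = rp B (G x)"
      proof (rule res_separated[OF B inf, where I = ?I and t = snd and W = "\<iota> \<circ> fst"])
        show "rp B (F x) \<in> pts B (Ty A x)" "rp B (G x) \<in> pts B (Ty A x)" using rp_pts[OF b] f g x by metis+
        show "covered (Ty A x) (Ty A x) (one (Ty A x)) {snd i \<cdot> (snd i)\<degree> |i. i \<in> ?I}"
          by (rule obj_covered_indexed[OF sqc_Ty[OF a x]])
        show "is_map ((\<iota> \<circ> fst) i) (Ty A x) (snd i)" if "i \<in> ?I" for i using that by auto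
        fix i assume "i \<in> ?I"
        then obtain U t where i: "i = (U, t)" "U \<in> Obj C" "is_map (\<iota> U) (Ty A x) t" by auto
        then show "res B (rp B (F x)) (snd i) = res B (rp B (G x)) (snd i)"
          using res_rp[OF b f(1)[OF x]] res_rp[OF b g(1)[OF x]] qfunctor_res[OF A B inf F x i(3)]
            qfunctor_res[OF A B inf G x i(3)] eq[OF i(2) res_pts[OF A inf x i(3)]] by simp
      qed
      then show "eqv B (F x) (G x)"
        using eqv_rp[OF b f(1)[OF x]] eqv_rp[OF b g(1)[OF x]] eqv_sym[OF b] eqv_trans[OF b] by metis
    qed
  qed
qed

text \<open>For \<open>x\<close> of arbitrary type the sections
  \<open>\<theta> U (res A x t)\<close>, over all maps \<open>t\<close> from some
  \<open>\<iota> U\<close> to its type, are glued to an element \<open>G x\<close>. That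
  \<open>G\<close> is a functor is checked on spans: by \<open>res_eq_iff\<close> a span below
  \<open>hm A y x\<close> is an equality of restrictions, which \<open>\<theta>\<close>
  preserves.\<close>

lemma nt_full:
  fixes A B :: "('o, 'a, 'v) qcat"
  assumes A: "scc A" and B: "scc B" and \<theta>: "\<theta> \<in> natural_transformations C (nv A) (nv B)"
  shows "\<exists>F\<in>qfunctors Q A B. nt A F B = \<theta>"
proof -
  have a: "sqc A" and b: "sqc B" using A B scc_sqc by auto
  note th = natural_transformationsD[OF \<theta>]
  have nat: "\<theta> T (res A x (gm T U f)) = res B (\<theta> U x) (gm T U f)"
    if "U \<in> Obj C" "T \<in> Obj C" "f \<in> Hom C T U" "x \<in> pts A (\<iota> U)" for U T f x
    using th(3)[OF that(1-3), of x] th(2)[OF that(1), of x] that(4) by (simp add: PAct_nv)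
  have "\<exists>z\<in>pts B (Ty A x). \<forall>U t. U \<in> Obj C \<longrightarrow> is_map (\<iota> U) (Ty A x) t \<longrightarrow> res B z t = \<theta> U (res A x t)" if x: "x \<in> Elts A" for x
  proof -
    let ?I = "{(U, t). U \<in> Obj C \<and> is_map (\<iota> U) (Ty A x) t}"
    have "\<exists>z\<in>pts B (Ty A x). \<forall>i\<in>?I. res B z (snd i) = \<theta> (fst i) (res A x (snd i))"
    proof (rule glue[OF B sqc_Ty[OF a x] obj_covered_indexed[OF sqc_Ty[OF a x]], where U = fst])
      show "fst i \<in> Obj C \<and> is_map (\<iota> (fst i)) (Ty A x) (snd i)" if "i \<in> ?I" for i using that by auto
      show "\<theta> (fst i) (res A x (snd i)) \<in> pts B (\<iota> (fst i))" if "i \<in> ?I" for i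
        using that th(2)[of "fst i"] res_pts[OF A inf x] by auto
      fix i j W f g assume i: "i \<in> ?I" and j: "j \<in> ?I" and sp: "(W, f, g) \<in> spans C (fst j) (fst i)"
        and e: "snd i \<cdot> gm W (fst i) f = snd j \<cdot> gm W (fst j) g"
      have W: "W \<in> Obj C" "f \<in> Hom C W (fst i)" "g \<in> Hom C W (fst j)" using sp by (auto simp: spans_def)
      have i': "fst i \<in> Obj C" "is_map (\<iota> (fst i)) (Ty A x) (snd i)" and j': "fst j \<in> Obj C" "is_map (\<iota> (fst j)) (Ty A x) (snd j)"
        using i j by auto
      show "res B (\<theta> (fst i) (res A x (snd i))) (gm W (fst i) f) = res B (\<theta> (fst j) (res A x (snd j))) (gm W (fst j) g)"
        using nat[OF i'(1) W(1,2) res_pts[OF A inf x i'(2)]] nat[OF j'(1) W(1,3) res_pts[OF A inf x j'(2)]]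
          res_res[OF A inf x i'(2) gm_map[OF i'(1) W(1,2)]] res_res[OF A inf x j'(2) gm_map[OF j'(1) W(1,3)]] e by simp
    qed
    then show ?thesis by fastforce
  qed
  then obtain G where G: "\<And>x. x \<in> Elts A \<Longrightarrow> G x \<in> pts B (Ty A x)"
    "\<And>x U t. x \<in> Elts A \<Longrightarrow> U \<in> Obj C \<Longrightarrow> is_map (\<iota> U) (Ty A x) t \<Longrightarrow> res B (G x) t = \<theta> U (res A x t)" by metis
  have G': "G x \<in> Elts B" "Ty B (G x) = Ty A x" if "x \<in> Elts A" for x using ptsD[OF G(1)[OF that]] by auto
  have F: "restrict G (Elts A) \<in> qfunctors Q A B"
  proof (rule qfunctorI[OF a b G'])
    fix x y assume x: "x \<in> Elts A" and y: "y \<in> Elts A"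
    show "hm A y x \<preceq> hm B (G y) (G x)"
    proof (rule arrow_leI[OF hm_hom[OF a x y]])
      show "hm B (G y) (G x) \<in> hom (Ty A x) (Ty A y)" using hm_hom[OF b] G' x y by metis
      fix U s t assume U: "U \<in> Obj C" and t: "is_map (\<iota> U) (Ty A x) t" and s: "is_map (\<iota> U) (Ty A y) s" and le: "s \<cdot> t\<degree> \<preceq> hm A y x"
      then have "res A y s = res A x t" using res_eq_iff[OF A inf x t y s] by simp
      then have "res B (G y) s = res B (G x) t" using G(2) x y U s t by simp
      then show "s \<cdot> t\<degree> \<preceq> hm B (G y) (G x)" using res_eq_iff[OF B inf G'(1)[OF x] _ G'(1)[OF y]] G'(2) x y s t by simp
    qed
  qed
  have "nt A (restrict G (Elts A)) B = \<theta>"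
  proof (rule natural_transformations_eqI[OF nt_natural[OF A B F] \<theta>])
    fix U x assume U: "U \<in> Obj C" and "x \<in> PSet (nv A) U"
    then have x: "x \<in> pts A (\<iota> U)" by simp
    note d = ptsD[OF x]
    have "res B (G x) (one (\<iota> U)) = \<theta> U (res A x (one (\<iota> U)))" using G(2)[OF d(1) U] is_map_one \<iota>_closed[OF U] d by simp
    then have "G x = \<theta> U x" using res_one[OF A inf x] res_one[OF B inf] G(1)[OF d(1)] d by simp
    then show "nt A (restrict G (Elts A)) B U x = \<theta> U x" using U x d ptsD(3)[OF G(1)[OF d(1)]] by (simp add: nt_def)
  qed
  then show ?thesis using F by blast
qed

text \<open>Arrows are classes of functors; by \<open>nvm_cls\<close> the value does not depend on
  the functor that is picked.\<close>

definition nvm :: "('o, 'a, 'v) qcat \<Rightarrow> ('o, 'a, 'v) qcat \<Rightarrow> ('v \<Rightarrow> 'v) set \<Rightarrow> 'c \<Rightarrow> 'v \<Rightarrow> 'v" where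
  "nvm A B f = nt A (SOME F. F \<in> f) B"

lemma nvm_cls:
  fixes A B :: "('o, 'a, 'v) qcat"
  assumes A: "scc A" and B: "scc B" and F: "F \<in> qfunctors Q A B" shows "nvm A B (cls A B F) = nt A F B"
proof -
  have a: "sqc A" and b: "sqc B" using A B scc_sqc by auto
  note e = qfunctor_iso_equiv[OF a b]
  have "F \<in> cls A B F" by (rule equiv_class_self[OF e F])
  then have "(SOME G. G \<in> cls A B F) \<in> cls A B F" by (rule someI[of "\<lambda>G. G \<in> cls A B F"])
  then obtain H where H: "H = (SOME G. G \<in> cls A B F)" "(F, H) \<in> qfunctor_iso Q A B" by simp
  then have "H \<in> qfunctors Q A B" using qfunctor_iso_iff[OF a b] by blast
  then have "nt A F B = nt A H B" using nt_eq_iff[OF A B F] equiv_class_eq[OF e H(2)] by blast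
  then show ?thesis by (simp only: nvm_def H(1))
qed

lemma nv_functor: "is_functor (SymCat_sc Q) (sheaf_category C J) (nv :: ('o, 'a, 'v) qcat \<Rightarrow> _) nvm"
  unfolding is_functor_def SymCat_sc_simps(1) mem_Collect_eq
proof (intro conjI ballI, unfold mem_Collect_eq sheaf_category_simps)
  fix A :: "('o, 'a, 'v) qcat" assume A: "scc A"
  have a: "sqc A" by (rule scc_sqc[OF A])
  show "is_sheaf C J (nv A)" by (rule nv_sheaf[OF A])
  show "nvm A A (Idn (SymCat_sc Q) A) = (\<lambda>U\<in>Obj C. \<lambda>x\<in>PSet (nv A) U. x)"
    unfolding SymCat_sc_simps nvm_cls[OF A A id_qfunctor[OF a]] nt_def by (auto simp: fun_eq_iff restrict_def dest: ptsD)
  fix B :: "('o, 'a, 'v) qcat" assume B: "scc B"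
  have b: "sqc B" by (rule scc_sqc[OF B])
  {
    fix f assume "f \<in> Hom (SymCat_sc Q) A B"
    then obtain F where F: "F \<in> qfunctors Q A B" "f = cls A B F" by (rule Hom_SymCat_scE)
    show "nvm A B f \<in> natural_transformations C (nv A) (nv B)"
      using nt_natural[OF A B F(1)] nvm_cls[OF A B F(1)] F by simp
  }
  fix D :: "('o, 'a, 'v) qcat" and f g assume D: "scc D" and f: "f \<in> Hom (SymCat_sc Q) A B" and g: "g \<in> Hom (SymCat_sc Q) B D"
  have d: "sqc D" by (rule scc_sqc[OF D])
  obtain F where F: "F \<in> qfunctors Q A B" "f = cls A B F" using f by (rule Hom_SymCat_scE)
  obtain G where G: "G \<in> qfunctors Q B D" "g = cls B D G" using g by (rule Hom_SymCat_scE)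
  note GF = qfunctor_compose[OF a b d F(1) G(1)]
  note pf = qfunctor_props[OF a b F(1)]
  have "rp D (G (F x)) = rp D (G (rp B (F x)))" if "x \<in> Elts A" for x
    using rp_eq[OF d qfunctor_eqv[OF b d G(1) eqv_rp[OF b pf(1)[OF that]]]] .
  moreover have "rp B (F x) \<in> pts B (\<iota> U)" if "x \<in> pts A (\<iota> U)" for x U
    using rp_pts[OF b pf(1)] pf(2) ptsD[OF that] by metis
  ultimately have "nt A (compose (Elts A) G F) D = (\<lambda>U\<in>Obj C. compose (PSet (nv A) U) (nt B G D U) (nt A F B U))"
    by (auto simp: nt_def compose_def fun_eq_iff dest: ptsD(1))
  then show "nvm A D (Comp (SymCat_sc Q) A B D g f) = (\<lambda>U\<in>Obj C. compose (PSet (nv A) U) (nvm B D g U) (nvm A B f U))"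
    unfolding F(2) G(2) Comp_SymCat_sc[OF a b d F(1) G(1)] nvm_cls[OF A D GF] nvm_cls[OF A B F(1)] nvm_cls[OF B D G(1)] .
qed

lemma nvm_bij:
  fixes A B :: "('o, 'a, 'v) qcat"
  assumes A: "scc A" and B: "scc B"
  shows "bij_betw (nvm A B) (Hom (SymCat_sc Q) A B) (natural_transformations C (nv A) (nv B))"
  unfolding bij_betw_def
proof (intro conjI inj_onI)
  fix f g assume "f \<in> Hom (SymCat_sc Q) A B" "g \<in> Hom (SymCat_sc Q) A B" and e: "nvm A B f = nvm A B g"
  then obtain F G where F: "F \<in> qfunctors Q A B" "f = cls A B F" and G: "G \<in> qfunctors Q A B" "g = cls A B G"
    by (auto elim!: Hom_SymCat_scE)
  then show "f = g" using e nt_eq_iff[OF A B F(1) G(1)] by (simp add: nvm_cls[OF A B])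
next
  show "nvm A B ` Hom (SymCat_sc Q) A B = natural_transformations C (nv A) (nv B)"
  proof (intro equalityI subsetI)
    fix \<theta> assume "\<theta> \<in> nvm A B ` Hom (SymCat_sc Q) A B"
    then obtain F where "F \<in> qfunctors Q A B" "\<theta> = nvm A B (cls A B F)" by (auto elim!: Hom_SymCat_scE)
    then show "\<theta> \<in> natural_transformations C (nv A) (nv B)" using nt_natural[OF A B] nvm_cls[OF A B] by simp
  next
    fix \<theta> assume "\<theta> \<in> natural_transformations C (nv A) (nv B)"
    then obtain F where "F \<in> qfunctors Q A B" "nt A F B = \<theta>" using nt_full[OF A B] by blast
    then show "\<theta> \<in> nvm A B ` Hom (SymCat_sc Q) A B"
      by (intro image_eqI[of _ _ "cls A B F"]) (simp_all add: nvm_cls[OF A B] cls_in_Hom)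
  qed
qed

end

section \<open>Completion and essential surjectivity\<close>

lemma sheaf_separated:
  assumes P: "is_sheaf C J P" and U: "U \<in> Obj C" and R: "R \<in> J U" and Rs: "is_sieve C U R" and x: "x \<in> PSet P U" and y: "y \<in> PSet P U"
    and e: "\<And>T s. (T, s) \<in> R \<Longrightarrow> PAct P T U s x = PAct P T U s y"
  shows "x = y"
proof -
  note p = is_presheafD[OF is_sheaf_presheaf[OF P]]
  have s: "T \<in> Obj C \<and> s \<in> Hom C T U" if "(T, s) \<in> R" for T s using Rs that unfolding is_sieve_def by blast
  have "matching_family C P U R (\<lambda>T s. PAct P T U s x)"
    unfolding matching_family_def using s p(3)[OF U _ _ x] p(5)[OF U _ _ _ _ x] by auto
  then have "\<exists>!z. z \<in> PSet P U \<and> (\<forall>(T, s)\<in>R. PAct P T U s z = PAct P T U s x)"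
    using P U R unfolding is_sheaf_def by blast
  moreover have "\<forall>(T, s)\<in>R. PAct P T U s y = PAct P T U s x" using e by auto
  ultimately show ?thesis using x y by blast
qed

lemma nat_iso:
  assumes P: "is_sheaf C J P" and R: "is_sheaf C J R" and \<theta>: "\<theta> \<in> natural_transformations C P R"
    and bij: "\<And>U. U \<in> Obj C \<Longrightarrow> bij_betw (\<theta> U) (PSet P U) (PSet R U)"
  shows "is_iso (sheaf_category C J) P R \<theta>"
  unfolding is_iso_def sheaf_category_simps
proof (intro conjI bexI \<theta>)
  note t = natural_transformationsD[OF \<theta>] and p = is_presheafD[OF is_sheaf_presheaf[OF P]]
  let ?i = "\<lambda>U\<in>Obj C. \<lambda>x\<in>PSet R U. inv_into (PSet P U) (\<theta> U) x"
  have i: "inv_into (PSet P U) (\<theta> U) x \<in> PSet P U" "\<theta> U (inv_into (PSet P U) (\<theta> U) x) = x" if "U \<in> Obj C" "x \<in> PSet R U" for U x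
    using bij[OF that(1)] that(2) unfolding bij_betw_def by (auto simp: f_inv_into_f intro: inv_into_into)
  have i': "inv_into (PSet P U) (\<theta> U) (\<theta> U x) = x" if "U \<in> Obj C" "x \<in> PSet P U" for U x
    using bij[OF that(1)] that(2) unfolding bij_betw_def by simp
  show "?i \<in> natural_transformations C R P"
  proof (rule natural_transformationsI[OF i(1) _ is_sheaf_presheaf[OF R]])
    fix U T f x assume *: "U \<in> Obj C" "T \<in> Obj C" "f \<in> Hom C T U" "x \<in> PSet R U"
    have "\<theta> T (PAct P T U f (inv_into (PSet P U) (\<theta> U) x)) = PAct R T U f x"
      using t(3)[OF *(1-3) i(1)[OF *(1,4)]] i(2)[OF *(1,4)] by simp
    then show "inv_into (PSet P T) (\<theta> T) (PAct R T U f x) = PAct P T U f (inv_into (PSet P U) (\<theta> U) x)"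
      using i'[OF *(2) p(3)[OF *(1-3) i(1)[OF *(1,4)]]] by simp
  qed
  show "(\<lambda>U\<in>Obj C. compose (PSet P U) (?i U) (\<theta> U)) = (\<lambda>U\<in>Obj C. \<lambda>x\<in>PSet P U. x)"
    using i' t(2) by (auto simp: compose_def fun_eq_iff)
  show "(\<lambda>U\<in>Obj C. compose (PSet R U) (\<theta> U) (?i U)) = (\<lambda>U\<in>Obj C. \<lambda>x\<in>PSet R U. x)"
    using i by (auto simp: compose_def fun_eq_iff)
qed

text \<open>Injectivity makes the local preimages of \<open>y\<close> unique, hence a matching
  family of \<open>P\<close>; the image of its amalgamation agrees with \<open>y\<close> locally,
  and \<open>R\<close> is separated.\<close>

lemma (in site) sheaf_image_local:
  assumes P: "is_sheaf C J P" and R: "is_sheaf C J R" and \<theta>: "\<theta> \<in> natural_transformations C P R"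
    and inj: "\<And>U. U \<in> Obj C \<Longrightarrow> inj_on (\<theta> U) (PSet P U)" and U: "U \<in> Obj C" and y: "y \<in> PSet R U"
    and S: "{(W, s). W \<in> Obj C \<and> s \<in> Hom C W U \<and> PAct R W U s y \<in> \<theta> W ` PSet P W} \<in> J U" (is "?S \<in> _")
  shows "y \<in> \<theta> U ` PSet P U"
proof -
  note p = is_presheafD[OF is_sheaf_presheaf[OF P]] and r = is_presheafD[OF is_sheaf_presheaf[OF R]] and t = natural_transformationsD[OF \<theta>]
  define x where "x W s = inv_into (PSet P W) (\<theta> W) (PAct R W U s y)" for W s
  have x: "x W s \<in> PSet P W" "\<theta> W (x W s) = PAct R W U s y" if "(W, s) \<in> ?S" for W s
    using that unfolding x_def by (auto intro: inv_into_into f_inv_into_f)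
  have "PAct P W' W f (x W s) = x W' (Comp C W' W U s f)" if s: "(W, s) \<in> ?S" and f: "W' \<in> Obj C" "f \<in> Hom C W' W" for W s W' f
  proof (rule inj_onD[OF inj[OF f(1)]])
    have W: "W \<in> Obj C" "s \<in> Hom C W U" using s by auto
    have sf: "(W', Comp C W' W U s f) \<in> ?S" by (rule sieve_comp[OF U S s f])
    show "PAct P W' W f (x W s) \<in> PSet P W'" "x W' (Comp C W' W U s f) \<in> PSet P W'" by (rule p(3)[OF W(1) f x(1)[OF s]], rule x(1)[OF sf])
    show "\<theta> W' (PAct P W' W f (x W s)) = \<theta> W' (x W' (Comp C W' W U s f))"
      using x(2)[OF s] x(2)[OF sf] t(3)[OF W(1) f x(1)[OF s]] r(5)[OF U W(1) f(1) W(2) f(2) y] by simp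
  qed
  then have "matching_family C P U ?S x" unfolding matching_family_def using x(1) by auto
  then have "\<exists>!z. z \<in> PSet P U \<and> (\<forall>(W, s)\<in>?S. PAct P W U s z = x W s)" using P U S unfolding is_sheaf_def by blast
  then obtain z where z: "z \<in> PSet P U" "\<And>W s. (W, s) \<in> ?S \<Longrightarrow> PAct P W U s z = x W s" by blast
  have "\<theta> U z = y"
  proof (rule sheaf_separated[OF R U S J_sieve[OF U S] t(2)[OF U z(1)] y])
    show "PAct R W U s (\<theta> U z) = PAct R W U s y" if "(W, s) \<in> ?S" for W s
      using z(2)[OF that] x(2)[OF that] t(3)[OF U _ _ z(1), of W s] that by auto
  qed
  then show ?thesis using z(1) by blast
qed

context involutive_quantaloid
begin

lemma covered_le: "a \<preceq> b \<Longrightarrow> a \<in> hom X Y \<Longrightarrow> covered X Y b B \<Longrightarrow> covered X Y a B"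
  unfolding covered_def using leq_trans by blast

text \<open>The elements of an enriched category must be members of \<open>'v\<close>; data indexed
  by an arbitrary small set are encoded along an injection.\<close>

lemma sqc_exists:
  fixes I :: "'i set"
  assumes sm: "small TYPE('v) I" and ty: "\<And>i. i \<in> I \<Longrightarrow> ty i \<in> Obj Q"
    and h: "\<And>i j. i \<in> I \<Longrightarrow> j \<in> I \<Longrightarrow> h j i \<in> hom (ty i) (ty j)"
    and tr: "\<And>i j k. i \<in> I \<Longrightarrow> j \<in> I \<Longrightarrow> k \<in> I \<Longrightarrow> h k j \<cdot> h j i \<preceq> h k i"
    and one: "\<And>i. i \<in> I \<Longrightarrow> one (ty i) \<preceq> h i i"
    and cv: "\<And>i j. i \<in> I \<Longrightarrow> j \<in> I \<Longrightarrow> h i j \<preceq> (h j i)\<degree>"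
  obtains A :: "('o, 'a, 'v) qcat" and e where "sqc A" "bij_betw e I (Elts A)" "\<And>i. i \<in> I \<Longrightarrow> Ty A (e i) = ty i"
    "\<And>i j. i \<in> I \<Longrightarrow> j \<in> I \<Longrightarrow> hm A (e j) (e i) = h j i"
proof -
  obtain e :: "'i \<Rightarrow> 'v" where e: "inj_on e I" using small_injection[OF sm] .
  define d where "d = inv_into I e"
  define A :: "('o, 'a, 'v) qcat" where
    "A = \<lparr>Elts = e ` I, Ty = (\<lambda>x\<in>e ` I. ty (d x)),
      Arr = (\<lambda>y x. if x \<in> e ` I \<and> y \<in> e ` I then snd (snd (the (h (d y) (d x)))) else undefined)\<rparr>"
  have d: "d (e i) = i" if "i \<in> I" for i using e that by (simp add: d_def)
  have E: "Elts A = e ` I" by (simp add: A_def)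
  have T: "Ty A (e i) = ty i" if "i \<in> I" for i using that d by (simp add: A_def)
  have H: "hm A (e j) (e i) = h j i" if "i \<in> I" "j \<in> I" for i j
    using h[OF that] that T d by (auto simp: hm_def A_def hom_def)
  have "sqc A"
  proof (rule sqcI)
    show "small TYPE('v) (Elts A)" unfolding E by (rule small_image[OF sm])
    show "Ty A \<in> Elts A \<rightarrow>\<^sub>E Obj Q" unfolding E using T ty by (auto simp: A_def d)
    show "Arr A y x = undefined" if "\<not> (x \<in> Elts A \<and> y \<in> Elts A)" for x y using that by (auto simp: A_def)
  qed (auto simp: E H T h tr one cv)
  then show ?thesis using that[of A e] E e T H by (simp add: bij_betw_def)
qed

text \<open>Elements of \<open>B\<close> are the points of \<open>A\<close>, and the hom-arrow from
  \<open>i\<close> to \<open>j\<close> is the composite of the distributor \<open>i\<close> with the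
  opposite of \<open>j\<close>. The last conclusion, that the representables cover every element,
  later shows that new elements come locally from old ones.\<close>

lemma completion:
  fixes A :: "('o, 'a, 'v) qcat"
  assumes A: "sqc A" and U: "universe TYPE('v)" and sm: "small_category TYPE('v) Q"
  obtains B :: "('o, 'a, 'v) qcat" and e where "scc B" "\<And>a. a \<in> Elts A \<Longrightarrow> e a \<in> Elts B" "\<And>a. a \<in> Elts A \<Longrightarrow> Ty B (e a) = Ty A a"
    "\<And>a a'. a \<in> Elts A \<Longrightarrow> a' \<in> Elts A \<Longrightarrow> hm B (e a') (e a) = hm A a' a"
    "\<And>b. b \<in> Elts B \<Longrightarrow> covered (Ty B b) (Ty B b) (one (Ty B b)) {hm B b (e a) \<cdot> hm B (e a) b |a. a \<in> Elts A}"
proof -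
  \<comment> \<open>Extensional families, so that the points form a subset of a small
    product.\<close>
  define I where "I = {(X, \<phi>). is_point A X \<phi> \<and> \<phi> \<in> extensional (Elts A)}"
  have "small TYPE('v) (Obj Q)" "\<And>X Y. X \<in> Obj Q \<Longrightarrow> Y \<in> Obj Q \<Longrightarrow> small TYPE('v) (Hom Q X Y)"
    using sm by (auto simp: small_category_def)
  then have sh: "small TYPE('v) (hom X Y)" if "X \<in> Obj Q" "Y \<in> Obj Q" for X Y
    using that small_image[of "Hom Q X Y" "\<lambda>f. Some (X, Y, f)"]
    by (rule_tac small_subset[of "(\<lambda>f. Some (X, Y, f)) ` Hom Q X Y"]) (auto simp: hom_def)
  have "small TYPE('v) (SIGMA X:Obj Q. PiE (Elts A) (\<lambda>y. hom X (Ty A y)))"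
    using A sm sqc_Ty[OF A] by (intro small_Sigma[OF U] small_PiE[OF U] sh) (auto simp: small_category_def sqc_def is_qcat_def)
  moreover have "I \<subseteq> (SIGMA X:Obj Q. PiE (Elts A) (\<lambda>y. hom X (Ty A y)))"
    unfolding I_def using is_pointD(1,2) by (auto simp: PiE_def)
  ultimately have smI: "small TYPE('v) I" by (rule small_subset)
  have I: "is_point A (fst i) (snd i)" if "i \<in> I" for i using that by (auto simp: I_def)
  note p = is_pointD[OF I]
  define S where "S j i = {(snd j y)\<degree> \<cdot> snd i y |y. y \<in> Elts A}" for i j :: "'o \<times> ('v \<Rightarrow> ('o, 'a) arrow)"
  define h where "h j i = jn (fst i) (fst j) (S j i)" for i j
  have sub: "S j i \<subseteq> hom (fst i) (fst j)" if "i \<in> I" "j \<in> I" for i j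
    unfolding S_def using cmp_hom[OF cv_hom[OF p(2)[OF that(2)]] p(2)[OF that(1)]] by blast
  have hh: "h j i \<in> hom (fst i) (fst j)" and hc: "covered (fst i) (fst j) (h j i) (S j i)" and hu: "\<And>b. b \<in> S j i \<Longrightarrow> b \<preceq> h j i"
    if "i \<in> I" "j \<in> I" for i j
    unfolding h_def using jn_props[OF p(1)[OF that(1)] p(1)[OF that(2)] sub[OF that]] by blast+
  have hu': "(snd j y)\<degree> \<cdot> snd i y \<preceq> h j i" if "i \<in> I" "j \<in> I" "y \<in> Elts A" for i j y
    by (rule hu[OF that(1,2)]) (use that in \<open>auto simp: S_def\<close>)
  have tr: "h k j \<cdot> h j i \<preceq> h k i" if i: "i \<in> I" and j: "j \<in> I" and k: "k \<in> I" for i j k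
  proof (rule covered_comp[OF hc[OF i j] hc[OF j k] hh[OF i k]])
    fix c b assume "c \<in> S j i" "b \<in> S k j"
    then obtain y w where y: "y \<in> Elts A" "b = (snd k y)\<degree> \<cdot> snd j y" and w: "w \<in> Elts A" "c = (snd j w)\<degree> \<cdot> snd i w"
      by (auto simp: S_def)
    have "b \<cdot> c = (snd k y)\<degree> \<cdot> (snd j y \<cdot> (snd j w)\<degree> \<cdot> snd i w)" using y w by (simp add: cmp_assoc)
    also have "\<dots> \<preceq> (snd k y)\<degree> \<cdot> (hm A y w \<cdot> snd i w)" by (intro cmp_mono_left cmp_mono_right p(5)[OF j y(1) w(1)])
    also have "\<dots> \<preceq> (snd k y)\<degree> \<cdot> snd i y" by (intro cmp_mono_left p(3)[OF i w(1) y(1)])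
    also have "\<dots> \<preceq> h k i" by (rule hu'[OF i k y(1)])
    finally show "b \<cdot> c \<preceq> h k i" .
  qed
  have one: "one (fst i) \<preceq> h i i" if i: "i \<in> I" for i
    by (rule coveredD[OF p(4)[OF i] hh[OF i i]]) (use hu[OF i i] in \<open>auto simp: S_def\<close>)
  have cvh: "h i j \<preceq> (h j i)\<degree>" if i: "i \<in> I" and j: "j \<in> I" for i j
  proof (rule coveredD[OF hc[OF j i] cv_hom[OF hh[OF i j]]])
    fix b assume "b \<in> S i j"
    then obtain y where y: "y \<in> Elts A" "b = (snd i y)\<degree> \<cdot> snd j y" by (auto simp: S_def)
    then show "b \<preceq> (h j i)\<degree>" using cv_mono[OF hu'[OF i j y(1)]] by (simp add: cv_cmp)
  qed
  obtain B :: "('o, 'a, 'v) qcat" and d where B: "sqc B" and d: "bij_betw d I (Elts B)"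
    and TB: "\<And>i. i \<in> I \<Longrightarrow> Ty B (d i) = fst i" and HB: "\<And>i j. i \<in> I \<Longrightarrow> j \<in> I \<Longrightarrow> hm B (d j) (d i) = h j i"
    by (rule sqc_exists[of I fst h]) (use smI p(1) hh tr one cvh in auto)
  have EB: "Elts B = d ` I" using d by (simp add: bij_betw_def)
  have "symmetrically_complete Q B"
    unfolding symmetrically_complete_iff[OF B universe_infinite[OF U]]
  proof (intro allI impI)
    fix X \<Phi> assume P: "is_point B X \<Phi>"
    have dI: "d i \<in> Elts B" if "i \<in> I" for i using that EB by blast
    note q = is_pointD[OF P]
    have q2: "\<Phi> (d i) \<in> hom X (fst i)" if "i \<in> I" for i using q(2)[OF dI[OF that]] TB[OF that] by simp
    have q3: "h j i \<cdot> \<Phi> (d i) \<preceq> \<Phi> (d j)" if "i \<in> I" "j \<in> I" for i j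
      using q(3)[OF dI[OF that(1)] dI[OF that(2)]] HB[OF that] by simp
    have q5: "\<Phi> (d i) \<cdot> (\<Phi> (d j))\<degree> \<preceq> h i j" if "i \<in> I" "j \<in> I" for i j
      using q(5)[OF dI[OF that(1)] dI[OF that(2)]] HB[OF that(2,1)] by simp
    \<comment> \<open>\<open>\<Phi>\<close> composed with the evaluation of points at
      \<open>y\<close>: the resulting \<open>\<psi>\<close> is the point of \<open>A\<close> that
      represents \<open>\<Phi>\<close>.\<close>
    define G where "G y = {snd i y \<cdot> \<Phi> (d i) |i. i \<in> I}" for y
    define \<psi> where "\<psi> = (\<lambda>y\<in>Elts A. jn X (Ty A y) (G y))"
    have Gs: "G y \<subseteq> hom X (Ty A y)" if "y \<in> Elts A" for y unfolding G_def using cmp_hom[OF p(2) q2] that by blast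
    have \<psi>h: "\<psi> y \<in> hom X (Ty A y)" and \<psi>c: "covered X (Ty A y) (\<psi> y) (G y)" and \<psi>u: "\<And>b. b \<in> G y \<Longrightarrow> b \<preceq> \<psi> y"
      if y: "y \<in> Elts A" for y
      using jn_props[OF q(1) sqc_Ty[OF A y] Gs[OF y]] y by (auto simp: \<psi>_def)
    have \<psi>u': "snd i y \<cdot> \<Phi> (d i) \<preceq> \<psi> y" if "i \<in> I" "y \<in> Elts A" for i y
      by (rule \<psi>u[OF that(2)]) (use that in \<open>unfold G_def, blast\<close>)
    have "is_point A X \<psi>"
    proof (rule is_pointI[OF q(1) \<psi>h])
      fix y y' assume y: "y \<in> Elts A" "y' \<in> Elts A"
      show "hm A y' y \<cdot> \<psi> y \<preceq> \<psi> y'"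
      proof (rule covered_right[OF \<psi>c[OF y(1)] hm_hom[OF A y] \<psi>h[OF y(2)]])
        fix b assume "b \<in> G y"
        then obtain i where i: "i \<in> I" "b = snd i y \<cdot> \<Phi> (d i)" by (auto simp: G_def)
        have "hm A y' y \<cdot> b \<preceq> snd i y' \<cdot> \<Phi> (d i)"
          using cmp_mono_right[OF p(3)[OF i(1) y]] i by (simp add: cmp_assoc)
        then show "hm A y' y \<cdot> b \<preceq> \<psi> y'" using \<psi>u'[OF i(1) y(2)] leq_trans by blast
      qed
      show "\<psi> y \<cdot> (\<psi> y')\<degree> \<preceq> hm A y y'"
      proof (rule covered_comp[OF covered_cv[OF \<psi>c[OF y(2)]] \<psi>c[OF y(1)] hm_hom[OF A y(2,1)]])
        fix c b assume "b \<in> G y" "c \<in> cv ` G y'"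
        then obtain i j where i: "i \<in> I" "b = snd i y \<cdot> \<Phi> (d i)" and j: "j \<in> I" "c = (snd j y' \<cdot> \<Phi> (d j))\<degree>" by (auto simp: G_def)
        have "b \<cdot> c = snd i y \<cdot> (\<Phi> (d i) \<cdot> (\<Phi> (d j))\<degree>) \<cdot> (snd j y')\<degree>" using i j by (simp add: cv_cmp cmp_assoc)
        also have "\<dots> \<preceq> snd i y \<cdot> h i j \<cdot> (snd j y')\<degree>" by (intro cmp_mono_right cmp_mono_left q5 i j)
        also have "\<dots> \<preceq> hm A y y'"
        proof (rule covered_ctx[OF hc[OF j(1) i(1)] p(2)[OF i(1) y(1)] cv_hom[OF p(2)[OF j(1) y(2)]] hm_hom[OF A y(2,1)]])
          fix c assume "c \<in> S i j"
          then obtain w where w: "w \<in> Elts A" "c = (snd i w)\<degree> \<cdot> snd j w" by (auto simp: S_def)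
          have "snd i y \<cdot> c \<cdot> (snd j y')\<degree> = (snd i y \<cdot> (snd i w)\<degree>) \<cdot> (snd j w \<cdot> (snd j y')\<degree>)" using w by (simp add: cmp_assoc)
          also have "\<dots> \<preceq> hm A y w \<cdot> hm A w y'" by (intro cmp_mono p(5)[OF i(1) y(1) w(1)] p(5)[OF j(1) w(1) y(2)])
          also have "\<dots> \<preceq> hm A y y'" by (rule hm_trans[OF A y(2) w(1) y(1)])
          finally show "snd i y \<cdot> c \<cdot> (snd j y')\<degree> \<preceq> hm A y y'" .
        qed
        finally show "b \<cdot> c \<preceq> hm A y y'" .
      qed
    next
      fix z assume z: "z \<in> hom X X" and le: "\<And>y. y \<in> Elts A \<Longrightarrow> (\<psi> y)\<degree> \<cdot> \<psi> y \<preceq> z"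
      show "one X \<preceq> z"
      proof (rule coveredD[OF q(4) z])
        fix b assume "b \<in> {(\<Phi> y)\<degree> \<cdot> \<Phi> y |y. y \<in> Elts B}"
        then obtain i where i: "i \<in> I" "b = (\<Phi> (d i))\<degree> \<cdot> \<Phi> (d i)" unfolding EB by blast
        have "(\<Phi> (d i))\<degree> \<cdot> one (fst i) \<cdot> \<Phi> (d i) \<preceq> z"
        proof (rule covered_ctx[OF p(4)[OF i(1)] cv_hom[OF q2[OF i(1)]] q2[OF i(1)] z])
          fix c assume "c \<in> {(snd i y)\<degree> \<cdot> snd i y |y. y \<in> Elts A}"
          then obtain y where y: "y \<in> Elts A" "c = (snd i y)\<degree> \<cdot> snd i y" by blast
          have "(\<Phi> (d i))\<degree> \<cdot> c \<cdot> \<Phi> (d i) = (snd i y \<cdot> \<Phi> (d i))\<degree> \<cdot> (snd i y \<cdot> \<Phi> (d i))" using y by (simp add: cv_cmp cmp_assoc)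
          also have "\<dots> \<preceq> (\<psi> y)\<degree> \<cdot> \<psi> y" by (intro cmp_mono cv_mono \<psi>u' i y)
          also have "\<dots> \<preceq> z" by (rule le[OF y(1)])
          finally show "(\<Phi> (d i))\<degree> \<cdot> c \<cdot> \<Phi> (d i) \<preceq> z" .
        qed
        then show "b \<preceq> z" using i cmp_one(1)[OF cv_hom[OF q2[OF i(1)]]] by simp
      qed
    qed
    then have \<psi>I: "(X, \<psi>) \<in> I" by (simp add: I_def \<psi>_def)
    have "\<Phi> (d i) = h i (X, \<psi>)" if i: "i \<in> I" for i
    proof (rule leq_antisym)
      have hX: "h i (X, \<psi>) \<in> hom X (fst i)" using hh[OF \<psi>I i] by simp
      have "one (fst i) \<cdot> \<Phi> (d i) \<preceq> h i (X, \<psi>)"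
      proof (rule covered_left[OF p(4)[OF i] q2[OF i] hX])
        fix c assume "c \<in> {(snd i y)\<degree> \<cdot> snd i y |y. y \<in> Elts A}"
        then obtain y where y: "y \<in> Elts A" "c = (snd i y)\<degree> \<cdot> snd i y" by blast
        have "c \<cdot> \<Phi> (d i) \<preceq> (snd i y)\<degree> \<cdot> \<psi> y" using cmp_mono_left[OF \<psi>u'[OF i y(1)]] y by (simp add: cmp_assoc)
        then show "c \<cdot> \<Phi> (d i) \<preceq> h i (X, \<psi>)" using hu'[OF \<psi>I i y(1)] leq_trans by simp
      qed
      then show "\<Phi> (d i) \<preceq> h i (X, \<psi>)" using cmp_one(2)[OF q2[OF i]] by simp
      have "covered X (fst i) (h i (X, \<psi>)) (S i (X, \<psi>))" using hc[OF \<psi>I i] by simp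
      then show "h i (X, \<psi>) \<preceq> \<Phi> (d i)"
      proof (rule coveredD[OF _ q2[OF i]])
        fix b assume "b \<in> S i (X, \<psi>)"
        then obtain y where y: "y \<in> Elts A" "b = (snd i y)\<degree> \<cdot> \<psi> y" by (auto simp: S_def)
        have "(snd i y)\<degree> \<cdot> \<psi> y \<preceq> \<Phi> (d i)"
        proof (rule covered_right[OF \<psi>c[OF y(1)] cv_hom[OF p(2)[OF i y(1)]] q2[OF i]])
          fix c assume "c \<in> G y"
          then obtain j where j: "j \<in> I" "c = snd j y \<cdot> \<Phi> (d j)" by (auto simp: G_def)
          have "(snd i y)\<degree> \<cdot> c \<preceq> h i j \<cdot> \<Phi> (d j)" using cmp_mono_right[OF hu'[OF j(1) i y(1)]] j by (simp add: cmp_assoc)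
          then show "(snd i y)\<degree> \<cdot> c \<preceq> \<Phi> (d i)" using q3[OF j(1) i] leq_trans by blast
        qed
        then show "b \<preceq> \<Phi> (d i)" using y by simp
      qed
    qed
    then have "\<forall>y\<in>Elts B. \<Phi> y = hm B y (d (X, \<psi>))" unfolding EB using HB[OF \<psi>I] by simp
    then show "\<exists>x\<in>Elts B. Ty B x = X \<and> (\<forall>y\<in>Elts B. \<Phi> y = hm B y x)" using dI[OF \<psi>I] TB[OF \<psi>I] by auto
  qed
  then have scB: "scc B" using B by (simp add: scc_def)
  define yo where "yo a = (Ty A a, \<lambda>y\<in>Elts A. hm A y a)" for a
  have yoI: "yo a \<in> I" if a: "a \<in> Elts A" for a
  proof -
    have "is_point A (Ty A a) (\<lambda>y\<in>Elts A. hm A y a)"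
    proof (rule is_pointI)
      fix z assume z: "z \<in> hom (Ty A a) (Ty A a)"
        and "\<And>y. y \<in> Elts A \<Longrightarrow> ((\<lambda>y\<in>Elts A. hm A y a) y)\<degree> \<cdot> (\<lambda>y\<in>Elts A. hm A y a) y \<preceq> z"
      then have le: "hm A a a \<cdot> hm A a a \<preceq> z" using a hm_cv[OF A a a] by fastforce
      have "one (Ty A a) \<preceq> hm A a a" by (rule hm_one[OF A a])
      also have "\<dots> \<preceq> hm A a a \<cdot> hm A a a" by (rule cmp_ge_left[OF hm_one[OF A a] hm_hom[OF A a a]])
      finally show "one (Ty A a) \<preceq> z" using le leq_trans by blast
    qed (use a sqc_Ty[OF A] hm_hom[OF A] hm_trans[OF A] hm_cv[OF A] in auto)
    then show ?thesis by (simp add: I_def yo_def)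
  qed
  \<comment> \<open>Yoneda: the hom-arrow from a point into a representable is the value of the
    point.\<close>
  have yon: "h (yo a) i = snd i a" if i: "i \<in> I" and a: "a \<in> Elts A" for i a
  proof (rule leq_antisym)
    have ia: "snd i a \<in> hom (fst i) (Ty A a)" by (rule p(2)[OF i a])
    have "covered (fst i) (Ty A a) (h (yo a) i) (S (yo a) i)" using hc[OF i yoI[OF a]] by (simp add: yo_def)
    then show "h (yo a) i \<preceq> snd i a"
    proof (rule coveredD[OF _ ia])
      fix b assume "b \<in> S (yo a) i"
      then obtain y where y: "y \<in> Elts A" "b = hm A a y \<cdot> snd i y" using hm_cv[OF A a] by (auto simp: S_def yo_def)
      then show "b \<preceq> snd i a" using p(3)[OF i y(1) a] by simp
    qed
    have "snd i a \<preceq> hm A a a \<cdot> snd i a" by (rule cmp_ge_left[OF hm_one[OF A a] ia])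
    also have "\<dots> = (snd (yo a) a)\<degree> \<cdot> snd i a" using a hm_cv[OF A a a] by (simp add: yo_def)
    also have "\<dots> \<preceq> h (yo a) i" by (rule hu'[OF i yoI[OF a] a])
    finally show "snd i a \<preceq> h (yo a) i" .
  qed
  show ?thesis
  proof (rule that[OF scB, of "\<lambda>a. d (yo a)"])
    show "d (yo a) \<in> Elts B" if "a \<in> Elts A" for a using yoI[OF that] EB by blast
    show "Ty B (d (yo a)) = Ty A a" if "a \<in> Elts A" for a using TB[OF yoI[OF that]] by (simp add: yo_def)
    show "hm B (d (yo a')) (d (yo a)) = hm A a' a" if "a \<in> Elts A" "a' \<in> Elts A" for a a'
      using HB[OF yoI[OF that(1)] yoI[OF that(2)]] yon[OF yoI[OF that(1)] that(2)] that by (simp add: yo_def)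
    fix b assume "b \<in> Elts B"
    then obtain i where i: "i \<in> I" "b = d i" using EB by blast
    have "hm B b (d (yo a)) \<cdot> hm B (d (yo a)) b = (snd i a)\<degree> \<cdot> snd i a" if a: "a \<in> Elts A" for a
    proof -
      have r: "hm B (d (yo a)) b = snd i a" using i HB[OF i(1) yoI[OF a]] yon[OF i(1) a] by simp
      have "d (yo a) \<in> Elts B" using yoI[OF a] EB by blast
      then have "hm B b (d (yo a)) = (snd i a)\<degree>" using hm_cv[OF B, of b "d (yo a)"] r \<open>b \<in> Elts B\<close> by simp
      then show ?thesis using r by simp
    qed
    then have "{hm B b (d (yo a)) \<cdot> hm B (d (yo a)) b |a. a \<in> Elts A} = {(snd i a)\<degree> \<cdot> snd i a |a. a \<in> Elts A}"
      by (intro Collect_cong) metis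
    then show "covered (Ty B b) (Ty B b) (one (Ty B b)) {hm B b (d (yo a)) \<cdot> hm B (d (yo a)) b |a. a \<in> Elts A}"
      using p(4)[OF i(1)] TB[OF i(1)] i by simp
  qed
qed

end

section \<open>From order to coverings; sheaves as completed categories of sections\<close>

context site_quantaloid
begin

lemma spans_comp:
  assumes "(W, f, g) \<in> spans C T U" "T \<in> Obj C" "U \<in> Obj C" "W' \<in> Obj C" "k \<in> Hom C W' W"
  shows "(W', Comp C W' W U f k, Comp C W' W T g k) \<in> spans C T U"
  using assms C.Comp_closed by (auto simp: spans_def)

text \<open>The spans whose restrictions are related by \<open>K\<close> are stable under
  precomposition; if they cover the identity of \<open>\<iota> U\<close>, then
  \<open>\<gamma>_local\<close> at the span \<open>(1, 1)\<close> yields a covering sieve. This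
  converts inequalities above an identity of \<open>Q\<close> into statements that hold locally, for
  sections, relations and their composites.\<close>

lemma relation_local:
  fixes A B :: "('o, 'a, 'v) qcat"
  assumes A: "scc A" and B: "scc B" and U: "U \<in> Obj C" and x: "x \<in> pts A (\<iota> U)" and y: "y \<in> pts B (\<iota> U)"
    and K: "\<And>W V k a b. \<lbrakk>W \<in> Obj C; V \<in> Obj C; k \<in> Hom C V W; (a, b) \<in> K W\<rbrakk> \<Longrightarrow> (res A a (gm V W k), res B b (gm V W k)) \<in> K V"
    and cov: "\<And>w. \<lbrakk>w \<in> hom (\<iota> U) (\<iota> U);
        \<And>W f g. \<lbrakk>W \<in> Obj C; f \<in> Hom C W U; g \<in> Hom C W U; (res A x (gm W U g), res B y (gm W U f)) \<in> K W\<rbrakk> \<Longrightarrow> gm W U f \<cdot> (gm W U g)\<degree> \<preceq> w\<rbrakk>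
      \<Longrightarrow> one (\<iota> U) \<preceq> w"
  shows "{(W, s). W \<in> Obj C \<and> s \<in> Hom C W U \<and> (res A x (gm W U s), res B y (gm W U s)) \<in> K W} \<in> J U"
proof -
  define D where "D = {(W, f, g). (W, f, g) \<in> spans C U U \<and> (res A x (gm W U g), res B y (gm W U f)) \<in> K W}"
  have D: "D \<subseteq> spans C U U" by (auto simp: D_def)
  have "(U, Idn C U, Idn C U) \<in> spans C U U" using U C.Idn_closed by (simp add: spans_def)
  then have "span_sieve C U U U (Idn C U) (Idn C U) D \<in> J U"
  proof (rule_tac covered_local[OF U U D])
    fix W f g W' k assume *: "(W, f, g) \<in> D" "W' \<in> Obj C" "k \<in> Hom C W' W"
    then have W: "W \<in> Obj C" "f \<in> Hom C W U" "g \<in> Hom C W U" and sp: "(W, f, g) \<in> spans C U U" by (auto simp: D_def spans_def)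
    have "(res A (res A x (gm W U g)) (gm W' W k), res B (res B y (gm W U f)) (gm W' W k)) \<in> K W'"
      using K[OF W(1) *(2,3)] *(1) by (auto simp: D_def)
    then show "(W', Comp C W' W U f k, Comp C W' W U g k) \<in> D"
      using spans_comp[OF sp U U *(2,3)] res_res[OF A inf ptsD(1)[OF x] gm_map_pts[OF x U W(1,3)] gm_map[OF W(1) *(2,3)]]
        res_res[OF B inf ptsD(1)[OF y] gm_map_pts[OF y U W(1,2)] gm_map[OF W(1) *(2,3)]]
        gm_Comp[OF U W(1) *(2) W(2) *(3)] gm_Comp[OF U W(1) *(2) W(3) *(3)] by (simp add: D_def)
  next
    have o: "gm U U (Idn C U) \<cdot> (gm U U (Idn C U))\<degree> = one (\<iota> U)"
      using U \<iota>_closed by (simp add: gm_Idn cv_one cmp_one[OF one_hom])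
    show "covered (\<iota> U) (\<iota> U) (gm U U (Idn C U) \<cdot> (gm U U (Idn C U))\<degree>) {gm W U f \<cdot> (gm W U g)\<degree> |W f g. (W, f, g) \<in> D}" (is "covered _ _ _ ?D")
      unfolding o
    proof (rule coveredI[OF one_hom[OF \<iota>_closed[OF U]]])
      show "c \<in> hom (\<iota> U) (\<iota> U)" if "c \<in> ?D" for c using that gm_span(2)[OF U U] D by blast
      fix w assume "w \<in> hom (\<iota> U) (\<iota> U)" and le: "\<And>c. c \<in> ?D \<Longrightarrow> c \<preceq> w"
      then show "one (\<iota> U) \<preceq> w"
      proof (rule_tac cov)
        fix W f g assume "W \<in> Obj C" "f \<in> Hom C W U" "g \<in> Hom C W U" "(res A x (gm W U g), res B y (gm W U f)) \<in> K W"
        then have "(W, f, g) \<in> D" by (simp add: D_def spans_def)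
        then show "gm W U f \<cdot> (gm W U g)\<degree> \<preceq> w" using le by blast
      qed
    qed
  qed
  then show ?thesis by (simp add: D_def spans_def C.Idn_Comp U cong: conj_cong)
qed

text \<open>Each factor is generated by spans, with inner legs \<open>k\<close> and
  \<open>k'\<close>. The middle composite of \<open>k'\<close> with the opposite of \<open>k\<close>
  is covered by commuting squares, and restriction along these produces spans that share their
  middle leg. Restricting both legs only decreases the arrow of a span, so the bounds by
  \<open>h1\<close> and \<open>h2\<close> persist.\<close>

lemma composite_leq:
  assumes U: "U \<in> Obj C" and T: "T \<in> Obj C" and Y: "Y \<in> Obj C"
    and h1: "h1 \<in> hom (\<iota> U) (\<iota> Y)" and h2: "h2 \<in> hom (\<iota> Y) (\<iota> T)" and w: "w \<in> hom (\<iota> U) (\<iota> T)"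
    and le: "\<And>W f k g. \<lbrakk>W \<in> Obj C; f \<in> Hom C W T; k \<in> Hom C W Y; g \<in> Hom C W U;
        gm W T f \<cdot> (gm W Y k)\<degree> \<preceq> h2; gm W Y k \<cdot> (gm W U g)\<degree> \<preceq> h1\<rbrakk> \<Longrightarrow> gm W T f \<cdot> (gm W U g)\<degree> \<preceq> w"
  shows "h2 \<cdot> h1 \<preceq> w"
proof (rule covered_comp[OF generate_covered[OF U Y h1] generate_covered[OF Y T h2] w])
  fix d c assume "d \<in> {gm W Y f \<cdot> (gm W U g)\<degree> |W f g. (W, f, g) \<in> spans C U Y \<and> gm W Y f \<cdot> (gm W U g)\<degree> \<preceq> h1}"
    "c \<in> {gm W T f \<cdot> (gm W Y g)\<degree> |W f g. (W, f, g) \<in> spans C Y T \<and> gm W T f \<cdot> (gm W Y g)\<degree> \<preceq> h2}"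
  then obtain V f k V' k' g where c: "c = gm V T f \<cdot> (gm V Y k)\<degree>" "V \<in> Obj C" "f \<in> Hom C V T" "k \<in> Hom C V Y" "c \<preceq> h2"
    and d: "d = gm V' Y k' \<cdot> (gm V' U g)\<degree>" "V' \<in> Obj C" "k' \<in> Hom C V' Y" "g \<in> Hom C V' U" "d \<preceq> h1"
    by (auto simp: spans_def)
  have "gm V T f \<cdot> ((gm V Y k)\<degree> \<cdot> gm V' Y k') \<cdot> (gm V' U g)\<degree> \<preceq> w"
  proof (rule covered_ctx[OF cospan_covered[OF d(2) c(2) gm_map[OF Y c(2,4)] gm_map[OF Y d(2,3)]]
        gm_hom[OF T c(2,3)] cv_hom[OF gm_hom[OF U d(2,4)]] w])
    fix b assume "b \<in> {gm W V u \<cdot> (gm W V' v)\<degree> |W u v. (W, u, v) \<in> spans C V' V \<and> gm V Y k \<cdot> gm W V u = gm V' Y k' \<cdot> gm W V' v}"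
    then obtain W u v where b: "b = gm W V u \<cdot> (gm W V' v)\<degree>" "W \<in> Obj C" "u \<in> Hom C W V" "v \<in> Hom C W V'"
      "gm V Y k \<cdot> gm W V u = gm V' Y k' \<cdot> gm W V' v" by (auto simp: spans_def)
    let ?f = "Comp C W V T f u" and ?k = "Comp C W V Y k u" and ?g = "Comp C W V' U g v"
    note g = gm_Comp[OF T c(2) b(2) c(3) b(3)] gm_Comp[OF Y c(2) b(2) c(4) b(3)] gm_Comp[OF U d(2) b(2) d(4) b(4)]
    have "gm W T ?f \<cdot> (gm W Y ?k)\<degree> = gm V T f \<cdot> (gm W V u \<cdot> (gm W V u)\<degree> \<cdot> (gm V Y k)\<degree>)" by (simp add: g cv_cmp cmp_assoc)
    also have "\<dots> \<preceq> c" unfolding c(1)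
      by (rule cmp_mono_left[OF cmp_le_left[OF is_mapD(6)[OF gm_map[OF c(2) b(2,3)]] cv_hom[OF gm_hom[OF Y c(2,4)]]]])
    finally have 1: "gm W T ?f \<cdot> (gm W Y ?k)\<degree> \<preceq> h2" using c(5) leq_trans by blast
    have "gm W Y ?k \<cdot> (gm W U ?g)\<degree> = gm V' Y k' \<cdot> (gm W V' v \<cdot> (gm W V' v)\<degree> \<cdot> (gm V' U g)\<degree>)"
      unfolding g b(5) by (simp add: cv_cmp cmp_assoc)
    also have "\<dots> \<preceq> d" unfolding d(1)
      by (rule cmp_mono_left[OF cmp_le_left[OF is_mapD(6)[OF gm_map[OF d(2) b(2,4)]] cv_hom[OF gm_hom[OF U d(2,4)]]]])
    finally have 2: "gm W Y ?k \<cdot> (gm W U ?g)\<degree> \<preceq> h1" using d(5) leq_trans by blast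
    have "gm W T ?f \<cdot> (gm W U ?g)\<degree> \<preceq> w"
      by (rule le[OF b(2) C.Comp_closed[OF b(2) c(2) T b(3) c(3)] C.Comp_closed[OF b(2) c(2) Y b(3) c(4)] C.Comp_closed[OF b(2) d(2) U b(4) d(4)] 1 2])
    then show "gm V T f \<cdot> b \<cdot> (gm V' U g)\<degree> \<preceq> w" unfolding g b(1) by (simp add: cv_cmp cmp_assoc)
  qed
  then show "c \<cdot> d \<preceq> w" using c(1) d(1) by (simp add: cmp_assoc)
qed

text \<open>\<open>A\<close> is the category of sections of \<open>P\<close>: the hom-arrow between
  two sections is the join of the spans on which their restrictions agree. \<open>B\<close> is its
  completion, and a section \<open>x\<close> over \<open>U\<close> goes to the representative of
  \<open>(U, x)\<close> in \<open>B\<close>.\<close>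

lemma nv_essentially_surjective:
  assumes P: "is_sheaf C J (P :: ('c, 'b, 'v) presheaf)"
  shows "\<exists>B. scc B \<and> (\<exists>\<kappa>\<in>natural_transformations C P (nv B). \<forall>U\<in>Obj C. bij_betw (\<kappa> U) (PSet P U) (PSet (nv B) U))"
proof -
  note p = is_presheafD[OF is_sheaf_presheaf[OF P]]
  define I where "I = Sigma (Obj C) (PSet P)"
  have smI: "small TYPE('v) I" unfolding I_def
    using C_small p(1) by (intro small_Sigma[OF universe]) (auto simp: small_category_def)
  define K where "K j i = {(W, f, g). (W, f, g) \<in> spans C (fst i) (fst j) \<and> PAct P W (fst j) f (snd j) = PAct P W (fst i) g (snd i)}" for i j
  define S where "S j i = {gm W (fst j) f \<cdot> (gm W (fst i) g)\<degree> |W f g. (W, f, g) \<in> K j i}" for i j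
  define h where "h j i = jn (\<iota> (fst i)) (\<iota> (fst j)) (S j i)" for i j
  have I: "fst i \<in> Obj C" "snd i \<in> PSet P (fst i)" "\<iota> (fst i) \<in> Obj Q" if "i \<in> I" for i using that \<iota>_closed by (auto simp: I_def)
  have Ks: "(W, f, g) \<in> spans C (fst i) (fst j)" "W \<in> Obj C" "f \<in> Hom C W (fst j)" "g \<in> Hom C W (fst i)"
    "PAct P W (fst j) f (snd j) = PAct P W (fst i) g (snd i)" if "(W, f, g) \<in> K j i" for i j W f g
    using that by (auto simp: K_def spans_def)
  have sub: "S j i \<subseteq> hom (\<iota> (fst i)) (\<iota> (fst j))" if "i \<in> I" "j \<in> I" for i j
    unfolding S_def using gm_span(2)[OF I(1)[OF that(1)] I(1)[OF that(2)]] Ks(1) by blast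
  have hh: "h j i \<in> hom (\<iota> (fst i)) (\<iota> (fst j))" and hc: "covered (\<iota> (fst i)) (\<iota> (fst j)) (h j i) (S j i)"
    and hu: "\<And>b. b \<in> S j i \<Longrightarrow> b \<preceq> h j i" if "i \<in> I" "j \<in> I" for i j
    unfolding h_def using jn_props[OF I(3)[OF that(1)] I(3)[OF that(2)] sub[OF that]] by blast+
  have hu': "gm W (fst j) f \<cdot> (gm W (fst i) g)\<degree> \<preceq> h j i" if "i \<in> I" "j \<in> I" "(W, f, g) \<in> K j i" for i j W f g
    by (rule hu[OF that(1,2)]) (use that(3) in \<open>auto simp: S_def\<close>)
  \<comment> \<open>A span below the hom-arrow is a span of agreement: \<open>\<gamma>_local\<close>
    gives agreement on a covering sieve, and \<open>P\<close> is separated. Transitivity of the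
    hom-arrows and injectivity of the map into \<open>B\<close> both rest on this.\<close>
  have hK: "PAct P W (fst k) f (snd k) = PAct P W (fst j) g (snd j)"
    if j: "j \<in> I" and k: "k \<in> I" and W: "W \<in> Obj C" and f: "f \<in> Hom C W (fst k)" and g: "g \<in> Hom C W (fst j)"
      and le: "gm W (fst k) f \<cdot> (gm W (fst j) g)\<degree> \<preceq> h k j" for j k W f g
  proof -
    note o = I(1)[OF j] I(1)[OF k]
    have sp: "(W, f, g) \<in> spans C (fst j) (fst k)" using W f g by (simp add: spans_def)
    have "covered (\<iota> (fst j)) (\<iota> (fst k)) (gm W (fst k) f \<cdot> (gm W (fst j) g)\<degree>) {gm W (fst k) f \<cdot> (gm W (fst j) g)\<degree> |W f g. (W, f, g) \<in> K k j}"
      using covered_le[OF le gm_span(2)[OF o sp] hc[OF j k]] unfolding S_def .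
    then have L: "span_sieve C (fst j) (fst k) W f g (K k j) \<in> J W"
    proof (rule covered_local[OF o _ _ sp, rotated 2])
      show "K k j \<subseteq> spans C (fst j) (fst k)" by (auto simp: K_def)
      show "(T, Comp C T V (fst k) f u, Comp C T V (fst j) g u) \<in> K k j"
        if s: "(V, f, g) \<in> K k j" and T: "T \<in> Obj C" "u \<in> Hom C T V" for V f g T u
        using p(5)[OF o(1) Ks(2)[OF s] T(1) Ks(4)[OF s] T(2) I(2)[OF j]] p(5)[OF o(2) Ks(2)[OF s] T(1) Ks(3)[OF s] T(2) I(2)[OF k]]
          spans_comp[OF Ks(1)[OF s] o T] Ks(5)[OF s] by (simp add: K_def)
    qed
    show ?thesis
      by (rule sheaf_separated[OF P W L C.J_sieve[OF W L] p(3)[OF o(2) W f I(2)[OF k]] p(3)[OF o(1) W g I(2)[OF j]]])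
        (use p(5)[OF o(2) W _ f _ I(2)[OF k]] p(5)[OF o(1) W _ g _ I(2)[OF j]] in \<open>auto simp: K_def\<close>)
  qed
  have tr: "h k j \<cdot> h j i \<preceq> h k i" if i: "i \<in> I" and j: "j \<in> I" and k: "k \<in> I" for i j k
    by (rule composite_leq[OF I(1)[OF i] I(1)[OF k] I(1)[OF j] hh[OF i j] hh[OF j k] hh[OF i k]], rule hu'[OF i k])
      (use hK[OF i j] hK[OF j k] in \<open>simp add: K_def spans_def\<close>)
  have idK: "(fst i, Idn C (fst i), Idn C (fst i)) \<in> K i i" if "i \<in> I" for i
    using C.Idn_closed I[OF that] by (simp add: K_def spans_def)
  have one: "one (\<iota> (fst i)) \<preceq> h i i" if i: "i \<in> I" for i
    using hu'[OF i i idK[OF i]] I[OF i] by (simp add: gm_Idn cv_one cmp_one[OF one_hom])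
  have cvh: "h i j \<preceq> (h j i)\<degree>" if i: "i \<in> I" and j: "j \<in> I" for i j
  proof (rule coveredD[OF hc[OF j i] cv_hom[OF hh[OF i j]]])
    fix b assume "b \<in> S i j"
    then obtain W f g where b: "(W, f, g) \<in> K i j" "b = gm W (fst i) f \<cdot> (gm W (fst j) g)\<degree>" by (auto simp: S_def)
    then have "(W, g, f) \<in> K j i" by (auto simp: K_def spans_def)
    then show "b \<preceq> (h j i)\<degree>" using cv_mono[OF hu'[OF i j]] b by (simp add: cv_cmp)
  qed
  obtain A :: "('o, 'a, 'v) qcat" and a where A: "sqc A" and a: "bij_betw a I (Elts A)"
    and TA: "\<And>i. i \<in> I \<Longrightarrow> Ty A (a i) = \<iota> (fst i)" and HA: "\<And>i j. i \<in> I \<Longrightarrow> j \<in> I \<Longrightarrow> hm A (a j) (a i) = h j i"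
    by (rule sqc_exists[of I "\<lambda>i. \<iota> (fst i)" h]) (use smI I(3) hh tr one cvh in auto)
  have EA: "Elts A = a ` I" using a by (simp add: bij_betw_def)
  obtain B :: "('o, 'a, 'v) qcat" and e where B: "scc B" and e: "\<And>x. x \<in> Elts A \<Longrightarrow> e x \<in> Elts B" "\<And>x. x \<in> Elts A \<Longrightarrow> Ty B (e x) = Ty A x"
    "\<And>x x'. x \<in> Elts A \<Longrightarrow> x' \<in> Elts A \<Longrightarrow> hm B (e x') (e x) = hm A x' x"
    "\<And>b. b \<in> Elts B \<Longrightarrow> covered (Ty B b) (Ty B b) (one (Ty B b)) {hm B b (e x) \<cdot> hm B (e x) b |x. x \<in> Elts A}"
    by (rule completion[OF A universe Q_small], (rule that; assumption))
  have b: "sqc B" by (rule scc_sqc[OF B])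
  define c where "c i = e (a i)" for i
  have aI: "a i \<in> Elts A" if "i \<in> I" for i using EA that by blast
  have c: "c i \<in> Elts B" "Ty B (c i) = \<iota> (fst i)" if "i \<in> I" for i
    using e(1,2)[OF aI[OF that]] TA[OF that] by (simp_all add: c_def)
  have hc': "hm B (c j) (c i) = h j i" if "i \<in> I" "j \<in> I" for i j
    using e(3)[OF aI[OF that(1)] aI[OF that(2)]] HA[OF that] by (simp add: c_def)
  \<comment> \<open>The span \<open>(1, f)\<close> is a span of agreement for the restricted section
    and \<open>x\<close>; so the hom-arrow between them lies above
    \<open>(gm T U f)\<degree>\<close>, and the unit of \<open>gm T U f\<close> gives the
    isomorphism.\<close>
  have res_c: "rp B (c (T, PAct P T U f x)) = res B (c (U, x)) (gm T U f)"
    if U: "U \<in> Obj C" and T: "T \<in> Obj C" and f: "f \<in> Hom C T U" and x: "x \<in> PSet P U" for U T f x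
  proof -
    have i: "(U, x) \<in> I" "(T, PAct P T U f x) \<in> I" using p(3)[OF U T f x] U T x by (auto simp: I_def)
    note m = gm_map[OF U T f]
    have m': "is_map (\<iota> T) (Ty B (c (U, x))) (gm T U f)" using m c[OF i(1)] by simp
    have "(T, Idn C T, f) \<in> K (T, PAct P T U f x) (U, x)"
      using T f C.Idn_closed p(4)[OF T p(3)[OF U T f x]] by (simp add: K_def spans_def)
    from hu'[OF i this] have "(gm T U f)\<degree> \<preceq> h (T, PAct P T U f x) (U, x)"
      using T cmp_one(2)[OF is_mapD(2)[OF m]] by (simp add: gm_Idn)
    then have "(gm T U f)\<degree> \<cdot> gm T U f \<preceq> hm B (c (T, PAct P T U f x)) (c (U, x)) \<cdot> gm T U f"
      unfolding hc'[OF i] by (rule cmp_mono_right)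
    then have "one (\<iota> T) \<preceq> hm B (c (T, PAct P T U f x)) (res B (c (U, x)) (gm T U f))"
      using hm_res_right[OF B inf c(1)[OF i(1)] m' c(1)[OF i(2)]] is_mapD(5)[OF m] leq_trans by simp
    moreover note r = res_pts[OF B inf c(1)[OF i(1)] m']
    ultimately have "eqv B (c (T, PAct P T U f x)) (res B (c (U, x)) (gm T U f))"
      using c[OF i(2)] ptsD[OF r] by (simp add: eqv_def)
    then show ?thesis using rp_eq[OF b] ptsD(3)[OF r] by metis
  qed
  have \<kappa>p: "rp B (c (U, x)) \<in> pts B (\<iota> U)" if "U \<in> Obj C" "x \<in> PSet P U" for U x
    using rp_pts[OF b c(1), of "(U, x)"] c(2)[of "(U, x)"] that by (simp add: I_def)
  have nat: "rp B (c (T, PAct P T U f x)) = res B (rp B (c (U, x))) (gm T U f)"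
    if U: "U \<in> Obj C" and T: "T \<in> Obj C" and f: "f \<in> Hom C T U" and x: "x \<in> PSet P U" for U T f x
    using res_c[OF that] res_rp[OF b c(1), of "(U, x)"] U x by (simp add: I_def)
  have injc: "x = y" if U: "U \<in> Obj C" and x: "x \<in> PSet P U" and y: "y \<in> PSet P U" and eq: "rp B (c (U, x)) = rp B (c (U, y))" for U x y
  proof -
    have i: "(U, x) \<in> I" "(U, y) \<in> I" using U x y by (auto simp: I_def)
    have "eqv B (c (U, x)) (c (U, y))"
      using eqv_rp[OF b c(1)[OF i(1)]] eqv_rp[OF b c(1)[OF i(2)]] eq eqv_sym[OF b] eqv_trans[OF b] by metis
    then have le: "one (\<iota> U) \<preceq> h (U, x) (U, y)" using c[OF i(1)] hc'[OF i(2,1)] by (auto simp: eqv_def)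
    then show "x = y"
      using hK[OF i(2,1) U, of "Idn C U" "Idn C U"] U p(4)[OF U x] p(4)[OF U y] C.Idn_closed
      by (simp add: gm_Idn cv_one cmp_one[OF one_hom] \<iota>_closed)
  qed
  let ?\<kappa> = "\<lambda>U\<in>Obj C. \<lambda>x\<in>PSet P U. rp B (c (U, x))"
  have \<kappa>: "?\<kappa> \<in> natural_transformations C P (nv B)"
    by (rule natural_transformationsI[OF _ _ is_sheaf_presheaf[OF P]]) (use \<kappa>p nat in \<open>simp_all add: PAct_nv\<close>)
  have inj: "inj_on (?\<kappa> U) (PSet P U)" if "U \<in> Obj C" for U using that injc[OF that] by (auto simp: inj_on_def)
  have surj: "\<exists>x\<in>PSet P U. rp B (c (U, x)) = z" if U: "U \<in> Obj C" and z: "z \<in> pts B (\<iota> U)" for U z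
  proof -
    note dz = ptsD[OF z]
    \<comment> \<open>The diagonal on the image: with \<open>z\<close> in both places
      \<open>relation_local\<close> yields the sieve along which \<open>z\<close> restricts into the
      image. Its hypothesis holds because the sections cover \<open>z\<close>, and
      \<open>sheaf_image_local\<close> then puts \<open>z\<close> itself into the image.\<close>
    define K' where "K' W = {(r, r) |r. \<exists>x\<in>PSet P W. rp B (c (W, x)) = r}" for W
    have "{(T, k). T \<in> Obj C \<and> k \<in> Hom C T U \<and> (res B z (gm T U k), res B z (gm T U k)) \<in> K' T} \<in> J U"
    proof (rule relation_local[OF B B U z z])
      show "(res B r (gm V W k), res B r' (gm V W k)) \<in> K' V"
        if "W \<in> Obj C" "V \<in> Obj C" "k \<in> Hom C V W" "(r, r') \<in> K' W" for W V k r r'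
        using that nat[OF that(1-3)] p(3)[OF that(1-3)] by (auto simp: K'_def)
      fix w assume w: "w \<in> hom (\<iota> U) (\<iota> U)"
        and le: "\<And>W f g. \<lbrakk>W \<in> Obj C; f \<in> Hom C W U; g \<in> Hom C W U; (res B z (gm W U g), res B z (gm W U f)) \<in> K' W\<rbrakk>
          \<Longrightarrow> gm W U f \<cdot> (gm W U g)\<degree> \<preceq> w"
      have zc: "covered (\<iota> U) (\<iota> U) (one (\<iota> U)) {hm B z (e x) \<cdot> hm B (e x) z |x. x \<in> Elts A}" using e(4)[OF dz(1)] dz(2) by simp
      show "one (\<iota> U) \<preceq> w"
      proof (rule coveredD[OF zc w])
        fix d assume "d \<in> {hm B z (e x) \<cdot> hm B (e x) z |x. x \<in> Elts A}"
        then obtain i where i: "i \<in> I" "d = hm B z (c i) \<cdot> hm B (c i) z" unfolding EA c_def by blast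
        note o = I(1)[OF i(1)]
        have h: "hm B (c i) z \<in> hom (\<iota> U) (\<iota> (fst i))" "hm B z (c i) \<in> hom (\<iota> (fst i)) (\<iota> U)"
          using hm_hom[OF b] c[OF i(1)] dz by metis+
        show "d \<preceq> w" unfolding i(2)
        proof (rule composite_leq[OF U U o h w])
          fix W f k g assume W: "W \<in> Obj C" "f \<in> Hom C W U" "k \<in> Hom C W (fst i)" "g \<in> Hom C W U"
            and f: "gm W U f \<cdot> (gm W (fst i) k)\<degree> \<preceq> hm B z (c i)" and g: "gm W (fst i) k \<cdot> (gm W U g)\<degree> \<preceq> hm B (c i) z"
          have m: "is_map (\<iota> W) (Ty B (c i)) (gm W (fst i) k)" using gm_map[OF o W(1,3)] c[OF i(1)] by simp
          have "res B z (gm W U f) = res B (c i) (gm W (fst i) k)" "res B (c i) (gm W (fst i) k) = res B z (gm W U g)"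
            using res_eq_iff[OF B inf c(1)[OF i(1)] m dz(1) gm_map_pts[OF z U W(1,2)]] f
              res_eq_iff[OF B inf dz(1) gm_map_pts[OF z U W(1,4)] c(1)[OF i(1)] m] g by simp_all
          moreover have "rp B (c (W, PAct P W (fst i) k (snd i))) = res B (c i) (gm W (fst i) k)"
            using res_c[OF o W(1,3) I(2)[OF i(1)]] by simp
          ultimately have "(res B z (gm W U g), res B z (gm W U f)) \<in> K' W"
            using p(3)[OF o W(1,3) I(2)[OF i(1)]] by (auto simp: K'_def)
          then show "gm W U f \<cdot> (gm W U g)\<degree> \<preceq> w" by (rule le[OF W(1,2,4)])
        qed
      qed
    qed
    moreover have "PAct (nv B) T U k z \<in> ?\<kappa> T ` PSet P T \<longleftrightarrow> (res B z (gm T U k), res B z (gm T U k)) \<in> K' T" if "T \<in> Obj C" for T k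
      using that by (auto simp: PAct_nv[OF z] K'_def image_iff eq_commute[of "res B z _"])
    ultimately have "{(T, k). T \<in> Obj C \<and> k \<in> Hom C T U \<and> PAct (nv B) T U k z \<in> ?\<kappa> T ` PSet P T} \<in> J U"
      by (simp cong: conj_cong)
    from C.sheaf_image_local[OF P nv_sheaf[OF B] \<kappa> inj U _ this] show ?thesis using z U by auto
  qed
  have "bij_betw (?\<kappa> U) (PSet P U) (PSet (nv B) U)" if U: "U \<in> Obj C" for U
    unfolding bij_betw_def using U inj[OF U] \<kappa>p[OF U] surj[OF U] by (auto simp: image_iff)
  then show ?thesis using B \<kappa> by blast
qed

theorem SymCat_sc_equivalent_sheaves:
  "equivalent_categories (SymCat_sc Q :: (('o, 'a, 'v) qcat, _) cat) (sheaf_category C J :: (('c, 'b, 'v) presheaf, _) cat)"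
proof (rule equivalent_categoriesI[OF category_SymCat_sc category_sheaf_category nv_functor])
  show "bij_betw (nvm A B) (Hom (SymCat_sc Q) A B) (Hom (sheaf_category C J) (nv A) (nv B))"
    if "A \<in> Obj (SymCat_sc Q)" "B \<in> Obj (SymCat_sc Q)" for A B :: "('o, 'a, 'v) qcat"
    using nvm_bij that by (simp add: SymCat_sc_simps(1) sheaf_category_simps)
  fix P :: "('c, 'b, 'v) presheaf" assume "P \<in> Obj (sheaf_category C J)"
  then have P: "is_sheaf C J P" by (simp add: sheaf_category_simps)
  then obtain B \<kappa> where B: "scc B" "\<kappa> \<in> natural_transformations C P (nv B)" "\<And>U. U \<in> Obj C \<Longrightarrow> bij_betw (\<kappa> U) (PSet P U) (PSet (nv B) U)"
    using nv_essentially_surjective by blast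
  then show "\<exists>X\<in>Obj (SymCat_sc Q). \<exists>i. is_iso (sheaf_category C J) P (nv X) i"
    using nat_iso[OF P nv_sheaf[OF B(1)] B(2,3)] by (auto simp: SymCat_sc_simps(1))
qed

end

section \<open>Relations in a category of sheaves\<close>

text \<open>Isolates what the comparison of relations requires: a functor \<open>N\<close> to
  sheaves that is bijective on homs and reaches every sheaf up to a natural sectionwise bijection.
  Relations are then computed on sections although the products of \<open>T\<close> are arbitrary
  choices.\<close>

locale sheaf_model = site C J + T: category T
  for C :: "('c, 'b) cat" and J and T :: "('t, 'f) cat" +
  fixes N :: "'t \<Rightarrow> ('c, 'b, 'v) presheaf" and N' :: "'t \<Rightarrow> 't \<Rightarrow> 'f \<Rightarrow> 'c \<Rightarrow> 'v \<Rightarrow> 'v"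
  assumes universe: "universe TYPE('v)"
    and N_functor: "is_functor T (sheaf_category C J) N N'"
    and N_bij: "\<lbrakk>A \<in> Obj T; B \<in> Obj T\<rbrakk> \<Longrightarrow> bij_betw (N' A B) (Hom T A B) (natural_transformations C (N A) (N B))"
    and N_surj: "is_sheaf C J P \<Longrightarrow> \<exists>A\<in>Obj T. \<exists>\<kappa>\<in>natural_transformations C P (N A). \<forall>U\<in>Obj C. bij_betw (\<kappa> U) (PSet P U) (PSet (N A) U)"
begin

abbreviation n :: "'t \<Rightarrow> 'c \<Rightarrow> 'v set" where "n A U \<equiv> PSet (N A) U"

lemma N_sheaf: "A \<in> Obj T \<Longrightarrow> is_sheaf C J (N A)"
  using N_functor by (simp add: is_functor_def sheaf_category_simps)

lemmas N_presheaf = is_presheafD[OF is_sheaf_presheaf[OF N_sheaf]]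

lemma N'_nat: "\<lbrakk>A \<in> Obj T; B \<in> Obj T; f \<in> Hom T A B\<rbrakk> \<Longrightarrow> N' A B f \<in> natural_transformations C (N A) (N B)"
  using N_functor by (simp add: is_functor_def sheaf_category_simps)

lemma N'_in: "\<lbrakk>A \<in> Obj T; B \<in> Obj T; f \<in> Hom T A B; U \<in> Obj C; x \<in> n A U\<rbrakk> \<Longrightarrow> N' A B f U x \<in> n B U"
  using natural_transformationsD(2)[OF N'_nat] by blast

lemma N'_PAct: "\<lbrakk>A \<in> Obj T; B \<in> Obj T; f \<in> Hom T A B; U \<in> Obj C; W \<in> Obj C; s \<in> Hom C W U; x \<in> n A U\<rbrakk>
    \<Longrightarrow> N' A B f W (PAct (N A) W U s x) = PAct (N B) W U s (N' A B f U x)"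
  using natural_transformationsD(3)[OF N'_nat] by blast

lemma N'_Comp: "\<lbrakk>A \<in> Obj T; B \<in> Obj T; D \<in> Obj T; f \<in> Hom T A B; g \<in> Hom T B D; U \<in> Obj C; x \<in> n A U\<rbrakk>
    \<Longrightarrow> N' A D (Comp T A B D g f) U x = N' B D g U (N' A B f U x)"
  using N_functor by (simp add: is_functor_def sheaf_category_simps compose_def)

lemma N'_Idn: "\<lbrakk>A \<in> Obj T; U \<in> Obj C; x \<in> n A U\<rbrakk> \<Longrightarrow> N' A A (Idn T A) U x = x"
  using N_functor by (simp add: is_functor_def sheaf_category_simps)

lemma N'_eqI:
  assumes "A \<in> Obj T" "B \<in> Obj T" "f \<in> Hom T A B" "g \<in> Hom T A B"
    and "\<And>U x. U \<in> Obj C \<Longrightarrow> x \<in> n A U \<Longrightarrow> N' A B f U x = N' A B g U x"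
  shows "f = g"
proof -
  have "N' A B f = N' A B g" by (rule natural_transformations_eqI[OF N'_nat N'_nat]) (use assms in auto)
  then show ?thesis using N_bij[OF assms(1,2)] assms(3,4) by (auto simp: bij_betw_def dest: inj_onD)
qed

lemma N'_full:
  assumes "A \<in> Obj T" "B \<in> Obj T" "\<And>U x. U \<in> Obj C \<Longrightarrow> x \<in> n A U \<Longrightarrow> \<theta> U x \<in> n B U"
    and "\<And>U W s x. \<lbrakk>U \<in> Obj C; W \<in> Obj C; s \<in> Hom C W U; x \<in> n A U; PAct (N A) W U s x \<in> n A W\<rbrakk>
      \<Longrightarrow> \<theta> W (PAct (N A) W U s x) = PAct (N B) W U s (\<theta> U x)"
  shows "\<exists>f\<in>Hom T A B. \<forall>U\<in>Obj C. \<forall>x\<in>n A U. N' A B f U x = \<theta> U x"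
proof -
  have "(\<lambda>U\<in>Obj C. \<lambda>x\<in>n A U. \<theta> U x) \<in> natural_transformations C (N A) (N B)"
    by (rule natural_transformationsI[OF _ _ is_sheaf_presheaf[OF N_sheaf]]) (use assms in auto)
  then have "(\<lambda>U\<in>Obj C. \<lambda>x\<in>n A U. \<theta> U x) \<in> N' A B ` Hom T A B"
    using N_bij[OF assms(1,2)] by (simp add: bij_betw_def)
  then obtain f where f: "(\<lambda>U\<in>Obj C. \<lambda>x\<in>n A U. \<theta> U x) = N' A B f" "f \<in> Hom T A B" by (rule imageE)
  then show ?thesis by (intro bexI[OF _ f(2)]) (simp add: f(1)[symmetric])
qed

abbreviation hold_sieve :: "'t \<Rightarrow> 't \<Rightarrow> ('c \<Rightarrow> ('v \<times> 'v) set) \<Rightarrow> 'c \<Rightarrow> 'v \<Rightarrow> 'v \<Rightarrow> ('c \<times> 'b) set" where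
  "hold_sieve A B R U a b \<equiv> {(W, s). W \<in> Obj C \<and> s \<in> Hom C W U \<and> (PAct (N A) W U s a, PAct (N B) W U s b) \<in> R W}"

text \<open>Subsheaves of the product of \<open>N A\<close> and \<open>N B\<close>, written as
  families of sets of pairs. The value \<open>{}\<close> outside \<open>Obj C\<close> makes them
  extensional.\<close>

definition crel :: "'t \<Rightarrow> 't \<Rightarrow> ('c \<Rightarrow> ('v \<times> 'v) set) \<Rightarrow> bool" where
  "crel A B R \<longleftrightarrow> (\<forall>U. U \<notin> Obj C \<longrightarrow> R U = {}) \<and> (\<forall>U\<in>Obj C. R U \<subseteq> n A U \<times> n B U) \<and>
     (\<forall>U\<in>Obj C. \<forall>W\<in>Obj C. \<forall>s\<in>Hom C W U. \<forall>(a, b)\<in>R U. (PAct (N A) W U s a, PAct (N B) W U s b) \<in> R W) \<and>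
     (\<forall>U\<in>Obj C. \<forall>a\<in>n A U. \<forall>b\<in>n B U.
        hold_sieve A B R U a b \<in> J U \<longrightarrow> (a, b) \<in> R U)"

lemma crelD:
  assumes "crel A B R"
  shows "U \<notin> Obj C \<Longrightarrow> R U = {}"
    "U \<in> Obj C \<Longrightarrow> (a, b) \<in> R U \<Longrightarrow> a \<in> n A U \<and> b \<in> n B U"
    "\<lbrakk>U \<in> Obj C; W \<in> Obj C; s \<in> Hom C W U; (a, b) \<in> R U\<rbrakk> \<Longrightarrow> (PAct (N A) W U s a, PAct (N B) W U s b) \<in> R W"
    "\<lbrakk>U \<in> Obj C; a \<in> n A U; b \<in> n B U;
      hold_sieve A B R U a b \<in> J U\<rbrakk> \<Longrightarrow> (a, b) \<in> R U"
  using assms unfolding crel_def by blast+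

lemma crelI:
  assumes "\<And>U. U \<notin> Obj C \<Longrightarrow> R U = {}"
    "\<And>U a b. U \<in> Obj C \<Longrightarrow> (a, b) \<in> R U \<Longrightarrow> a \<in> n A U \<and> b \<in> n B U"
    "\<And>U W s a b. \<lbrakk>U \<in> Obj C; W \<in> Obj C; s \<in> Hom C W U; (a, b) \<in> R U\<rbrakk> \<Longrightarrow> (PAct (N A) W U s a, PAct (N B) W U s b) \<in> R W"
    "\<And>U a b. \<lbrakk>U \<in> Obj C; a \<in> n A U; b \<in> n B U;
      hold_sieve A B R U a b \<in> J U\<rbrakk> \<Longrightarrow> (a, b) \<in> R U"
  shows "crel A B R"
  unfolding crel_def
proof (intro conjI allI ballI impI)
  show "R U = {}" if "U \<notin> Obj C" for U using assms(1) that .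
  show "R U \<subseteq> n A U \<times> n B U" if "U \<in> Obj C" for U using assms(2)[OF that] by auto
  show "case x of (a, b) \<Rightarrow> (PAct (N A) W U s a, PAct (N B) W U s b) \<in> R W"
    if "U \<in> Obj C" "W \<in> Obj C" "s \<in> Hom C W U" "x \<in> R U" for U W s x
    using assms(3)[OF that(1-3)] that(4) by (cases x) simp
qed (rule assms(4))

lemma rel_sieve:
  assumes A: "A \<in> Obj T" and B: "B \<in> Obj T" and U: "U \<in> Obj C" and ab: "a \<in> n A U" "b \<in> n B U"
    and r: "\<And>U W s a b. \<lbrakk>U \<in> Obj C; W \<in> Obj C; s \<in> Hom C W U; (a, b) \<in> R U\<rbrakk> \<Longrightarrow> (PAct (N A) W U s a, PAct (N B) W U s b) \<in> R W"
  shows "is_sieve C U (hold_sieve A B R U a b)"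
  unfolding is_sieve_def
proof (safe)
  fix W s W' t assume *: "W \<in> Obj C" "s \<in> Hom C W U" "(PAct (N A) W U s a, PAct (N B) W U s b) \<in> R W" "W' \<in> Obj C" "t \<in> Hom C W' W"
  show "Comp C W' W U s t \<in> Hom C W' U" by (rule Comp_closed) (use * U in auto)
  show "(PAct (N A) W' U (Comp C W' W U s t) a, PAct (N B) W' U (Comp C W' W U s t) b) \<in> R W'"
    using r[OF *(1,4,5,3)] N_presheaf(5)[OF A U *(1,4,2,5) ab(1)] N_presheaf(5)[OF B U *(1,4,2,5) ab(2)] by simp
qed

text \<open>For a relation stable under restriction one local step already gives the closure: a
  second step adds nothing, by the local character of \<open>J\<close>
  (\<open>crel_cl\<close>).\<close>

definition cl :: "'t \<Rightarrow> 't \<Rightarrow> ('c \<Rightarrow> ('v \<times> 'v) set) \<Rightarrow> 'c \<Rightarrow> ('v \<times> 'v) set" where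
  "cl A B R U = (if U \<in> Obj C then {(a, b). a \<in> n A U \<and> b \<in> n B U \<and>
     hold_sieve A B R U a b \<in> J U} else {})"

lemma cl_props:
  assumes A: "A \<in> Obj T" and B: "B \<in> Obj T"
    and i: "\<And>U a b. U \<in> Obj C \<Longrightarrow> (a, b) \<in> R U \<Longrightarrow> a \<in> n A U \<and> b \<in> n B U"
    and r: "\<And>U W s a b. \<lbrakk>U \<in> Obj C; W \<in> Obj C; s \<in> Hom C W U; (a, b) \<in> R U\<rbrakk> \<Longrightarrow> (PAct (N A) W U s a, PAct (N B) W U s b) \<in> R W"
  shows crel_cl: "crel A B (cl A B R)"
    and cl_upper: "U \<in> Obj C \<Longrightarrow> R U \<subseteq> cl A B R U"
    and cl_least: "crel A B S \<Longrightarrow> (\<And>U. U \<in> Obj C \<Longrightarrow> R U \<subseteq> S U) \<Longrightarrow> cl A B R U \<subseteq> S U"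
proof -
  let ?S = "hold_sieve A B R"
  have pb: "sieve_pullback C W U s (?S U a b) = ?S W (PAct (N A) W U s a) (PAct (N B) W U s b)"
    if "U \<in> Obj C" "W \<in> Obj C" "s \<in> Hom C W U" "a \<in> n A U" "b \<in> n B U" for U W s a b
    unfolding sieve_pullback_def
    using N_presheaf(5)[OF A that(1,2) _ that(3) _ that(4)] N_presheaf(5)[OF B that(1,2) _ that(3) _ that(5)] Comp_closed[OF _ that(2,1) _ that(3)]
    by (intro Collect_cong) (auto simp: split_def)
  show "crel A B (cl A B R)"
  proof (rule crelI)
    fix U W s a b assume *: "U \<in> Obj C" "W \<in> Obj C" "s \<in> Hom C W U" "(a, b) \<in> cl A B R U"
    then have ab: "a \<in> n A U" "b \<in> n B U" "?S U a b \<in> J U" by (auto simp: cl_def)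
    show "(PAct (N A) W U s a, PAct (N B) W U s b) \<in> cl A B R W"
      using J_pullback[OF *(1-3) ab(3)] pb[OF *(1-3) ab(1,2)] N_presheaf(3)[OF A *(1-3) ab(1)] N_presheaf(3)[OF B *(1-3) ab(2)] *
      by (simp add: cl_def)
  next
    fix U a b assume U: "U \<in> Obj C" and ab: "a \<in> n A U" "b \<in> n B U"
      and c: "hold_sieve A B (cl A B R) U a b \<in> J U"
    have "?S U a b \<in> J U"
    proof (rule J_local[OF U c rel_sieve[OF A B U ab r]])
      fix W s assume "(W, s) \<in> hold_sieve A B (cl A B R) U a b"
      then have W: "W \<in> Obj C" "s \<in> Hom C W U" "(PAct (N A) W U s a, PAct (N B) W U s b) \<in> cl A B R W" by auto
      then show "sieve_pullback C W U s (?S U a b) \<in> J W" unfolding pb[OF U W(1,2) ab] by (auto simp: cl_def)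
    qed
    then show "(a, b) \<in> cl A B R U" using U ab by (simp add: cl_def)
  qed (auto simp: cl_def split: if_splits)
  show "R U \<subseteq> cl A B R U" if U: "U \<in> Obj C"
  proof
    fix x assume "x \<in> R U"
    then obtain a b where x: "x = (a, b)" "(a, b) \<in> R U" by (metis surj_pair)
    have "?S U a b = {(W, s). W \<in> Obj C \<and> s \<in> Hom C W U}" using r[OF U _ _ x(2)] by auto
    then show "x \<in> cl A B R U" using x i[OF U x(2)] J_max[OF U] U by (simp add: cl_def)
  qed
  show "cl A B R U \<subseteq> S U" if S: "crel A B S" and sub: "\<And>U. U \<in> Obj C \<Longrightarrow> R U \<subseteq> S U"
  proof
    fix x assume "x \<in> cl A B R U"
    then obtain a b where x: "x = (a, b)" "U \<in> Obj C" "a \<in> n A U" "b \<in> n B U" "?S U a b \<in> J U"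
      by (auto simp: cl_def split: if_splits)
    have "hold_sieve A B S U a b \<in> J U"
      by (rule J_superset[OF x(2,5) rel_sieve[OF A B x(2-4) crelD(3)[OF S]]]) (use sub in auto)
    then show "x \<in> S U" using crelD(4)[OF S x(2-4)] x(1) by simp
  qed
qed

text \<open>A tabulation in the sense of allegories. Products and pullbacks are both obtained as
  tabulations, so one universal property serves for both.\<close>

definition tab :: "'t \<Rightarrow> 't \<Rightarrow> ('c \<Rightarrow> ('v \<times> 'v) set) \<Rightarrow> 't \<Rightarrow> 'f \<Rightarrow> 'f \<Rightarrow> bool" where
  "tab A B R M f g \<longleftrightarrow> M \<in> Obj T \<and> f \<in> Hom T M A \<and> g \<in> Hom T M B \<and>
     (\<forall>U\<in>Obj C. bij_betw (\<lambda>z. (N' M A f U z, N' M B g U z)) (n M U) (R U))"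

lemma tabD:
  assumes "tab A B R M f g"
  shows "M \<in> Obj T" "f \<in> Hom T M A" "g \<in> Hom T M B"
    "U \<in> Obj C \<Longrightarrow> z \<in> n M U \<Longrightarrow> (N' M A f U z, N' M B g U z) \<in> R U"
    "\<lbrakk>U \<in> Obj C; z \<in> n M U; z' \<in> n M U; N' M A f U z = N' M A f U z'; N' M B g U z = N' M B g U z'\<rbrakk> \<Longrightarrow> z = z'"
    "\<lbrakk>U \<in> Obj C; (a, b) \<in> R U\<rbrakk> \<Longrightarrow> \<exists>z\<in>n M U. N' M A f U z = a \<and> N' M B g U z = b"
proof -
  show "M \<in> Obj T" "f \<in> Hom T M A" "g \<in> Hom T M B" using assms by (auto simp: tab_def)
  have bij: "bij_betw (\<lambda>z. (N' M A f U z, N' M B g U z)) (n M U) (R U)" if "U \<in> Obj C" for U using assms that by (auto simp: tab_def)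
  show "U \<in> Obj C \<Longrightarrow> z \<in> n M U \<Longrightarrow> (N' M A f U z, N' M B g U z) \<in> R U" using bij[of U] by (auto simp: bij_betw_def)
  show "\<lbrakk>U \<in> Obj C; z \<in> n M U; z' \<in> n M U; N' M A f U z = N' M A f U z'; N' M B g U z = N' M B g U z'\<rbrakk> \<Longrightarrow> z = z'"
    using bij[of U] by (auto simp: bij_betw_def dest: inj_onD)
  show "\<lbrakk>U \<in> Obj C; (a, b) \<in> R U\<rbrakk> \<Longrightarrow> \<exists>z\<in>n M U. N' M A f U z = a \<and> N' M B g U z = b"
    using bij[of U] by (force simp: bij_betw_def image_iff)
qed

lemma tabI:
  assumes "M \<in> Obj T" "f \<in> Hom T M A" "g \<in> Hom T M B"
    "\<And>U z. U \<in> Obj C \<Longrightarrow> z \<in> n M U \<Longrightarrow> (N' M A f U z, N' M B g U z) \<in> R U"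
    "\<And>U z z'. \<lbrakk>U \<in> Obj C; z \<in> n M U; z' \<in> n M U; N' M A f U z = N' M A f U z'; N' M B g U z = N' M B g U z'\<rbrakk> \<Longrightarrow> z = z'"
    "\<And>U a b. \<lbrakk>U \<in> Obj C; (a, b) \<in> R U\<rbrakk> \<Longrightarrow> \<exists>z\<in>n M U. N' M A f U z = a \<and> N' M B g U z = b"
  shows "tab A B R M f g"
  unfolding tab_def bij_betw_def using assms by (auto simp: inj_on_def image_iff) metis

text \<open>Pairs of sections are coded in \<open>'v\<close> by an injection \<open>p\<close>. The
  coded relation is a sheaf because amalgamations exist in each component and \<open>R\<close> is
  closed; \<open>N_surj\<close> then provides an object of \<open>T\<close> for it.\<close>

lemma tabulate:
  assumes A: "A \<in> Obj T" and B: "B \<in> Obj T" and R: "crel A B R"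
  shows "\<exists>M f g. tab A B R M f g"
proof -
  have "|UNIV \<times> UNIV :: ('v \<times> 'v) set| \<le>o |UNIV :: 'v set|"
    using card_of_Times_same_infinite[OF universe_infinite[OF universe]] ordIso_imp_ordLeq by blast
  then obtain p :: "'v \<times> 'v \<Rightarrow> 'v" where p: "inj p" unfolding card_of_ordLeq[symmetric] by auto
  have pe: "p x = p y \<longleftrightarrow> x = y" for x y using p by (auto dest: injD)
  note r = crelD[OF R] and NA = N_presheaf[OF A] and NB = N_presheaf[OF B]
  define pl where "pl = inv p"
  have pl: "pl (p x) = x" for x using p by (simp add: pl_def)
  define P :: "('c, 'b, 'v) presheaf" where
    "P = \<lparr>PSet = (\<lambda>U. p ` R U), PAct = (\<lambda>W U s. \<lambda>x\<in>p ` R U. p (PAct (N A) W U s (fst (pl x)), PAct (N B) W U s (snd (pl x))))\<rparr>"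
  have PS: "PSet P U = p ` R U" for U by (simp add: P_def)
  have PA: "PAct P W U s (p (a, b)) = p (PAct (N A) W U s a, PAct (N B) W U s b)" if "(a, b) \<in> R U" for W U s a b
    using that pl by (simp add: P_def)
  have PE: "\<exists>a b. x = p (a, b) \<and> (a, b) \<in> R U" if "x \<in> PSet P U" for x U using that by (auto simp: PS)
  have pre: "is_presheaf C P" unfolding is_presheaf_def
  proof (intro conjI ballI)
    fix U assume U: "U \<in> Obj C"
    have "small TYPE('v) (n A U \<times> n B U)" by (intro small_Sigma[OF universe] NA(1) NB(1) U)
    then have "small TYPE('v) (R U)" by (rule small_subset) (use r(2)[OF U] in auto)
    then show "small TYPE('v) (PSet P U)" unfolding PS by (rule small_image)
    show "PAct P U U (Idn C U) x = x" if x: "x \<in> PSet P U" for x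
    proof -
      obtain a b where "x = p (a, b)" "(a, b) \<in> R U" using PE[OF x] by blast
      then show ?thesis using r(2)[OF U] NA(4)[OF U] NB(4)[OF U] by (simp add: PA)
    qed
    fix W assume W: "W \<in> Obj C"
    {
      fix s assume s: "s \<in> Hom C W U"
      show "PAct P W U s \<in> PSet P U \<rightarrow>\<^sub>E PSet P W"
      proof (rule PiE_I)
        show "PAct P W U s x \<in> PSet P W" if x: "x \<in> PSet P U" for x
        proof -
          obtain a b where "x = p (a, b)" "(a, b) \<in> R U" using PE[OF x] by blast
          then show ?thesis using r(3)[OF U W s] by (simp add: PA PS)
        qed
        show "PAct P W U s x = undefined" if "x \<notin> PSet P U" for x using that by (simp add: P_def)
      qed
      fix W' t x assume W': "W' \<in> Obj C" and t: "t \<in> Hom C W' W" and x: "x \<in> PSet P U"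
      obtain a b where ab: "x = p (a, b)" "(a, b) \<in> R U" using PE[OF x] by blast
      then show "PAct P W' U (Comp C W' W U s t) x = PAct P W' W t (PAct P W U s x)"
        using r(2)[OF U ab(2)] r(3)[OF U W s ab(2)] NA(5)[OF U W W' s t] NB(5)[OF U W W' s t] by (simp add: PA)
    }
  qed
  have "is_sheaf C J P" unfolding is_sheaf_def
  proof (intro conjI pre ballI allI impI)
    fix U S x assume U: "U \<in> Obj C" and S: "S \<in> J U" and M: "matching_family C P U S x"
    note Ss = sieve_arrow[OF U S]
    define a where "a W s = fst (pl (x W s))" for W s
    define b where "b W s = snd (pl (x W s))" for W s
    have x: "x W s = p (a W s, b W s)" "(a W s, b W s) \<in> R W" if "(W, s) \<in> S" for W s
    proof -
      have "x W s \<in> p ` R W" using M that by (auto simp: matching_family_def PS)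
      then show "x W s = p (a W s, b W s)" "(a W s, b W s) \<in> R W" using pl by (auto simp: a_def b_def)
    qed
    have ab: "a W s \<in> n A W" "b W s \<in> n B W" if "(W, s) \<in> S" for W s using r(2)[OF _ x(2)[OF that]] Ss[OF that] by auto
    have m: "PAct (N A) W' W t (a W s) = a W' (Comp C W' W U s t) \<and> PAct (N B) W' W t (b W s) = b W' (Comp C W' W U s t)"
      if s: "(W, s) \<in> S" and t: "W' \<in> Obj C" "t \<in> Hom C W' W" for W s W' t
    proof -
      have "PAct P W' W t (x W s) = x W' (Comp C W' W U s t)" using M s t by (auto simp: matching_family_def)
      then show ?thesis using x(1)[OF s] x(1)[OF sieve_comp[OF U S s t]] PA[OF x(2)[OF s]] by (simp add: pe)
    qed
    have mf: "matching_family C (N A) U S a" "matching_family C (N B) U S b" unfolding matching_family_def using ab m by auto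
    have "\<exists>!z. z \<in> n A U \<and> (\<forall>(W, s)\<in>S. PAct (N A) W U s z = a W s)"
      using N_sheaf[OF A] U S mf(1) unfolding is_sheaf_def by blast
    then obtain \<alpha> where \<alpha>: "\<alpha> \<in> n A U" "\<forall>(W, s)\<in>S. PAct (N A) W U s \<alpha> = a W s" by blast
    have "\<exists>!z. z \<in> n B U \<and> (\<forall>(W, s)\<in>S. PAct (N B) W U s z = b W s)"
      using N_sheaf[OF B] U S mf(2) unfolding is_sheaf_def by blast
    then obtain \<beta> where \<beta>: "\<beta> \<in> n B U" "\<forall>(W, s)\<in>S. PAct (N B) W U s \<beta> = b W s" by blast
    have "hold_sieve A B R U \<alpha> \<beta> \<in> J U"
    proof (rule J_superset[OF U S rel_sieve[OF A B U \<alpha>(1) \<beta>(1) r(3)]], safe)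
      fix W s assume s: "(W, s) \<in> S"
      then show "W \<in> Obj C" "s \<in> Hom C W U" using Ss by auto
      have "PAct (N A) W U s \<alpha> = a W s" "PAct (N B) W U s \<beta> = b W s" using \<alpha>(2) \<beta>(2) s by auto
      then show "(PAct (N A) W U s \<alpha>, PAct (N B) W U s \<beta>) \<in> R W" using x(2)[OF s] by simp
    qed
    then have in_R: "(\<alpha>, \<beta>) \<in> R U" by (rule r(4)[OF U \<alpha>(1) \<beta>(1)])
    show "\<exists>!z. z \<in> PSet P U \<and> (\<forall>(W, s)\<in>S. PAct P W U s z = x W s)"
    proof (rule ex1I[of _ "p (\<alpha>, \<beta>)"])
      show "p (\<alpha>, \<beta>) \<in> PSet P U \<and> (\<forall>(W, s)\<in>S. PAct P W U s (p (\<alpha>, \<beta>)) = x W s)"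
      proof (intro conjI ballI, unfold split_paired_all prod.case)
        show "p (\<alpha>, \<beta>) \<in> PSet P U" using in_R by (simp add: PS)
        fix W s assume s: "(W, s) \<in> S"
        have "PAct (N A) W U s \<alpha> = a W s" "PAct (N B) W U s \<beta> = b W s" using \<alpha>(2) \<beta>(2) s by auto
        then show "PAct P W U s (p (\<alpha>, \<beta>)) = x W s" using PA[OF in_R] x(1)[OF s] by simp
      qed
      fix z assume z: "z \<in> PSet P U \<and> (\<forall>(W, s)\<in>S. PAct P W U s z = x W s)"
      then obtain a' b' where z': "z = p (a', b')" "(a', b') \<in> R U" using PE by blast
      have eq: "PAct (N A) W U s a' = PAct (N A) W U s \<alpha> \<and> PAct (N B) W U s b' = PAct (N B) W U s \<beta>" if s: "(W, s) \<in> S" for W s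
      proof -
        have "PAct P W U s z = x W s" using z s by blast
        then have "p (PAct (N A) W U s a', PAct (N B) W U s b') = p (a W s, b W s)" using PA[OF z'(2)] x(1)[OF s] z'(1) by simp
        then have "PAct (N A) W U s a' = a W s \<and> PAct (N B) W U s b' = b W s" by (simp add: pe)
        moreover have "PAct (N A) W U s \<alpha> = a W s" "PAct (N B) W U s \<beta> = b W s" using \<alpha>(2) \<beta>(2) s by auto
        ultimately show ?thesis by simp
      qed
      have "a' = \<alpha>" by (rule sheaf_separated[OF N_sheaf[OF A] U S J_sieve[OF U S] _ \<alpha>(1)]) (use eq r(2)[OF U z'(2)] in auto)
      moreover have "b' = \<beta>" by (rule sheaf_separated[OF N_sheaf[OF B] U S J_sieve[OF U S] _ \<beta>(1)]) (use eq r(2)[OF U z'(2)] in auto)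
      ultimately show "z = p (\<alpha>, \<beta>)" using z' by simp
    qed
  qed
  from N_surj[OF this] obtain M \<kappa> where M: "M \<in> Obj T" and \<kappa>: "\<kappa> \<in> natural_transformations C P (N M)"
    and bij: "\<And>U. U \<in> Obj C \<Longrightarrow> bij_betw (\<kappa> U) (PSet P U) (n M U)" by blast
  define i where "i U = inv_into (PSet P U) (\<kappa> U)" for U
  have i: "i U z \<in> PSet P U" "\<kappa> U (i U z) = z" if "U \<in> Obj C" "z \<in> n M U" for U z
    using bij[OF that(1)] that(2) unfolding bij_betw_def i_def by (auto simp: f_inv_into_f intro: inv_into_into)
  have i': "i U (\<kappa> U y) = y" if "U \<in> Obj C" "y \<in> PSet P U" for U y
    using bij[OF that(1)] that(2) unfolding bij_betw_def i_def by simp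
  have iR: "pl (i U z) \<in> R U" "p (pl (i U z)) = i U z" if "U \<in> Obj C" "z \<in> n M U" for U z
    using i(1)[OF that] pl by (auto simp: PS)
  have inat: "pl (i W (PAct (N M) W U s z)) = (PAct (N A) W U s (fst (pl (i U z))), PAct (N B) W U s (snd (pl (i U z))))"
    if *: "U \<in> Obj C" "W \<in> Obj C" "s \<in> Hom C W U" "z \<in> n M U" for U W s z
  proof -
    have "\<kappa> W (PAct P W U s (i U z)) = PAct (N M) W U s z"
      using natural_transformationsD(3)[OF \<kappa> *(1-3) i(1)[OF *(1,4)]] i(2)[OF *(1,4)] by simp
    then have "i W (PAct (N M) W U s z) = PAct P W U s (i U z)"
      using i'[OF *(2) is_presheafD(3)[OF pre *(1-3) i(1)[OF *(1,4)]]] by simp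
    also have "\<dots> = p (PAct (N A) W U s (fst (pl (i U z))), PAct (N B) W U s (snd (pl (i U z))))"
      using PA[of "fst (pl (i U z))" "snd (pl (i U z))" U W s] iR[OF *(1,4)] by simp
    finally show ?thesis by (simp add: pl)
  qed
  have mem: "fst (pl (i U z)) \<in> n A U" "snd (pl (i U z)) \<in> n B U" if "U \<in> Obj C" "z \<in> n M U" for U z
    using r(2)[OF that(1), of "fst (pl (i U z))" "snd (pl (i U z))"] iR(1)[OF that] by auto
  obtain f where f: "f \<in> Hom T M A" "\<And>U z. U \<in> Obj C \<Longrightarrow> z \<in> n M U \<Longrightarrow> N' M A f U z = fst (pl (i U z))"
    using N'_full[OF M A, of "\<lambda>U z. fst (pl (i U z))"] mem(1) inat by fastforce
  obtain g where g: "g \<in> Hom T M B" "\<And>U z. U \<in> Obj C \<Longrightarrow> z \<in> n M U \<Longrightarrow> N' M B g U z = snd (pl (i U z))"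
    using N'_full[OF M B, of "\<lambda>U z. snd (pl (i U z))"] mem(2) inat by fastforce
  have "tab A B R M f g"
  proof (rule tabI[OF M f(1) g(1)])
    fix U z assume z: "U \<in> Obj C" "z \<in> n M U"
    show "(N' M A f U z, N' M B g U z) \<in> R U" using f g iR z by simp
    fix z' assume z': "z' \<in> n M U" "N' M A f U z = N' M A f U z'" "N' M B g U z = N' M B g U z'"
    then have "pl (i U z) = pl (i U z')" using f g z by (simp add: prod_eq_iff)
    then have "i U z = i U z'" using iR(2) z z' by metis
    then show "z = z'" using i(2) z z' by metis
  next
    fix U a b assume U: "U \<in> Obj C" and ab: "(a, b) \<in> R U"
    have "p (a, b) \<in> PSet P U" using ab by (simp add: PS)
    then have z: "\<kappa> U (p (a, b)) \<in> n M U" "i U (\<kappa> U (p (a, b))) = p (a, b)" using natural_transformationsD(2)[OF \<kappa> U] i'[OF U] by auto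
    then show "\<exists>z\<in>n M U. N' M A f U z = a \<and> N' M B g U z = b" using f g U pl by (intro bexI[OF _ z(1)]) simp
  qed
  then show ?thesis by blast
qed

text \<open>The legs are jointly injective, so the factorisation is forced on each section; this
  also makes it natural and unique.\<close>

lemma tab_universal:
  assumes A: "A \<in> Obj T" and B: "B \<in> Obj T" and t: "tab A B R M f g" and Z: "Z \<in> Obj T" and f': "f' \<in> Hom T Z A" and g': "g' \<in> Hom T Z B"
    and r: "\<And>U z. U \<in> Obj C \<Longrightarrow> z \<in> n Z U \<Longrightarrow> (N' Z A f' U z, N' Z B g' U z) \<in> R U"
  shows "\<exists>!h. h \<in> Hom T Z M \<and> Comp T Z M A f h = f' \<and> Comp T Z M B g h = g'"
proof -
  note d = tabD[OF t]
  have "\<forall>U z. \<exists>y. U \<in> Obj C \<longrightarrow> z \<in> n Z U \<longrightarrow> y \<in> n M U \<and> N' M A f U y = N' Z A f' U z \<and> N' M B g U y = N' Z B g' U z"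
    using d(6)[OF _ r] by blast
  then obtain \<theta> where \<theta>: "\<And>U z. U \<in> Obj C \<Longrightarrow> z \<in> n Z U \<Longrightarrow> \<theta> U z \<in> n M U \<and> N' M A f U (\<theta> U z) = N' Z A f' U z \<and> N' M B g U (\<theta> U z) = N' Z B g' U z"
    by metis
  have "\<exists>h\<in>Hom T Z M. \<forall>U\<in>Obj C. \<forall>x\<in>n Z U. N' Z M h U x = \<theta> U x"
  proof (rule N'_full[OF Z d(1)])
    show "\<theta> U z \<in> n M U" if "U \<in> Obj C" "z \<in> n Z U" for U z using \<theta>[OF that] by blast
    fix U W s z assume *: "U \<in> Obj C" "W \<in> Obj C" "s \<in> Hom C W U" "z \<in> n Z U" "PAct (N Z) W U s z \<in> n Z W"
    note t1 = \<theta>[OF *(1,4)] and t2 = \<theta>[OF *(2,5)]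
    show "\<theta> W (PAct (N Z) W U s z) = PAct (N M) W U s (\<theta> U z)"
    proof (rule d(5)[OF *(2)])
      show "\<theta> W (PAct (N Z) W U s z) \<in> n M W" using t2 by blast
      show "PAct (N M) W U s (\<theta> U z) \<in> n M W" using N_presheaf(3)[OF d(1) *(1-3)] t1 by blast
      show "N' M A f W (\<theta> W (PAct (N Z) W U s z)) = N' M A f W (PAct (N M) W U s (\<theta> U z))"
        using t1 t2 N'_PAct[OF d(1) A d(2) *(1-3)] N'_PAct[OF Z A f' *(1-4)] by simp
      show "N' M B g W (\<theta> W (PAct (N Z) W U s z)) = N' M B g W (PAct (N M) W U s (\<theta> U z))"
        using t1 t2 N'_PAct[OF d(1) B d(3) *(1-3)] N'_PAct[OF Z B g' *(1-4)] by simp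
    qed
  qed
  then obtain h where h: "h \<in> Hom T Z M" "\<And>U x. U \<in> Obj C \<Longrightarrow> x \<in> n Z U \<Longrightarrow> N' Z M h U x = \<theta> U x" by blast
  show ?thesis
  proof (rule ex1I[of _ h], intro conjI)
    show "h \<in> Hom T Z M" by fact
    show "Comp T Z M A f h = f'"
      by (rule N'_eqI[OF Z A T.Comp_closed[OF Z d(1) A h(1) d(2)] f']) (use N'_Comp[OF Z d(1) A h(1) d(2)] h \<theta> in auto)
    show "Comp T Z M B g h = g'"
      by (rule N'_eqI[OF Z B T.Comp_closed[OF Z d(1) B h(1) d(3)] g']) (use N'_Comp[OF Z d(1) B h(1) d(3)] h \<theta> in auto)
    fix k assume k: "k \<in> Hom T Z M \<and> Comp T Z M A f k = f' \<and> Comp T Z M B g k = g'"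
    show "k = h"
    proof (rule N'_eqI[OF Z d(1) _ h(1)])
      show "k \<in> Hom T Z M" using k by blast
      fix U x assume x: "U \<in> Obj C" "x \<in> n Z U"
      have "N' M A f U (N' Z M k U x) = N' Z A f' U x" "N' M B g U (N' Z M k U x) = N' Z B g' U x"
        using N'_Comp[OF Z d(1) A _ d(2) x] N'_Comp[OF Z d(1) B _ d(3) x] k by auto
      then show "N' Z M k U x = N' Z M h U x"
        using d(5)[OF x(1)] N'_in[OF Z d(1) _ x] k \<theta>[OF x] h(2)[OF x] by simp
    qed
  qed
qed

section \<open>Products, pullbacks and monomorphisms computed on sections\<close>

definition full :: "'t \<Rightarrow> 't \<Rightarrow> 'c \<Rightarrow> ('v \<times> 'v) set" where
  "full A B U = (if U \<in> Obj C then n A U \<times> n B U else {})"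

lemma crel_full: "A \<in> Obj T \<Longrightarrow> B \<in> Obj T \<Longrightarrow> crel A B (full A B)"
  by (rule crelI) (auto simp: full_def N_presheaf(3) split: if_splits)

lemma is_product_tab:
  assumes A: "A \<in> Obj T" and B: "B \<in> Obj T" and t: "tab A B (full A B) P p q"
  shows "is_product T A B (P, p, q)"
  unfolding is_product_def prod.case
proof (intro conjI ballI)
  note d = tabD[OF t]
  show "P \<in> Obj T" "p \<in> Hom T P A" "q \<in> Hom T P B" by (fact d)+
  fix Z f g assume Z: "Z \<in> Obj T" and f: "f \<in> Hom T Z A" and g: "g \<in> Hom T Z B"
  show "\<exists>!h. h \<in> Hom T Z P \<and> Comp T Z P A p h = f \<and> Comp T Z P B q h = g"
    by (rule tab_universal[OF A B t Z f g]) (use N'_in[OF Z A f] N'_in[OF Z B g] in \<open>auto simp: full_def\<close>)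
qed

text \<open>\<open>Prd\<close> is an arbitrary product. The two universal properties compare it with
  a tabulation of the full relation, and the comparison arrows carry the description by pairs of
  sections over to it.\<close>

lemma tab_Prd:
  assumes A: "A \<in> Obj T" and B: "B \<in> Obj T"
  shows "tab A B (full A B) (Prd T A B) (pr1 T A B) (pr2 T A B)"
proof -
  obtain P p q where t: "tab A B (full A B) P p q" using tabulate[OF A B crel_full[OF A B]] by blast
  note d = tabD[OF t]
  have "is_product T A B (product_cone T A B)" unfolding product_cone_def by (rule someI[of "is_product T A B", OF is_product_tab[OF A B t]])
  then have ip: "is_product T A B (Prd T A B, pr1 T A B, pr2 T A B)" by (simp add: Prd_def pr1_def pr2_def)
  let ?P = "Prd T A B" and ?p = "pr1 T A B" and ?q = "pr2 T A B"
  have P: "?P \<in> Obj T" "?p \<in> Hom T ?P A" "?q \<in> Hom T ?P B"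
    and u: "\<And>Z f g. \<lbrakk>Z \<in> Obj T; f \<in> Hom T Z A; g \<in> Hom T Z B\<rbrakk> \<Longrightarrow> \<exists>!h. h \<in> Hom T Z ?P \<and> Comp T Z ?P A ?p h = f \<and> Comp T Z ?P B ?q h = g"
    using ip unfolding is_product_def by auto
  obtain k where k: "k \<in> Hom T P ?P" "Comp T P ?P A ?p k = p" "Comp T P ?P B ?q k = q" using u[OF d(1-3)] by blast
  have "\<exists>!h. h \<in> Hom T ?P P \<and> Comp T ?P P A p h = ?p \<and> Comp T ?P P B q h = ?q"
    by (rule tab_universal[OF A B t P]) (use N'_in[OF P(1) A P(2)] N'_in[OF P(1) B P(3)] in \<open>auto simp: full_def\<close>)
  then obtain h where h: "h \<in> Hom T ?P P" "Comp T ?P P A p h = ?p" "Comp T ?P P B q h = ?q" by blast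
  have "Comp T ?P P ?P k h = Idn T ?P"
  proof -
    have "Comp T ?P ?P A ?p (Comp T ?P P ?P k h) = ?p" "Comp T ?P ?P B ?q (Comp T ?P P ?P k h) = ?q"
      using T.Comp_assoc[OF P(1) d(1) P(1) A h(1) k(1) P(2)] T.Comp_assoc[OF P(1) d(1) P(1) B h(1) k(1) P(3)] k h by simp_all
    then show ?thesis
      using u[OF P] T.Comp_closed[OF P(1) d(1) P(1) h(1) k(1)] T.Idn_closed[OF P(1)] T.Comp_Idn[OF P(1) A P(2)] T.Comp_Idn[OF P(1) B P(3)] by blast
  qed
  then have kh: "N' P ?P k U (N' ?P P h U z) = z" if "U \<in> Obj C" "z \<in> n ?P U" for U z
    using N'_Comp[OF P(1) d(1) P(1) h(1) k(1) that] N'_Idn[OF P(1) that] by simp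
  show ?thesis
  proof (rule tabI[OF P])
    fix U z assume U: "U \<in> Obj C" and z: "z \<in> n ?P U"
    show "(N' ?P A ?p U z, N' ?P B ?q U z) \<in> full A B U" using N'_in[OF P(1) A P(2) U z] N'_in[OF P(1) B P(3) U z] U by (simp add: full_def)
    fix z' assume z': "z' \<in> n ?P U" "N' ?P A ?p U z = N' ?P A ?p U z'" "N' ?P B ?q U z = N' ?P B ?q U z'"
    have e: "N' P A p U (N' ?P P h U y) = N' ?P A ?p U y" "N' P B q U (N' ?P P h U y) = N' ?P B ?q U y" if "y \<in> n ?P U" for y
      using N'_Comp[OF P(1) d(1) A h(1) d(2) U that] N'_Comp[OF P(1) d(1) B h(1) d(3) U that] h by simp_all
    have "N' ?P P h U z = N' ?P P h U z'"
      using d(5)[OF U N'_in[OF P(1) d(1) h(1) U z] N'_in[OF P(1) d(1) h(1) U z'(1)]] e[OF z] e[OF z'(1)] z'(2,3) by simp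
    then show "z = z'" using kh[OF U z] kh[OF U z'(1)] by metis
  next
    fix U a b assume U: "U \<in> Obj C" and "(a, b) \<in> full A B U"
    then obtain z where z: "z \<in> n P U" "N' P A p U z = a" "N' P B q U z = b" using d(6)[OF U] by blast
    then show "\<exists>z\<in>n ?P U. N' ?P A ?p U z = a \<and> N' ?P B ?q U z = b"
      using N'_in[OF d(1) P(1) k(1) U z(1)] N'_Comp[OF d(1) P(1) A k(1) P(2) U z(1)] N'_Comp[OF d(1) P(1) B k(1) P(3) U z(1)] k
      by (intro bexI[of _ "N' P ?P k U z"]) simp_all
  qed
qed

text \<open>Closed because \<open>N B\<close> is separated: two sections of it that agree on a cover
  are equal.\<close>

lemma crel_pullback:
  assumes M: "M \<in> Obj T" and L: "L \<in> Obj T" and B: "B \<in> Obj T" and f: "f \<in> Hom T M B" and g: "g \<in> Hom T L B"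
  shows "crel M L (\<lambda>U. if U \<in> Obj C then {(u, v). u \<in> n M U \<and> v \<in> n L U \<and> N' M B f U u = N' L B g U v} else {})" (is "crel M L ?X")
proof (rule crelI)
  show "(PAct (N M) W U s u, PAct (N L) W U s v) \<in> ?X W" if *: "U \<in> Obj C" "W \<in> Obj C" "s \<in> Hom C W U" "(u, v) \<in> ?X U" for U W s u v
    using that N'_PAct[OF M B f *(1-3)] N'_PAct[OF L B g *(1-3)] N_presheaf(3)[OF M *(1-3)] N_presheaf(3)[OF L *(1-3)] by auto
  fix U u v assume U: "U \<in> Obj C" and uv: "u \<in> n M U" "v \<in> n L U"
    and J: "hold_sieve M L ?X U u v \<in> J U" (is "?J \<in> _")
  have "N' M B f U u = N' L B g U v"
  proof (rule sheaf_separated[OF N_sheaf[OF B] U J J_sieve[OF U J] N'_in[OF M B f U uv(1)] N'_in[OF L B g U uv(2)]])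
    fix W s assume "(W, s) \<in> ?J"
    then show "PAct (N B) W U s (N' M B f U u) = PAct (N B) W U s (N' L B g U v)"
      using N'_PAct[OF M B f U _ _ uv(1), of W s] N'_PAct[OF L B g U _ _ uv(2), of W s] by auto
  qed
  then show "(u, v) \<in> ?X U" using U uv by simp
qed (auto split: if_splits)

lemma pullback_tab:
  assumes M: "M \<in> Obj T" and L: "L \<in> Obj T" and B: "B \<in> Obj T" and f: "f \<in> Hom T M B" and g: "g \<in> Hom T L B"
  shows "\<exists>W a b. W \<in> Obj T \<and> a \<in> Hom T W M \<and> b \<in> Hom T W L \<and> Comp T W M B f a = Comp T W L B g b \<and>
    (\<forall>U\<in>Obj C. \<forall>u\<in>n M U. \<forall>v\<in>n L U. N' M B f U u = N' L B g U v \<longrightarrow> (\<exists>z\<in>n W U. N' W M a U z = u \<and> N' W L b U z = v)) \<and>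
    is_pullback T M L B f g W a b"
proof -
  let ?X = "\<lambda>U. if U \<in> Obj C then {(u, v). u \<in> n M U \<and> v \<in> n L U \<and> N' M B f U u = N' L B g U v} else {}"
  obtain W a b where t: "tab M L ?X W a b" using tabulate[OF M L crel_pullback[OF assms]] by blast
  note d = tabD[OF t]
  have e: "Comp T W M B f a = Comp T W L B g b"
  proof (rule N'_eqI[OF d(1) B T.Comp_closed[OF d(1) M B d(2) f] T.Comp_closed[OF d(1) L B d(3) g]])
    fix U z assume z: "U \<in> Obj C" "z \<in> n W U"
    show "N' W B (Comp T W M B f a) U z = N' W B (Comp T W L B g b) U z"
      using d(4)[OF z] z N'_Comp[OF d(1) M B d(2) f z] N'_Comp[OF d(1) L B d(3) g z] by simp
  qed
  have "is_pullback T M L B f g W a b" unfolding is_pullback_def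
  proof (intro conjI ballI impI d(1-3) e)
    fix Z c d' assume Z: "Z \<in> Obj T" and c: "c \<in> Hom T Z M" and d': "d' \<in> Hom T Z L" and eq: "Comp T Z M B f c = Comp T Z L B g d'"
    show "\<exists>!h. h \<in> Hom T Z W \<and> Comp T Z W M a h = c \<and> Comp T Z W L b h = d'"
    proof (rule tab_universal[OF M L t Z c d'])
      fix U z assume z: "U \<in> Obj C" "z \<in> n Z U"
      show "(N' Z M c U z, N' Z L d' U z) \<in> ?X U"
        using z eq N'_in[OF Z M c z] N'_in[OF Z L d' z] N'_Comp[OF Z M B c f z] N'_Comp[OF Z L B d' g z] by simp
    qed
  qed
  moreover have "\<exists>z\<in>n W U. N' W M a U z = u \<and> N' W L b U z = v"
    if "U \<in> Obj C" "u \<in> n M U" "v \<in> n L U" "N' M B f U u = N' L B g U v" for U u v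
    by (rule d(6)[OF that(1)]) (use that in simp)
  ultimately show ?thesis using d(1-3) e by blast
qed

text \<open>The kernel pair of a monomorphism has equal legs, and by \<open>pullback_tab\<close> it
  contains every pair of sections with the same image; so the components are injective.\<close>

lemma mono_iff:
  assumes P: "P \<in> Obj T"
  shows "(M, m) \<in> monos_into T P \<longleftrightarrow> M \<in> Obj T \<and> m \<in> Hom T M P \<and> (\<forall>U\<in>Obj C. inj_on (N' M P m U) (n M U))"
proof (intro iffI conjI)
  assume mm: "(M, m) \<in> monos_into T P"
  then show M: "M \<in> Obj T" and m: "m \<in> Hom T M P" by (auto simp: monos_into_def)
  obtain L k l where d: "L \<in> Obj T" "k \<in> Hom T L M" "l \<in> Hom T L M" "Comp T L M P m k = Comp T L M P m l"
    and ex: "\<And>U z z'. \<lbrakk>U \<in> Obj C; z \<in> n M U; z' \<in> n M U; N' M P m U z = N' M P m U z'\<rbrakk> \<Longrightarrow> \<exists>w\<in>n L U. N' L M k U w = z \<and> N' L M l U w = z'"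
    using pullback_tab[OF M M P m m] by blast
  have kl: "k = l" using mm d by (auto simp: monos_into_def)
  show "\<forall>U\<in>Obj C. inj_on (N' M P m U) (n M U)"
  proof (intro ballI inj_onI)
    fix U z z' assume U: "U \<in> Obj C" and z: "z \<in> n M U" "z' \<in> n M U" "N' M P m U z = N' M P m U z'"
    then show "z = z'" using ex kl by blast
  qed
next
  assume *: "M \<in> Obj T \<and> m \<in> Hom T M P \<and> (\<forall>U\<in>Obj C. inj_on (N' M P m U) (n M U))"
  then have M: "M \<in> Obj T" and m: "m \<in> Hom T M P" by auto
  have "h = k" if Z: "Z \<in> Obj T" and h: "h \<in> Hom T Z M" and k: "k \<in> Hom T Z M" and e: "Comp T Z M P m h = Comp T Z M P m k" for Z h k
  proof (rule N'_eqI[OF Z M h k])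
    fix U x assume x: "U \<in> Obj C" "x \<in> n Z U"
    have "N' M P m U (N' Z M h U x) = N' M P m U (N' Z M k U x)"
      using e N'_Comp[OF Z M P h m x] N'_Comp[OF Z M P k m x] by simp
    then show "N' Z M h U x = N' Z M k U x"
      using * x N'_in[OF Z M h x] N'_in[OF Z M k x] by (auto dest: inj_onD)
  qed
  then show "(M, m) \<in> monos_into T P" using M m by (auto simp: monos_into_def)
qed

section \<open>Subobjects of a product as closed relations\<close>

definition rl :: "'t \<Rightarrow> 't \<Rightarrow> 't \<times> 'f \<Rightarrow> 'c \<Rightarrow> ('v \<times> 'v) set" where
  "rl A B = (\<lambda>(M, m) U. if U \<in> Obj C then
     (\<lambda>z. (N' (Prd T A B) A (pr1 T A B) U (N' M (Prd T A B) m U z), N' (Prd T A B) B (pr2 T A B) U (N' M (Prd T A B) m U z))) ` n M U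
     else {})"

context
  fixes A B assumes A: "A \<in> Obj T" and B: "B \<in> Obj T"
begin

abbreviation (input) P where "P \<equiv> Prd T A B"

lemmas Pd = tabD[OF tab_Prd[OF A B]]

lemma rl_in: "U \<in> Obj C \<Longrightarrow> M \<in> Obj T \<Longrightarrow> m \<in> Hom T M P \<Longrightarrow> (a, b) \<in> rl A B (M, m) U \<Longrightarrow> a \<in> n A U \<and> b \<in> n B U"
  by (auto simp: rl_def intro!: N'_in[OF Pd(1) A Pd(2)] N'_in[OF Pd(1) B Pd(3)] N'_in[OF _ Pd(1)])

lemma rl_PAct:
  assumes M: "M \<in> Obj T" and m: "m \<in> Hom T M P" and U: "U \<in> Obj C" and W: "W \<in> Obj C" and s: "s \<in> Hom C W U" and ab: "(a, b) \<in> rl A B (M, m) U"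
  shows "(PAct (N A) W U s a, PAct (N B) W U s b) \<in> rl A B (M, m) W"
proof -
  obtain z where z: "z \<in> n M U" "a = N' P A (pr1 T A B) U (N' M P m U z)" "b = N' P B (pr2 T A B) U (N' M P m U z)"
    using ab U by (auto simp: rl_def)
  have mz: "N' M P m U z \<in> n P U" by (rule N'_in[OF M Pd(1) m U z(1)])
  show ?thesis unfolding rl_def using W z N_presheaf(3)[OF M U W s z(1)] N'_PAct[OF M Pd(1) m U W s z(1)]
      N'_PAct[OF Pd(1) A Pd(2) U W s mz] N'_PAct[OF Pd(1) B Pd(3) U W s mz] by (auto intro!: image_eqI)
qed

text \<open>For an arbitrary arrow into the product, stability under restriction is all that
  \<open>rl_PAct\<close> gives. For a monomorphism, a pair that is related locally is a section of
  the product lying locally in the image, and \<open>sheaf_image_local\<close> puts it into the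
  image.\<close>

lemma mono_rl_crel: assumes m: "(M, m) \<in> monos_into T P" shows "crel A B (rl A B (M, m))"
proof (rule crelI)
  have M: "M \<in> Obj T" "m \<in> Hom T M P" and inj: "\<And>U. U \<in> Obj C \<Longrightarrow> inj_on (N' M P m U) (n M U)" using m mono_iff[OF Pd(1)] by auto
  show "rl A B (M, m) U = {}" if "U \<notin> Obj C" for U using that by (simp add: rl_def)
  show "a \<in> n A U \<and> b \<in> n B U" if "U \<in> Obj C" "(a, b) \<in> rl A B (M, m) U" for U a b using rl_in that M by blast
  show "(PAct (N A) W U s a, PAct (N B) W U s b) \<in> rl A B (M, m) W"
    if "U \<in> Obj C" "W \<in> Obj C" "s \<in> Hom C W U" "(a, b) \<in> rl A B (M, m) U" for U W s a b using rl_PAct[OF M that] .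
  fix U a b assume U: "U \<in> Obj C" and ab: "a \<in> n A U" "b \<in> n B U"
    and S: "hold_sieve A B (rl A B (M, m)) U a b \<in> J U" (is "?S \<in> _")
  obtain y where y: "y \<in> n P U" "N' P A (pr1 T A B) U y = a" "N' P B (pr2 T A B) U y = b"
    using Pd(6)[OF U, of a b] ab U by (auto simp: full_def)
  have ex: "\<exists>z. z \<in> n M W \<and> N' M P m W z = PAct (N P) W U s y" if s: "(W, s) \<in> ?S" for W s
  proof -
    have W: "W \<in> Obj C" "s \<in> Hom C W U" using s by auto
    obtain z where z: "z \<in> n M W" "N' P A (pr1 T A B) W (N' M P m W z) = PAct (N A) W U s a" "N' P B (pr2 T A B) W (N' M P m W z) = PAct (N B) W U s b"
      using s by (auto simp: rl_def)
    have "N' M P m W z = PAct (N P) W U s y"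
      by (rule Pd(5)[OF W(1) N'_in[OF M(1) Pd(1) M(2) W(1) z(1)] N_presheaf(3)[OF Pd(1) U W y(1)]])
        (use z y N'_PAct[OF Pd(1) A Pd(2) U W y(1)] N'_PAct[OF Pd(1) B Pd(3) U W y(1)] in auto)
    then show ?thesis using z(1) by blast
  qed
  have "?S = {(W, s). W \<in> Obj C \<and> s \<in> Hom C W U \<and> PAct (N P) W U s y \<in> N' M P m W ` n M W}" (is "_ = ?S'")
  proof
    have "(W, s) \<in> ?S'" if s: "(W, s) \<in> ?S" for W s using ex[OF s] s by (auto intro: rev_image_eqI)
    then show "?S \<subseteq> ?S'" by auto
    have "(W, s) \<in> ?S" if "W \<in> Obj C" "s \<in> Hom C W U" "z \<in> n M W" "PAct (N P) W U s y = N' M P m W z" for W s z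
      using that y N'_PAct[OF Pd(1) A Pd(2) U that(1,2) y(1)] N'_PAct[OF Pd(1) B Pd(3) U that(1,2) y(1)]
      by (auto simp: rl_def intro!: rev_image_eqI[OF that(3)])
    then show "?S' \<subseteq> ?S" by auto
  qed
  then have "y \<in> N' M P m U ` n M U"
    using S sheaf_image_local[OF N_sheaf[OF M(1)] N_sheaf[OF Pd(1)] N'_nat[OF M(1) Pd(1) M(2)] inj U y(1)] by simp
  then obtain z where z: "z \<in> n M U" "N' M P m U z = y" by blast
  then show "(a, b) \<in> rl A B (M, m) U" using U y z by (auto simp: rl_def intro!: image_eqI)
qed

lemma pair_exists:
  assumes Z: "Z \<in> Obj T" and f: "f \<in> Hom T Z A" and g: "g \<in> Hom T Z B"
  shows "\<exists>h\<in>Hom T Z P. Comp T Z P A (pr1 T A B) h = f \<and> Comp T Z P B (pr2 T A B) h = g"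
  using tab_universal[OF A B tab_Prd[OF A B] Z f g] N'_in[OF Z A f] N'_in[OF Z B g] by (auto simp: full_def)

lemma crel_mono:
  assumes R: "crel A B R" shows "\<exists>r\<in>monos_into T P. rl A B r = R"
proof -
  obtain M f g where t: "tab A B R M f g" using tabulate[OF A B R] by blast
  note d = tabD[OF t]
  obtain m where m: "m \<in> Hom T M P" "Comp T M P A (pr1 T A B) m = f" "Comp T M P B (pr2 T A B) m = g" using pair_exists[OF d(1-3)] by blast
  have e: "N' P A (pr1 T A B) U (N' M P m U z) = N' M A f U z" "N' P B (pr2 T A B) U (N' M P m U z) = N' M B g U z"
    if "U \<in> Obj C" "z \<in> n M U" for U z
    using N'_Comp[OF d(1) Pd(1) A m(1) Pd(2) that] N'_Comp[OF d(1) Pd(1) B m(1) Pd(3) that] m by simp_all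
  have "rl A B (M, m) U = R U" for U
  proof (cases "U \<in> Obj C")
    case True
    then show ?thesis using t e[OF True] unfolding tab_def bij_betw_def by (auto simp: rl_def)
  next
    case False
    then show ?thesis using crelD(1)[OF R] by (simp add: rl_def)
  qed
  moreover have "(M, m) \<in> monos_into T P" unfolding mono_iff[OF Pd(1)]
  proof (intro conjI ballI inj_onI d(1) m(1))
    fix U z z' assume U: "U \<in> Obj C" "z \<in> n M U" "z' \<in> n M U" "N' M P m U z = N' M P m U z'"
    then show "z = z'" using d(5)[OF U(1-3)] e[OF U(1,2)] e[OF U(1,3)] by simp
  qed
  ultimately show ?thesis by blast
qed

text \<open>Given the inclusion, sections of \<open>W\<close> lift uniquely, since \<open>m\<close>
  is injective, and uniqueness makes the lift natural. The arrow \<open>w\<close> is arbitrary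
  because images are compared with arrows that need not be mono.\<close>

lemma factors_iff:
  assumes W: "W \<in> Obj T" and w: "w \<in> Hom T W P" and m: "(M, m) \<in> monos_into T P"
  shows "factors_through T P (W, w) (M, m) \<longleftrightarrow> (\<forall>U\<in>Obj C. rl A B (W, w) U \<subseteq> rl A B (M, m) U)"
proof -
  have M: "M \<in> Obj T" "m \<in> Hom T M P" and inj: "\<And>U. U \<in> Obj C \<Longrightarrow> inj_on (N' M P m U) (n M U)" using m mono_iff[OF Pd(1)] by auto
  show ?thesis
  proof
    assume "factors_through T P (W, w) (M, m)"
    then obtain k where k: "k \<in> Hom T W M" "w = Comp T W M P m k" by (auto simp: factors_through_def)
    show "\<forall>U\<in>Obj C. rl A B (W, w) U \<subseteq> rl A B (M, m) U"
      using N'_Comp[OF W M(1) Pd(1) k(1) M(2)] N'_in[OF W M(1) k(1)] k(2) by (auto simp: rl_def)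
  next
    assume sub: "\<forall>U\<in>Obj C. rl A B (W, w) U \<subseteq> rl A B (M, m) U"
    have ex: "\<exists>z\<in>n M U. N' M P m U z = N' W P w U x" if x: "U \<in> Obj C" "x \<in> n W U" for U x
    proof -
      have "(N' P A (pr1 T A B) U (N' W P w U x), N' P B (pr2 T A B) U (N' W P w U x)) \<in> rl A B (M, m) U"
        using sub x by (auto simp: rl_def)
      then obtain z where z: "z \<in> n M U" "N' P A (pr1 T A B) U (N' W P w U x) = N' P A (pr1 T A B) U (N' M P m U z)"
        "N' P B (pr2 T A B) U (N' W P w U x) = N' P B (pr2 T A B) U (N' M P m U z)" using x by (auto simp: rl_def)
      then show ?thesis using Pd(5)[OF x(1) N'_in[OF W Pd(1) w x] N'_in[OF M(1) Pd(1) M(2) x(1) z(1)]] by metis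
    qed
    then obtain \<theta> where \<theta>: "\<And>U x. U \<in> Obj C \<Longrightarrow> x \<in> n W U \<Longrightarrow> \<theta> U x \<in> n M U \<and> N' M P m U (\<theta> U x) = N' W P w U x" by metis
    have "\<exists>k\<in>Hom T W M. \<forall>U\<in>Obj C. \<forall>x\<in>n W U. N' W M k U x = \<theta> U x"
    proof (rule N'_full[OF W M(1)])
      show "\<theta> U x \<in> n M U" if "U \<in> Obj C" "x \<in> n W U" for U x using \<theta>[OF that] by blast
      fix U V s x assume *: "U \<in> Obj C" "V \<in> Obj C" "s \<in> Hom C V U" "x \<in> n W U" "PAct (N W) V U s x \<in> n W V"
      show "\<theta> V (PAct (N W) V U s x) = PAct (N M) V U s (\<theta> U x)"
        by (rule inj_onD[OF inj[OF *(2)]])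
          (use \<theta>[OF *(1,4)] \<theta>[OF *(2,5)] N_presheaf(3)[OF M(1) *(1-3)] N'_PAct[OF M(1) Pd(1) M(2) *(1-3)] N'_PAct[OF W Pd(1) w *(1-4)] in auto)
    qed
    then obtain k where k: "k \<in> Hom T W M" "\<And>U x. U \<in> Obj C \<Longrightarrow> x \<in> n W U \<Longrightarrow> N' W M k U x = \<theta> U x" by blast
    have "w = Comp T W M P m k"
      by (rule N'_eqI[OF W Pd(1) w T.Comp_closed[OF W M(1) Pd(1) k(1) M(2)]]) (use N'_Comp[OF W M(1) Pd(1) k(1) M(2)] k(2) \<theta> in auto)
    then show "factors_through T P (W, w) (M, m)" using k(1) by (auto simp: factors_through_def)
  qed
qed

lemma factors_iff':
  assumes "r \<in> monos_into T P" "s \<in> monos_into T P"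
  shows "factors_through T P r s \<longleftrightarrow> (\<forall>U\<in>Obj C. rl A B r U \<subseteq> rl A B s U)"
  using assms factors_iff[of "fst r" "snd r" "fst s" "snd s"] by (cases r; cases s) (auto simp: monos_into_def)

lemma mono_equiv_iff: "(r, s) \<in> mono_equiv T P \<longleftrightarrow> r \<in> monos_into T P \<and> s \<in> monos_into T P \<and> rl A B r = rl A B s"
proof -
  have "rl A B r U = rl A B s U" if "U \<notin> Obj C" for U using that by (cases r; cases s) (simp add: rl_def)
  then have e: "rl A B r = rl A B s \<longleftrightarrow> (\<forall>U\<in>Obj C. rl A B r U \<subseteq> rl A B s U) \<and> (\<forall>U\<in>Obj C. rl A B s U \<subseteq> rl A B r U)"
    by (auto simp: fun_eq_iff)
  show ?thesis unfolding mono_equiv_def mem_Collect_eq prod.case e using factors_iff'[of r s] factors_iff'[of s r] by blast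
qed

text \<open>The fibre of \<open>rl\<close> over \<open>R\<close>; by \<open>mono_equiv_iff\<close>
  the fibres over closed relations are the equivalence classes of monomorphisms.\<close>

definition sb :: "('c \<Rightarrow> ('v \<times> 'v) set) \<Rightarrow> ('t \<times> 'f) set" where
  "sb R = {r \<in> monos_into T P. rl A B r = R}"

lemma sb_bij: "bij_betw sb {R. crel A B R} (subobjects T P)"
  unfolding bij_betw_def
proof
  show "inj_on sb {R. crel A B R}" using crel_mono by (auto simp: inj_on_def sb_def)
  have e: "mono_equiv T P `` {r} = sb (rl A B r)" if "r \<in> monos_into T P" for r
    using that by (auto simp: mono_equiv_iff sb_def)
  show "sb ` {R. crel A B R} = subobjects T P"
  proof (intro equalityI subsetI)
    fix S assume "S \<in> sb ` {R. crel A B R}"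
    then obtain R where R: "crel A B R" "S = sb R" by blast
    obtain r where r: "r \<in> monos_into T P" "rl A B r = R" using crel_mono[OF R(1)] by blast
    then show "S \<in> subobjects T P" unfolding subobjects_def using e[OF r(1)] R(2) quotientI[OF r(1)] by metis
  next
    fix S assume "S \<in> subobjects T P"
    then obtain r where r: "r \<in> monos_into T P" "S = mono_equiv T P `` {r}" unfolding subobjects_def by (auto elim: quotientE)
    then show "S \<in> sb ` {R. crel A B R}" using e[OF r(1)] mono_rl_crel[of "fst r" "snd r"] by auto
  qed
qed

lemma sb_le:
  assumes "crel A B R" "crel A B S"
  shows "(\<exists>r\<in>sb R. \<exists>s\<in>sb S. factors_through T P r s) \<longleftrightarrow> (\<forall>U\<in>Obj C. R U \<subseteq> S U)"
  using crel_mono[OF assms(1)] crel_mono[OF assms(2)] factors_iff' by (auto simp: sb_def)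

end

lemma rl_legs:
  assumes A: "A \<in> Obj T" and B: "B \<in> Obj T" and M: "M \<in> Obj T" and m: "m \<in> Hom T M (Prd T A B)" and U: "U \<in> Obj C"
  shows "rl A B (M, m) U = (\<lambda>z. (N' M A (Comp T M (Prd T A B) A (pr1 T A B) m) U z, N' M B (Comp T M (Prd T A B) B (pr2 T A B) m) U z)) ` n M U"
  using N'_Comp[OF M Pd(1)[OF A B] A m Pd(2)[OF A B] U] N'_Comp[OF M Pd(1)[OF A B] B m Pd(3)[OF A B] U] U
  by (auto simp: rl_def)

lemma mono_legs:
  assumes A: "A \<in> Obj T" and B: "B \<in> Obj T"
  shows "(M, m) \<in> monos_into T (Prd T A B) \<longleftrightarrow> M \<in> Obj T \<and> m \<in> Hom T M (Prd T A B) \<and>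
    (\<forall>U\<in>Obj C. inj_on (\<lambda>z. (N' M A (Comp T M (Prd T A B) A (pr1 T A B) m) U z, N' M B (Comp T M (Prd T A B) B (pr2 T A B) m) U z)) (n M U))"
proof -
  note p = Pd[OF A B]
  have "N' M (Prd T A B) m U z = N' M (Prd T A B) m U z' \<longleftrightarrow>
     N' M A (Comp T M (Prd T A B) A (pr1 T A B) m) U z = N' M A (Comp T M (Prd T A B) A (pr1 T A B) m) U z' \<and>
     N' M B (Comp T M (Prd T A B) B (pr2 T A B) m) U z = N' M B (Comp T M (Prd T A B) B (pr2 T A B) m) U z'"
    if "M \<in> Obj T" "m \<in> Hom T M (Prd T A B)" "U \<in> Obj C" "z \<in> n M U" "z' \<in> n M U" for U z z'
    using p(5)[OF that(3) N'_in[OF that(1) p(1) that(2,3,4)] N'_in[OF that(1) p(1) that(2,3,5)]]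
      N'_Comp[OF that(1) p(1) A that(2) p(2) that(3,4)] N'_Comp[OF that(1) p(1) A that(2) p(2) that(3,5)]
      N'_Comp[OF that(1) p(1) B that(2) p(3) that(3,4)] N'_Comp[OF that(1) p(1) B that(2) p(3) that(3,5)] by auto
  then show ?thesis unfolding mono_iff[OF p(1)] inj_on_def by auto
qed

lemma crel_eqI: "crel A B R \<Longrightarrow> crel A B S \<Longrightarrow> (\<And>U. U \<in> Obj C \<Longrightarrow> R U = S U) \<Longrightarrow> R = S"
  using crelD(1) by (intro ext) metis

section \<open>Diagonal, opposite and composite of closed relations\<close>

definition dg :: "'t \<Rightarrow> 'c \<Rightarrow> ('v \<times> 'v) set" where
  "dg A U = (if U \<in> Obj C then {(a, a) |a. a \<in> n A U} else {})"

lemma sb_diagonal: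
  assumes A: "A \<in> Obj T" shows "rel_diagonal T A = sb A A (dg A)"
proof -
  let ?P = "Prd T A A"
  have d: "(A, d) \<in> monos_into T ?P \<and> rl A A (A, d) = dg A"
    if d: "d \<in> Hom T A ?P" "Comp T A ?P A (pr1 T A A) d = Idn T A" "Comp T A ?P A (pr2 T A A) d = Idn T A" for d
  proof
    show "(A, d) \<in> monos_into T ?P" unfolding mono_legs[OF A A] d(2,3) using A d(1) N'_Idn[OF A] by (simp add: inj_on_def)
    show "rl A A (A, d) = dg A"
    proof
      fix U show "rl A A (A, d) U = dg A U"
        using rl_legs[OF A A A d(1), of U, unfolded d(2,3)] N'_Idn[OF A] by (cases "U \<in> Obj C") (auto simp: dg_def rl_def)
    qed
  qed
  obtain d where dd: "d \<in> Hom T A ?P" "Comp T A ?P A (pr1 T A A) d = Idn T A" "Comp T A ?P A (pr2 T A A) d = Idn T A"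
    using pair_exists[OF A A A T.Idn_closed[OF A] T.Idn_closed[OF A]] by blast
  show ?thesis unfolding rel_diagonal_def sb_def[OF A A] mono_equiv_iff[OF A A] using d dd by auto
qed

lemma sb_opposite:
  assumes A: "A \<in> Obj T" and B: "B \<in> Obj T"
  shows "rel_opposite T A B (sb A B R) = sb B A (\<lambda>U. (R U)\<inverse>)"
proof -
  let ?P = "Prd T A B" and ?O = "Prd T B A"
  have sw: "(M, m) \<in> monos_into T ?P \<and> rl A B (M, m) = R \<longleftrightarrow> (M, m') \<in> monos_into T ?O \<and> rl B A (M, m') = (\<lambda>U. (R U)\<inverse>)"
    if M: "M \<in> Obj T" and m: "m \<in> Hom T M ?P" and m': "m' \<in> Hom T M ?O"
      and e: "Comp T M ?O B (pr1 T B A) m' = Comp T M ?P B (pr2 T A B) m" "Comp T M ?O A (pr2 T B A) m' = Comp T M ?P A (pr1 T A B) m"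
    for M m m'
  proof -
    have "rl B A (M, m') U = (rl A B (M, m) U)\<inverse>" for U
    proof (cases "U \<in> Obj C")
      case True
      then show ?thesis unfolding rl_legs[OF A B M m True] rl_legs[OF B A M m' True] e by auto
    qed (simp add: rl_def)
    then have "rl A B (M, m) = R \<longleftrightarrow> rl B A (M, m') = (\<lambda>U. (R U)\<inverse>)"
      by (simp add: fun_eq_iff)
    moreover have "(M, m) \<in> monos_into T ?P \<longleftrightarrow> (M, m') \<in> monos_into T ?O"
      unfolding mono_legs[OF A B] mono_legs[OF B A] e using M m m' by (auto simp: inj_on_def)
    ultimately show ?thesis by blast
  qed
  show ?thesis
  proof (intro equalityI subsetI)
    fix x assume "x \<in> rel_opposite T A B (sb A B R)"
    then obtain M m m' where x: "x = (M, m')" "m' \<in> Hom T M ?O" "(M, m) \<in> sb A B R"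
      "Comp T M ?O B (pr1 T B A) m' = Comp T M ?P B (pr2 T A B) m" "Comp T M ?O A (pr2 T B A) m' = Comp T M ?P A (pr1 T A B) m"
      by (auto simp: rel_opposite_def)
    then show "x \<in> sb B A (\<lambda>U. (R U)\<inverse>)" using sw[of M m m'] by (auto simp: sb_def[OF A B] sb_def[OF B A] monos_into_def)
  next
    fix x assume x: "x \<in> sb B A (\<lambda>U. (R U)\<inverse>)"
    obtain M m' where xm: "x = (M, m')" by (metis surj_pair)
    have M: "M \<in> Obj T" "m' \<in> Hom T M ?O" using x xm by (auto simp: sb_def[OF B A] monos_into_def)
    obtain m where m: "m \<in> Hom T M ?P" "Comp T M ?P A (pr1 T A B) m = Comp T M ?O A (pr2 T B A) m'"
      "Comp T M ?P B (pr2 T A B) m = Comp T M ?O B (pr1 T B A) m'"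
      using pair_exists[OF A B M(1) T.Comp_closed[OF M(1) Pd(1)[OF B A] A M(2) Pd(3)[OF B A]] T.Comp_closed[OF M(1) Pd(1)[OF B A] B M(2) Pd(2)[OF B A]]]
      by blast
    have "(M, m) \<in> sb A B R" using sw[OF M(1) m(1) M(2)] m(2,3) x xm by (auto simp: sb_def[OF A B] sb_def[OF B A])
    then show "x \<in> rel_opposite T A B (sb A B R)" using M m xm by (auto simp: rel_opposite_def)
  qed
qed

text \<open>\<open>O\<close> composes in diagram order, so \<open>R\<close> acts first. The
  pointwise composite is stable under restriction; closing it lets intermediate sections that exist
  only locally count as well.\<close>

definition rc :: "'t \<Rightarrow> 't \<Rightarrow> 't \<Rightarrow> ('c \<Rightarrow> ('v \<times> 'v) set) \<Rightarrow> ('c \<Rightarrow> ('v \<times> 'v) set) \<Rightarrow> 'c \<Rightarrow> ('v \<times> 'v) set" where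
  "rc A B D S R = cl A D (\<lambda>U. R U O S U)"

text \<open>Monomorphisms have closed relations, so the image of an arrow is the closure of its
  relation \<open>rl\<close>; and the arrow from the pullback has the relation
  \<open>R U O S U\<close>. Both hold for any representatives, pullback and image, so the set
  defined by \<open>rel_comp\<close> is a single class.\<close>

lemma sb_comp:
  assumes A: "A \<in> Obj T" and B: "B \<in> Obj T" and D: "D \<in> Obj T" and R: "crel A B R" and S: "crel B D S"
  shows "crel A D (rc A B D S R)" and "rel_comp T A B D (sb B D S) (sb A B R) = sb A D (rc A B D S R)"
proof -
  let ?AB = "Prd T A B" and ?BD = "Prd T B D" and ?AD = "Prd T A D"
  define K where "K U = R U O S U" for U
  have Ki: "a \<in> n A U \<and> b \<in> n D U" if "U \<in> Obj C" "(a, b) \<in> K U" for U a b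
    using that crelD(2)[OF R] crelD(2)[OF S] by (auto simp: K_def)
  have Kr: "(PAct (N A) W U s a, PAct (N D) W U s b) \<in> K W" if *: "U \<in> Obj C" "W \<in> Obj C" "s \<in> Hom C W U" and ab: "(a, b) \<in> K U" for U W s a b
  proof -
    obtain y where "(a, y) \<in> R U" "(y, b) \<in> S U" using ab by (auto simp: K_def)
    then show ?thesis using crelD(3)[OF R *] crelD(3)[OF S *] unfolding K_def by blast
  qed
  have rc: "rc A B D S R = cl A D K" by (simp add: rc_def K_def[abs_def])
  have cK: "crel A D (cl A D K)" by (rule crel_cl[OF A D Ki Kr])
  have cu: "K U \<subseteq> cl A D K U" if "U \<in> Obj C" for U by (rule cl_upper[OF A D Ki Kr that])
  have cleast: "cl A D K U \<subseteq> S' U" if "crel A D S'" "\<And>U. U \<in> Obj C \<Longrightarrow> K U \<subseteq> S' U" for S' U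
    by (rule cl_least[OF A D Ki Kr that])
  show "crel A D (rc A B D S R)" unfolding rc by (rule cK)
  note p = Pd[OF A B] and q = Pd[OF B D] and r = Pd[OF A D]
  have im: "is_image T ?AD (W, w) i \<longleftrightarrow> i \<in> sb A D (rc A B D S R)"
    if W: "W \<in> Obj T" and w: "w \<in> Hom T W ?AD" and rlw: "\<And>U. U \<in> Obj C \<Longrightarrow> rl A D (W, w) U = K U" for W w i
  proof
    assume i: "is_image T ?AD (W, w) i"
    then have im: "i \<in> monos_into T ?AD" by (simp add: is_image_def)
    obtain I \<mu> where I: "i = (I, \<mu>)" by (metis surj_pair)
    have ci: "crel A D (rl A D i)" using mono_rl_crel[OF A D] im I by simp
    have "K U \<subseteq> rl A D i U" if "U \<in> Obj C" for U
      using i factors_iff[OF A D W w] im I rlw that by (auto simp: is_image_def)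
    then have 1: "cl A D K U \<subseteq> rl A D i U" for U using cleast[OF ci] by blast
    obtain k where k: "k \<in> monos_into T ?AD" "rl A D k = cl A D K" using crel_mono[OF A D cK] by blast
    have "factors_through T ?AD (W, w) k"
      using factors_iff[OF A D W w, of "fst k" "snd k"] k cu rlw by simp
    then have "factors_through T ?AD i k" using i k(1) by (auto simp: is_image_def)
    then have 2: "rl A D i U \<subseteq> cl A D K U" if "U \<in> Obj C" for U using factors_iff'[OF A D im k(1)] k(2) that by simp
    have "rl A D i = cl A D K" by (rule crel_eqI[OF ci cK]) (use 1 2 in blast)
    then show "i \<in> sb A D (rc A B D S R)" using im rc by (simp add: sb_def[OF A D])
  next
    assume "i \<in> sb A D (rc A B D S R)"
    then have i: "i \<in> monos_into T ?AD" "rl A D i = cl A D K" using rc by (auto simp: sb_def[OF A D])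
    have "factors_through T ?AD (W, w) i" using factors_iff[OF A D W w, of "fst i" "snd i"] i cu rlw by simp
    moreover have "factors_through T ?AD i k" if k: "k \<in> monos_into T ?AD" "factors_through T ?AD (W, w) k" for k
    proof -
      have "crel A D (rl A D k)" using mono_rl_crel[OF A D, of "fst k" "snd k"] k(1) by simp
      moreover have "K U \<subseteq> rl A D k U" if "U \<in> Obj C" for U using factors_iff[OF A D W w, of "fst k" "snd k"] k rlw that by auto
      ultimately have "cl A D K U \<subseteq> rl A D k U" for U by (rule cleast)
      then show ?thesis using factors_iff'[OF A D i(1) k(1)] i(2) by simp
    qed
    ultimately show "is_image T ?AD (W, w) i" using i(1) by (simp add: is_image_def)
  qed
  have pbim: "rl A D (W, w) U = K U"
    if M: "(M, m) \<in> sb A B R" and L: "(L, l) \<in> sb B D S"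
      and pb: "is_pullback T M L B (Comp T M ?AB B (pr2 T A B) m) (Comp T L ?BD B (pr1 T B D) l) W a b"
      and w: "w \<in> Hom T W ?AD" and e: "Comp T W ?AD A (pr1 T A D) w = Comp T W M A (Comp T M ?AB A (pr1 T A B) m) a"
        "Comp T W ?AD D (pr2 T A D) w = Comp T W L D (Comp T L ?BD D (pr2 T B D) l) b"
      and U: "U \<in> Obj C" for M m L l W a b w U
  proof -
    have M': "M \<in> Obj T" "m \<in> Hom T M ?AB" "rl A B (M, m) = R" and L': "L \<in> Obj T" "l \<in> Hom T L ?BD" "rl B D (L, l) = S"
      using M L by (auto simp: sb_def[OF A B] sb_def[OF B D] monos_into_def)
    let ?m1 = "Comp T M ?AB A (pr1 T A B) m" and ?m2 = "Comp T M ?AB B (pr2 T A B) m"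
    let ?l1 = "Comp T L ?BD B (pr1 T B D) l" and ?l2 = "Comp T L ?BD D (pr2 T B D) l"
    have m: "?m1 \<in> Hom T M A" "?m2 \<in> Hom T M B" "?l1 \<in> Hom T L B" "?l2 \<in> Hom T L D"
      using T.Comp_closed M' L' p(1-3) q(1-3) A B D by auto
    have W: "W \<in> Obj T" "a \<in> Hom T W M" "b \<in> Hom T W L" and ab: "Comp T W M B ?m2 a = Comp T W L B ?l1 b"
      and univ: "\<And>Z c d. \<lbrakk>Z \<in> Obj T; c \<in> Hom T Z M; d \<in> Hom T Z L; Comp T Z M B ?m2 c = Comp T Z L B ?l1 d\<rbrakk>
        \<Longrightarrow> \<exists>h\<in>Hom T Z W. Comp T Z W M a h = c \<and> Comp T Z W L b h = d"
      using pb unfolding is_pullback_def by blast+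
    have RM: "R U = (\<lambda>z. (N' M A ?m1 U z, N' M B ?m2 U z)) ` n M U" and SL: "S U = (\<lambda>z. (N' L B ?l1 U z, N' L D ?l2 U z)) ` n L U"
      using rl_legs[OF A B M'(1,2) U] rl_legs[OF B D L'(1,2) U] M'(3) L'(3) by simp_all
    have rw: "rl A D (W, w) U = (\<lambda>z. (N' M A ?m1 U (N' W M a U z), N' L D ?l2 U (N' W L b U z))) ` n W U"
      unfolding rl_legs[OF A D W(1) w U] e
      using N'_Comp[OF W(1) M'(1) A W(2) m(1) U] N'_Comp[OF W(1) L'(1) D W(3) m(4) U] by simp
    have eqz: "N' M B ?m2 U (N' W M a U z) = N' L B ?l1 U (N' W L b U z)" if z: "z \<in> n W U" for z
      using N'_Comp[OF W(1) M'(1) B W(2) m(2) U z] N'_Comp[OF W(1) L'(1) B W(3) m(3) U z] ab by simp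
    show ?thesis
    proof (intro equalityI subsetI)
      fix x assume "x \<in> rl A D (W, w) U"
      then obtain z where z: "z \<in> n W U" "x = (N' M A ?m1 U (N' W M a U z), N' L D ?l2 U (N' W L b U z))" unfolding rw by blast
      have "(N' M A ?m1 U (N' W M a U z), N' M B ?m2 U (N' W M a U z)) \<in> R U" unfolding RM using N'_in[OF W(1) M'(1) W(2) U z(1)] by blast
      moreover have "(N' M B ?m2 U (N' W M a U z), N' L D ?l2 U (N' W L b U z)) \<in> S U" unfolding SL eqz[OF z(1)] using N'_in[OF W(1) L'(1) W(3) U z(1)] by blast
      ultimately show "x \<in> K U" unfolding K_def z(2) by blast
    next
      fix x assume "x \<in> K U"
      then obtain u v where uv: "u \<in> n M U" "v \<in> n L U" "N' M B ?m2 U u = N' L B ?l1 U v" "x = (N' M A ?m1 U u, N' L D ?l2 U v)"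
        unfolding K_def RM SL by auto
      \<comment> \<open>The given pullback is known only by its universal property, so a section
        over \<open>(u, v)\<close> is taken from a tabulated pullback \<open>G\<close> and mapped
        along the induced \<open>h\<close>.\<close>
      obtain G f g where d: "G \<in> Obj T" "f \<in> Hom T G M" "g \<in> Hom T G L" "Comp T G M B ?m2 f = Comp T G L B ?l1 g"
        and ex: "\<exists>z\<in>n G U. N' G M f U z = u \<and> N' G L g U z = v"
        using pullback_tab[OF M'(1) L'(1) B m(2,3)] U uv(1-3) by blast
      obtain h where h: "h \<in> Hom T G W" "Comp T G W M a h = f" "Comp T G W L b h = g" using univ[OF d] by blast
      obtain z where z: "z \<in> n G U" "N' G M f U z = u" "N' G L g U z = v" using ex by blast
      have hz: "N' W M a U (N' G W h U z) = u" "N' W L b U (N' G W h U z) = v"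
        using N'_Comp[OF d(1) W(1) M'(1) h(1) W(2) U z(1)] N'_Comp[OF d(1) W(1) L'(1) h(1) W(3) U z(1)] h z by simp_all
      show "x \<in> rl A D (W, w) U" unfolding rw uv(4)
        by (rule image_eqI[of _ _ "N' G W h U z"]) (use hz N'_in[OF d(1) W(1) h(1) U z(1)] in simp_all)
    qed
  qed
  show "rel_comp T A B D (sb B D S) (sb A B R) = sb A D (rc A B D S R)"
  proof (intro equalityI subsetI)
    fix i assume "i \<in> rel_comp T A B D (sb B D S) (sb A B R)"
    then obtain M m L l W a b w where *: "(M, m) \<in> sb A B R" "(L, l) \<in> sb B D S"
      "is_pullback T M L B (Comp T M ?AB B (pr2 T A B) m) (Comp T L ?BD B (pr1 T B D) l) W a b"
      "w \<in> Hom T W ?AD" "Comp T W ?AD A (pr1 T A D) w = Comp T W M A (Comp T M ?AB A (pr1 T A B) m) a"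
      "Comp T W ?AD D (pr2 T A D) w = Comp T W L D (Comp T L ?BD D (pr2 T B D) l) b" "is_image T ?AD (W, w) i"
      unfolding rel_comp_def by auto
    have W: "W \<in> Obj T" using *(3) by (simp add: is_pullback_def)
    show "i \<in> sb A D (rc A B D S R)" using im[OF W *(4) pbim[OF *(1-6)]] *(7) by blast
  next
    fix i assume i: "i \<in> sb A D (rc A B D S R)"
    obtain M m where M: "(M, m) \<in> sb A B R" using crel_mono[OF A B R] by (auto simp: sb_def[OF A B])
    obtain L l where L: "(L, l) \<in> sb B D S" using crel_mono[OF B D S] by (auto simp: sb_def[OF B D])
    have M': "M \<in> Obj T" "m \<in> Hom T M ?AB" and L': "L \<in> Obj T" "l \<in> Hom T L ?BD"
      using M L by (auto simp: sb_def[OF A B] sb_def[OF B D] monos_into_def)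
    let ?m1 = "Comp T M ?AB A (pr1 T A B) m" and ?m2 = "Comp T M ?AB B (pr2 T A B) m"
    let ?l1 = "Comp T L ?BD B (pr1 T B D) l" and ?l2 = "Comp T L ?BD D (pr2 T B D) l"
    have m: "?m1 \<in> Hom T M A" "?m2 \<in> Hom T M B" "?l1 \<in> Hom T L B" "?l2 \<in> Hom T L D"
      using T.Comp_closed M' L' p(1-3) q(1-3) A B D by auto
    obtain W a b where pb: "is_pullback T M L B ?m2 ?l1 W a b" using pullback_tab[OF M'(1) L'(1) B m(2,3)] by blast
    then have W: "W \<in> Obj T" "a \<in> Hom T W M" "b \<in> Hom T W L" by (auto simp: is_pullback_def)
    obtain w where w: "w \<in> Hom T W ?AD" "Comp T W ?AD A (pr1 T A D) w = Comp T W M A ?m1 a" "Comp T W ?AD D (pr2 T A D) w = Comp T W L D ?l2 b"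
      using pair_exists[OF A D W(1) T.Comp_closed[OF W(1) M'(1) A W(2) m(1)] T.Comp_closed[OF W(1) L'(1) D W(3) m(4)]] by blast
    have "is_image T ?AD (W, w) i" using im[OF W(1) w(1) pbim[OF M L pb w]] i by blast
    then show "i \<in> rel_comp T A B D (sb B D S) (sb A B R)" unfolding rel_comp_def using M L pb w by blast
  qed
qed

end

section \<open>Distributors as relations of sheaves\<close>

context site_quantaloid
begin

lemma sheaf_model_nv: "sheaf_model C J (SymCat_sc Q :: (('o, 'a, 'v) qcat, _) cat) nv nvm"
proof (intro sheaf_model.intro sheaf_model_axioms.intro)
  show "site C J" ..
  show "category (SymCat_sc Q :: (('o, 'a, 'v) qcat, _) cat)" by (rule category_SymCat_sc)
  show "universe TYPE('v)" by (rule universe)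
  show "is_functor (SymCat_sc Q) (sheaf_category C J) (nv :: ('o, 'a, 'v) qcat \<Rightarrow> _) nvm" by (rule nv_functor)
  show "bij_betw (nvm A B) (Hom (SymCat_sc Q) A B) (natural_transformations C (nv A) (nv B))"
    if "A \<in> Obj (SymCat_sc Q)" "B \<in> Obj (SymCat_sc Q)" for A B :: "('o, 'a, 'v) qcat"
    using nvm_bij that by (simp add: SymCat_sc_simps(1))
  show "\<exists>A\<in>Obj (SymCat_sc Q). \<exists>\<kappa>\<in>natural_transformations C P (nv A). \<forall>U\<in>Obj C. bij_betw (\<kappa> U) (PSet P U) (PSet (nv A) U)"
    if "is_sheaf C J P" for P :: "('c, 'b, 'v) presheaf"
    using nv_essentially_surjective[OF that] by (auto simp: SymCat_sc_simps(1))
qed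

interpretation M: sheaf_model C J "SymCat_sc Q :: (('o, 'a, 'v) qcat, _) cat" nv nvm
  by (rule sheaf_model_nv)

lemma scc_Obj: "A \<in> Obj (SymCat_sc Q) \<longleftrightarrow> scc A" by (simp add: SymCat_sc_simps(1))

text \<open>\<open>hm B y' y \<cdot> s\<close> is generated by spans with legs a map
  \<open>s'\<close> and an arrow \<open>g\<close> of the site. By \<open>res_eq_iff\<close> the
  restriction of \<open>y'\<close> along \<open>s'\<close> is that of \<open>y\<close> along
  \<open>s \<cdot> gm W U g\<close>, so the new pair is again in \<open>R\<close>. Stated for any
  \<open>R\<close> stable under restriction, the lemma serves both actions of a distributor, through
  \<open>R\<close> and through its converse.\<close>

lemma hm_span_leq:
  fixes A B :: "('o, 'a, 'v) qcat"
  assumes A: "scc A" and B: "scc B"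
    and rr: "\<And>U W g x y. \<lbrakk>U \<in> Obj C; W \<in> Obj C; g \<in> Hom C W U; (x, y) \<in> R U\<rbrakk> \<Longrightarrow> (res A x (gm W U g), res B y (gm W U g)) \<in> R W"
    and x: "x \<in> Elts A" and y: "y \<in> Elts B" "y' \<in> Elts B" and U: "U \<in> Obj C"
    and t: "is_map (\<iota> U) (Ty A x) t" and s: "is_map (\<iota> U) (Ty B y) s" and ts: "(res A x t, res B y s) \<in> R U"
    and w: "w \<in> hom (Ty A x) (Ty B y')"
    and le: "\<And>W t s. \<lbrakk>W \<in> Obj C; is_map (\<iota> W) (Ty A x) t; is_map (\<iota> W) (Ty B y') s; (res A x t, res B y' s) \<in> R W\<rbrakk> \<Longrightarrow> s \<cdot> t\<degree> \<preceq> w"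
  shows "hm B y' y \<cdot> (s \<cdot> t\<degree>) \<preceq> w"
proof -
  note b = scc_sqc[OF B]
  have "hm B y' y \<cdot> s \<cdot> t\<degree> \<preceq> w"
  proof (rule covered_left[OF arrow_covered_dom[OF U cmp_hom[OF hm_hom[OF b y] is_mapD(1)[OF s]]] is_mapD(2)[OF t] w])
    fix d assume "d \<in> {s' \<cdot> (gm W U g)\<degree> |W s' g. W \<in> Obj C \<and> g \<in> Hom C W U \<and> is_map (\<iota> W) (Ty B y') s' \<and> s' \<cdot> (gm W U g)\<degree> \<preceq> hm B y' y \<cdot> s}"
    then obtain W s' g where d: "d = s' \<cdot> (gm W U g)\<degree>" "W \<in> Obj C" "g \<in> Hom C W U" "is_map (\<iota> W) (Ty B y') s'" "d \<preceq> hm B y' y \<cdot> s" by blast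
    note g = gm_map[OF U d(2,3)] and ry = res_pts[OF B inf y(1) s]
    have "s' \<cdot> (gm W U g)\<degree> \<preceq> hm B y' (res B y s)" using d(1,5) hm_res_right[OF B inf y(1) s y(2)] by simp
    then have "res B y' s' = res B (res B y s) (gm W U g)"
      using res_eq_iff[OF B inf ptsD(1)[OF ry] gm_map_pts[OF ry U d(2,3)] y(2) d(4)] by simp
    then have "(res A x (t \<cdot> gm W U g), res B y' s') \<in> R W" using rr[OF U d(2,3) ts] res_res[OF A inf x t g] by simp
    from le[OF d(2) is_map_cmp[OF t g] d(4) this] show "d \<cdot> t\<degree> \<preceq> w" using d(1) by (simp add: cv_cmp cmp_assoc)
  qed
  then show ?thesis by (simp add: cmp_assoc)
qed

context
  fixes A B :: "('o, 'a, 'v) qcat"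
  assumes A: "scc A" and B: "scc B"
begin

text \<open>\<open>t\<close> lies below the hom-arrow from the restriction to \<open>x\<close> and
  \<open>t\<degree>\<close> below the reverse one; the action law through these arrows gives the two
  inequalities.\<close>

lemma dm_res_right:
  assumes \<Phi>: "\<Phi> \<in> distributors Q A B" and x: "x \<in> Elts A" and t: "is_map X (Ty A x) t" and y: "y \<in> Elts B"
  shows "dm A B \<Phi> y (res A x t) = dm A B \<Phi> y x \<cdot> t"
proof -
  note a = scc_sqc[OF A] and b = scc_sqc[OF B]
  note m = is_mapD[OF t] and r = ptsD[OF res_pts[OF A inf x t]]
  have 1: "t \<preceq> hm A x (res A x t)" using cmp_ge_left[OF hm_one[OF a x] m(1)] hm_res_right[OF A inf x t x] by simp
  have 2: "t\<degree> \<preceq> hm A (res A x t) x" using cmp_ge_right[OF hm_one[OF a x] m(2)] hm_res_left[OF A inf x t x] by simp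
  have d: "dm A B \<Phi> y (res A x t) \<in> hom X (Ty B y)" using dm_hom[OF a b \<Phi> r(1) y] r(2) by simp
  have "dm A B \<Phi> y (res A x t) \<preceq> dm A B \<Phi> y (res A x t) \<cdot> (t\<degree> \<cdot> t)" by (rule cmp_ge_right[OF m(5) d])
  also have "\<dots> \<preceq> dm A B \<Phi> y (res A x t) \<cdot> (hm A (res A x t) x \<cdot> t)" by (rule cmp_mono_left[OF cmp_mono_right[OF 2]])
  also have "\<dots> = dm A B \<Phi> y (res A x t) \<cdot> hm A (res A x t) x \<cdot> t" by (simp add: cmp_assoc)
  also have "\<dots> \<preceq> dm A B \<Phi> y x \<cdot> t" by (rule cmp_mono_right[OF dm_right[OF a b \<Phi> r(1) x y]])
  finally have le: "dm A B \<Phi> y (res A x t) \<preceq> dm A B \<Phi> y x \<cdot> t" .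
  have "dm A B \<Phi> y x \<cdot> t \<preceq> dm A B \<Phi> y x \<cdot> hm A x (res A x t)" by (rule cmp_mono_left[OF 1])
  also have "\<dots> \<preceq> dm A B \<Phi> y (res A x t)" by (rule dm_right[OF a b \<Phi> x r(1) y])
  finally show ?thesis using le leq_antisym by blast
qed

lemma dm_res_left:
  assumes \<Phi>: "\<Phi> \<in> distributors Q A B" and x: "x \<in> Elts A" and y: "y \<in> Elts B" and s: "is_map Y (Ty B y) s"
  shows "dm A B \<Phi> (res B y s) x = s\<degree> \<cdot> dm A B \<Phi> y x"
proof -
  note a = scc_sqc[OF A] and b = scc_sqc[OF B]
  note m = is_mapD[OF s] and r = ptsD[OF res_pts[OF B inf y s]]
  have 1: "s \<preceq> hm B y (res B y s)" using cmp_ge_left[OF hm_one[OF b y] m(1)] hm_res_right[OF B inf y s y] by simp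
  have 2: "s\<degree> \<preceq> hm B (res B y s) y" using cmp_ge_right[OF hm_one[OF b y] m(2)] hm_res_left[OF B inf y s y] by simp
  have d: "dm A B \<Phi> (res B y s) x \<in> hom (Ty A x) Y" using dm_hom[OF a b \<Phi> x r(1)] r(2) by simp
  have "dm A B \<Phi> (res B y s) x \<preceq> s\<degree> \<cdot> s \<cdot> dm A B \<Phi> (res B y s) x" by (rule cmp_ge_left[OF m(5) d])
  also have "\<dots> \<preceq> s\<degree> \<cdot> hm B y (res B y s) \<cdot> dm A B \<Phi> (res B y s) x" by (rule cmp_mono_right[OF cmp_mono_left[OF 1]])
  also have "\<dots> = s\<degree> \<cdot> (hm B y (res B y s) \<cdot> dm A B \<Phi> (res B y s) x)" by (simp add: cmp_assoc)
  also have "\<dots> \<preceq> s\<degree> \<cdot> dm A B \<Phi> y x" by (rule cmp_mono_left[OF dm_left[OF a b \<Phi> x r(1) y]])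
  finally have le: "dm A B \<Phi> (res B y s) x \<preceq> s\<degree> \<cdot> dm A B \<Phi> y x" .
  have "s\<degree> \<cdot> dm A B \<Phi> y x \<preceq> hm B (res B y s) y \<cdot> dm A B \<Phi> y x" by (rule cmp_mono_right[OF 2])
  also have "\<dots> \<preceq> dm A B \<Phi> (res B y s) x" by (rule dm_left[OF a b \<Phi> x y r(1)])
  finally show ?thesis using le leq_antisym by blast
qed

definition rd :: "('v \<Rightarrow> 'v \<Rightarrow> 'a) \<Rightarrow> 'c \<Rightarrow> ('v \<times> 'v) set" where
  "rd \<Phi> U = (if U \<in> Obj C then {(x, y). x \<in> pts A (\<iota> U) \<and> y \<in> pts B (\<iota> U) \<and> one (\<iota> U) \<preceq> dm A B \<Phi> y x} else {})"

text \<open>The analogue of \<open>res_eq_iff\<close> for a distributor: restriction composes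
  \<open>\<Phi>\<close> with the two maps, which the adjunctions move across.\<close>

lemma rd_res_iff:
  assumes \<Phi>: "\<Phi> \<in> distributors Q A B" and x: "x \<in> Elts A" and y: "y \<in> Elts B" and U: "U \<in> Obj C"
    and t: "is_map (\<iota> U) (Ty A x) t" and s: "is_map (\<iota> U) (Ty B y) s"
  shows "(res A x t, res B y s) \<in> rd \<Phi> U \<longleftrightarrow> s \<cdot> t\<degree> \<preceq> dm A B \<Phi> y x"
proof -
  note a = scc_sqc[OF A] and b = scc_sqc[OF B]
  note rx = res_pts[OF A inf x t] and ry = res_pts[OF B inf y s]
  note S = is_mapD[OF s] and T = is_mapD[OF t] and d = dm_hom[OF a b \<Phi> x y]
  have "dm A B \<Phi> (res B y s) (res A x t) = s\<degree> \<cdot> (dm A B \<Phi> y x \<cdot> t)"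
    using dm_res_left[OF \<Phi> ptsD(1)[OF rx] y s] dm_res_right[OF \<Phi> x t y] by simp
  then have "(res A x t, res B y s) \<in> rd \<Phi> U \<longleftrightarrow> one (\<iota> U) \<preceq> s\<degree> \<cdot> (dm A B \<Phi> y x \<cdot> t)"
    using rx ry U by (simp add: rd_def)
  also have "\<dots> \<longleftrightarrow> s \<cdot> one (\<iota> U) \<preceq> dm A B \<Phi> y x \<cdot> t"
    by (rule map_shift_left[OF s one_hom[OF S(3)] cmp_hom[OF d T(1)], symmetric])
  also have "\<dots> \<longleftrightarrow> s \<cdot> t\<degree> \<preceq> dm A B \<Phi> y x"
    using map_shift_right[OF t S(1) d] cmp_one(1)[OF S(1)] by simp
  finally show ?thesis .
qed

lemma rd_gm_iff:
  assumes \<Phi>: "\<Phi> \<in> distributors Q A B" and U: "U \<in> Obj C" and x: "x \<in> pts A (\<iota> U)" and y: "y \<in> pts B (\<iota> U)"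
    and W: "W \<in> Obj C" and f: "f \<in> Hom C W U" and g: "g \<in> Hom C W U"
  shows "(res A x (gm W U g), res B y (gm W U f)) \<in> rd \<Phi> W \<longleftrightarrow> gm W U f \<cdot> (gm W U g)\<degree> \<preceq> dm A B \<Phi> y x"
  by (rule rd_res_iff[OF \<Phi> ptsD(1)[OF x] ptsD(1)[OF y] W gm_map_pts[OF x U W g] gm_map_pts[OF y U W f]])

text \<open>For closedness: by \<open>rd_gm_iff\<close>, being related along \<open>s\<close> means
  that \<open>gm W U s \<cdot> (gm W U s)\<degree>\<close> lies below the entry of
  \<open>\<Phi>\<close>, and over a covering sieve these arrows cover the identity.\<close>

lemma crel_rd:
  assumes \<Phi>: "\<Phi> \<in> distributors Q A B" shows "M.crel A B (rd \<Phi>)"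
proof (rule M.crelI, unfold PSet_nv)
  note a = scc_sqc[OF A] and b = scc_sqc[OF B]
  show "rd \<Phi> U = {}" if "U \<notin> Obj C" for U using that by (simp add: rd_def)
  show "x \<in> pts A (\<iota> U) \<and> y \<in> pts B (\<iota> U)" if "U \<in> Obj C" "(x, y) \<in> rd \<Phi> U" for U x y using that by (simp add: rd_def)
  fix U W s x y assume U: "U \<in> Obj C" and W: "W \<in> Obj C" and s: "s \<in> Hom C W U" and xy: "(x, y) \<in> rd \<Phi> U"
  have p: "x \<in> pts A (\<iota> U)" "y \<in> pts B (\<iota> U)" "one (\<iota> U) \<preceq> dm A B \<Phi> y x" using xy U by (auto simp: rd_def)
  have "gm W U s \<cdot> (gm W U s)\<degree> \<preceq> dm A B \<Phi> y x" using is_mapD(6)[OF gm_map[OF U W s]] p(3) leq_trans by blast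
  then show "(PAct (nv A) W U s x, PAct (nv B) W U s y) \<in> rd \<Phi> W"
    using rd_gm_iff[OF \<Phi> U p(1,2) W s s] p by (simp add: PAct_nv)
next
  note a = scc_sqc[OF A] and b = scc_sqc[OF B]
  fix U x y assume U: "U \<in> Obj C" and x: "x \<in> pts A (\<iota> U)" and y: "y \<in> pts B (\<iota> U)"
    and S: "{(W, s). W \<in> Obj C \<and> s \<in> Hom C W U \<and> (PAct (nv A) W U s x, PAct (nv B) W U s y) \<in> rd \<Phi> W} \<in> J U"
  have d: "dm A B \<Phi> y x \<in> hom (\<iota> U) (\<iota> U)" using dm_hom[OF a b \<Phi> ptsD(1)[OF x] ptsD(1)[OF y]] ptsD(2)[OF x] ptsD(2)[OF y] by simp
  have "one (\<iota> U) \<preceq> dm A B \<Phi> y x"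
  proof (rule coveredD[OF cover_covered[OF U S] d])
    fix c assume "c \<in> {gm T U s \<cdot> (gm T U s)\<degree> |T s. (T, s) \<in> {(W, s). W \<in> Obj C \<and> s \<in> Hom C W U \<and> (PAct (nv A) W U s x, PAct (nv B) W U s y) \<in> rd \<Phi> W}}"
    then obtain W s where "c = gm W U s \<cdot> (gm W U s)\<degree>" "W \<in> Obj C" "s \<in> Hom C W U" "(PAct (nv A) W U s x, PAct (nv B) W U s y) \<in> rd \<Phi> W" by blast
    then show "c \<preceq> dm A B \<Phi> y x" using rd_gm_iff[OF \<Phi> U x y, of W s s] x y by (simp add: PAct_nv)
  qed
  then show "(x, y) \<in> rd \<Phi> U" using U x y by (simp add: rd_def)
qed

text \<open>A distributor is covered by the spans of maps below it, and \<open>rd_res_iff\<close>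
  reads these off the relation.\<close>

lemma rd_le_iff:
  assumes \<Phi>: "\<Phi> \<in> distributors Q A B" and \<Psi>: "\<Psi> \<in> distributors Q A B"
  shows "Le (SymDist Q) A B \<Phi> \<Psi> \<longleftrightarrow> (\<forall>U\<in>Obj C. rd \<Phi> U \<subseteq> rd \<Psi> U)"
  unfolding Le_SymDist[OF scc_sqc[OF A] scc_sqc[OF B] \<Phi> \<Psi>]
proof
  note a = scc_sqc[OF A] and b = scc_sqc[OF B]
  assume le: "\<forall>x\<in>Elts A. \<forall>y\<in>Elts B. dm A B \<Phi> y x \<preceq> dm A B \<Psi> y x"
  show "\<forall>U\<in>Obj C. rd \<Phi> U \<subseteq> rd \<Psi> U"
  proof (intro ballI subsetI)
    fix U p assume U: "U \<in> Obj C" and "p \<in> rd \<Phi> U"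
    then obtain x y where p: "p = (x, y)" "x \<in> pts A (\<iota> U)" "y \<in> pts B (\<iota> U)" "one (\<iota> U) \<preceq> dm A B \<Phi> y x" by (auto simp: rd_def)
    then have "dm A B \<Phi> y x \<preceq> dm A B \<Psi> y x" using le ptsD(1)[OF p(2)] ptsD(1)[OF p(3)] by simp
    from leq_trans[OF p(4) this] show "p \<in> rd \<Psi> U" using p(1-3) U by (simp add: rd_def)
  qed
next
  note a = scc_sqc[OF A] and b = scc_sqc[OF B]
  assume sub: "\<forall>U\<in>Obj C. rd \<Phi> U \<subseteq> rd \<Psi> U"
  show "\<forall>x\<in>Elts A. \<forall>y\<in>Elts B. dm A B \<Phi> y x \<preceq> dm A B \<Psi> y x"
  proof (intro ballI)
    fix x y assume x: "x \<in> Elts A" and y: "y \<in> Elts B"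
    show "dm A B \<Phi> y x \<preceq> dm A B \<Psi> y x"
    proof (rule arrow_leI[OF dm_hom[OF a b \<Phi> x y] dm_hom[OF a b \<Psi> x y]])
      fix U s t assume *: "U \<in> Obj C" "is_map (\<iota> U) (Ty A x) t" "is_map (\<iota> U) (Ty B y) s" "s \<cdot> t\<degree> \<preceq> dm A B \<Phi> y x"
      then show "s \<cdot> t\<degree> \<preceq> dm A B \<Psi> y x" using rd_res_iff[OF \<Phi> x y *(1-3)] rd_res_iff[OF \<Psi> x y *(1-3)] sub by blast
    qed
  qed
qed

text \<open>The entry of \<open>\<Phi>\<close> at \<open>y\<close>, \<open>x\<close> is the join of
  the spans \<open>s \<cdot> t\<degree>\<close> whose restrictions are related by \<open>R\<close>.
  That its relation is no larger than \<open>R\<close> uses closedness: from an identity below the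
  entry, \<open>relation_local\<close> extracts a covering sieve on which \<open>R\<close>
  holds.\<close>

lemma rd_surj:
  assumes R: "M.crel A B R" shows "\<exists>\<Phi>\<in>distributors Q A B. rd \<Phi> = R"
proof -
  note a = scc_sqc[OF A] and b = scc_sqc[OF B]
  note r = M.crelD[OF R, unfolded PSet_nv]
  have rr: "(res A x (gm W U s), res B y (gm W U s)) \<in> R W" if "U \<in> Obj C" "W \<in> Obj C" "s \<in> Hom C W U" "(x, y) \<in> R U" for U W s x y
    using r(3)[OF that] r(2)[OF that(1,4)] by (simp add: PAct_nv)
  define S where "S y x = {s \<cdot> t\<degree> |U s t. U \<in> Obj C \<and> is_map (\<iota> U) (Ty A x) t \<and> is_map (\<iota> U) (Ty B y) s \<and> (res A x t, res B y s) \<in> R U}" for y x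
  define \<phi> where "\<phi> y x = jn (Ty A x) (Ty B y) (S y x)" for y x
  have sub: "S y x \<subseteq> hom (Ty A x) (Ty B y)" for x y unfolding S_def using cmp_hom[OF is_mapD(1) is_mapD(2)] by blast
  have \<phi>h: "\<phi> y x \<in> hom (Ty A x) (Ty B y)" and \<phi>c: "covered (Ty A x) (Ty B y) (\<phi> y x) (S y x)" and \<phi>u: "\<And>b. b \<in> S y x \<Longrightarrow> b \<preceq> \<phi> y x"
    if "x \<in> Elts A" "y \<in> Elts B" for x y
    unfolding \<phi>_def using jn_props[OF sqc_Ty[OF a that(1)] sqc_Ty[OF b that(2)] sub] by blast+
  have \<phi>u': "s \<cdot> t\<degree> \<preceq> \<phi> y x"
    if "x \<in> Elts A" "y \<in> Elts B" "U \<in> Obj C" "is_map (\<iota> U) (Ty A x) t" "is_map (\<iota> U) (Ty B y) s" "(res A x t, res B y s) \<in> R U" for x y U s t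
    by (rule \<phi>u[OF that(1,2)]) (use that in \<open>auto simp: S_def\<close>)
  define \<Phi> where "\<Phi> = mk_dist A B \<phi>"
  have \<Phi>: "\<Phi> \<in> distributors Q A B" unfolding \<Phi>_def
  proof (rule mk_dist_closed[OF a b \<phi>h])
    fix x y y' assume x: "x \<in> Elts A" and y: "y \<in> Elts B" "y' \<in> Elts B"
    show "hm B y' y \<cdot> \<phi> y x \<preceq> \<phi> y' x"
    proof (rule covered_right[OF \<phi>c[OF x y(1)] hm_hom[OF b y] \<phi>h[OF x y(2)]])
      fix c assume "c \<in> S y x"
      then obtain U s t where c: "c = s \<cdot> t\<degree>" "U \<in> Obj C" "is_map (\<iota> U) (Ty A x) t" "is_map (\<iota> U) (Ty B y) s" "(res A x t, res B y s) \<in> R U"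
        unfolding S_def by blast
      show "hm B y' y \<cdot> c \<preceq> \<phi> y' x" unfolding c(1)
        by (rule hm_span_leq[where R = R, OF A B rr x y c(2-5) \<phi>h[OF x y(2)] \<phi>u'[OF x y(2)]])
    qed
  next
    fix x x' y assume x: "x \<in> Elts A" "x' \<in> Elts A" and y: "y \<in> Elts B"
    show "\<phi> y x \<cdot> hm A x x' \<preceq> \<phi> y x'"
    proof (rule covered_left[OF \<phi>c[OF x(1) y] hm_hom[OF a x(2,1)] \<phi>h[OF x(2) y]])
      fix c assume "c \<in> S y x"
      then obtain U s t where c: "c = s \<cdot> t\<degree>" "U \<in> Obj C" "is_map (\<iota> U) (Ty A x) t" "is_map (\<iota> U) (Ty B y) s" "(res A x t, res B y s) \<in> R U"
        unfolding S_def by blast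
      \<comment> \<open>Under the involution the right action becomes the left action for the
        converse relation.\<close>
      have "hm A x' x \<cdot> (t \<cdot> s\<degree>) \<preceq> (\<phi> y x')\<degree>"
        by (rule hm_span_leq[where R = "\<lambda>U. (R U)\<inverse>", OF B A _ y x c(2,4,3) _ cv_hom[OF \<phi>h[OF x(2) y]]])
          (use rr c(5) cv_mono[OF \<phi>u'[OF x(2) y]] in \<open>auto simp: cv_cmp\<close>)
      then show "c \<cdot> hm A x x' \<preceq> \<phi> y x'"
        using cv_mono[of "hm A x' x \<cdot> (t \<cdot> s\<degree>)" "(\<phi> y x')\<degree>"] c(1) hm_cv[OF a x] hm_cv[OF a x(2,1)] by (simp add: cv_cmp)
    qed
  qed
  have d: "dm A B \<Phi> y x = \<phi> y x" if "x \<in> Elts A" "y \<in> Elts B" for x y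
    unfolding \<Phi>_def by (rule dm_mk_dist[where \<phi> = \<phi>]) (use that \<phi>h in auto)
  have "rd \<Phi> = R"
  proof (rule M.crel_eqI[OF crel_rd[OF \<Phi>] R], intro equalityI subsetI)
    fix U p assume U: "U \<in> Obj C" and p: "p \<in> R U"
    obtain x y where xy: "p = (x, y)" by (metis surj_pair)
    have P: "x \<in> pts A (\<iota> U)" "y \<in> pts B (\<iota> U)" using r(2)[OF U] p xy by auto
    note o = is_map_one[OF \<iota>_closed[OF U]]
    have "one (\<iota> U) \<cdot> (one (\<iota> U))\<degree> \<preceq> \<phi> y x"
      by (rule \<phi>u'[OF ptsD(1)[OF P(1)] ptsD(1)[OF P(2)] U])
        (use o ptsD(2)[OF P(1)] ptsD(2)[OF P(2)] res_one[OF A inf P(1)] res_one[OF B inf P(2)] p xy in simp_all)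
    then have "one (\<iota> U) \<preceq> \<phi> y x" using cv_one[OF \<iota>_closed[OF U]] cmp_one(1)[OF one_hom[OF \<iota>_closed[OF U]]] by simp
    then show "p \<in> rd \<Phi> U" using xy U P d ptsD(1)[OF P(1)] ptsD(1)[OF P(2)] by (simp add: rd_def)
  next
    fix U p assume U: "U \<in> Obj C" and "p \<in> rd \<Phi> U"
    then obtain x y where p: "p = (x, y)" "x \<in> pts A (\<iota> U)" "y \<in> pts B (\<iota> U)" and "one (\<iota> U) \<preceq> dm A B \<Phi> y x"
      by (auto simp: rd_def)
    then have le: "one (\<iota> U) \<preceq> \<phi> y x" using d[OF ptsD(1)[OF p(2)] ptsD(1)[OF p(3)]] by simp
    note dx = ptsD[OF p(2)] and dy = ptsD[OF p(3)]
    have "{(W, s). W \<in> Obj C \<and> s \<in> Hom C W U \<and> (res A x (gm W U s), res B y (gm W U s)) \<in> R W} \<in> J U"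
    proof (rule relation_local[OF A B U p(2,3)])
      show "(res A a (gm V W k), res B b (gm V W k)) \<in> R V"
        if "W \<in> Obj C" "V \<in> Obj C" "k \<in> Hom C V W" "(a, b) \<in> R W" for W V k a b by (rule rr[OF that])
      fix z assume z: "z \<in> hom (\<iota> U) (\<iota> U)"
        and leD: "\<And>W f g. \<lbrakk>W \<in> Obj C; f \<in> Hom C W U; g \<in> Hom C W U; (res A x (gm W U g), res B y (gm W U f)) \<in> R W\<rbrakk>
          \<Longrightarrow> gm W U f \<cdot> (gm W U g)\<degree> \<preceq> z"
      have cov: "covered (\<iota> U) (\<iota> U) (\<phi> y x) (S y x)" using \<phi>c[OF dx(1) dy(1)] dx(2) dy(2) by simp
      have "\<phi> y x \<preceq> z"
      proof (rule coveredD[OF cov z])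
        fix c assume "c \<in> S y x"
        then obtain V s t where c: "c = s \<cdot> t\<degree>" "V \<in> Obj C" "is_map (\<iota> V) (\<iota> U) t" "is_map (\<iota> V) (\<iota> U) s" "(res A x t, res B y s) \<in> R V"
          unfolding S_def dx(2) dy(2) by blast
        note s = is_mapD[OF c(4)] and t = is_mapD[OF c(3)]
        show "c \<preceq> z" unfolding c(1)
        proof (rule composite_leq[OF U U c(2) t(2) s(1) z])
          fix W f k g assume W: "W \<in> Obj C" "f \<in> Hom C W U" "k \<in> Hom C W V" "g \<in> Hom C W U"
            and f: "gm W U f \<cdot> (gm W V k)\<degree> \<preceq> s" and g: "gm W V k \<cdot> (gm W U g)\<degree> \<preceq> t\<degree>"
          note mf = gm_map[OF U W(1,2)] and mk = gm_map[OF c(2) W(1,3)] and mg = gm_map[OF U W(1,4)]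
          \<comment> \<open>Shifted along the adjunction of \<open>gm W V k\<close>, each bound
            compares two maps and is therefore an equation. Both legs factor through
            \<open>k\<close>, so the pair of restrictions is a restriction of the pair in
            \<open>R\<close>.\<close>
          have "gm W U f \<preceq> s \<cdot> gm W V k" using f map_shift_right[OF mk gm_hom[OF U W(1,2)] s(1)] by simp
          then have fk: "gm W U f = s \<cdot> gm W V k" by (rule map_leq_imp_eq[OF mf is_map_cmp[OF c(4) mk]])
          have "gm W U g \<cdot> (gm W V k)\<degree> \<preceq> t" using cv_mono[OF g] by (simp add: cv_cmp)
          then have "gm W U g \<preceq> t \<cdot> gm W V k" using map_shift_right[OF mk gm_hom[OF U W(1,4)] t(1)] by simp
          then have gk: "gm W U g = t \<cdot> gm W V k" by (rule map_leq_imp_eq[OF mg is_map_cmp[OF c(3) mk]])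
          have "(res A x (gm W U g), res B y (gm W U f)) \<in> R W"
            using rr[OF c(2) W(1,3) c(5)] res_res[OF A inf dx(1) _ mk, of t] res_res[OF B inf dy(1) _ mk, of s] c(3,4) dx dy
            by (simp add: fk gk)
          then show "gm W U f \<cdot> (gm W U g)\<degree> \<preceq> z" by (rule leD[OF W(1,2,4)])
        qed
      qed
      then show "one (\<iota> U) \<preceq> z" using le leq_trans by blast
    qed
    then show "p \<in> R U" using r(4)[OF U p(2,3)] p(1) by (simp add: PAct_nv[OF p(2)] PAct_nv[OF p(3)])
  qed
  then show ?thesis using \<Phi> by blast
qed

lemma rd_bij: "bij_betw rd (distributors Q A B) {R. M.crel A B R}"
  unfolding bij_betw_def
proof
  note a = scc_sqc[OF A] and b = scc_sqc[OF B]
  show "inj_on rd (distributors Q A B)"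
  proof (rule inj_onI)
    fix \<Phi> \<Psi> assume \<Phi>: "\<Phi> \<in> distributors Q A B" and \<Psi>: "\<Psi> \<in> distributors Q A B" and e: "rd \<Phi> = rd \<Psi>"
    then have "Le (SymDist Q) A B \<Phi> \<Psi>" "Le (SymDist Q) A B \<Psi> \<Phi>" using rd_le_iff[OF \<Phi> \<Psi>] rd_le_iff[OF \<Psi> \<Phi>] by auto
    then show "\<Phi> = \<Psi>"
      using dist_eqI[OF a b \<Phi> \<Psi>] leq_antisym unfolding Le_SymDist[OF a b \<Phi> \<Psi>] Le_SymDist[OF a b \<Psi> \<Phi>] by blast
  qed
  show "rd ` distributors Q A B = {R. M.crel A B R}" using crel_rd rd_surj by (auto simp: image_iff)
qed

end

lemma rd_Arr: assumes A: "scc (A :: ('o, 'a, 'v) qcat)" shows "rd A A (Arr A) = M.dg A"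
proof
  have a: "sqc A" by (rule scc_sqc[OF A])
  fix U
  have "one (\<iota> U) \<preceq> hm A y x \<longleftrightarrow> x = y" if "x \<in> pts A (\<iota> U)" "y \<in> pts A (\<iota> U)" for x y
    using pts_eqI[OF a that(2,1)] hm_one[OF a ptsD(1)[OF that(1)]] ptsD(2)[OF that(1)] by auto
  then show "rd A A (Arr A) U = M.dg A U" by (auto simp: rd_def[OF A A] M.dg_def dm_Arr)
qed

lemma rd_inv:
  assumes A: "scc (A :: ('o, 'a, 'v) qcat)" and B: "scc (B :: ('o, 'a, 'v) qcat)" and \<Phi>: "\<Phi> \<in> distributors Q A B"
  shows "rd B A (dist_inv A B \<Phi>) = (\<lambda>U. (rd A B \<Phi> U)\<inverse>)"
proof
  note a = scc_sqc[OF A] and b = scc_sqc[OF B]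
  fix U
  have "one (\<iota> U) \<preceq> dm B A (dist_inv A B \<Phi>) x y \<longleftrightarrow> one (\<iota> U) \<preceq> dm A B \<Phi> y x"
    if "U \<in> Obj C" "x \<in> pts A (\<iota> U)" "y \<in> pts B (\<iota> U)" for x y
    using dm_inv[OF a b \<Phi> ptsD(1)[OF that(2)] ptsD(1)[OF that(3)]] leq_cvI[OF _ \<iota>_closed[OF that(1)]] cv_cv by metis
  then show "rd B A (dist_inv A B \<Phi>) U = (rd A B \<Phi> U)\<inverse>" by (auto simp: rd_def[OF A B] rd_def[OF B A])
qed

text \<open>The composite distributor has a closed relation containing the pointwise composite
  \<open>K\<close>, hence also the closure of \<open>K\<close>. Conversely, let the identity lie
  below the join over \<open>y\<close>, and cover the type of \<open>y\<close> by maps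
  \<open>t\<close>. A span with middle leg \<open>k\<close> has the restriction of \<open>y\<close>
  along \<open>t \<cdot> gm W V k\<close> as its intermediate section, and
  \<open>relation_local\<close> turns such spans into a covering sieve.\<close>

lemma rd_comp:
  assumes A: "scc (A :: ('o, 'a, 'v) qcat)" and B: "scc (B :: ('o, 'a, 'v) qcat)" and D: "scc (D :: ('o, 'a, 'v) qcat)"
    and \<Phi>: "\<Phi> \<in> distributors Q A B" and \<Psi>: "\<Psi> \<in> distributors Q B D"
  shows "rd A D (dist_comp Q A B D \<Psi> \<Phi>) = M.rc A B D (rd B D \<Psi>) (rd A B \<Phi>)"
proof -
  note a = scc_sqc[OF A] and b = scc_sqc[OF B] and d = scc_sqc[OF D]
  let ?R = "rd A B \<Phi>" and ?S = "rd B D \<Psi>" and ?T = "dist_comp Q A B D \<Psi> \<Phi>"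
  note cR = crel_rd[OF A B \<Phi>] and cS = crel_rd[OF B D \<Psi>] and dT = dist_comp_closed[OF a b d \<Phi> \<Psi>]
  note cT = crel_rd[OF A D dT]
  define K where "K U = ?R U O ?S U" for U
  have o: "A \<in> Obj (SymCat_sc Q)" "B \<in> Obj (SymCat_sc Q)" "D \<in> Obj (SymCat_sc Q)" using A B D scc_Obj by auto
  have Ki: "x \<in> PSet (nv A) U \<and> z \<in> PSet (nv D) U" if "U \<in> Obj C" "(x, z) \<in> K U" for U x z
    using that M.crelD(2)[OF cR] M.crelD(2)[OF cS] by (auto simp: K_def)
  have Kr: "(PAct (nv A) W U s x, PAct (nv D) W U s z) \<in> K W" if *: "U \<in> Obj C" "W \<in> Obj C" "s \<in> Hom C W U" and xz: "(x, z) \<in> K U" for U W s x z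
  proof -
    obtain y where "(x, y) \<in> ?R U" "(y, z) \<in> ?S U" using xz by (auto simp: K_def)
    then show ?thesis using M.crelD(3)[OF cR *] M.crelD(3)[OF cS *] unfolding K_def by blast
  qed
  have rc: "M.rc A B D ?S ?R = M.cl A D K" by (simp add: M.rc_def K_def[abs_def])
  have cc: "M.crel A D (M.cl A D K)" by (rule M.crel_cl[OF o(1,3) Ki Kr])
  show ?thesis unfolding rc
  proof (rule M.crel_eqI[OF cT cc], intro equalityI)
    fix U assume U: "U \<in> Obj C"
    have sub: "K U \<subseteq> rd A D ?T U" if U: "U \<in> Obj C" for U
    proof
      fix p assume "p \<in> K U"
      then obtain x y z where p: "p = (x, z)" "(x, y) \<in> ?R U" "(y, z) \<in> ?S U" by (auto simp: K_def)
      have x: "x \<in> pts A (\<iota> U)" "y \<in> pts B (\<iota> U)" "one (\<iota> U) \<preceq> dm A B \<Phi> y x" using p(2) U by (auto simp: rd_def[OF A B])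
      have z: "z \<in> pts D (\<iota> U)" "one (\<iota> U) \<preceq> dm B D \<Psi> z y" using p(3) U by (auto simp: rd_def[OF B D])
      have "one (\<iota> U) \<cdot> one (\<iota> U) \<preceq> dm B D \<Psi> z y \<cdot> dm A B \<Phi> y x" by (intro cmp_mono x z)
      also have "\<dots> \<preceq> dm A D ?T z x" by (rule dm_comp_upper[OF a b d \<Phi> \<Psi> ptsD(1)[OF x(1)] ptsD(1)[OF z(1)] ptsD(1)[OF x(2)]])
      finally show "p \<in> rd A D ?T U" using p(1) x(1) z(1) U cmp_one(1)[OF one_hom[OF \<iota>_closed[OF U]]] by (simp add: rd_def[OF A D])
    qed
    show "M.cl A D K U \<subseteq> rd A D ?T U" by (rule M.cl_least[OF o(1,3) Ki Kr cT sub])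
    show "rd A D ?T U \<subseteq> M.cl A D K U"
    proof
      fix p assume "p \<in> rd A D ?T U"
      then obtain x z where p: "p = (x, z)" "x \<in> pts A (\<iota> U)" "z \<in> pts D (\<iota> U)" "one (\<iota> U) \<preceq> dm A D ?T z x"
        using U by (auto simp: rd_def[OF A D])
      note dx = ptsD[OF p(2)] and dz = ptsD[OF p(3)]
      have "{(W, s). W \<in> Obj C \<and> s \<in> Hom C W U \<and> (res A x (gm W U s), res D z (gm W U s)) \<in> K W} \<in> J U"
      proof (rule relation_local[OF A D U p(2,3)])
        show "(res A u (gm V W k), res D v (gm V W k)) \<in> K V"
          if "W \<in> Obj C" "V \<in> Obj C" "k \<in> Hom C V W" "(u, v) \<in> K W" for W V k u v
          using Kr[OF that] Ki[OF that(1,4)] by (simp add: PAct_nv)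
        fix w assume w: "w \<in> hom (\<iota> U) (\<iota> U)"
          and le: "\<And>W f g. \<lbrakk>W \<in> Obj C; f \<in> Hom C W U; g \<in> Hom C W U; (res A x (gm W U g), res D z (gm W U f)) \<in> K W\<rbrakk>
            \<Longrightarrow> gm W U f \<cdot> (gm W U g)\<degree> \<preceq> w"
        have w': "w \<in> hom (Ty A x) (Ty D z)" using w dx(2) dz(2) by simp
        have "dm A D ?T z x \<preceq> w"
          unfolding dm_comp_iff[OF a b d \<Phi> \<Psi> dx(1) dz(1) w']
        proof
          fix y assume y: "y \<in> Elts B"
          let ?h1 = "dm A B \<Phi> y x" and ?h2 = "dm B D \<Psi> z y"
          have h1: "?h1 \<in> hom (\<iota> U) (Ty B y)" using dm_hom[OF a b \<Phi> dx(1) y] dx(2) by simp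
          have h2: "?h2 \<in> hom (Ty B y) (\<iota> U)" using dm_hom[OF b d \<Psi> y dz(1)] dz(2) by simp
          have "?h2 \<cdot> one (Ty B y) \<cdot> ?h1 \<preceq> w"
          proof (rule covered_ctx[OF obj_covered[OF sqc_Ty[OF b y]] h2 h1 w])
            fix c assume "c \<in> {t \<cdot> t\<degree> |V t. V \<in> Obj C \<and> is_map (\<iota> V) (Ty B y) t}"
            then obtain V t where c: "c = t \<cdot> t\<degree>" "V \<in> Obj C" "is_map (\<iota> V) (Ty B y) t" by blast
            note t = is_mapD[OF c(3)]
            have "(?h2 \<cdot> t) \<cdot> (t\<degree> \<cdot> ?h1) \<preceq> w"
            proof (rule composite_leq[OF U U c(2) cmp_hom[OF t(2) h1] cmp_hom[OF h2 t(1)] w])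
              fix W f k g assume W: "W \<in> Obj C" "f \<in> Hom C W U" "k \<in> Hom C W V" "g \<in> Hom C W U"
                and f: "gm W U f \<cdot> (gm W V k)\<degree> \<preceq> ?h2 \<cdot> t" and g: "gm W V k \<cdot> (gm W U g)\<degree> \<preceq> t\<degree> \<cdot> ?h1"
              note m = is_map_cmp[OF c(3) gm_map[OF c(2) W(1,3)]]
              have "gm W U f \<cdot> (t \<cdot> gm W V k)\<degree> \<preceq> ?h2 \<cdot> (t \<cdot> t\<degree>)"
                using cmp_mono_right[OF f, of "t\<degree>"] by (simp add: cv_cmp cmp_assoc)
              also have "\<dots> \<preceq> ?h2" by (rule cmp_le_right[OF t(6) h2])
              finally have 1: "(res B y (t \<cdot> gm W V k), res D z (gm W U f)) \<in> ?S W"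
                using rd_res_iff[OF B D \<Psi> y dz(1) W(1) m gm_map_pts[OF p(3) U W(1,2)]] by simp
              have "t \<cdot> gm W V k \<cdot> (gm W U g)\<degree> \<preceq> t \<cdot> t\<degree> \<cdot> ?h1"
                using cmp_mono_left[OF g, of t] by (simp add: cmp_assoc)
              also have "\<dots> \<preceq> ?h1" by (rule cmp_le_left[OF t(6) h1])
              finally have "(res A x (gm W U g), res B y (t \<cdot> gm W V k)) \<in> ?R W"
                using rd_res_iff[OF A B \<Phi> dx(1) y W(1) gm_map_pts[OF p(2) U W(1,4)] m] by simp
              then have "(res A x (gm W U g), res D z (gm W U f)) \<in> K W" unfolding K_def using 1 by auto
              then show "gm W U f \<cdot> (gm W U g)\<degree> \<preceq> w" by (rule le[OF W(1,2,4)])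
            qed
            then show "?h2 \<cdot> c \<cdot> ?h1 \<preceq> w" using c(1) by (simp add: cmp_assoc)
          qed
          then show "?h2 \<cdot> ?h1 \<preceq> w" using cmp_one(1)[OF h2] by simp
        qed
        then show "one (\<iota> U) \<preceq> w" using p(4) leq_trans by blast
      qed
      then show "p \<in> M.cl A D K U" using U p PAct_nv[OF p(2)] PAct_nv[OF p(3)] by (simp add: M.cl_def)
    qed
  qed
qed

text \<open>Both sides have the same objects, so the equivalence is the identity on objects and
  \<open>sb\<close> after \<open>rd\<close> on arrows.\<close>

theorem SymDist_sc_equivalent_Rel_of_topos:
  "equivalent_involutive_quantaloids (SymDist_sc Q :: (('o, 'a, 'v) qcat, _) inv_quantaloid_rec)
     (Rel_of_topos (SymCat_sc Q :: (('o, 'a, 'v) qcat, _) cat))"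
proof -
  let ?D = "SymDist_sc Q :: (('o, 'a, 'v) qcat, _) inv_quantaloid_rec" and ?T = "SymCat_sc Q :: (('o, 'a, 'v) qcat, _) cat"
  have ob: "Obj ?D = {A. scc A}" by (auto simp: SymDist_sc_def SymDist_simps scc_def)
  have ops: "Hom ?D = distributors Q" "Idn ?D = Arr" "Comp ?D = dist_comp Q" "Le ?D = Le (SymDist Q)" "Inv ?D = dist_inv"
    by (simp_all add: SymDist_sc_def SymDist_simps)
  show ?thesis
  proof (rule iso_involutive_quantaloid[where \<phi> = "\<lambda>A B \<Phi>. M.sb A B (rd A B \<Phi>)"], unfold ob ops mem_Collect_eq)
    show "involutive_quantaloid ?D" unfolding SymDist_sc_def
      by (rule involutive_quantaloid_subset[OF involutive_quantaloid_SymDist]) auto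
    show "Obj (Rel_of_topos ?T) = {A. scc A}" by (simp add: Rel_of_topos_def SymCat_sc_simps(1))
    fix A B :: "('o, 'a, 'v) qcat" assume A: "scc A" and B: "scc B"
    have o: "A \<in> Obj ?T" "B \<in> Obj ?T" using A B scc_Obj by auto
    show "bij_betw (\<lambda>\<Phi>. M.sb A B (rd A B \<Phi>)) (distributors Q A B) (Hom (Rel_of_topos ?T) A B)"
      using bij_betw_trans[OF rd_bij[OF A B] M.sb_bij[OF o]] by (simp add: Rel_of_topos_def comp_def)
    show "M.sb A A (rd A A (Arr A)) = Idn (Rel_of_topos ?T) A"
      using rd_Arr[OF A] M.sb_diagonal[OF o(1)] by (simp add: Rel_of_topos_def)
    {
      fix \<Phi> assume \<Phi>: "\<Phi> \<in> distributors Q A B"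
      show "M.sb B A (rd B A (dist_inv A B \<Phi>)) = Inv (Rel_of_topos ?T) A B (M.sb A B (rd A B \<Phi>))"
        using rd_inv[OF A B \<Phi>] M.sb_opposite[OF o] by (simp add: Rel_of_topos_def)
      fix \<Psi> assume \<Psi>: "\<Psi> \<in> distributors Q A B"
      show "Le (Rel_of_topos ?T) A B (M.sb A B (rd A B \<Phi>)) (M.sb A B (rd A B \<Psi>)) \<longleftrightarrow> Le (SymDist Q) A B \<Phi> \<Psi>"
        using M.sb_le[OF o crel_rd[OF A B \<Phi>] crel_rd[OF A B \<Psi>]] rd_le_iff[OF A B \<Phi> \<Psi>] by (simp add: Rel_of_topos_def)
    }
    fix D :: "('o, 'a, 'v) qcat" and \<Phi> \<Psi> assume D: "scc D" and \<Phi>: "\<Phi> \<in> distributors Q A B" and \<Psi>: "\<Psi> \<in> distributors Q B D"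
    have o': "D \<in> Obj ?T" using D scc_Obj by auto
    show "M.sb A D (rd A D (dist_comp Q A B D \<Psi> \<Phi>)) = Comp (Rel_of_topos ?T) A B D (M.sb B D (rd B D \<Psi>)) (M.sb A B (rd A B \<Phi>))"
      using rd_comp[OF A B D \<Phi> \<Psi>] M.sb_comp(2)[OF o o' crel_rd[OF A B \<Phi>] crel_rd[OF B D \<Psi>]] by (simp add: Rel_of_topos_def)
  qed
qed

end

section \<open>Closed cribles\<close>

lemma extend_simps:
  fixes Q :: "('o, 'a) quantaloid_rec"
  shows "Obj (quantaloid_rec.extend Q \<lparr>Inv = I\<rparr>) = Obj Q" "Hom (quantaloid_rec.extend Q \<lparr>Inv = I\<rparr>) = Hom Q"
    "Idn (quantaloid_rec.extend Q \<lparr>Inv = I\<rparr>) = Idn Q" "Comp (quantaloid_rec.extend Q \<lparr>Inv = I\<rparr>) = Comp Q"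
    "Le (quantaloid_rec.extend Q \<lparr>Inv = I\<rparr>) = Le Q" "Inv (quantaloid_rec.extend Q \<lparr>Inv = I\<rparr>) = I"
    "Join (quantaloid_rec.extend Q \<lparr>Inv = I\<rparr>) = Join Q"
    "category (quantaloid_rec.extend Q \<lparr>Inv = I\<rparr>) \<longleftrightarrow> category Q"
    "quantaloid (quantaloid_rec.extend Q \<lparr>Inv = I\<rparr>) \<longleftrightarrow> quantaloid Q"
  by (simp_all add: quantaloid_rec.defs Join_def hom_order_def fun_eq_iff category_def quantaloid_def quantaloid_axioms_def)

definition crible_opposite :: "('o \<times> 'a \<times> 'a) set \<Rightarrow> ('o \<times> 'a \<times> 'a) set" where
  "crible_opposite R = {(U, f, g). (U, g, f) \<in> R}"

text \<open>Reversal of spans is built in here; that it is the canonical involution is shown in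
  \<open>canonical_inv_CR\<close>.\<close>

definition involutive_cribles ::
  "('o, 'a, 'm) cat_scheme \<Rightarrow> ('o \<Rightarrow> ('o \<times> 'a) set set) \<Rightarrow> ('o, ('o \<times> 'a \<times> 'a) set) inv_quantaloid_rec"
where
  "involutive_cribles C J = quantaloid_rec.extend (crible_quantaloid C J) \<lparr>Inv = \<lambda>X Y. crible_opposite\<rparr>"

text \<open>The closed crible generated by the span \<open>(f, 1)\<close>. The equation
  \<open>h = f k\<close> is asked only on a cover, since closed cribles cannot separate arrows that
  agree on a cover.\<close>

definition graph ::
  "('o, 'a, 'm) cat_scheme \<Rightarrow> ('o \<Rightarrow> ('o \<times> 'a) set set) \<Rightarrow> 'o \<Rightarrow> 'o \<Rightarrow> 'a \<Rightarrow> ('o \<times> 'a \<times> 'a) set"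
where
  "graph C J V U f = {(W, h, k) \<in> spans C V U.
     {(T, s). T \<in> Obj C \<and> s \<in> Hom C T W \<and> Comp C T W U h s = Comp C T V U f (Comp C T W V k s)} \<in> J W}"

context site
begin

lemma spans_iff: "(U, f, g) \<in> spans C X Y \<longleftrightarrow> U \<in> Obj C \<and> f \<in> Hom C U Y \<and> g \<in> Hom C U X"
  by (simp add: spans_def)

lemma crible_span: "R \<in> closed_cribles C J X Y \<Longrightarrow> (U, f, g) \<in> R \<Longrightarrow> U \<in> Obj C \<and> f \<in> Hom C U Y \<and> g \<in> Hom C U X"
  by (auto simp: closed_cribles_def spans_def)

lemma crible_comp:
  "\<lbrakk>R \<in> closed_cribles C J X Y; (U, f, g) \<in> R; V \<in> Obj C; s \<in> Hom C V U\<rbrakk> \<Longrightarrow> (V, Comp C V U Y f s, Comp C V U X g s) \<in> R"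
  unfolding closed_cribles_def by blast

lemma crible_closed:
  assumes "R \<in> closed_cribles C J X Y" "(U, f, g) \<in> spans C X Y"
    "span_sieve C X Y U f g R \<in> J U"
  shows "(U, f, g) \<in> R"
proof -
  have "\<forall>(U, f, g)\<in>spans C X Y.
      span_sieve C X Y U f g R \<in> J U \<longrightarrow> (U, f, g) \<in> R"
    using assms(1) unfolding closed_cribles_def by blast
  from bspec[OF this assms(2)] assms(3) show ?thesis by simp
qed

lemma crible_local:
  assumes X: "X \<in> Obj C" and Y: "Y \<in> Obj C" and R: "R \<in> closed_cribles C J X Y"
    and s: "U \<in> Obj C" "f \<in> Hom C U Y" "g \<in> Hom C U X" and S: "S \<in> J U"
    and l: "\<And>V s. \<lbrakk>(V, s) \<in> S; V \<in> Obj C; s \<in> Hom C V U\<rbrakk> \<Longrightarrow> (V, Comp C V U Y f s, Comp C V U X g s) \<in> R"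
  shows "(U, f, g) \<in> R"
proof -
  have "span_sieve C X Y U f g R \<in> J U"
  proof (rule J_superset[OF s(1) S])
    show "is_sieve C U (span_sieve C X Y U f g R)"
      using crible_comp[OF R] s X Y by (auto simp: is_sieve_def Comp_closed Comp_assoc[symmetric])
    show "S \<subseteq> span_sieve C X Y U f g R"
      using sieve_arrow[OF s(1) S] l by auto
  qed
  then show ?thesis using crible_closed[OF R] s by (simp add: spans_iff)
qed

text \<open>The sieve of a restricted span is the pullback of the sieve of the span, so one local
  step is already closed, by the local character of \<open>J\<close>.\<close>

lemma locally_closed:
  assumes X: "X \<in> Obj C" and Y: "Y \<in> Obj C" and A: "A \<subseteq> spans C X Y"
    and cl: "\<And>U f g V s. \<lbrakk>(U, f, g) \<in> A; V \<in> Obj C; s \<in> Hom C V U\<rbrakk> \<Longrightarrow> (V, Comp C V U Y f s, Comp C V U X g s) \<in> A"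
  shows "{(U, f, g) \<in> spans C X Y. span_sieve C X Y U f g A \<in> J U}
    \<in> closed_cribles C J X Y" (is "?L \<in> _")
proof -
  let ?S = "\<lambda>U f g. span_sieve C X Y U f g A"
  have pb: "sieve_pullback C V U s (?S U f g) = ?S V (Comp C V U Y f s) (Comp C V U X g s)"
    if "U \<in> Obj C" "V \<in> Obj C" "s \<in> Hom C V U" "f \<in> Hom C U Y" "g \<in> Hom C U X" for U V s f g
    using that X Y by (auto simp: sieve_pullback_def Comp_closed Comp_assoc)
  have sv: "is_sieve C U (?S U f g)" if "U \<in> Obj C" "f \<in> Hom C U Y" "g \<in> Hom C U X" for U f g
    using that X Y cl by (auto simp: is_sieve_def Comp_closed Comp_assoc[symmetric])
  have 1: "(V, Comp C V U Y f s, Comp C V U X g s) \<in> ?L"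
    if "(U, f, g) \<in> ?L" "V \<in> Obj C" "s \<in> Hom C V U" for U f g V s
  proof -
    have *: "U \<in> Obj C" "f \<in> Hom C U Y" "g \<in> Hom C U X" "?S U f g \<in> J U" using that by (auto simp: spans_iff)
    show ?thesis using J_pullback[OF *(1) that(2,3) *(4)] pb[OF *(1) that(2,3) *(2,3)] * that X Y
      by (simp add: spans_iff Comp_closed)
  qed
  have 2: "(U, f, g) \<in> ?L" if s: "(U, f, g) \<in> spans C X Y"
    and S: "span_sieve C X Y U f g ?L \<in> J U" for U f g
  proof -
    have *: "U \<in> Obj C" "f \<in> Hom C U Y" "g \<in> Hom C U X" using s by (auto simp: spans_iff)
    have "?S U f g \<in> J U" by (rule J_local[OF *(1) S sv[OF *]]) (use * pb in auto)
    then show ?thesis using s by simp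
  qed
  show ?thesis unfolding closed_cribles_def using 1 2 by blast
qed

text \<open>For a set stable under precomposition one local step gives the closure. This makes
  composites explicit: a span belongs to the composite when a middle leg exists locally
  (\<open>Comp_CR_mem\<close>).\<close>

lemma crible_closure_mem:
  assumes X: "X \<in> Obj C" and Y: "Y \<in> Obj C" and A: "A \<subseteq> spans C X Y"
    and cl: "\<And>U f g V s. \<lbrakk>(U, f, g) \<in> A; V \<in> Obj C; s \<in> Hom C V U\<rbrakk> \<Longrightarrow> (V, Comp C V U Y f s, Comp C V U X g s) \<in> A"
  shows "crible_closure C J X Y A =
    {(U, f, g) \<in> spans C X Y. span_sieve C X Y U f g A \<in> J U}"
    (is "_ = ?L")
proof
  have "A \<subseteq> ?L"
  proof
    fix a assume a: "a \<in> A"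
    obtain U f g where e: "a = (U, f, g)" by (cases a)
    then have U: "(U, f, g) \<in> spans C X Y" "U \<in> Obj C" using a A by (auto simp: spans_iff)
    have "span_sieve C X Y U f g A = {(V, s). V \<in> Obj C \<and> s \<in> Hom C V U}"
      using cl a e by auto
    then show "a \<in> ?L" using J_max[OF U(2)] U e by simp
  qed
  then show "crible_closure C J X Y A \<subseteq> ?L" using locally_closed[OF X Y A cl] by (auto simp: crible_closure_def)
  show "?L \<subseteq> crible_closure C J X Y A" unfolding crible_closure_def
  proof (intro Inter_greatest subsetI)
    fix R a assume R: "R \<in> {R \<in> closed_cribles C J X Y. A \<subseteq> R}" and a: "a \<in> ?L"
    obtain U f g where e: "a = (U, f, g)" by (cases a)
    then have U: "U \<in> Obj C" "f \<in> Hom C U Y" "g \<in> Hom C U X"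
      and S: "span_sieve C X Y U f g A \<in> J U"
      using a by (auto simp: spans_iff)
    have "(U, f, g) \<in> R" by (rule crible_local[OF X Y _ U S]) (use R in auto)
    then show "a \<in> R" by (simp add: e)
  qed
qed

lemma crible_closure_least: "R \<in> closed_cribles C J X Y \<Longrightarrow> crible_closure C J X Y A \<subseteq> R \<longleftrightarrow> A \<subseteq> R"
  by (auto simp: crible_closure_def)

lemma crible_closure_cong:
  assumes "\<And>R. R \<in> closed_cribles C J X Y \<Longrightarrow> A \<subseteq> R \<longleftrightarrow> B \<subseteq> R"
  shows "crible_closure C J X Y A = crible_closure C J X Y B"
  unfolding crible_closure_def using assms by (intro arg_cong[of _ _ Inter]) auto

text \<open>\<open>crible_closure_mem\<close> wants a set stable under precomposition, so the
  generator is first replaced by all spans \<open>(f, f)\<close>.\<close>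

lemma crible_Idn:
  assumes X: "X \<in> Obj C"
  shows "crible_closure C J X X {(X, Idn C X, Idn C X)} =
    {(U, f, g) \<in> spans C X X. eq_sieve C X U f g \<in> J U}"
proof -
  let ?A = "{(U, f, f) |U f. U \<in> Obj C \<and> f \<in> Hom C U X}"
  have A: "?A \<subseteq> spans C X X" by (auto simp: spans_iff)
  have cl: "(V, Comp C V U X f s, Comp C V U X g s) \<in> ?A" if "(U, f, g) \<in> ?A" "V \<in> Obj C" "s \<in> Hom C V U" for U f g V s
    using that X by (auto simp: Comp_closed)
  have "crible_closure C J X X {(X, Idn C X, Idn C X)} = crible_closure C J X X ?A"
  proof (rule crible_closure_cong, rule iffI)
    fix R assume R: "R \<in> closed_cribles C J X X"
    show "?A \<subseteq> R" if i: "{(X, Idn C X, Idn C X)} \<subseteq> R"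
    proof
      fix a assume "a \<in> ?A"
      then obtain U f where a: "a = (U, f, f)" "U \<in> Obj C" "f \<in> Hom C U X" by auto
      show "a \<in> R" using crible_comp[OF R, of X "Idn C X" "Idn C X" U f] i a X by (simp add: Idn_Comp)
    qed
    show "{(X, Idn C X, Idn C X)} \<subseteq> R" if "?A \<subseteq> R" using that X Idn_closed by auto
  qed
  also have "\<dots> = {(U, f, g) \<in> spans C X X. eq_sieve C X U f g \<in> J U}"
  proof -
    have "(V, Comp C V U X f s, Comp C V U X g s) \<in> ?A \<longleftrightarrow> Comp C V U X f s = Comp C V U X g s"
      if "V \<in> Obj C" "s \<in> Hom C V U" "(U, f, g) \<in> spans C X X" for V s U f g
      using that X by (auto simp: spans_iff Comp_closed)
    moreover have "crible_closure C J X X ?A = {(U, f, g) \<in> spans C X X.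
        span_sieve C X X U f g ?A \<in> J U}"
      by (rule crible_closure_mem[OF X X A]) (rule cl)
    ultimately show ?thesis
      by (simp only:, intro Collect_cong) (auto simp: split_def cong: conj_cong)
  qed
  finally show ?thesis .
qed

lemma relative_product:
  assumes X: "X \<in> Obj C" and Y: "Y \<in> Obj C" and Z: "Z \<in> Obj C"
    and R: "R \<in> closed_cribles C J X Y" and S: "S \<in> closed_cribles C J Y Z"
  shows "{(U, h, g). \<exists>f. (U, h, f) \<in> S \<and> (U, f, g) \<in> R} \<subseteq> spans C X Z"
    and "\<And>U f g V s. \<lbrakk>(U, f, g) \<in> {(U, h, g). \<exists>f. (U, h, f) \<in> S \<and> (U, f, g) \<in> R}; V \<in> Obj C; s \<in> Hom C V U\<rbrakk>
      \<Longrightarrow> (V, Comp C V U Z f s, Comp C V U X g s) \<in> {(U, h, g). \<exists>f. (U, h, f) \<in> S \<and> (U, f, g) \<in> R}"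
  using crible_span[OF R] crible_span[OF S] crible_comp[OF R] crible_comp[OF S] by (fastforce simp: spans_iff)+

abbreviation "CR \<equiv> involutive_cribles C J"

lemma involutive_cribles_simps:
  "Obj CR = Obj C" "Hom CR = closed_cribles C J" "Le CR X Y R S \<longleftrightarrow> R \<subseteq> S" "Inv CR X Y R = crible_opposite R"
  by (simp_all add: involutive_cribles_def extend_simps crible_quantaloid_def)

lemma Idn_CR_mem:
  "X \<in> Obj C \<Longrightarrow> (U, f, g) \<in> Idn CR X \<longleftrightarrow> U \<in> Obj C \<and> f \<in> Hom C U X \<and> g \<in> Hom C U X \<and>
    eq_sieve C X U f g \<in> J U"
  by (simp add: involutive_cribles_def extend_simps crible_quantaloid_def crible_Idn spans_iff)

lemma Idn_CR_refl: "X \<in> Obj C \<Longrightarrow> U \<in> Obj C \<Longrightarrow> f \<in> Hom C U X \<Longrightarrow> (U, f, f) \<in> Idn CR X"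
  using J_max[of U] by (simp add: Idn_CR_mem)

lemma Idn_CR_le: "z \<in> closed_cribles C J X X \<Longrightarrow> Idn CR X \<subseteq> z \<longleftrightarrow> (X, Idn C X, Idn C X) \<in> z"
  by (simp add: involutive_cribles_def extend_simps crible_quantaloid_def crible_closure_least)

lemma Comp_CR_mem:
  assumes "X \<in> Obj C" "Y \<in> Obj C" "Z \<in> Obj C" "R \<in> closed_cribles C J X Y" "S \<in> closed_cribles C J Y Z"
  shows "(U, h, g) \<in> Comp CR X Y Z S R \<longleftrightarrow> U \<in> Obj C \<and> h \<in> Hom C U Z \<and> g \<in> Hom C U X \<and>
    {(V, s). V \<in> Obj C \<and> s \<in> Hom C V U \<and> (\<exists>f. (V, Comp C V U Z h s, f) \<in> S \<and> (V, f, Comp C V U X g s) \<in> R)} \<in> J U"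
  using crible_closure_mem[OF assms(1,3) relative_product[OF assms]]
  by (simp add: involutive_cribles_def extend_simps crible_quantaloid_def spans_iff)

lemma Comp_CR_le:
  "z \<in> closed_cribles C J X Z \<Longrightarrow> Comp CR X Y Z S R \<subseteq> z \<longleftrightarrow> (\<forall>U h f g. (U, h, f) \<in> S \<longrightarrow> (U, f, g) \<in> R \<longrightarrow> (U, h, g) \<in> z)"
  by (auto simp add: involutive_cribles_def extend_simps crible_quantaloid_def crible_closure_least)

lemma Comp_CR_I: "(U, h, f) \<in> S \<Longrightarrow> (U, f, g) \<in> R \<Longrightarrow> (U, h, g) \<in> Comp CR X Y Z S R"
  by (auto simp add: involutive_cribles_def extend_simps crible_quantaloid_def crible_closure_def)

lemma crible_opposite_closed:
  assumes "R \<in> closed_cribles C J X Y" shows "crible_opposite R \<in> closed_cribles C J Y X"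
proof -
  have e: "span_sieve C Y X U f g (crible_opposite R)
    = span_sieve C X Y U g f R" for U f g
    by (simp add: crible_opposite_def)
  have 1: "crible_opposite R \<subseteq> spans C Y X" using crible_span[OF assms] by (auto simp: crible_opposite_def spans_iff)
  have 2: "\<forall>(U, f, g)\<in>crible_opposite R. \<forall>V\<in>Obj C. \<forall>s\<in>Hom C V U. (V, Comp C V U X f s, Comp C V U Y g s) \<in> crible_opposite R"
    using crible_comp[OF assms] by (auto simp: crible_opposite_def)
  have 3: "(U, f, g) \<in> crible_opposite R"
    if "(U, f, g) \<in> spans C Y X" "span_sieve C X Y U g f R \<in> J U" for U f g
    using that crible_closed[OF assms] by (simp add: crible_opposite_def spans_iff)
  show ?thesis unfolding closed_cribles_def mem_Collect_eq e by (intro conjI 1 2, clarify, rule 3)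
qed

lemma involutive_quantaloid_cribles:
  assumes "quantaloid (crible_quantaloid C J)"
  shows "involutive_quantaloid CR"
proof (rule involutive_quantaloidI)
  show "quantaloid CR" using assms by (simp add: involutive_cribles_def extend_simps)
  fix X Y assume X: "X \<in> Obj CR" and Y: "Y \<in> Obj CR"
  then have XY: "X \<in> Obj C" "Y \<in> Obj C" by (simp_all add: involutive_cribles_simps)
  show "Inv CR X Y R \<in> Hom CR Y X" if "R \<in> Hom CR X Y" for R
    using that crible_opposite_closed by (simp add: involutive_cribles_simps)
  show "Inv CR X X (Idn CR X) = Idn CR X"
  proof -
    have "eq_sieve C X U f g
      = eq_sieve C X U g f" for U f g by auto
    then have "(U, f, g) \<in> Idn CR X \<longleftrightarrow> (U, g, f) \<in> Idn CR X" for U f g unfolding Idn_CR_mem[OF XY(1)] by metis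
    then show ?thesis by (auto simp: involutive_cribles_simps crible_opposite_def)
  qed
  show "Inv CR Y X (Inv CR X Y R) = R" for R by (simp add: involutive_cribles_simps crible_opposite_def)
  show "Le CR Y X (Inv CR X Y R) (Inv CR X Y S)" if "Le CR X Y R S" for R S
    using that by (auto simp: involutive_cribles_simps crible_opposite_def)
  fix Z R S assume "Z \<in> Obj CR" "R \<in> Hom CR X Y" "S \<in> Hom CR Y Z"
  then have *: "Z \<in> Obj C" "R \<in> closed_cribles C J X Y" "S \<in> closed_cribles C J Y Z" by (simp_all add: involutive_cribles_simps)
  have "(U, h, g) \<in> Inv CR X Z (Comp CR X Y Z S R) \<longleftrightarrow> (U, h, g) \<in> Comp CR Z Y X (Inv CR X Y R) (Inv CR Y Z S)" for U h g
    unfolding involutive_cribles_simps Comp_CR_mem[OF *(1) XY(2,1) *(3,2)[THEN crible_opposite_closed]]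
    by (simp add: crible_opposite_def Comp_CR_mem[OF XY *] conj_commute cong: conj_cong) blast
  then show "Inv CR X Z (Comp CR X Y Z S R) = Comp CR Z Y X (Inv CR X Y R) (Inv CR Y Z S)" by auto
qed

text \<open>The unit provides, locally and for each \<open>x\<close>, some \<open>k\<close> with
  \<open>(x, k)\<close> in \<open>S\<close> and \<open>(k, x)\<close> in \<open>R\<close>; the
  counit makes such values locally unique. A \<open>y\<close> related to \<open>x\<close> by either
  crible agrees locally with \<open>k\<close>, so locally it is related by both, and closedness
  makes this hold outright. Hence the canonical involution of the cribles can be computed from
  opposites.\<close>

lemma crible_adjoint_unique:
  assumes X: "X \<in> Obj C" and Y: "Y \<in> Obj C" and adj: "is_adjoint CR X Y R S"
  shows "S = crible_opposite R"
proof -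
  have R: "R \<in> closed_cribles C J X Y" and S: "S \<in> closed_cribles C J Y X"
    and u: "Idn CR X \<subseteq> Comp CR X Y X S R" and c: "Comp CR Y X Y R S \<subseteq> Idn CR Y"
    using adj by (simp_all add: is_adjoint_def involutive_cribles_simps)
  have R': "crible_opposite R \<in> closed_cribles C J Y X" by (rule crible_opposite_closed[OF R])
  have single: "(U, k, y) \<in> Idn CR Y" if "(U, k, x) \<in> R" "(U, x, y) \<in> S" for U k x y
    using c Comp_CR_I[OF that] by blast
  have total: "{(V, s). V \<in> Obj C \<and> s \<in> Hom C V U \<and> (\<exists>k. (V, Comp C V U X x s, k) \<in> S \<and> (V, k, Comp C V U X x s) \<in> R)} \<in> J U"
    if "U \<in> Obj C" "x \<in> Hom C U X" for U x
    using Idn_CR_refl[OF X that] u by (auto simp: Comp_CR_mem[OF X Y X R S])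
  have loc: "(U, x, y) \<in> S \<and> (U, y, x) \<in> R" if U: "U \<in> Obj C" "x \<in> Hom C U X" "y \<in> Hom C U Y"
    and xy: "(U, x, y) \<in> S \<or> (U, y, x) \<in> R" for U x y
  proof -
    have step: "(V, Comp C V U X x s, Comp C V U Y y s) \<in> S \<and> (V, Comp C V U Y y s, Comp C V U X x s) \<in> R"
      if V: "V \<in> Obj C" "s \<in> Hom C V U" and k: "(V, Comp C V U X x s, k) \<in> S" "(V, k, Comp C V U X x s) \<in> R" for V s k
    proof -
      have e: "Comp C V U X x s \<in> Hom C V X" "Comp C V U Y y s \<in> Hom C V Y" "k \<in> Hom C V Y"
        using U V X Y crible_span[OF S k(1)] by (simp_all add: Comp_closed)
      have "(V, k, Comp C V U Y y s) \<in> Idn CR Y \<or> (V, Comp C V U Y y s, k) \<in> Idn CR Y"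
        using xy single[OF k(2)] single[OF _ k(1)] crible_comp[OF S, of U x y V s] crible_comp[OF R, of U y x V s] V by blast
      then have Q: "eq_sieve C Y V k (Comp C V U Y y s) \<in> J V" (is "?Q \<in> _")
        by (auto simp: Idn_CR_mem[OF Y] eq_commute[of "Comp C _ _ _ k _"])
      have "(V, Comp C V U X x s, Comp C V U Y y s) \<in> S"
      proof (rule crible_local[OF Y X S V(1) e(1,2) Q])
        show "(W, Comp C W V X (Comp C V U X x s) t, Comp C W V Y (Comp C V U Y y s) t) \<in> S" if "(W, t) \<in> ?Q" for W t
          using crible_comp[OF S k(1), of W t] that by simp
      qed
      moreover have "(V, Comp C V U Y y s, Comp C V U X x s) \<in> R"
      proof (rule crible_local[OF X Y R V(1) e(2,1) Q])
        show "(W, Comp C W V Y (Comp C V U Y y s) t, Comp C W V X (Comp C V U X x s) t) \<in> R" if "(W, t) \<in> ?Q" for W t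
          using crible_comp[OF R k(2), of W t] that by simp
      qed
      ultimately show ?thesis ..
    qed
    show ?thesis
      using crible_local[OF Y X S U(1,2,3) total[OF U(1,2)]] crible_local[OF X Y R U(1,3,2) total[OF U(1,2)]] step by blast
  qed
  have "(U, x, y) \<in> S \<longleftrightarrow> (U, y, x) \<in> R" for U x y
    using loc[of U x y] crible_span[OF S, of U x y] crible_span[OF R, of U y x] by blast
  then show ?thesis by (auto simp: crible_opposite_def)
qed

section \<open>Graphs of the arrows of the site\<close>

lemma graph_mem:
  "(W, h, k) \<in> graph C J V U f \<longleftrightarrow> W \<in> Obj C \<and> h \<in> Hom C W U \<and> k \<in> Hom C W V \<and>
     {(T, s). T \<in> Obj C \<and> s \<in> Hom C T W \<and> Comp C T W U h s = Comp C T V U f (Comp C T W V k s)} \<in> J W"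
  by (simp add: graph_def spans_iff)

lemma graph_closed:
  assumes V: "V \<in> Obj C" and U: "U \<in> Obj C" and f: "f \<in> Hom C V U"
  shows "graph C J V U f \<in> closed_cribles C J V U"
proof -
  let ?A = "{(T, Comp C T V U f k, k) |T k. T \<in> Obj C \<and> k \<in> Hom C T V}"
  have A: "?A \<subseteq> spans C V U" using V U f by (auto simp: spans_iff Comp_closed)
  have cl: "(T', Comp C T' T U h s, Comp C T' T V k s) \<in> ?A" if "(T, h, k) \<in> ?A" "T' \<in> Obj C" "s \<in> Hom C T' T" for T h k T' s
    using that V U f by (auto simp: Comp_closed Comp_assoc)
  have "(T, Comp C T W U h s, Comp C T W V k s) \<in> ?A \<longleftrightarrow> Comp C T W U h s = Comp C T V U f (Comp C T W V k s)"
    if "T \<in> Obj C" "s \<in> Hom C T W" "(W, h, k) \<in> spans C V U" for T s W h k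
    using that V U f by (auto simp: spans_iff Comp_closed)
  then have "graph C J V U f = {(W, h, k) \<in> spans C V U. span_sieve C V U W h k ?A \<in> J W}"
    unfolding graph_def by (intro Collect_cong) (auto simp: split_def cong: conj_cong)
  then show ?thesis using locally_closed[OF V U A cl] by simp
qed

lemma graph_refl:
  assumes "V \<in> Obj C" "U \<in> Obj C" "f \<in> Hom C V U" "W \<in> Obj C" "k \<in> Hom C W V"
  shows "(W, Comp C W V U f k, k) \<in> graph C J V U f"
proof -
  have "{(T, s). T \<in> Obj C \<and> s \<in> Hom C T W \<and> Comp C T W U (Comp C W V U f k) s = Comp C T V U f (Comp C T W V k s)}
    = {(T, s). T \<in> Obj C \<and> s \<in> Hom C T W}" using assms by (auto simp: Comp_assoc)
  then show ?thesis using assms J_max[of W] by (simp add: graph_mem Comp_closed)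
qed

lemma graph_refl_Idn:
  assumes "V \<in> Obj C" "U \<in> Obj C" "f \<in> Hom C V U"
  shows "(V, f, Idn C V) \<in> graph C J V U f"
  using graph_refl[OF assms assms(1) Idn_closed[OF assms(1)]] assms by (simp add: Comp_Idn)

text \<open>On a cover \<open>h\<close> equals \<open>f k\<close>, and \<open>z\<close> is closed,
  so \<open>f k\<close> may be replaced by \<open>h\<close> in a span of \<open>z\<close>.\<close>

lemma graph_local:
  assumes o: "V \<in> Obj C" "U \<in> Obj C" "X \<in> Obj C" and f: "f \<in> Hom C V U" and z: "z \<in> closed_cribles C J X U"
    and h: "(W, h, k) \<in> graph C J V U f" and l: "l \<in> Hom C W X" and m: "(W, Comp C W V U f k, l) \<in> z"
  shows "(W, h, l) \<in> z"
proof -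
  have *: "W \<in> Obj C" "h \<in> Hom C W U" "k \<in> Hom C W V" using h by (simp_all add: graph_mem)
  have S: "{(T, s). T \<in> Obj C \<and> s \<in> Hom C T W \<and> Comp C T W U h s = Comp C T V U f (Comp C T W V k s)} \<in> J W" (is "?S \<in> _")
    using h by (simp add: graph_mem)
  show ?thesis
  proof (rule crible_local[OF o(3,2) z *(1,2) l S])
    show "(T, Comp C T W U h s, Comp C T W X l s) \<in> z" if "(T, s) \<in> ?S" for T s
      using that crible_comp[OF z m, of T s] * o f by (simp add: Comp_assoc)
  qed
qed

text \<open>The composite is the closed crible generated by the span. Conditions of
  \<open>site_quantaloid\<close> on arrows of spans thereby become membership conditions.\<close>

lemma graph_span_le:
  assumes T: "T \<in> Obj C" and U: "U \<in> Obj C" and z: "z \<in> closed_cribles C J T U" and s: "(W, f, g) \<in> spans C T U"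
  shows "Comp CR T W U (graph C J W U f) (crible_opposite (graph C J W T g)) \<subseteq> z \<longleftrightarrow> (W, f, g) \<in> z"
proof
  have *: "W \<in> Obj C" "f \<in> Hom C W U" "g \<in> Hom C W T" using s by (auto simp: spans_iff)
  show "(W, f, g) \<in> z" if "Comp CR T W U (graph C J W U f) (crible_opposite (graph C J W T g)) \<subseteq> z"
    using that graph_refl_Idn[OF *(1) U *(2)] graph_refl_Idn[OF *(1) T *(3)] unfolding Comp_CR_le[OF z]
    by (auto simp: crible_opposite_def)
  assume m: "(W, f, g) \<in> z"
  show "Comp CR T W U (graph C J W U f) (crible_opposite (graph C J W T g)) \<subseteq> z" unfolding Comp_CR_le[OF z]
  proof (intro allI impI)
    fix Z a c b assume a: "(Z, a, c) \<in> graph C J W U f" and "(Z, c, b) \<in> crible_opposite (graph C J W T g)"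
    then have b: "(Z, b, c) \<in> graph C J W T g" by (simp add: crible_opposite_def)
    have Z: "Z \<in> Obj C" "a \<in> Hom C Z U" "c \<in> Hom C Z W" "b \<in> Hom C Z T" using a b by (simp_all add: graph_mem)
    have "(Z, Comp C Z W T g c, Comp C Z W U f c) \<in> crible_opposite z"
      using crible_comp[OF z m Z(1,3)] by (simp add: crible_opposite_def)
    then have "(Z, b, Comp C Z W U f c) \<in> crible_opposite z"
      using graph_local[OF *(1) T U *(3) crible_opposite_closed[OF z] b] Z * U by (simp add: Comp_closed)
    then show "(Z, a, b) \<in> z" using graph_local[OF *(1) U T *(2) z a Z(4)] by (simp add: crible_opposite_def)
  qed
qed

lemma small_category_cribles:
  assumes U: "universe TYPE('v)" and C: "small_category TYPE('v) C" and Q: "quantaloid (crible_quantaloid C J)"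
  shows "small_category TYPE('v) CR"
proof -
  have "small TYPE('v) (closed_cribles C J X Y)" if X: "X \<in> Obj C" "Y \<in> Obj C" for X Y
  proof -
    have "small TYPE('v) (Sigma (Obj C) (\<lambda>U. Hom C U Y \<times> Hom C U X))"
      using C X by (intro small_Sigma[OF U]) (auto simp: small_category_def)
    then have "small TYPE('v) (Pow (Sigma (Obj C) (\<lambda>U. Hom C U Y \<times> Hom C U X)))" by (rule small_Pow[OF U])
    then show ?thesis by (rule small_subset) (auto simp: closed_cribles_def spans_def)
  qed
  then show ?thesis using C Q by (simp add: small_category_def involutive_cribles_simps)
      (simp add: involutive_cribles_def extend_simps quantaloid_def)
qed

end

context site
begin

text \<open>By \<open>graph_span_le\<close> generation says that a crible consists of its spans,
  covering is closedness of cribles, and locality is the one-step description of the closure. Every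
  object is in the image of \<open>\<iota>\<close>, so its identity covers it.\<close>

theorem site_quantaloid_cribles:
  assumes U: "universe TYPE('v)" and C: "small_category TYPE('v) C" and R: "quantaloid (crible_quantaloid C J)"
  shows "site_quantaloid TYPE('v) CR C J (\<lambda>U. U) (graph C J)"
proof -
  interpret I: involutive_quantaloid CR by (rule involutive_quantaloid_cribles[OF R])
  note s = involutive_cribles_simps
  have Idn: "Idn CR X \<in> closed_cribles C J X X" if "X \<in> Obj C" for X using I.Idn_closed[of X] that by (simp add: s)
  have Comp: "Comp CR X Y Z S T \<in> closed_cribles C J X Z"
    if "X \<in> Obj C" "Y \<in> Obj C" "Z \<in> Obj C" "T \<in> closed_cribles C J X Y" "S \<in> closed_cribles C J Y Z" for X Y Z S T
    using I.Comp_closed[of X Y Z T S] that by (simp add: s)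
  show ?thesis
  proof (intro site_quantaloid.intro site_quantaloid_axioms.intro, unfold s span_arrow_def)
    show "involutive_quantaloid CR" by (rule I.involutive_quantaloid_axioms)
    show "site C J" by (rule site_axioms)
    show "universe TYPE('v)" by (rule U)
    show "small_category TYPE('v) CR" by (rule small_category_cribles[OF U C R])
    show "small_category TYPE('v) C" by (rule C)
    fix U assume U: "U \<in> Obj C"
    then show "U \<in> Obj C" .
    show "graph C J U U (Idn C U) = Idn CR U"
    proof -
      have "(W, h, k) \<in> graph C J U U (Idn C U) \<longleftrightarrow> (W, h, k) \<in> Idn CR U" for W h k
        using U by (simp add: graph_mem Idn_CR_mem Comp_closed Idn_Comp cong: conj_cong)
      then show ?thesis by auto
    qed
    show "Idn CR U \<subseteq> z"
      if R: "R \<in> J U" and z: "z \<in> closed_cribles C J U U"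
        and le: "\<And>T s. (T, s) \<in> R \<Longrightarrow> Comp CR U T U (graph C J T U s) (crible_opposite (graph C J T U s)) \<subseteq> z" for R z
      unfolding Idn_CR_le[OF z]
    proof (rule crible_local[OF U U z U Idn_closed[OF U] Idn_closed[OF U] R])
      fix T s assume s: "(T, s) \<in> R" "T \<in> Obj C" "s \<in> Hom C T U"
      then have "(T, s, s) \<in> z" using graph_span_le[OF U U z, of T s s] le[OF s(1)] by (simp add: spans_iff)
      then show "(T, Comp C T U U (Idn C U) s, Comp C T U U (Idn C U) s) \<in> z" using s U by (simp add: Idn_Comp)
    qed
    fix T assume T: "T \<in> Obj C"
    show "is_symmetric_left_adjoint CR T U (graph C J T U f)" if f: "f \<in> Hom C T U" for f
      unfolding is_symmetric_left_adjoint_def is_adjoint_def s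
    proof (intro conjI)
      note g = graph_closed[OF T U f]
      show "graph C J T U f \<in> closed_cribles C J T U" by (rule g)
      show g': "crible_opposite (graph C J T U f) \<in> closed_cribles C J U T" by (rule crible_opposite_closed[OF g])
      show "Idn CR T \<subseteq> Comp CR T U T (crible_opposite (graph C J T U f)) (graph C J T U f)"
        unfolding Idn_CR_le[OF Comp[OF T U T g g']]
        by (rule Comp_CR_I[of _ _ f]) (simp_all add: crible_opposite_def graph_refl_Idn T U f)
      show "Comp CR U T U (graph C J T U f) (crible_opposite (graph C J T U f)) \<subseteq> Idn CR U"
        using graph_span_le[OF U U Idn[OF U], of T f f] Idn_CR_refl[OF U T f] T f by (simp add: spans_iff)
    qed
    show "graph C J W U (Comp C W T U f g) = Comp CR W T U (graph C J T U f) (graph C J W T g)"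
      if W: "W \<in> Obj C" and f: "f \<in> Hom C T U" and g: "g \<in> Hom C W T" for W f g
    proof
      have fg: "Comp C W T U f g \<in> Hom C W U" using W T U f g by (simp add: Comp_closed)
      note G = graph_closed[OF W U fg] and F1 = graph_closed[OF T U f] and F2 = graph_closed[OF W T g]
      note K = Comp[OF W T U F2 F1]
      show "Comp CR W T U (graph C J T U f) (graph C J W T g) \<subseteq> graph C J W U (Comp C W T U f g)"
        unfolding Comp_CR_le[OF G]
      proof (intro allI impI)
        fix Z h k l assume h: "(Z, h, k) \<in> graph C J T U f" and k: "(Z, k, l) \<in> graph C J W T g"
        have Z: "Z \<in> Obj C" "h \<in> Hom C Z U" "k \<in> Hom C Z T" "l \<in> Hom C Z W" using h k by (simp_all add: graph_mem)
        have S: "{(V, s). V \<in> Obj C \<and> s \<in> Hom C V Z \<and> Comp C V Z T k s = Comp C V W T g (Comp C V Z W l s)} \<in> J Z" (is "?S \<in> _")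
          using k by (simp add: graph_mem)
        have "(Z, Comp C Z T U f k, l) \<in> graph C J W U (Comp C W T U f g)"
        proof (rule crible_local[OF W U G Z(1) _ Z(4) S])
          show "Comp C Z T U f k \<in> Hom C Z U" using Z T U f by (simp add: Comp_closed)
          fix V s assume "(V, s) \<in> ?S"
          then have V: "V \<in> Obj C" "s \<in> Hom C V Z" "Comp C V Z T k s = Comp C V W T g (Comp C V Z W l s)" by auto
          then have "Comp C V Z U (Comp C Z T U f k) s = Comp C V W U (Comp C W T U f g) (Comp C V Z W l s)"
            using Z W T U f g by (simp add: Comp_assoc Comp_closed)
          then show "(V, Comp C V Z U (Comp C Z T U f k) s, Comp C V Z W l s) \<in> graph C J W U (Comp C W T U f g)"
            using graph_refl[OF W U fg V(1), of "Comp C V Z W l s"] V Z W by (simp add: Comp_closed)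
        qed
        then show "(Z, h, l) \<in> graph C J W U (Comp C W T U f g)" by (rule graph_local[OF T U W f G h Z(4)])
      qed
      show "graph C J W U (Comp C W T U f g) \<subseteq> Comp CR W T U (graph C J T U f) (graph C J W T g)"
      proof
        fix a assume "a \<in> graph C J W U (Comp C W T U f g)"
        moreover obtain Z h l where a: "a = (Z, h, l)" by (cases a)
        ultimately have h: "(Z, h, l) \<in> graph C J W U (Comp C W T U f g)" by simp
        then have Z: "Z \<in> Obj C" "h \<in> Hom C Z U" "l \<in> Hom C Z W" by (simp_all add: graph_mem)
        have "(Z, Comp C Z T U f (Comp C Z W T g l), l) \<in> Comp CR W T U (graph C J T U f) (graph C J W T g)"
          using Comp_CR_I graph_refl[OF T U f Z(1), of "Comp C Z W T g l"] graph_refl[OF W T g Z(1,3)] Z W T g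
          by (simp add: Comp_closed)
        then have "(Z, Comp C Z W U (Comp C W T U f g) l, l) \<in> Comp CR W T U (graph C J T U f) (graph C J W T g)"
          using Z W T U f g by (simp add: Comp_assoc)
        then show "a \<in> Comp CR W T U (graph C J T U f) (graph C J W T g)"
          unfolding a by (rule graph_local[OF W U W fg K h Z(3)])
      qed
    qed
    show "r \<subseteq> z" if r: "r \<in> closed_cribles C J U T" and z: "z \<in> closed_cribles C J U T"
        and le: "\<And>W f g. \<lbrakk>(W, f, g) \<in> spans C U T;
            Comp CR U W T (graph C J W T f) (crible_opposite (graph C J W U g)) \<subseteq> r\<rbrakk>
          \<Longrightarrow> Comp CR U W T (graph C J W T f) (crible_opposite (graph C J W U g)) \<subseteq> z" for r z
    proof
      fix a assume a: "a \<in> r"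
      then have sp: "a \<in> spans C U T" using r by (auto simp: closed_cribles_def)
      obtain W f g where e: "a = (W, f, g)" by (cases a)
      show "a \<in> z" using a sp le[of W f g] graph_span_le[OF U T r, of W f g] graph_span_le[OF U T z, of W f g] unfolding e by blast
    qed
    show "span_sieve C U T W f g A \<in> J W"
      if A: "A \<subseteq> spans C U T"
        and cl: "\<And>W f g W' k. \<lbrakk>(W, f, g) \<in> A; W' \<in> Obj C; k \<in> Hom C W' W\<rbrakk> \<Longrightarrow> (W', Comp C W' W T f k, Comp C W' W U g k) \<in> A"
        and sp: "(W, f, g) \<in> spans C U T"
        and cov: "\<And>z. \<lbrakk>z \<in> closed_cribles C J U T; \<And>W f g. (W, f, g) \<in> A \<Longrightarrow>
              Comp CR U W T (graph C J W T f) (crible_opposite (graph C J W U g)) \<subseteq> z\<rbrakk>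
            \<Longrightarrow> Comp CR U W T (graph C J W T f) (crible_opposite (graph C J W U g)) \<subseteq> z" for A W f g
    proof -
      \<comment> \<open>The test crible: the closure of \<open>A\<close>, written so that membership
        of the span gives the claim.\<close>
      let ?L = "{(W, f, g) \<in> spans C U T. span_sieve C U T W f g A \<in> J W}"
      have L: "?L \<in> closed_cribles C J U T" by (rule locally_closed[OF U T A]) (rule cl)
      have "A \<subseteq> ?L"
      proof -
        have "A \<subseteq> crible_closure C J U T A" by (auto simp: crible_closure_def)
        also have "\<dots> = ?L" by (rule crible_closure_mem[OF U T A]) (rule cl)
        finally show ?thesis .
      qed
      then have "Comp CR U W T (graph C J W T f) (crible_opposite (graph C J W U g)) \<subseteq> ?L"
        by (intro cov[OF L]) (use graph_span_le[OF U T L] A in blast)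
      then have "(W, f, g) \<in> ?L" using graph_span_le[OF U T L sp] by blast
      then show ?thesis by simp
    qed
    show "Idn CR U \<subseteq> z" if "z \<in> closed_cribles C J U U"
      and le: "\<And>X t. \<lbrakk>X \<in> Obj C; is_symmetric_left_adjoint CR X U t\<rbrakk> \<Longrightarrow> Comp CR U X U t (crible_opposite t) \<subseteq> z" for z
    proof -
      have i: "crible_opposite (Idn CR U) = Idn CR U" using I.Inv_Idn[of U] U by (simp add: s)
      have c: "Comp CR U U U (Idn CR U) (Idn CR U) = Idn CR U" using I.Idn_Comp[of U U "Idn CR U"] I.Idn_closed[of U] U by (simp add: s)
      have "is_symmetric_left_adjoint CR U U (Idn CR U)"
        unfolding is_symmetric_left_adjoint_def is_adjoint_def s i c using Idn[OF U] by simp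
      from le[OF U this] show ?thesis unfolding i c .
    qed
  qed
qed

end

text \<open>The axioms about the objects \<open>\<iota> U\<close> concern hom-sets on which
  \<open>H'\<close> is an order isomorphism compatible with composition, identities and involution,
  so they carry over. The objects of \<open>S\<close>, including those outside the image of
  \<open>H\<close>, are covered by the hypothesis \<open>gen\<close>.\<close>

lemma (in site_quantaloid) site_quantaloid_transfer:
  fixes S :: "('p, 'd, 'n) inv_quantaloid_rec_scheme"
  assumes S: "involutive_quantaloid S" and small: "small_category TYPE('v) S" and H: "is_functor Q S H H'"
    and bij: "\<And>X Y. \<lbrakk>X \<in> Obj Q; Y \<in> Obj Q\<rbrakk> \<Longrightarrow> bij_betw (H' X Y) (Hom Q X Y) (Hom S (H X) (H Y))"
    and le: "\<And>X Y f g. \<lbrakk>X \<in> Obj Q; Y \<in> Obj Q; f \<in> Hom Q X Y; g \<in> Hom Q X Y\<rbrakk>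
      \<Longrightarrow> Le S (H X) (H Y) (H' X Y f) (H' X Y g) \<longleftrightarrow> Le Q X Y f g"
    and inv: "\<And>X Y f. \<lbrakk>X \<in> Obj Q; Y \<in> Obj Q; f \<in> Hom Q X Y\<rbrakk> \<Longrightarrow> H' Y X (Inv Q X Y f) = Inv S (H X) (H Y) (H' X Y f)"
    and gen: "\<And>X z. \<lbrakk>X \<in> Obj S; z \<in> Hom S X X;
        \<And>U t. \<lbrakk>U \<in> Obj C; is_symmetric_left_adjoint S (H (\<iota> U)) X t\<rbrakk>
          \<Longrightarrow> Le S X X (Comp S X (H (\<iota> U)) X t (Inv S (H (\<iota> U)) X t)) z\<rbrakk>
      \<Longrightarrow> Le S X X (Idn S X) z"
  shows "site_quantaloid TYPE('v) S C J (\<lambda>U. H (\<iota> U)) (\<lambda>T U f. H' (\<iota> T) (\<iota> U) (\<gamma> T U f))"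
proof -
  interpret S: involutive_quantaloid S by (rule S)
  let ?sp = "span_arrow S (\<lambda>U. H (\<iota> U)) (\<lambda>T U f. H' (\<iota> T) (\<iota> U) (\<gamma> T U f))"
  have HO: "H X \<in> Obj S" if "X \<in> Obj Q" for X using H that by (simp add: is_functor_def)
  have HH: "H' X Y f \<in> Hom S (H X) (H Y)" if "X \<in> Obj Q" "Y \<in> Obj Q" "f \<in> Hom Q X Y" for X Y f
    using H that by (simp add: is_functor_def)
  have HI: "H' X X (Idn Q X) = Idn S (H X)" if "X \<in> Obj Q" for X using H that by (simp add: is_functor_def)
  have HC: "H' X Z (Comp Q X Y Z g f) = Comp S (H X) (H Y) (H Z) (H' Y Z g) (H' X Y f)"
    if "X \<in> Obj Q" "Y \<in> Obj Q" "Z \<in> Obj Q" "f \<in> Hom Q X Y" "g \<in> Hom Q Y Z" for X Y Z f g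
    using H that by (simp add: is_functor_def)
  have sur: "\<exists>w\<in>Hom Q X Y. z = H' X Y w" if "X \<in> Obj Q" "Y \<in> Obj Q" "z \<in> Hom S (H X) (H Y)" for X Y z
    using bij[OF that(1,2)] that(3) by (auto simp: bij_betw_def)
  have sp: "?sp T U W f g
      = H' (\<iota> T) (\<iota> U) (spn T U W f g)"
    and sph: "spn T U W f g \<in> Hom Q (\<iota> T) (\<iota> U)"
    if "T \<in> Obj C" "U \<in> Obj C" "(W, f, g) \<in> spans C T U" for T U W f g
    using that by (simp_all add: C.spans_iff \<iota>_closed \<gamma>_closed Inv_closed Comp_closed HC inv span_arrow_def)
  show ?thesis
  proof (intro site_quantaloid.intro site_quantaloid_axioms.intro)
    show "involutive_quantaloid S" by (rule S)
    show "site C J" by (rule C.site_axioms)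
    show "universe TYPE('v)" by (rule universe)
    show "small_category TYPE('v) S" by (rule small)
    show "small_category TYPE('v) C" by (rule C_small)
    show "Le S X X (Idn S X) z" if "X \<in> Obj S" "z \<in> Hom S X X"
        "\<And>U t. \<lbrakk>U \<in> Obj C; is_symmetric_left_adjoint S (H (\<iota> U)) X t\<rbrakk>
          \<Longrightarrow> Le S X X (Comp S X (H (\<iota> U)) X t (Inv S (H (\<iota> U)) X t)) z" for X z
      by (rule gen[OF that])
    fix U assume U: "U \<in> Obj C"
    note i = \<iota>_closed[OF U]
    show "H (\<iota> U) \<in> Obj S" by (rule HO[OF i])
    show "H' (\<iota> U) (\<iota> U) (\<gamma> U U (Idn C U)) = Idn S (H (\<iota> U))" using U i by (simp add: \<gamma>_Idn HI)
    show "Le S (H (\<iota> U)) (H (\<iota> U)) (Idn S (H (\<iota> U))) z"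
      if R: "R \<in> J U" and z: "z \<in> Hom S (H (\<iota> U)) (H (\<iota> U))"
        and l: "\<And>T s. (T, s) \<in> R \<Longrightarrow> Le S (H (\<iota> U)) (H (\<iota> U)) (?sp U U T s s) z" for R z
    proof -
      obtain w where w: "w \<in> Hom Q (\<iota> U) (\<iota> U)" "z = H' (\<iota> U) (\<iota> U) w" using sur[OF i i z] by blast
      have "Le Q (\<iota> U) (\<iota> U) (Idn Q (\<iota> U)) w"
      proof (rule \<gamma>_cover[OF U R w(1)])
        fix T s assume s: "(T, s) \<in> R"
        then have "(T, s, s) \<in> spans C U U" using C.sieve_arrow[OF U R] by (simp add: C.spans_iff)
        then show "Le Q (\<iota> U) (\<iota> U) (spn U U T s s) w"
          using l[OF s] sp[OF U U] sph[OF U U] w le[OF i i] by simp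
      qed
      then show ?thesis using le[OF i i Idn_closed[OF i] w(1)] HI[OF i] w by simp
    qed
    fix T assume T: "T \<in> Obj C"
    note j = \<iota>_closed[OF T]
    show "is_symmetric_left_adjoint S (H (\<iota> T)) (H (\<iota> U)) (H' (\<iota> T) (\<iota> U) (\<gamma> T U f))" if f: "f \<in> Hom C T U" for f
    proof -
      have g: "\<gamma> T U f \<in> Hom Q (\<iota> T) (\<iota> U)" using \<gamma>_closed U T f by blast
      have "is_adjoint Q (\<iota> T) (\<iota> U) (\<gamma> T U f) (Inv Q (\<iota> T) (\<iota> U) (\<gamma> T U f))"
        using \<gamma>_map[OF U T f] by (simp add: is_symmetric_left_adjoint_def)
      then have "Le Q (\<iota> T) (\<iota> T) (Idn Q (\<iota> T)) (Comp Q (\<iota> T) (\<iota> U) (\<iota> T) (Inv Q (\<iota> T) (\<iota> U) (\<gamma> T U f)) (\<gamma> T U f))"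
        "Le Q (\<iota> U) (\<iota> U) (Comp Q (\<iota> U) (\<iota> T) (\<iota> U) (\<gamma> T U f) (Inv Q (\<iota> T) (\<iota> U) (\<gamma> T U f))) (Idn Q (\<iota> U))"
        by (simp_all add: is_adjoint_def)
      then show ?thesis unfolding is_symmetric_left_adjoint_def is_adjoint_def
        using i j g by (simp add: HH inv[symmetric] HI[symmetric] HC[symmetric] Inv_closed le Idn_closed Comp_closed)
    qed
    show "H' (\<iota> W) (\<iota> U) (\<gamma> W U (Comp C W T U f g)) =
        Comp S (H (\<iota> W)) (H (\<iota> T)) (H (\<iota> U)) (H' (\<iota> T) (\<iota> U) (\<gamma> T U f)) (H' (\<iota> W) (\<iota> T) (\<gamma> W T g))"
      if "W \<in> Obj C" "f \<in> Hom C T U" "g \<in> Hom C W T" for W f g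
      using U T that by (simp add: \<gamma>_Comp HC \<iota>_closed \<gamma>_closed)
    show "Le S (H (\<iota> U)) (H (\<iota> T)) r z"
      if r: "r \<in> Hom S (H (\<iota> U)) (H (\<iota> T))" and z: "z \<in> Hom S (H (\<iota> U)) (H (\<iota> T))"
        and l: "\<And>W f g. \<lbrakk>(W, f, g) \<in> spans C U T;
          Le S (H (\<iota> U)) (H (\<iota> T)) (?sp U T W f g) r\<rbrakk>
          \<Longrightarrow> Le S (H (\<iota> U)) (H (\<iota> T)) (?sp U T W f g) z" for r z
    proof -
      obtain w where w: "w \<in> Hom Q (\<iota> U) (\<iota> T)" "z = H' (\<iota> U) (\<iota> T) w" using sur[OF i j z] by blast
      obtain q where q: "q \<in> Hom Q (\<iota> U) (\<iota> T)" "r = H' (\<iota> U) (\<iota> T) q" using sur[OF i j r] by blast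
      have "Le Q (\<iota> U) (\<iota> T) q w"
      proof (rule \<gamma>_generate[OF U T q(1) w(1)])
        fix W f g assume s: "(W, f, g) \<in> spans C U T"
          and "Le Q (\<iota> U) (\<iota> T) (spn U T W f g) q"
        then show "Le Q (\<iota> U) (\<iota> T) (spn U T W f g) w"
          using l[OF s] sp[OF U T s] sph[OF U T s] w q le[OF i j] by simp
      qed
      then show ?thesis using le[OF i j q(1) w(1)] w q by simp
    qed
    show "span_sieve C U T W f g A \<in> J W"
      if A: "A \<subseteq> spans C U T"
        and cl: "\<And>W f g W' k. \<lbrakk>(W, f, g) \<in> A; W' \<in> Obj C; k \<in> Hom C W' W\<rbrakk> \<Longrightarrow> (W', Comp C W' W T f k, Comp C W' W U g k) \<in> A"
        and s: "(W, f, g) \<in> spans C U T"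
        and cov: "\<And>z. \<lbrakk>z \<in> Hom S (H (\<iota> U)) (H (\<iota> T)); \<And>W f g. (W, f, g) \<in> A \<Longrightarrow>
          Le S (H (\<iota> U)) (H (\<iota> T)) (?sp U T W f g) z\<rbrakk>
          \<Longrightarrow> Le S (H (\<iota> U)) (H (\<iota> T)) (?sp U T W f g) z" for A W f g
    proof (rule \<gamma>_local[OF U T A cl s])
      fix z assume z: "z \<in> Hom Q (\<iota> U) (\<iota> T)" and l: "\<And>W f g. (W, f, g) \<in> A \<Longrightarrow>
          Le Q (\<iota> U) (\<iota> T) (spn U T W f g) z"
      have "Le S (H (\<iota> U)) (H (\<iota> T)) (?sp U T W f g) (H' (\<iota> U) (\<iota> T) z)"
      proof (rule cov[OF HH[OF i j z]])
        fix W f g assume a: "(W, f, g) \<in> A"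
        then have s: "(W, f, g) \<in> spans C U T" using A by blast
        show "Le S (H (\<iota> U)) (H (\<iota> T)) (?sp U T W f g) (H' (\<iota> U) (\<iota> T) z)"
          unfolding sp[OF U T s] le[OF i j sph[OF U T s] z] by (rule l[OF a])
      qed
      then show "Le Q (\<iota> U) (\<iota> T) (spn U T W f g) z"
        unfolding sp[OF U T s] le[OF i j sph[OF U T s] z] .
    qed
  qed
qed

section \<open>The canonical involution and splitting\<close>

text \<open>One arrow lies below another when their join is the latter; a homomorphism preserves
  this, and an injective one reflects it.\<close>

lemma homomorphism_Le_iff:
  assumes Q: "quantaloid Q" and R: "quantaloid R" and H: "is_homomorphism Q R F F'"
    and inj: "inj_on (F' X Y) (Hom Q X Y)" and X: "X \<in> Obj Q" "Y \<in> Obj Q" and f: "f \<in> Hom Q X Y" "g \<in> Hom Q X Y"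
  shows "Le R (F X) (F Y) (F' X Y f) (F' X Y g) \<longleftrightarrow> Le Q X Y f g"
proof -
  interpret Q: quantaloid Q by (rule Q)
  interpret R: quantaloid R by (rule R)
  have F: "F X \<in> Obj R" "F Y \<in> Obj R" "F' X Y f \<in> Hom R (F X) (F Y)" "F' X Y g \<in> Hom R (F X) (F Y)"
    using H X f by (auto simp: is_homomorphism_def is_functor_def)
  have J: "F' X Y (Join Q X Y {f, g}) = Join R (F X) (F Y) {F' X Y f, F' X Y g}"
    using H X f by (simp add: is_homomorphism_def)
  have c: "Join Q X Y {f, g} \<in> Hom Q X Y" using Q.Join_closed X f by simp
  have "Le Q X Y f g \<longleftrightarrow> Join Q X Y {f, g} = g"
    using Q.Join_pair[OF X f] Q.Join_upper[OF X, of "{f, g}" f] f by auto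
  also have "\<dots> \<longleftrightarrow> F' X Y (Join Q X Y {f, g}) = F' X Y g" using inj_onD[OF inj _ c f(2)] by auto
  also have "\<dots> \<longleftrightarrow> Le R (F X) (F Y) (F' X Y f) (F' X Y g)" unfolding J
    using R.Join_pair[OF F] R.Join_upper[OF F(1,2), of "{F' X Y f, F' X Y g}" "F' X Y f"] F by auto
  finally show ?thesis ..
qed

text \<open>Changes the apex of a span of adjoints along an isomorphism without changing the
  composite; it serves to move an apex into the image of an equivalence.\<close>

lemma (in quantaloid) adjoint_iso:
  assumes o: "X \<in> Obj Q" "Y \<in> Obj Q" "W \<in> Obj Q" and f: "is_adjoint Q X Y f f'"
    and w: "w \<in> Hom Q W X" "v \<in> Hom Q X W" "Comp Q W X W v w = Idn Q W" "Comp Q X W X w v = Idn Q X"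
  shows "is_adjoint Q W Y (Comp Q W X Y f w) (Comp Q Y X W v f')"
    and "\<And>Z g. \<lbrakk>Z \<in> Obj Q; g \<in> Hom Q X Z\<rbrakk> \<Longrightarrow> Comp Q Y W Z (Comp Q W X Z g w) (Comp Q Y X W v f') = Comp Q Y X Z g f'"
proof -
  have F: "f \<in> Hom Q X Y" "f' \<in> Hom Q Y X" "Le Q X X (Idn Q X) (Comp Q X Y X f' f)" "Le Q Y Y (Comp Q Y X Y f f') (Idn Q Y)"
    using f by (simp_all add: is_adjoint_def)
  have wv: "Comp Q Y W X w (Comp Q Y X W v h) = h" if "h \<in> Hom Q Y X" for h
    using Comp_assoc[of Y X W X h v w] o w that by (simp add: Idn_Comp)
  show *: "Comp Q Y W Z (Comp Q W X Z g w) (Comp Q Y X W v f') = Comp Q Y X Z g f'" if "Z \<in> Obj Q" "g \<in> Hom Q X Z" for Z g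
    using o F w that by (simp add: Comp_assoc Comp_closed wv)
  have "Le Q W X w (Comp Q W X X (Comp Q X Y X f' f) w)"
    using Comp_mono_left[of W X X w "Idn Q X" "Comp Q X Y X f' f"] o F w by (simp add: Idn_Comp Idn_closed Comp_closed)
  then have "Le Q W W (Comp Q W X W v w) (Comp Q W X W v (Comp Q W X X (Comp Q X Y X f' f) w))"
    using o F w by (intro Comp_mono_right) (simp_all add: Comp_closed)
  then have "Le Q W W (Idn Q W) (Comp Q W Y W (Comp Q Y X W v f') (Comp Q W X Y f w))"
    using o F w by (simp add: Comp_assoc Comp_closed)
  then show "is_adjoint Q W Y (Comp Q W X Y f w) (Comp Q Y X W v f')"
    using F w o *[OF o(2) F(1)] by (simp add: is_adjoint_def Comp_closed)
qed

section \<open>Equivalences of quantaloids preserve the canonical involution\<close>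

locale equivalent_quantaloid = Q: quantaloid Q + R: quantaloid R
  for Q :: "('o, 'a, 'm) quantaloid_rec_scheme" and R :: "('p, 'b, 'n) quantaloid_rec_scheme" +
  fixes F F' G G'
  assumes equivalence: "inverse_equivalences Q R F F' G G'" and homomorphism: "is_homomorphism Q R F F'"
begin

lemma obj: "X \<in> Obj Q \<Longrightarrow> F X \<in> Obj R"
  and hom: "\<lbrakk>X \<in> Obj Q; Y \<in> Obj Q; f \<in> Hom Q X Y\<rbrakk> \<Longrightarrow> F' X Y f \<in> Hom R (F X) (F Y)"
  and idn: "X \<in> Obj Q \<Longrightarrow> F' X X (Idn Q X) = Idn R (F X)"
  and comp: "\<lbrakk>X \<in> Obj Q; Y \<in> Obj Q; Z \<in> Obj Q; f \<in> Hom Q X Y; g \<in> Hom Q Y Z\<rbrakk>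
    \<Longrightarrow> F' X Z (Comp Q X Y Z g f) = Comp R (F X) (F Y) (F Z) (F' Y Z g) (F' X Y f)"
  and join: "\<lbrakk>X \<in> Obj Q; Y \<in> Obj Q; A \<subseteq> Hom Q X Y\<rbrakk> \<Longrightarrow> F' X Y (Join Q X Y A) = Join R (F X) (F Y) (F' X Y ` A)"
  and obj': "U \<in> Obj R \<Longrightarrow> G U \<in> Obj Q"
  using homomorphism equivalence by (simp_all add: is_homomorphism_def is_functor_def inverse_equivalences_def)

lemma bij: "X \<in> Obj Q \<Longrightarrow> Y \<in> Obj Q \<Longrightarrow> bij_betw (F' X Y) (Hom Q X Y) (Hom R (F X) (F Y))"
  by (rule inverse_equivalences_bij_betw[OF Q.category_axioms R.category_axioms equivalence])

lemma inj: "\<lbrakk>X \<in> Obj Q; Y \<in> Obj Q; f \<in> Hom Q X Y; g \<in> Hom Q X Y; F' X Y f = F' X Y g\<rbrakk> \<Longrightarrow> f = g"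
  using bij by (auto simp: bij_betw_def dest: inj_onD)

lemma surj: assumes "X \<in> Obj Q" "Y \<in> Obj Q" "h \<in> Hom R (F X) (F Y)" obtains f where "f \<in> Hom Q X Y" "h = F' X Y f"
  using bij[OF assms(1,2)] assms(3) by (auto simp: bij_betw_def)

lemma Le_iff: "\<lbrakk>X \<in> Obj Q; Y \<in> Obj Q; f \<in> Hom Q X Y; g \<in> Hom Q X Y\<rbrakk>
    \<Longrightarrow> Le R (F X) (F Y) (F' X Y f) (F' X Y g) \<longleftrightarrow> Le Q X Y f g"
  using bij by (intro homomorphism_Le_iff[OF Q.quantaloid_axioms R.quantaloid_axioms homomorphism]) (auto simp: bij_betw_def)

lemma adjoint_iff:
  "\<lbrakk>X \<in> Obj Q; Y \<in> Obj Q; f \<in> Hom Q X Y; g \<in> Hom Q Y X\<rbrakk>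
    \<Longrightarrow> is_adjoint R (F X) (F Y) (F' X Y f) (F' Y X g) \<longleftrightarrow> is_adjoint Q X Y f g"
  by (simp add: is_adjoint_def hom idn[symmetric] comp[symmetric] Le_iff Q.Idn_closed Q.Comp_closed)

lemma iso_image:
  assumes "U \<in> Obj R"
  obtains w v where "w \<in> Hom R (F (G U)) U" "v \<in> Hom R U (F (G U))"
    "Comp R (F (G U)) U (F (G U)) v w = Idn R (F (G U))" "Comp R U (F (G U)) U w v = Idn R U"
  using equivalence assms unfolding inverse_equivalences_def naturally_iso_to_identity_def is_iso_def by metis

text \<open>The spans of left adjoints in the two suprema correspond: an apex \<open>U\<close> of
  \<open>R\<close> is isomorphic to \<open>F (G U)\<close>, and \<open>adjoint_iso\<close> moves it
  there. Being a homomorphism, \<open>F'\<close> preserves the supremum.\<close>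

lemma canonical_inv:
  assumes X: "X \<in> Obj Q" and Y: "Y \<in> Obj Q" and q: "q \<in> Hom Q Y X"
  shows "F' X Y (canonical_inv Q Y X q) = canonical_inv R (F Y) (F X) (F' Y X q)"
proof -
  let ?A = "{Comp Q X U Y g f' | U f f' g g'. U \<in> Obj Q \<and> is_adjoint Q U X f f' \<and> is_adjoint Q U Y g g' \<and> Le Q Y X (Comp Q Y U X f g') q}"
  let ?B = "{Comp R (F X) U (F Y) g f' | U f f' g g'. U \<in> Obj R \<and> is_adjoint R U (F X) f f' \<and> is_adjoint R U (F Y) g g' \<and>
    Le R (F Y) (F X) (Comp R (F Y) U (F X) f g') (F' Y X q)}"
  have A: "?A \<subseteq> Hom Q X Y" using X Y by (auto simp: is_adjoint_def intro: Q.Comp_closed)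
  have "F' X Y ` ?A = ?B"
  proof
    show "F' X Y ` ?A \<subseteq> ?B"
    proof
      fix b assume "b \<in> F' X Y ` ?A"
      then obtain U f f' g g' where b: "b = F' X Y (Comp Q X U Y g f')" and U: "U \<in> Obj Q"
        and ad: "is_adjoint Q U X f f'" "is_adjoint Q U Y g g'" and l: "Le Q Y X (Comp Q Y U X f g') q" by blast
      have h: "f \<in> Hom Q U X" "f' \<in> Hom Q X U" "g \<in> Hom Q U Y" "g' \<in> Hom Q Y U" using ad by (simp_all add: is_adjoint_def)
      have "b = Comp R (F X) (F U) (F Y) (F' U Y g) (F' X U f')" using b h X Y U by (simp add: comp)
      moreover have "is_adjoint R (F U) (F X) (F' U X f) (F' X U f')" "is_adjoint R (F U) (F Y) (F' U Y g) (F' Y U g')"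
        using ad h X Y U by (simp_all add: adjoint_iff)
      moreover have "Le R (F Y) (F X) (Comp R (F Y) (F U) (F X) (F' U X f) (F' Y U g')) (F' Y X q)"
        using l h X Y U q by (simp add: comp[symmetric] Le_iff Q.Comp_closed)
      ultimately show "b \<in> ?B" using obj[OF U] by blast
    qed
    show "?B \<subseteq> F' X Y ` ?A"
    proof
      fix b assume "b \<in> ?B"
      then obtain U f f' g g' where b: "b = Comp R (F X) U (F Y) g f'" and U: "U \<in> Obj R"
        and ad: "is_adjoint R U (F X) f f'" "is_adjoint R U (F Y) g g'"
        and l: "Le R (F Y) (F X) (Comp R (F Y) U (F X) f g') (F' Y X q)" by blast
      have h: "f \<in> Hom R U (F X)" "g \<in> Hom R U (F Y)" "f' \<in> Hom R (F X) U" "g' \<in> Hom R (F Y) U" using ad by (simp_all add: is_adjoint_def)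
      let ?U = "G U"
      note gu = obj'[OF U]
      obtain w v where w: "w \<in> Hom R (F ?U) U" "v \<in> Hom R U (F ?U)"
        "Comp R (F ?U) U (F ?U) v w = Idn R (F ?U)" "Comp R U (F ?U) U w v = Idn R U" using iso_image[OF U] .
      note i = R.adjoint_iso[OF U obj[OF X] obj[OF gu] ad(1) w] and j = R.adjoint_iso[OF U obj[OF Y] obj[OF gu] ad(2) w]
      obtain f0 where f0: "f0 \<in> Hom Q ?U X" "Comp R (F ?U) U (F X) f w = F' ?U X f0"
        using surj[OF gu X] i(1) by (metis is_adjoint_def)
      obtain g0 where g0: "g0 \<in> Hom Q ?U Y" "Comp R (F ?U) U (F Y) g w = F' ?U Y g0"
        using surj[OF gu Y] j(1) by (metis is_adjoint_def)
      obtain f1 where f1: "f1 \<in> Hom Q X ?U" "Comp R (F X) U (F ?U) v f' = F' X ?U f1"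
        using surj[OF X gu] i(1) by (metis is_adjoint_def)
      obtain g1 where g1: "g1 \<in> Hom Q Y ?U" "Comp R (F Y) U (F ?U) v g' = F' Y ?U g1"
        using surj[OF Y gu] j(1) by (metis is_adjoint_def)
      have "is_adjoint Q ?U X f0 f1" "is_adjoint Q ?U Y g0 g1"
        using i(1) j(1) f0 f1 g0 g1 X Y gu by (simp_all add: adjoint_iff)
      moreover have "Le Q Y X (Comp Q Y ?U X f0 g1) q"
      proof -
        have "F' Y X (Comp Q Y ?U X f0 g1) = Comp R (F Y) U (F X) f g'"
          using j(2)[OF obj[OF X] h(1)] f0 g1 X Y gu by (simp add: comp)
        then show ?thesis using l Le_iff[OF Y X Q.Comp_closed[OF Y gu X g1(1) f0(1)] q] by simp
      qed
      moreover have "b = F' X Y (Comp Q X ?U Y g0 f1)"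
        using b i(2)[OF obj[OF Y] h(2)] g0 f1 X Y gu by (simp add: comp)
      ultimately show "b \<in> F' X Y ` ?A" using gu by blast
    qed
  qed
  then show ?thesis unfolding canonical_inv_def join[OF X Y A] by simp
qed

end

lemma canonical_inv_closed:
  assumes "quantaloid Q" "X \<in> Obj Q" "Y \<in> Obj Q" shows "canonical_inv Q Y X q \<in> Hom Q X Y"
proof -
  interpret quantaloid Q by fact
  show ?thesis unfolding canonical_inv_def using assms
    by (intro Join_closed) (auto simp: is_adjoint_def intro: Comp_closed)
qed

text \<open>Right adjoints are opposites, so each composite of \<open>g\<close> with
  \<open>f'\<close> is the reversal of that of \<open>f\<close> with \<open>g'\<close> and lies
  below the reversal of \<open>q\<close>. Conversely, graphs are left adjoints, and their spans
  generate the reversal of \<open>q\<close>.\<close>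

lemma (in site) canonical_inv_CR:
  assumes U: "universe TYPE('v)" and C: "small_category TYPE('v) C" and R: "quantaloid (crible_quantaloid C J)"
    and X: "X \<in> Obj C" and Y: "Y \<in> Obj C" and q: "q \<in> closed_cribles C J Y X"
  shows "canonical_inv CR Y X q = crible_opposite q"
proof -
  interpret I: site_quantaloid CR C J "TYPE('v)" "\<lambda>U. U" "graph C J" by (rule site_quantaloid_cribles[OF U C R])
  note s = involutive_cribles_simps
  let ?A = "{Comp CR X U Y g f' | U f f' g g'. U \<in> Obj CR \<and> is_adjoint CR U X f f' \<and> is_adjoint CR U Y g g' \<and>
        Le CR Y X (Comp CR Y U X f g') q}"
  have A: "?A \<subseteq> Hom CR X Y" using X Y by (auto simp: is_adjoint_def s intro: I.Comp_closed[unfolded s])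
  have XY: "X \<in> Obj CR" "Y \<in> Obj CR" using X Y by (simp_all add: s)
  have q': "crible_opposite q \<in> Hom CR X Y" using crible_opposite_closed[OF q] by (simp add: s)
  have c: "canonical_inv CR Y X q \<in> Hom CR X Y" unfolding canonical_inv_def by (rule I.Join_closed[OF XY A])
  show ?thesis
  proof (rule I.Le_antisym[OF XY c q'])
    show "Le CR X Y (canonical_inv CR Y X q) (crible_opposite q)"
      unfolding canonical_inv_def I.Join_le_iff[OF XY A q']
    proof
      fix a assume "a \<in> ?A"
      then obtain U f f' g g' where a: "a = Comp CR X U Y g f'" and U: "U \<in> Obj C"
        and ad: "is_adjoint CR U X f f'" "is_adjoint CR U Y g g'" and l: "Comp CR Y U X f g' \<subseteq> q" by (auto simp: s)
      have h: "f \<in> closed_cribles C J U X" "g \<in> closed_cribles C J U Y" "g' \<in> closed_cribles C J Y U"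
        using ad by (simp_all add: is_adjoint_def s)
      have e: "f' = crible_opposite f" "g' = crible_opposite g"
        using crible_adjoint_unique[OF U X ad(1)] crible_adjoint_unique[OF U Y ad(2)] by auto
      have "crible_opposite (Comp CR Y U X f g') = Comp CR X U Y (crible_opposite g') (crible_opposite f)"
        using I.Inv_Comp[of Y U X g' f] h X Y U by (simp add: s)
      moreover have "crible_opposite g' = g" by (simp add: e crible_opposite_def)
      ultimately have "crible_opposite (Comp CR Y U X f g') = a" by (simp add: a e)
      then show "Le CR X Y a (crible_opposite q)" using l by (auto simp: s crible_opposite_def)
    qed
    show "Le CR X Y (crible_opposite q) (canonical_inv CR Y X q)"
    proof (rule I.\<gamma>_generate[OF X Y q' c, unfolded span_arrow_def])
      fix W f g assume sp: "(W, f, g) \<in> spans C X Y"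
        and l: "Le CR X Y (Comp CR X W Y (graph C J W Y f) (Inv CR W X (graph C J W X g))) (crible_opposite q)"
      have h: "W \<in> Obj C" "f \<in> Hom C W Y" "g \<in> Hom C W X" using sp by (simp_all add: spans_iff)
      have "(W, f, g) \<in> crible_opposite q"
        using l graph_span_le[OF X Y crible_opposite_closed[OF q] sp] by (simp add: s)
      then have "(W, g, f) \<in> q" by (simp add: crible_opposite_def)
      then have "Comp CR Y W X (graph C J W X g) (crible_opposite (graph C J W Y f)) \<subseteq> q"
        using graph_span_le[OF Y X q, of W g f] h by (simp add: spans_iff)
      then have "Comp CR X W Y (graph C J W Y f) (crible_opposite (graph C J W X g)) \<in> ?A"
        using I.\<gamma>_map[OF X h(1,3)] I.\<gamma>_map[OF Y h(1,2)] h(1) unfolding is_symmetric_left_adjoint_def s by blast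
      then show "Le CR X Y (Comp CR X W Y (graph C J W Y f) (Inv CR W X (graph C J W X g))) (canonical_inv CR Y X q)"
        unfolding canonical_inv_def using I.Join_upper[OF XY A] by (simp add: s)
    qed
  qed
qed


text \<open>\<open>F\<close> takes the canonical involution of \<open>Q\<close> to reversal of spans
  and is faithful, which yields the laws of an involution. The representation of the site in the
  cribles is then carried along \<open>G\<close>.\<close>

theorem (in site) site_quantaloid_canonical_inv:
  fixes Q :: "('o, 'a) quantaloid_rec"
  assumes U: "universe TYPE('v)" and C: "small_category TYPE('v) C" and R: "quantaloid (crible_quantaloid C J)"
    and Q: "quantaloid Q" and Q_small: "small_category TYPE('v) Q"
    and E: "inverse_equivalences Q (crible_quantaloid C J) F F' G G'"
    and F: "is_homomorphism Q (crible_quantaloid C J) F F'" and G: "is_homomorphism (crible_quantaloid C J) Q G G'"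
  shows "site_quantaloid TYPE('v) (with_canonical_inv Q) C J G (\<lambda>T U f. G' T U (graph C J T U f))"
proof -
  interpret I: site_quantaloid CR C J "TYPE('v)" "\<lambda>U. U" "graph C J" by (rule site_quantaloid_cribles[OF U C R])
  note s = involutive_cribles_simps
  have ext: "is_functor Q CR F F' \<longleftrightarrow> is_functor Q (crible_quantaloid C J) F F'"
    "is_functor CR Q G G' \<longleftrightarrow> is_functor (crible_quantaloid C J) Q G G'"
    "naturally_iso_to_identity CR = naturally_iso_to_identity (crible_quantaloid C J)"
    by (simp_all add: is_functor_def is_iso_def naturally_iso_to_identity_def involutive_cribles_def extend_simps fun_eq_iff)
  have E': "inverse_equivalences Q CR F F' G G'" using E by (simp add: inverse_equivalences_def ext)
  have F': "is_homomorphism Q CR F F'" using F by (simp add: is_homomorphism_def ext) (simp add: involutive_cribles_def extend_simps)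
  have G': "is_homomorphism CR Q G G'" using G by (simp add: is_homomorphism_def ext) (simp add: involutive_cribles_def extend_simps)
  interpret Q: quantaloid Q by (rule Q)
  interpret F: equivalent_quantaloid Q CR F F' G G' by unfold_locales (rule E', rule F')
  interpret G: equivalent_quantaloid CR Q G G' F F' by unfold_locales (rule inverse_equivalences_sym[OF E'], rule G')
  let ?E = "with_canonical_inv Q"
  have es: "Obj ?E = Obj Q" "Hom ?E = Hom Q" "Idn ?E = Idn Q" "Comp ?E = Comp Q" "Le ?E = Le Q" "Inv ?E = canonical_inv Q"
    "quantaloid ?E \<longleftrightarrow> quantaloid Q" "category ?E \<longleftrightarrow> category Q"
    by (simp_all add: with_canonical_inv_def extend_simps)
  have ic: "canonical_inv Q X Y f \<in> Hom Q Y X" if "X \<in> Obj Q" "Y \<in> Obj Q" for X Y f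
    by (rule canonical_inv_closed[OF Q that(2,1)])
  have Fo: "F X \<in> Obj C" if "X \<in> Obj Q" for X using F.obj[OF that] by (simp add: s)
  have Fi: "F' Y X (canonical_inv Q X Y f) = Inv CR (F X) (F Y) (F' X Y f)" if "X \<in> Obj Q" "Y \<in> Obj Q" "f \<in> Hom Q X Y" for X Y f
    using F.canonical_inv[OF that(2,1,3)] canonical_inv_CR[OF U C R Fo[OF that(2)] Fo[OF that(1)]] F.hom[OF that] by (simp add: s)
  have Gi: "G' Y X (Inv CR X Y f) = canonical_inv Q (G X) (G Y) (G' X Y f)" if "X \<in> Obj CR" "Y \<in> Obj CR" "f \<in> Hom CR X Y" for X Y f
    using G.canonical_inv[OF that(2,1,3)] canonical_inv_CR[OF U C R, of Y X f] that by (simp add: s)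
  have inv_E: "involutive_quantaloid ?E"
  proof (rule involutive_quantaloidI, unfold es)
    show "quantaloid Q" by (rule Q)
    fix X Y assume X: "X \<in> Obj Q" and Y: "Y \<in> Obj Q"
    show "canonical_inv Q X Y f \<in> Hom Q Y X" for f by (rule ic[OF X Y])
    show "canonical_inv Q X X (Idn Q X) = Idn Q X"
      by (rule F.inj[OF X X]) (use X in \<open>simp_all add: ic Q.Idn_closed Fi F.idn I.Inv_Idn F.obj\<close>)
    show "Le Q Y X (canonical_inv Q X Y f) (canonical_inv Q X Y g)" if "f \<in> Hom Q X Y" "g \<in> Hom Q X Y" "Le Q X Y f g" for f g
      using that X Y I.Inv_mono[of "F X" "F Y" "F' X Y f" "F' X Y g"]
      by (simp add: F.Le_iff[OF Y X ic[OF X Y] ic[OF X Y], symmetric] Fi F.Le_iff F.obj F.hom)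
    show "canonical_inv Q Y X (canonical_inv Q X Y f) = f" if "f \<in> Hom Q X Y" for f
      by (rule F.inj[OF X Y]) (use that X Y in \<open>simp_all add: ic Fi I.Inv_Inv F.obj F.hom\<close>)
    show "canonical_inv Q X Z (Comp Q X Y Z g f) = Comp Q Z Y X (canonical_inv Q X Y f) (canonical_inv Q Y Z g)"
      if "Z \<in> Obj Q" "f \<in> Hom Q X Y" "g \<in> Hom Q Y Z" for Z f g
      by (rule F.inj[OF that(1) X])
        (use that X Y in \<open>simp_all add: ic Fi Q.Comp_closed F.comp I.Inv_Comp F.obj F.hom\<close>)
  qed
  show ?thesis
  proof (rule I.site_quantaloid_transfer[where S = "with_canonical_inv Q" and H = G and H' = G', unfolded es])
    show "involutive_quantaloid ?E" by (rule inv_E)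
    show "small_category TYPE('v) ?E" using Q_small by (simp add: small_category_def es)
    show "is_functor CR ?E G G'" using E' by (simp add: inverse_equivalences_def is_functor_def es)
    show "bij_betw (G' X Y) (Hom CR X Y) (Hom Q (G X) (G Y))" if "X \<in> Obj CR" "Y \<in> Obj CR" for X Y by (rule G.bij[OF that])
    show "Le Q (G X) (G Y) (G' X Y f) (G' X Y g) \<longleftrightarrow> Le CR X Y f g"
      if "X \<in> Obj CR" "Y \<in> Obj CR" "f \<in> Hom CR X Y" "g \<in> Hom CR X Y" for X Y f g by (rule G.Le_iff[OF that])
    show "G' Y X (Inv CR X Y f) = canonical_inv Q (G X) (G Y) (G' X Y f)"
      if "X \<in> Obj CR" "Y \<in> Obj CR" "f \<in> Hom CR X Y" for X Y f by (rule Gi[OF that])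
    fix X z assume X: "X \<in> Obj Q" and z: "z \<in> Hom Q X X"
      and le: "\<And>U t. \<lbrakk>U \<in> Obj C; is_symmetric_left_adjoint ?E (G U) X t\<rbrakk> \<Longrightarrow> Le Q X X (Comp Q X (G U) X t (canonical_inv Q (G U) X t)) z"
    \<comment> \<open>The isomorphism \<open>w\<close> from \<open>G (F X)\<close> alone covers
      \<open>X\<close>, and its inverse \<open>v\<close> is its right adjoint. That \<open>v\<close>
      is also the canonical involute of \<open>w\<close> is seen after applying \<open>F\<close>,
      because right adjoints between cribles are opposites.\<close>
    obtain w v where w: "w \<in> Hom Q (G (F X)) X" "v \<in> Hom Q X (G (F X))"
      "Comp Q (G (F X)) X (G (F X)) v w = Idn Q (G (F X))" "Comp Q X (G (F X)) X w v = Idn Q X" using G.iso_image[OF X] .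
    have gx: "G (F X) \<in> Obj Q" using G.obj[OF F.obj[OF X]] .
    have ad: "is_adjoint Q (G (F X)) X w v" using w X gx by (simp add: is_adjoint_def Q.Le_refl Q.Idn_closed)
    then have "is_adjoint CR (F (G (F X))) (F X) (F' (G (F X)) X w) (F' X (G (F X)) v)"
      using F.adjoint_iff[OF gx X w(1,2)] by simp
    then have "F' X (G (F X)) v = F' X (G (F X)) (canonical_inv Q (G (F X)) X w)"
      using crible_adjoint_unique[OF Fo[OF gx] Fo[OF X]] Fi[OF gx X w(1)] by (simp add: s)
    then have v: "v = canonical_inv Q (G (F X)) X w" using F.inj[OF X gx w(2) ic[OF gx X]] by simp
    have "is_symmetric_left_adjoint ?E (G (F X)) X w"
      using ad v by (simp add: is_symmetric_left_adjoint_def is_adjoint_def es)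
    from le[OF Fo[OF X] this] show "Le Q X X (Idn Q X) z" using w(4) v by simp
  qed
qed

text \<open>If \<open>s \<cdot> t\<degree> \<preceq> e\<close> for maps \<open>s\<close> and
  \<open>t\<close>, then \<open>s \<cdot> s\<degree> \<preceq> s \<cdot> t\<degree> \<cdot> t
  \<cdot> s\<degree> \<preceq> e\<close>, hence \<open>s \<preceq> e \<cdot> s\<close>. So
  \<open>e \<cdot> s\<close> is a map into the object that splits \<open>e\<close>, and \<open>s
  \<cdot> t\<degree> \<preceq> (e \<cdot> s) \<cdot> (e \<cdot> s)\<degree>\<close> shows that such
  maps cover it.\<close>

lemma (in site_quantaloid) idempotent_generated:
  assumes e: "e \<in> hom X X" "e \<cdot> e = e" "e\<degree> = e" and z: "z \<in> hom X X"
    and le: "\<And>U t. \<lbrakk>U \<in> Obj C; t \<in> hom (\<iota> U) X; e \<cdot> t = t; one (\<iota> U) \<preceq> t\<degree> \<cdot> t; t \<cdot> t\<degree> \<preceq> e\<rbrakk> \<Longrightarrow> t \<cdot> t\<degree> \<preceq> z"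
  shows "e \<preceq> z"
proof (rule coveredD[OF arrow_covered[OF e(1)] z])
  fix b assume "b \<in> {s \<cdot> t\<degree> |U s t. U \<in> Obj C \<and> is_map (\<iota> U) X t \<and> is_map (\<iota> U) X s \<and> s \<cdot> t\<degree> \<preceq> e}"
  then obtain U s t where b: "b = s \<cdot> t\<degree>" "U \<in> Obj C" "is_map (\<iota> U) X t" "is_map (\<iota> U) X s" "s \<cdot> t\<degree> \<preceq> e" by blast
  note T = is_mapD[OF b(3)] and S = is_mapD[OF b(4)]
  have se: "(e \<cdot> s)\<degree> = s\<degree> \<cdot> e" by (simp add: cv_cmp e)
  have ee: "e \<cdot> (e \<cdot> c) = e \<cdot> c" for c by (simp add: cmp_assoc[symmetric] e)
  have ss: "s \<cdot> s\<degree> \<preceq> e"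
  proof -
    have "s \<cdot> s\<degree> \<preceq> (s \<cdot> (t\<degree> \<cdot> t)) \<cdot> s\<degree>" by (rule cmp_mono_right[OF cmp_ge_right[OF T(5) S(1)]])
    also have "\<dots> = (s \<cdot> t\<degree>) \<cdot> (s \<cdot> t\<degree>)\<degree>" by (simp add: cv_cmp cmp_assoc)
    also have "\<dots> \<preceq> e \<cdot> e\<degree>" by (rule cmp_mono[OF b(5) cv_mono[OF b(5)]])
    finally show ?thesis by (simp add: e)
  qed
  have sss: "s \<preceq> e \<cdot> s"
  proof -
    have "s \<preceq> s \<cdot> (s\<degree> \<cdot> s)" by (rule cmp_ge_right[OF S(5,1)])
    also have "\<dots> \<preceq> e \<cdot> s" using cmp_mono_right[OF ss, of s] by (simp add: cmp_assoc)
    finally show ?thesis .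
  qed
  have "one (\<iota> U) \<preceq> s\<degree> \<cdot> s" by (rule S(5))
  also have "\<dots> \<preceq> (e \<cdot> s)\<degree> \<cdot> (e \<cdot> s)" by (rule cmp_mono[OF cv_mono[OF sss] sss])
  finally have 1: "one (\<iota> U) \<preceq> (e \<cdot> s)\<degree> \<cdot> (e \<cdot> s)" .
  have "(e \<cdot> s) \<cdot> (e \<cdot> s)\<degree> = e \<cdot> (s \<cdot> s\<degree>) \<cdot> e" by (simp add: se cmp_assoc)
  also have "\<dots> \<preceq> e \<cdot> e \<cdot> e" by (rule cmp_mono_right[OF cmp_mono_left[OF ss]])
  finally have 2: "(e \<cdot> s) \<cdot> (e \<cdot> s)\<degree> \<preceq> e" by (simp add: e)
  have "s \<cdot> t\<degree> \<preceq> (s \<cdot> (s\<degree> \<cdot> s)) \<cdot> t\<degree>" by (rule cmp_mono_right[OF cmp_ge_right[OF S(5,1)]])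
  also have "\<dots> = s \<cdot> s\<degree> \<cdot> (s \<cdot> t\<degree>)" by (simp add: cmp_assoc)
  also have "\<dots> \<preceq> ((e \<cdot> s) \<cdot> s\<degree>) \<cdot> e" by (rule cmp_mono[OF cmp_mono_right[OF sss] b(5)])
  also have "\<dots> = (e \<cdot> s) \<cdot> (e \<cdot> s)\<degree>" by (simp add: se cmp_assoc)
  also have "\<dots> \<preceq> z" by (rule le[OF b(2) cmp_hom[OF e(1) S(1)] ee 1 2])
  finally show "b \<preceq> z" using b by simp
qed

text \<open>An object of \<open>Q\<close> is embedded as its identity idempotent, with the same
  homs, order and involution; the covering of the other objects is
  \<open>idempotent_generated\<close>.\<close>

theorem site_quantaloid_ssi:
  fixes Q :: "('o, 'a) inv_quantaloid_rec"
  assumes "site_quantaloid TYPE('v) Q C J \<iota> \<gamma>"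
  shows "site_quantaloid TYPE('v) (ssi Q) C J (\<lambda>U. (\<iota> U, Idn Q (\<iota> U))) (\<lambda>T U f. \<gamma> T U f)"
proof -
  interpret site_quantaloid Q C J "TYPE('v)" \<iota> \<gamma> by (rule assms)
  interpret S: involutive_quantaloid "ssi Q" by (rule involutive_quantaloid_ssi[OF involutive_quantaloid_axioms])
  show ?thesis
  proof (rule site_quantaloid_transfer[where H = "\<lambda>X. (X, Idn Q X)" and H' = "\<lambda>X Y f. f"])
    show "involutive_quantaloid (ssi Q)" by (rule S.involutive_quantaloid_axioms)
    show "small_category TYPE('v) (ssi Q)"
    proof -
      have sm: "small TYPE('v) (Obj Q)" "\<And>X Y. \<lbrakk>X \<in> Obj Q; Y \<in> Obj Q\<rbrakk> \<Longrightarrow> small TYPE('v) (Hom Q X Y)"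
        using Q_small by (auto simp: small_category_def)
      have "small TYPE('v) (Obj (ssi Q))"
        by (rule small_subset[OF small_Sigma[OF universe sm(1), of "\<lambda>A. Hom Q A A"]]) (auto simp: sm(2) ssi_simps)
      moreover have "small TYPE('v) (Hom (ssi Q) X Y)" if "X \<in> Obj (ssi Q)" "Y \<in> Obj (ssi Q)" for X Y
        using that by (cases X; cases Y) (auto simp: ssi_simps intro!: small_subset[OF sm(2)[of "fst X" "fst Y"]])
      ultimately show ?thesis by (simp add: small_category_def S.category_axioms)
    qed
    show "is_functor Q (ssi Q) (\<lambda>X. (X, Idn Q X)) (\<lambda>X Y f. f)"
      by (simp add: is_functor_def ssi_simps Idn_closed Idn_Comp Comp_Idn Inv_Idn)
    show "bij_betw (\<lambda>f. f) (Hom Q X Y) (Hom (ssi Q) (X, Idn Q X) (Y, Idn Q Y))" if "X \<in> Obj Q" "Y \<in> Obj Q" for X Y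
    proof -
      have "Hom (ssi Q) (X, Idn Q X) (Y, Idn Q Y) = Hom Q X Y" using that by (auto simp: ssi_simps Idn_Comp Comp_Idn)
      then show ?thesis by (simp add: bij_betw_def)
    qed
    fix X z assume X: "X \<in> Obj (ssi Q)" and z: "z \<in> Hom (ssi Q) X X"
      and le: "\<And>U t. \<lbrakk>U \<in> Obj C; is_symmetric_left_adjoint (ssi Q) (\<iota> U, Idn Q (\<iota> U)) X t\<rbrakk>
        \<Longrightarrow> Le (ssi Q) X X (Comp (ssi Q) X (\<iota> U, Idn Q (\<iota> U)) X t (Inv (ssi Q) (\<iota> U, Idn Q (\<iota> U)) X t)) z"
    obtain B e where Xe: "X = (B, e)" by (cases X)
    have B: "B \<in> Obj Q" "e \<in> Hom Q B B" "Comp Q B B B e e = e" "Inv Q B B e = e" "z \<in> Hom Q B B" using X z by (auto simp: Xe ssi_simps)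
    have "Some (B, B, e) \<preceq> Some (B, B, z)"
    proof (rule idempotent_generated)
      show "Some (B, B, e) \<in> hom B B" "Some (B, B, e) \<cdot> Some (B, B, e) = Some (B, B, e)" "(Some (B, B, e))\<degree> = Some (B, B, e)"
        "Some (B, B, z) \<in> hom B B" using B by (simp_all add: Some_hom_iff cmp_Some cv_Some)
      fix U t assume U: "U \<in> Obj C" and t: "t \<in> hom (\<iota> U) B" and et: "Some (B, B, e) \<cdot> t = t"
        and u: "one (\<iota> U) \<preceq> t\<degree> \<cdot> t" and c: "t \<cdot> t\<degree> \<preceq> Some (B, B, e)"
      obtain w where w: "t = Some (\<iota> U, B, w)" "w \<in> Hom Q (\<iota> U) B" using t by (auto simp: hom_def)
      note i = \<iota>_closed[OF U] and wi = Inv_closed[OF \<iota>_closed[OF U] B(1) w(2)]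
      have ew: "Comp Q (\<iota> U) B B e w = w" using et w i B by (simp add: cmp_Some)
      moreover have "Comp Q B B (\<iota> U) (Inv Q (\<iota> U) B w) e = Inv Q (\<iota> U) B w"
        using Inv_Comp[OF i B(1,1) w(2) B(2)] ew B by simp
      moreover have "Le Q (\<iota> U) (\<iota> U) (Idn Q (\<iota> U)) (Comp Q (\<iota> U) B (\<iota> U) (Inv Q (\<iota> U) B w) w)"
        using u w i wi B by (simp add: one_def cv_Some cmp_Some leq_Some Idn_closed Comp_closed)
      moreover have "Le Q B B (Comp Q B (\<iota> U) B w (Inv Q (\<iota> U) B w)) e"
        using c w i wi B by (simp add: cv_Some cmp_Some leq_Some Comp_closed)
      ultimately have "is_symmetric_left_adjoint (ssi Q) (\<iota> U, Idn Q (\<iota> U)) X w"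
        using w i wi B by (simp add: is_symmetric_left_adjoint_def is_adjoint_def ssi_simps Xe Idn_Comp Comp_Idn)
      from le[OF U this] show "t \<cdot> t\<degree> \<preceq> Some (B, B, z)"
        using w i wi B by (simp add: Xe ssi_simps cv_Some cmp_Some leq_Some Comp_closed)
    qed
    then show "Le (ssi Q) X X (Idn (ssi Q) X) z" using B by (simp add: Xe ssi_simps leq_Some)
  qed (simp_all add: ssi_simps)
qed

theorem corollary3p15:
  fixes Q :: "('o, 'a) quantaloid_rec"
  assumes "universe TYPE('v)"
    and "small_quantaloid_of_closed_cribles TYPE('v) Q"
  shows "grothendieck_topos TYPE('v) (Sh TYPE('v) (with_canonical_inv Q)) \<and>
         equivalent_involutive_quantaloids
           (Rel TYPE('v) (with_canonical_inv Q))
           (Rel_of_topos (Sh TYPE('v) (with_canonical_inv Q)))"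
proof -
  obtain C :: "('v, 'v) cat" and J where Q: "quantaloid Q" "small_category TYPE('v) Q"
    and C: "small_site TYPE('v) C J" and eq: "equivalent_quantaloids Q (crible_quantaloid C J)"
    using assms(2) unfolding small_quantaloid_of_closed_cribles_def by blast
  obtain F F' G G' where R: "quantaloid (crible_quantaloid C J)"
    and E: "inverse_equivalences Q (crible_quantaloid C J) F F' G G'"
      "is_homomorphism Q (crible_quantaloid C J) F F'" "is_homomorphism (crible_quantaloid C J) Q G G'"
    using eq unfolding equivalent_quantaloids_def by blast
  have C': "small_category TYPE('v) C" "grothendieck_topology C J" using C by (simp_all add: small_site_def)
  interpret C: site C J using C' by (auto simp: small_category_def site_def site_axioms_def)
  \<comment> \<open>The site given by the hypothesis represents the splitting as well, and both
    claims are theorems about such a representation.\<close>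
  interpret site_quantaloid "ssi (with_canonical_inv Q)" C J "TYPE('v)"
    "\<lambda>U. (G U, Idn (with_canonical_inv Q) (G U))" "\<lambda>T U f. G' T U (graph C J T U f)"
    by (rule site_quantaloid_ssi[OF C.site_quantaloid_canonical_inv[OF assms(1) C'(1) R Q E]])
  show ?thesis
    unfolding grothendieck_topos_def Sh_def Rel_def
    using SymCat_sc_equivalent_sheaves SymDist_sc_equivalent_Rel_of_topos C by blast
qed

end
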